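(* Let $G$ be a finite group and let $\mathcal{O}$ be a disk-like $G$-transfer system. There is an equivalence of categories $$\mathcal{O}\text{-}\mathrm{Mackey}^G_{\mathbb{Q}}\cong\prod_{(H)\in\mathrm{Sub}^{\mathcal{O}}(G)/G}\mathrm{Coeff}^{N_G(H)}_{\langle H\rangle^{\mathcal{O}},\mathbb{Q}}.$$
   Context: A $G$-transfer system $\mathcal{O}$ is a partial order on the set $\mathrm{Sub}(G)$ of subgroups of $G$, written $K\to H$, which refines inclusion and satisfies: $K\to H$ implies $gKg^{-1}\to gHg^{-1}$ for all $g\in G$; and $K\to H$, $L\subseteq H$ imply $K\cap L\to L$. $\mathcal{O}$ is disk-like if it is the smallest transfer system containing the set of all relations $H\to G$ that lie in $\mathcal{O}$. $\mathrm{Sub}^{\mathcal{O}}(G)$ is the set of subgroups $H$ with $H\to G$ in $\mathcal{O}$, and $\mathrm{Sub}^{\mathcal{O}}(G)/G$ its set of conjugacy classes. For every subgroup $J$ there is a unique smallest element $H_{\mathcal{O}}(J)$ of $\mathrm{Sub}^{\mathcal{O}}(G)$ containing $J$. Subgroups $J,K$ are inseparable if $H_{\mathcal{O}}(J)$ and $H_{\mathcal{O}}(K)$ are conjugate in $G$; $[H]^{\mathcal{O}}$ is the inseparability (equivalence) class of $H$. $\mathrm{Fin}^G_{\mathcal{O}}$ is the wide subcategory of finite $G$-sets consisting of equivariant maps $f\colon S\to T$ with $\mathrm{Stab}(s)\to\mathrm{Stab}(f(s))$ in $\mathcal{O}$ for all $s$. The Lindner category $\mathcal{A}^{\mathcal{O}}$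 has objects the finite $G$-sets and morphisms from $S$ to $T$ the isomorphism classes of spans $S\leftarrow U\xrightarrow{h}T$ with $h\in\mathrm{Fin}^G_{\mathcal{O}}$, composed by pullback; disjoint union is the biproduct. $\mathcal{O}\text{-}\mathrm{Mackey}^G_{\mathbb{Q}}$ is the category of product preserving functors from $\mathcal{A}^{\mathcal{O}}$ to $\mathbb{Q}$-vector spaces and natural transformations. For $H\in\mathrm{Sub}^{\mathcal{O}}(G)$ and $N=N_G(H)$, $\mathrm{Coeff}^{N}_{\langle H\rangle^{\mathcal{O}},\mathbb{Q}}$ is the category of contravariant functors to $\mathbb{Q}$-modules from the full subcategory of the orbit category of $N$ spanned by $\{N/K\mid K\in[H]^{\mathcal{O}},\ K\subseteq H\}$. *)

theory Defs
  imports Complex_Main "HOL-Algebra.Group_Action" "HOL-Algebra.Left_Coset" "HOL-Algebra.Module"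
begin

section \<open>Categories\<close>

text \<open>
  Hom-sets are indexed by source and target and need not be disjoint, so composition takes the
  three objects as arguments: \<open>Cmp C a b c g f\<close> is the composite of \<open>f : a \<rightarrow> b\<close> and \<open>g : b \<rightarrow> c\<close>.
\<close>

record ('o, 'm) cat =
  Ob :: "'o set"
  Mor :: "'o \<Rightarrow> 'o \<Rightarrow> 'm set"
  Cmp :: "'o \<Rightarrow> 'o \<Rightarrow> 'o \<Rightarrow> 'm \<Rightarrow> 'm \<Rightarrow> 'm"
  Idn :: "'o \<Rightarrow> 'm"

locale category =
  fixes C :: "('o, 'm) cat"
  assumes idn_mor: "a \<in> Ob C \<Longrightarrow> Idn C a \<in> Mor C a a"
    and cmp_mor: "\<lbrakk>a \<in> Ob C; b \<in> Ob C; c \<in> Ob C; f \<in> Mor C a b; g \<in> Mor C b c\<rbrakk>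
      \<Longrightarrow> Cmp C a b c g f \<in> Mor C a c"
    and idn_left: "\<lbrakk>a \<in> Ob C; b \<in> Ob C; f \<in> Mor C a b\<rbrakk> \<Longrightarrow> Cmp C a b b (Idn C b) f = f"
    and idn_right: "\<lbrakk>a \<in> Ob C; b \<in> Ob C; f \<in> Mor C a b\<rbrakk> \<Longrightarrow> Cmp C a a b f (Idn C a) = f"
    and cmp_assoc: "\<lbrakk>a \<in> Ob C; b \<in> Ob C; c \<in> Ob C; d \<in> Ob C;
        f \<in> Mor C a b; g \<in> Mor C b c; h \<in> Mor C c d\<rbrakk>
      \<Longrightarrow> Cmp C a b d (Cmp C b c d h g) f = Cmp C a c d h (Cmp C a b c g f)"

definition iso_mor :: "('o, 'm) cat \<Rightarrow> 'o \<Rightarrow> 'o \<Rightarrow> 'm \<Rightarrow> bool" where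
  "iso_mor C a b f \<longleftrightarrow> f \<in> Mor C a b \<and>
     (\<exists>g \<in> Mor C b a. Cmp C a b a g f = Idn C a \<and> Cmp C b a b f g = Idn C b)"

definition op_cat :: "('o, 'm) cat \<Rightarrow> ('o, 'm) cat" where
  "op_cat C = \<lparr>Ob = Ob C, Mor = (\<lambda>a b. Mor C b a),
     Cmp = (\<lambda>a b c g f. Cmp C c b a f g), Idn = Idn C\<rparr>"

definition full_subcat :: "('o, 'm) cat \<Rightarrow> 'o set \<Rightarrow> ('o, 'm) cat" where
  "full_subcat C A = C\<lparr>Ob := Ob C \<inter> A\<rparr>"

definition prod_cat :: "'i set \<Rightarrow> ('i \<Rightarrow> ('o, 'm) cat) \<Rightarrow> ('i \<Rightarrow> 'o, 'i \<Rightarrow> 'm) cat" where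
  "prod_cat I C = \<lparr>Ob = (\<Pi>\<^sub>E i\<in>I. Ob (C i)), Mor = (\<lambda>a b. \<Pi>\<^sub>E i\<in>I. Mor (C i) (a i) (b i)),
     Cmp = (\<lambda>a b c g f. \<lambda>i\<in>I. Cmp (C i) (a i) (b i) (c i) (g i) (f i)),
     Idn = (\<lambda>a. \<lambda>i\<in>I. Idn (C i) (a i))\<rparr>"

record ('o, 'm, 'p, 'n) cfunctor =
  fobj :: "'o \<Rightarrow> 'p"
  fmor :: "'o \<Rightarrow> 'o \<Rightarrow> 'm \<Rightarrow> 'n"

definition is_functor :: "('o, 'm) cat \<Rightarrow> ('p, 'n) cat \<Rightarrow> ('o, 'm, 'p, 'n) cfunctor \<Rightarrow> bool" where
  "is_functor C D F \<longleftrightarrow>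
     fobj F \<in> Ob C \<rightarrow>\<^sub>E Ob D \<and>
     fmor F \<in> (\<Pi>\<^sub>E a\<in>Ob C. \<Pi>\<^sub>E b\<in>Ob C. Mor C a b \<rightarrow>\<^sub>E Mor D (fobj F a) (fobj F b)) \<and>
     (\<forall>a \<in> Ob C. fmor F a a (Idn C a) = Idn D (fobj F a)) \<and>
     (\<forall>a \<in> Ob C. \<forall>b \<in> Ob C. \<forall>c \<in> Ob C. \<forall>f \<in> Mor C a b. \<forall>g \<in> Mor C b c.
        fmor F a c (Cmp C a b c g f)
          = Cmp D (fobj F a) (fobj F b) (fobj F c) (fmor F b c g) (fmor F a b f))"

definition id_functor :: "('o, 'm) cat \<Rightarrow> ('o, 'm, 'o, 'm) cfunctor" where
  "id_functor C = \<lparr>fobj = (\<lambda>a\<in>Ob C. a), fmor = (\<lambda>a\<in>Ob C. \<lambda>b\<in>Ob C. \<lambda>f\<in>Mor C a b. f)\<rparr>"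

definition comp_functor :: "('o, 'm) cat \<Rightarrow> ('p, 'n, 'q, 'k) cfunctor \<Rightarrow> ('o, 'm, 'p, 'n) cfunctor
    \<Rightarrow> ('o, 'm, 'q, 'k) cfunctor" where
  "comp_functor C K F = \<lparr>fobj = (\<lambda>a\<in>Ob C. fobj K (fobj F a)),
     fmor = (\<lambda>a\<in>Ob C. \<lambda>b\<in>Ob C. \<lambda>f\<in>Mor C a b. fmor K (fobj F a) (fobj F b) (fmor F a b f))\<rparr>"

definition nat_trans :: "('o, 'm) cat \<Rightarrow> ('p, 'n) cat \<Rightarrow> ('o, 'm, 'p, 'n) cfunctor
    \<Rightarrow> ('o, 'm, 'p, 'n) cfunctor \<Rightarrow> ('o \<Rightarrow> 'n) set" where
  "nat_trans C D F K = {\<eta> \<in> (\<Pi>\<^sub>E a\<in>Ob C. Mor D (fobj F a) (fobj K a)).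
     \<forall>a \<in> Ob C. \<forall>b \<in> Ob C. \<forall>f \<in> Mor C a b.
       Cmp D (fobj F a) (fobj F b) (fobj K b) (\<eta> b) (fmor F a b f)
         = Cmp D (fobj F a) (fobj K a) (fobj K b) (fmor K a b f) (\<eta> a)}"

definition functor_cat :: "('o, 'm) cat \<Rightarrow> ('p, 'n) cat
    \<Rightarrow> (('o, 'm, 'p, 'n) cfunctor, 'o \<Rightarrow> 'n) cat" where
  "functor_cat C D = \<lparr>Ob = {F. is_functor C D F}, Mor = nat_trans C D,
     Cmp = (\<lambda>F K L \<theta> \<eta>. \<lambda>a\<in>Ob C. Cmp D (fobj F a) (fobj K a) (fobj L a) (\<theta> a) (\<eta> a)),
     Idn = (\<lambda>F. \<lambda>a\<in>Ob C. Idn D (fobj F a))\<rparr>"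

definition naturally_isomorphic :: "('o, 'm) cat \<Rightarrow> ('p, 'n) cat \<Rightarrow> ('o, 'm, 'p, 'n) cfunctor
    \<Rightarrow> ('o, 'm, 'p, 'n) cfunctor \<Rightarrow> bool" where
  "naturally_isomorphic C D F K \<longleftrightarrow>
     (\<exists>\<eta> \<in> nat_trans C D F K. \<forall>a \<in> Ob C. iso_mor D (fobj F a) (fobj K a) (\<eta> a))"

definition equivalent_categories :: "('o, 'm) cat \<Rightarrow> ('p, 'n) cat \<Rightarrow> bool" where
  "equivalent_categories C D \<longleftrightarrow> category C \<and> category D \<and>
     (\<exists>F K. is_functor C D F \<and> is_functor D C K \<and>
        naturally_isomorphic C C (id_functor C) (comp_functor C K F) \<and>
        naturally_isomorphic D D (comp_functor D F K) (id_functor D))"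

definition is_product :: "('o, 'm) cat \<Rightarrow> 'i set \<Rightarrow> ('i \<Rightarrow> 'o) \<Rightarrow> 'o \<Rightarrow> ('i \<Rightarrow> 'm) \<Rightarrow> bool" where
  "is_product C I X P p \<longleftrightarrow> P \<in> Ob C \<and> (\<forall>i \<in> I. X i \<in> Ob C \<and> p i \<in> Mor C P (X i)) \<and>
     (\<forall>Z \<in> Ob C. \<forall>f. (\<forall>i \<in> I. f i \<in> Mor C Z (X i)) \<longrightarrow>
        (\<exists>!u. u \<in> Mor C Z P \<and> (\<forall>i \<in> I. Cmp C Z P (X i) (p i) u = f i)))"

text \<open>
  Finite sets of natural numbers cover, up to reindexing, all finite products, the empty one
  (terminal object) included.
\<close>

definition product_preserving ::
    "('o, 'm) cat \<Rightarrow> ('p, 'n) cat \<Rightarrow> ('o, 'm, 'p, 'n) cfunctor \<Rightarrow> bool" where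
  "product_preserving C D F \<longleftrightarrow>
     (\<forall>(I :: nat set) X P p. finite I \<longrightarrow> is_product C I X P p \<longrightarrow>
        is_product D I (\<lambda>i. fobj F (X i)) (fobj F P) (\<lambda>i. fmor F P (X i) (p i)))"


section \<open>Rational vector spaces\<close>

definition rat_ring :: "rat ring" where
  "rat_ring = \<lparr>carrier = UNIV, mult = (*), one = 1, zero = 0, add = (+)\<rparr>"

text \<open>
  The type \<open>'v\<close> bounds the size of the vector spaces under consideration: they are the ones whose
  underlying set is a subset of \<open>'v\<close>. The fields \<open>mult\<close> and \<open>one\<close> that the module record inherits
  from rings carry no information; they only give rise to isomorphic copies of objects.
\<close>

definition vect_cat :: "((rat, 'v) module, 'v \<Rightarrow> 'v) cat" where
  "vect_cat = \<lparr>Ob = {V. module rat_ring V},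
     Mor = (\<lambda>V W. {f \<in> carrier V \<rightarrow>\<^sub>E carrier W.
        (\<forall>x \<in> carrier V. \<forall>y \<in> carrier V. f (x \<oplus>\<^bsub>V\<^esub> y) = f x \<oplus>\<^bsub>W\<^esub> f y) \<and>
        (\<forall>r. \<forall>x \<in> carrier V. f (r \<odot>\<^bsub>V\<^esub> x) = r \<odot>\<^bsub>W\<^esub> f x)}),
     Cmp = (\<lambda>U V W g f. compose (carrier U) g f),
     Idn = (\<lambda>V. \<lambda>x\<in>carrier V. x)\<rparr>"


section \<open>Transfer systems\<close>

definition transfer_system :: "('g, 'a) monoid_scheme \<Rightarrow> ('g set \<times> 'g set) set \<Rightarrow> bool" where
  "transfer_system G \<O> \<longleftrightarrow>
     \<O> \<subseteq> {H. subgroup H G} \<times> {H. subgroup H G} \<and>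
     partial_order_on {H. subgroup H G} \<O> \<and>
     (\<forall>(K, H) \<in> \<O>. K \<subseteq> H) \<and>
     (\<forall>(K, H) \<in> \<O>. \<forall>g \<in> carrier G.
        (g <#\<^bsub>G\<^esub> K #>\<^bsub>G\<^esub> (inv\<^bsub>G\<^esub> g), g <#\<^bsub>G\<^esub> H #>\<^bsub>G\<^esub> (inv\<^bsub>G\<^esub> g)) \<in> \<O>) \<and>
     (\<forall>(K, H) \<in> \<O>. \<forall>L. subgroup L G \<and> L \<subseteq> H \<longrightarrow> (K \<inter> L, L) \<in> \<O>)"

definition disk_like :: "('g, 'a) monoid_scheme \<Rightarrow> ('g set \<times> 'g set) set \<Rightarrow> bool" where
  "disk_like G \<O> \<longleftrightarrow> transfer_system G \<O> \<and>
     (\<forall>T. transfer_system G T \<and> {(H, carrier G) | H. (H, carrier G) \<in> \<O>} \<subseteq> T \<longrightarrow> \<O> \<subseteq> T)"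

definition Sub_O :: "('g, 'a) monoid_scheme \<Rightarrow> ('g set \<times> 'g set) set \<Rightarrow> 'g set set" where
  "Sub_O G \<O> = {H. (H, carrier G) \<in> \<O>}"

definition Sub_O_classes :: "('g, 'a) monoid_scheme \<Rightarrow> ('g set \<times> 'g set) set \<Rightarrow> 'g set set set" where
  "Sub_O_classes G \<O> = orbits G (Sub_O G \<O>)
     (\<lambda>g. \<lambda>H\<in>{H. subgroup H G}. g <#\<^bsub>G\<^esub> H #>\<^bsub>G\<^esub> (inv\<^bsub>G\<^esub> g))"

text \<open>
  For a transfer system on a finite group, \<open>Sub_O\<close> is closed under intersection and contains the
  whole group, so the least element exists.
\<close>

definition H_O :: "('g, 'a) monoid_scheme \<Rightarrow> ('g set \<times> 'g set) set \<Rightarrow> 'g set \<Rightarrow> 'g set" where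
  "H_O G \<O> J = (LEAST H. H \<in> Sub_O G \<O> \<and> J \<subseteq> H)"

definition inseparable ::
    "('g, 'a) monoid_scheme \<Rightarrow> ('g set \<times> 'g set) set \<Rightarrow> 'g set \<Rightarrow> 'g set \<Rightarrow> bool" where
  "inseparable G \<O> J K \<longleftrightarrow> subgroup J G \<and> subgroup K G \<and>
     (\<exists>g \<in> carrier G. g <#\<^bsub>G\<^esub> H_O G \<O> J #>\<^bsub>G\<^esub> (inv\<^bsub>G\<^esub> g) = H_O G \<O> K)"

definition insep_class ::
    "('g, 'a) monoid_scheme \<Rightarrow> ('g set \<times> 'g set) set \<Rightarrow> 'g set \<Rightarrow> 'g set set" where
  "insep_class G \<O> H = {K. inseparable G \<O> H K}"


section \<open>Finite \<open>G\<close>-sets\<close>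

record ('g, 's) gset =
  pts :: "'s set"
  act :: "'g \<Rightarrow> 's \<Rightarrow> 's"

definition finite_gset :: "('g, 'a) monoid_scheme \<Rightarrow> ('g, 's) gset \<Rightarrow> bool" where
  "finite_gset G S \<longleftrightarrow> finite (pts S) \<and> group_action G (pts S) (act S) \<and>
     act S \<in> extensional (carrier G)"

definition gset_hom ::
    "('g, 'a) monoid_scheme \<Rightarrow> ('g, 's) gset \<Rightarrow> ('g, 't) gset \<Rightarrow> ('s \<Rightarrow> 't) set" where
  "gset_hom G S T = {f \<in> pts S \<rightarrow>\<^sub>E pts T.
     \<forall>g \<in> carrier G. \<forall>x \<in> pts S. f (act S g x) = act T g (f x)}"

definition Fin_O_hom :: "('g, 'a) monoid_scheme \<Rightarrow> ('g set \<times> 'g set) set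
    \<Rightarrow> ('g, 's) gset \<Rightarrow> ('g, 't) gset \<Rightarrow> ('s \<Rightarrow> 't) set" where
  "Fin_O_hom G \<O> S T = {f \<in> gset_hom G S T.
     \<forall>s \<in> pts S. (stabilizer G (act S) s, stabilizer G (act T) (f s)) \<in> \<O>}"

definition coset_gset :: "('g, 'a) monoid_scheme \<Rightarrow> 'g set \<Rightarrow> ('g, 'g set) gset" where
  "coset_gset G K = \<lparr>pts = lcosets\<^bsub>G\<^esub> K, act = (\<lambda>g\<in>carrier G. \<lambda>A\<in>lcosets\<^bsub>G\<^esub> K. g <#\<^bsub>G\<^esub> A)\<rparr>"

definition orbit_cat :: "('g, 'a) monoid_scheme \<Rightarrow> (('g, 'g set) gset, 'g set \<Rightarrow> 'g set) cat" where
  "orbit_cat G = \<lparr>Ob = {coset_gset G K | K. subgroup K G}, Mor = gset_hom G,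
     Cmp = (\<lambda>R S T g f. compose (pts R) g f), Idn = (\<lambda>S. \<lambda>x\<in>pts S. x)\<rparr>"


section \<open>The Lindner category\<close>

record ('g, 'u, 's) gspan =
  apex :: "('g, 'u) gset"
  lleg :: "'u \<Rightarrow> 's"
  rleg :: "'u \<Rightarrow> 's"

definition spans :: "('g, 'a) monoid_scheme \<Rightarrow> ('g set \<times> 'g set) set
    \<Rightarrow> ('g, 's) gset \<Rightarrow> ('g, 's) gset \<Rightarrow> ('g, 'u, 's) gspan set" where
  "spans G \<O> S T = {u. finite_gset G (apex u) \<and> lleg u \<in> gset_hom G (apex u) S \<and>
     rleg u \<in> Fin_O_hom G \<O> (apex u) T}"

definition span_iso ::
    "('g, 'a) monoid_scheme \<Rightarrow> ('g, 'u, 's) gspan \<Rightarrow> ('g, 'w, 's) gspan \<Rightarrow> bool" where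
  "span_iso G u v \<longleftrightarrow> (\<exists>f \<in> gset_hom G (apex u) (apex v).
     bij_betw f (pts (apex u)) (pts (apex v)) \<and>
     (\<forall>x \<in> pts (apex u). lleg v (f x) = lleg u x \<and> rleg v (f x) = rleg u x))"

definition span_rel :: "('g, 'a) monoid_scheme \<Rightarrow> ('g set \<times> 'g set) set
    \<Rightarrow> ('g, 's) gset \<Rightarrow> ('g, 's) gset \<Rightarrow> ('g, 'u, 's) gspan rel" where
  "span_rel G \<O> S T = {(u, v). u \<in> spans G \<O> S T \<and> v \<in> spans G \<O> S T \<and> span_iso G u v}"

definition fibre_product :: "('g, 'a) monoid_scheme \<Rightarrow> ('g, 'u) gset \<Rightarrow> ('g, 'w) gset
    \<Rightarrow> ('u \<Rightarrow> 't) \<Rightarrow> ('w \<Rightarrow> 't) \<Rightarrow> ('g, 'u \<times> 'w) gset" where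
  "fibre_product G U V h k = (let P = {(y, z). y \<in> pts U \<and> z \<in> pts V \<and> h y = k z} in
     \<lparr>pts = P, act = (\<lambda>g\<in>carrier G. \<lambda>p\<in>P. (act U g (fst p), act V g (snd p)))\<rparr>)"

definition span_comp :: "('g, 'a) monoid_scheme \<Rightarrow> ('g, 'u, 's) gspan \<Rightarrow> ('g, 'w, 's) gspan
    \<Rightarrow> ('g, 'u \<times> 'w, 's) gspan" where
  "span_comp G u v = (let P = fibre_product G (apex u) (apex v) (rleg u) (lleg v) in
     \<lparr>apex = P, lleg = (\<lambda>p\<in>pts P. lleg u (fst p)), rleg = (\<lambda>p\<in>pts P. rleg v (snd p))\<rparr>)"

definition id_span :: "('g, 's) gset \<Rightarrow> ('g, 's, 's) gspan" where
  "id_span S = \<lparr>apex = S, lleg = (\<lambda>x\<in>pts S. x), rleg = (\<lambda>x\<in>pts S. x)\<rparr>"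

text \<open>
  The objects are the finite \<open>G\<close>-sets whose underlying set is a subset of \<open>'s\<close>; for infinite \<open>'s\<close>
  every finite \<open>G\<close>-set is isomorphic to one of these. The apexes of spans are also taken in \<open>'s\<close>,
  whereas \<open>span_comp\<close> has its apex in \<open>'s \<times> 's\<close>. The composite of two classes therefore consists of
  the spans with apex in \<open>'s\<close> that are isomorphic to the pullback.
\<close>

definition lindner_cat :: "('g, 'a) monoid_scheme \<Rightarrow> ('g set \<times> 'g set) set
    \<Rightarrow> (('g, 's) gset, ('g, 's, 's) gspan set) cat" where
  "lindner_cat G \<O> = \<lparr>Ob = {S. finite_gset G S},
     Mor = (\<lambda>S T. spans G \<O> S T // span_rel G \<O> S T),
     Cmp = (\<lambda>R S T \<beta> \<alpha>. {w \<in> spans G \<O> R T. \<exists>u \<in> \<alpha>. \<exists>v \<in> \<beta>. span_iso G w (span_comp G u v)}),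
     Idn = (\<lambda>S. span_rel G \<O> S S `` {id_span S})\<rparr>"


section \<open>Incomplete Mackey functors and coefficient systems\<close>

type_synonym ('g, 's, 'v) mackey_functor =
  "(('g, 's) gset, ('g, 's, 's) gspan set, (rat, 'v) module, 'v \<Rightarrow> 'v) cfunctor"

type_synonym ('g, 's, 'v) mackey_map = "('g, 's) gset \<Rightarrow> 'v \<Rightarrow> 'v"

definition mackey_cat :: "('g, 'a) monoid_scheme \<Rightarrow> ('g set \<times> 'g set) set
    \<Rightarrow> (('g, 's, 'v) mackey_functor, ('g, 's, 'v) mackey_map) cat" where
  "mackey_cat G \<O> = full_subcat (functor_cat (lindner_cat G \<O>) vect_cat)
     {M. product_preserving (lindner_cat G \<O>) vect_cat M}"

type_synonym ('g, 'v) coeff_system =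
  "(('g, 'g set) gset, 'g set \<Rightarrow> 'g set, (rat, 'v) module, 'v \<Rightarrow> 'v) cfunctor"

type_synonym ('g, 'v) coeff_map = "('g, 'g set) gset \<Rightarrow> 'v \<Rightarrow> 'v"

definition coeff_cat :: "('g, 'a) monoid_scheme \<Rightarrow> ('g set \<times> 'g set) set \<Rightarrow> 'g set
    \<Rightarrow> (('g, 'v) coeff_system, ('g, 'v) coeff_map) cat" where
  "coeff_cat G \<O> H = (let N = G\<lparr>carrier := normalizer G H\<rparr> in
     functor_cat
       (op_cat (full_subcat (orbit_cat N)
          {coset_gset N K | K. K \<in> insep_class G \<O> H \<and> K \<subseteq> H}))
       vect_cat)"

end

theory Submission
  imports Defs
begin

text \<open>
  Disk-likeness means that \<open>K \<rightarrow> L\<close> holds iff \<open>K = L \<inter> A\<close> for some \<open>A \<in> Sub_O\<close>. For a Mackey functor \<open>M\<close>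
  and a subgroup \<open>K\<close> let \<open>\<Phi>\<^sub>K M \<subseteq> M(G/K)\<close> consist of the elements whose restriction to \<open>K \<inter> A\<close> vanishes for
  all \<open>A \<in> Sub_O\<close> not containing \<open>K\<close>. Restriction maps preserve these subspaces and vanish on them
  unless they relate inseparable subgroups, so they form a coefficient system for every conjugacy class.

  Conversely, a family \<open>X\<close> of coefficient systems gives a Mackey functor: an element of its value at \<open>S\<close> is
  a compatible family of \<open>x(s, L) \<in> X(L)\<close> over all \<open>s \<in> S\<close> and \<open>L \<rightarrow> Stab s\<close>. A span
  \<open>S \<leftarrow> U \<rightarrow> T\<close> with legs \<open>f\<close>, \<open>h\<close> sends \<open>x\<close> to
  \<open>y(t, L) = \<Sum> res x(f u, L')\<close>, where \<open>u\<close> ranges over the \<open>L\<close>-fixed points of the fibre of \<open>h\<close> over \<open>t\<close>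
  and \<open>L'\<close> is the intersection of \<open>Stab (f u)\<close> with the hull of \<open>L\<close>.

  For \<open>X = \<Phi> M\<close>, the sum of the transfers of the \<open>x(s, L)\<close> along \<open>G/L \<rightarrow> S\<close>, weighted by the order of \<open>L\<close>, is
  natural by the double coset formula. It is bijective: restricting the sum along \<open>G/L \<rightarrow> S\<close> recovers
  a nonzero integer multiple of \<open>x(s, L)\<close> up to contributions of smaller hulls, and an element of \<open>M(S)\<close>
  all of whose restrictions vanish is zero. Both statements divide by group orders.
\<close>

section \<open>Categories\<close>

text \<open>The integer by which \<open>x(s, L)\<close> is multiplied is the order of the normalizer
  of its hull: if \<open>K\<close> has hull \<open>rep c\<close>, the points of \<open>G/K\<close>
  at which a subgroup with hull \<open>rep c\<close> is cut out form one orbit of the normalizer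
  with stabilizer \<open>K\<close>, and each carries weight \<open>card K\<close>. The weights come
  from replacing sums over orbits by sums over points, an orbit being counted once for each of its
  points. Classes other than \<open>c\<close> that occur on \<open>G/K\<close> have representatives
  of smaller order, so the system relating an element to its restrictions is triangular with respect
  to the order of the hull, with invertible diagonal. Only the passage from Mackey functors to
  coefficient systems is made into a functor; the reverse construction is needed on objects alone,
  and \<open>assemble\<close> serves to prove that the functor is full and faithful. The encoding
  adds one obstacle: points and vectors live in fixed types, whereas pullbacks and spaces of
  families do not, so these have to be copied back, which is possible up to isomorphism.\<close>

lemma is_functorD:
  assumes "is_functor C D F"
  shows "a \<in> Ob C \<Longrightarrow> fobj F a \<in> Ob D"
    and "\<lbrakk>a \<in> Ob C; b \<in> Ob C; f \<in> Mor C a b\<rbrakk> \<Longrightarrow> fmor F a b f \<in> Mor D (fobj F a) (fobj F b)"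
    and "a \<in> Ob C \<Longrightarrow> fmor F a a (Idn C a) = Idn D (fobj F a)"
    and "\<lbrakk>a \<in> Ob C; b \<in> Ob C; c \<in> Ob C; f \<in> Mor C a b; g \<in> Mor C b c\<rbrakk> \<Longrightarrow>
      fmor F a c (Cmp C a b c g f)
        = Cmp D (fobj F a) (fobj F b) (fobj F c) (fmor F b c g) (fmor F a b f)"
proof -
  note F = assms[unfolded is_functor_def]
  show "a \<in> Ob C \<Longrightarrow> fobj F a \<in> Ob D" using F by blast
  show "fmor F a b f \<in> Mor D (fobj F a) (fobj F b)" if "a \<in> Ob C" "b \<in> Ob C" "f \<in> Mor C a b"
  proof -
    have "fmor F a b \<in> Mor C a b \<rightarrow>\<^sub>E Mor D (fobj F a) (fobj F b)"
      using F that(1,2) by (meson PiE_mem)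
    then show ?thesis using that(3) by (rule PiE_mem)
  qed
  show "a \<in> Ob C \<Longrightarrow> fmor F a a (Idn C a) = Idn D (fobj F a)" using F by blast
  show "\<lbrakk>a \<in> Ob C; b \<in> Ob C; c \<in> Ob C; f \<in> Mor C a b; g \<in> Mor C b c\<rbrakk> \<Longrightarrow>
      fmor F a c (Cmp C a b c g f)
        = Cmp D (fobj F a) (fobj F b) (fobj F c) (fmor F b c g) (fmor F a b f)"
    using F by blast
qed

lemma is_functor_restrictI:
  assumes "\<And>a. a \<in> Ob C \<Longrightarrow> fo a \<in> Ob D"
    and "\<And>a b f. \<lbrakk>a \<in> Ob C; b \<in> Ob C; f \<in> Mor C a b\<rbrakk> \<Longrightarrow> fm a b f \<in> Mor D (fo a) (fo b)"
    and "\<And>a. a \<in> Ob C \<Longrightarrow> Idn C a \<in> Mor C a a"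
    and "\<And>a b c f g. \<lbrakk>a \<in> Ob C; b \<in> Ob C; c \<in> Ob C; f \<in> Mor C a b; g \<in> Mor C b c\<rbrakk> \<Longrightarrow>
        Cmp C a b c g f \<in> Mor C a c"
    and "\<And>a. a \<in> Ob C \<Longrightarrow> fm a a (Idn C a) = Idn D (fo a)"
    and "\<And>a b c f g. \<lbrakk>a \<in> Ob C; b \<in> Ob C; c \<in> Ob C; f \<in> Mor C a b; g \<in> Mor C b c\<rbrakk> \<Longrightarrow>
        fm a c (Cmp C a b c g f) = Cmp D (fo a) (fo b) (fo c) (fm b c g) (fm a b f)"
  shows "is_functor C D \<lparr>fobj = (\<lambda>a\<in>Ob C. fo a),
     fmor = (\<lambda>a\<in>Ob C. \<lambda>b\<in>Ob C. \<lambda>f\<in>Mor C a b. fm a b f)\<rparr>"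
  unfolding is_functor_def using assms by (auto simp: PiE_iff)

lemma nat_transD:
  assumes "\<eta> \<in> nat_trans C D F K"
  shows "a \<in> Ob C \<Longrightarrow> \<eta> a \<in> Mor D (fobj F a) (fobj K a)"
    and "\<lbrakk>a \<in> Ob C; b \<in> Ob C; f \<in> Mor C a b\<rbrakk> \<Longrightarrow>
      Cmp D (fobj F a) (fobj F b) (fobj K b) (\<eta> b) (fmor F a b f)
         = Cmp D (fobj F a) (fobj K a) (fobj K b) (fmor K a b f) (\<eta> a)"
    and "\<eta> \<in> extensional (Ob C)"
  using assms unfolding nat_trans_def by (auto simp: PiE_iff)

lemma category_functor_cat:
  assumes "category D"
  shows "category (functor_cat C D)"
proof -
  interpret D: category D by fact
  note fD = is_functorD nat_transD
  show ?thesis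
  proof (unfold_locales, goal_cases)
    case (1 F)
    then have F: "is_functor C D F" by (simp add: functor_cat_def)
    then show ?case
      by (auto simp: functor_cat_def nat_trans_def is_functorD[OF F] D.idn_mor D.idn_left D.idn_right)
  next
    case (2 F K L \<eta> \<theta>)
    then have F: "is_functor C D F" "is_functor C D K" "is_functor C D L"
      and e: "\<eta> \<in> nat_trans C D F K" "\<theta> \<in> nat_trans C D K L" by (simp_all add: functor_cat_def)
    note FD = is_functorD[OF F(1)] is_functorD[OF F(2)] is_functorD[OF F(3)]
      nat_transD[OF e(1)] nat_transD[OF e(2)]
    have "Cmp D (fobj F a) (fobj F b) (fobj L b) (Cmp D (fobj F b) (fobj K b) (fobj L b) (\<theta> b) (\<eta> b)) (fmor F a b f)
      = Cmp D (fobj F a) (fobj L a) (fobj L b) (fmor L a b f) (Cmp D (fobj F a) (fobj K a) (fobj L a) (\<theta> a) (\<eta> a))"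
      if "a \<in> Ob C" "b \<in> Ob C" "f \<in> Mor C a b" for a b f
    proof -
      have "Cmp D (fobj F a) (fobj F b) (fobj L b) (Cmp D (fobj F b) (fobj K b) (fobj L b) (\<theta> b) (\<eta> b)) (fmor F a b f)
         = Cmp D (fobj F a) (fobj K b) (fobj L b) (\<theta> b) (Cmp D (fobj F a) (fobj F b) (fobj K b) (\<eta> b) (fmor F a b f))"
        by (rule D.cmp_assoc) (use that FD in auto)
      also have "\<dots> = Cmp D (fobj F a) (fobj K b) (fobj L b) (\<theta> b) (Cmp D (fobj F a) (fobj K a) (fobj K b) (fmor K a b f) (\<eta> a))"
        using that FD by simp
      also have "\<dots> = Cmp D (fobj F a) (fobj K a) (fobj L b) (Cmp D (fobj K a) (fobj K b) (fobj L b) (\<theta> b) (fmor K a b f)) (\<eta> a)"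
        by (rule D.cmp_assoc[symmetric]) (use that FD in auto)
      also have "\<dots> = Cmp D (fobj F a) (fobj K a) (fobj L b) (Cmp D (fobj K a) (fobj L a) (fobj L b) (fmor L a b f) (\<theta> a)) (\<eta> a)"
        using that FD by simp
      also have "\<dots> = Cmp D (fobj F a) (fobj L a) (fobj L b) (fmor L a b f) (Cmp D (fobj F a) (fobj K a) (fobj L a) (\<theta> a) (\<eta> a))"
        by (rule D.cmp_assoc) (use that FD in auto)
      finally show ?thesis .
    qed
    then show ?case
      using FD by (auto simp: functor_cat_def nat_trans_def intro: D.cmp_mor)
  next
    case (3 F K \<eta>)
    then have F: "is_functor C D F" "is_functor C D K"
      and e: "\<eta> \<in> nat_trans C D F K" by (simp_all add: functor_cat_def)
    note FD = is_functorD[OF F(1)] is_functorD[OF F(2)] nat_transD[OF e(1)]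
    show ?case
      using FD by (auto simp: functor_cat_def D.idn_left intro!: extensionalityI[of _ "Ob C"])
  next
    case (4 F K \<eta>)
    then have F: "is_functor C D F" "is_functor C D K"
      and e: "\<eta> \<in> nat_trans C D F K" by (simp_all add: functor_cat_def)
    note FD = is_functorD[OF F(1)] is_functorD[OF F(2)] nat_transD[OF e(1)]
    show ?case
      using FD by (auto simp: functor_cat_def D.idn_right intro!: extensionalityI[of _ "Ob C"])
  next
    case (5 F K L M \<eta> \<theta> \<kappa>)
    then have F: "is_functor C D F" "is_functor C D K" "is_functor C D L" "is_functor C D M"
      and e: "\<eta> \<in> nat_trans C D F K" "\<theta> \<in> nat_trans C D K L" "\<kappa> \<in> nat_trans C D L M"
      by (simp_all add: functor_cat_def)
    note FD = is_functorD[OF F(1)] is_functorD[OF F(2)] is_functorD[OF F(3)] is_functorD[OF F(4)]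
      nat_transD[OF e(1)] nat_transD[OF e(2)] nat_transD[OF e(3)]
    show ?case
      using D.cmp_assoc by (auto simp: functor_cat_def FD intro!: restrict_ext)
  qed
qed

lemma category_full_subcat:
  assumes "category C" shows "category (full_subcat C A)"
proof -
  interpret category C by fact
  show ?thesis
    by unfold_locales (auto simp: full_subcat_def idn_mor cmp_mor idn_left idn_right cmp_assoc)
qed

lemma category_prod_cat:
  assumes "\<And>i. i \<in> I \<Longrightarrow> category (C i)" shows "category (prod_cat I C)"
  by unfold_locales
    (use assms in \<open>auto simp: prod_cat_def PiE_iff category.idn_mor category.cmp_mor category.idn_left
      category.idn_right category.cmp_assoc intro!: extensionalityI[of _ I]\<close>)

text \<open>The quasi-inverse sends \<open>d\<close> to a chosen \<open>k d\<close> with an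
  isomorphism \<open>e d\<close> from \<open>F (k d)\<close> to \<open>d\<close>, and a morphism to
  the unique preimage under \<open>F\<close> of its conjugate by these isomorphisms. In this form
  the criterion spares the construction of an inverse functor on morphisms.\<close>

lemma equivalent_categoriesI:
  assumes C: "category C" and D: "category D" and F: "is_functor C D F"
    and ff: "\<And>a b. a \<in> Ob C \<Longrightarrow> b \<in> Ob C \<Longrightarrow>
      bij_betw (fmor F a b) (Mor C a b) (Mor D (fobj F a) (fobj F b))"
    and es: "\<And>d. d \<in> Ob D \<Longrightarrow> \<exists>c \<in> Ob C. \<exists>f. iso_mor D (fobj F c) d f"
  shows "equivalent_categories C D"
proof -
  interpret C: category C by fact
  interpret D: category D by fact
  obtain k e where k: "\<And>d. d \<in> Ob D \<Longrightarrow> k d \<in> Ob C"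
    and e: "\<And>d. d \<in> Ob D \<Longrightarrow> iso_mor D (fobj F (k d)) d (e d)"
    using es by metis
  have "\<forall>d. \<exists>e'. d \<in> Ob D \<longrightarrow> e d \<in> Mor D (fobj F (k d)) d \<and> e' \<in> Mor D d (fobj F (k d)) \<and>
      Cmp D (fobj F (k d)) d (fobj F (k d)) e' (e d) = Idn D (fobj F (k d)) \<and>
      Cmp D d (fobj F (k d)) d (e d) e' = Idn D d"
    using e unfolding iso_mor_def by blast
  then obtain e' where e': "\<And>d. d \<in> Ob D \<Longrightarrow> e d \<in> Mor D (fobj F (k d)) d"
      "\<And>d. d \<in> Ob D \<Longrightarrow> e' d \<in> Mor D d (fobj F (k d))"
      "\<And>d. d \<in> Ob D \<Longrightarrow> Cmp D (fobj F (k d)) d (fobj F (k d)) (e' d) (e d) = Idn D (fobj F (k d))"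
      "\<And>d. d \<in> Ob D \<Longrightarrow> Cmp D d (fobj F (k d)) d (e d) (e' d) = Idn D d"
    by metis
  note Fo = is_functorD(1)[OF F] and Fm = is_functorD(2)[OF F] and Fi = is_functorD(3)[OF F]
    and Fc = is_functorD(4)[OF F]
  define G where "G a b = the_inv_into (Mor C a b) (fmor F a b)" for a b
  have G_mor: "G a b g \<in> Mor C a b" and FG: "fmor F a b (G a b g) = g"
    if "a \<in> Ob C" "b \<in> Ob C" "g \<in> Mor D (fobj F a) (fobj F b)" for a b g
    using ff[OF that(1,2)] that(3) unfolding G_def
    by (auto simp: bij_betw_def intro: the_inv_into_into f_the_inv_into_f)
  have inj: "f = g" if "a \<in> Ob C" "b \<in> Ob C" "f \<in> Mor C a b" "g \<in> Mor C a b" "fmor F a b f = fmor F a b g" for a b f g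
    using ff[OF that(1,2)] that(3-) by (auto simp: bij_betw_def dest: inj_onD)
  \<comment> \<open>\<open>t d d' g\<close> is \<open>g\<close> conjugated by the chosen
    isomorphisms, hence a morphism between objects in the image of \<open>F\<close>.\<close>
  define t where "t d d' g = Cmp D (fobj F (k d)) d (fobj F (k d')) (Cmp D d d' (fobj F (k d')) (e' d') g) (e d)" for d d' g
  have t_mor: "t d d' g \<in> Mor D (fobj F (k d)) (fobj F (k d'))" if "d \<in> Ob D" "d' \<in> Ob D" "g \<in> Mor D d d'" for d d' g
    unfolding t_def using that by (intro D.cmp_mor[of _ d] D.cmp_mor[of _ d']) (auto simp: k Fo e')
  have t_e: "Cmp D (fobj F (k d)) (fobj F (k d')) d' (e d') (t d d' g) = Cmp D (fobj F (k d)) d d' g (e d)"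
    if "d \<in> Ob D" "d' \<in> Ob D" "g \<in> Mor D d d'" for d d' g
  proof -
    have "Cmp D (fobj F (k d)) (fobj F (k d')) d' (e d') (t d d' g)
      = Cmp D (fobj F (k d)) d d' (Cmp D d (fobj F (k d')) d' (e d') (Cmp D d d' (fobj F (k d')) (e' d') g)) (e d)"
      unfolding t_def by (rule D.cmp_assoc[symmetric]) (use that in \<open>auto simp: k Fo e' intro: D.cmp_mor[of _ d']\<close>)
    also have "Cmp D d (fobj F (k d')) d' (e d') (Cmp D d d' (fobj F (k d')) (e' d') g) =
      Cmp D d d' d' (Cmp D d' (fobj F (k d')) d' (e d') (e' d')) g"
      by (rule D.cmp_assoc[symmetric]) (use that in \<open>auto simp: k Fo e'\<close>)
    finally show ?thesis using that by (simp add: e' D.idn_left)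
  qed
  \<comment> \<open>\<open>e d\<close> is monic, having \<open>e' d\<close> as a left inverse;
    identities between transported morphisms can be checked after composing with it.\<close>
  have e_mono: "x = y" if "d \<in> Ob D" "z \<in> Ob D" "x \<in> Mor D z (fobj F (k d))" "y \<in> Mor D z (fobj F (k d))"
    "Cmp D z (fobj F (k d)) d (e d) x = Cmp D z (fobj F (k d)) d (e d) y" for x y z d
  proof -
    have *: "x = Cmp D z d (fobj F (k d)) (e' d) (Cmp D z (fobj F (k d)) d (e d) x)"
      if "d \<in> Ob D" "z \<in> Ob D" "x \<in> Mor D z (fobj F (k d))" for x
      using D.cmp_assoc[of z "fobj F (k d)" d "fobj F (k d)" x "e d" "e' d"] that
      by (simp add: k Fo e' D.idn_left)
    show ?thesis using *[OF that(1,2,3)] *[OF that(1,2,4)] that(5) by simp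
  qed
  define K where "K = \<lparr>fobj = (\<lambda>d\<in>Ob D. k d),
     fmor = (\<lambda>a\<in>Ob D. \<lambda>b\<in>Ob D. \<lambda>f\<in>Mor D a b. G (k a) (k b) (t a b f))\<rparr>"
  have t_idn: "t d d (Idn D d) = Idn D (fobj F (k d))" if "d \<in> Ob D" for d
    using that by (simp add: t_def e' D.idn_right k Fo)
  have t_cmp: "t a c (Cmp D a b c g f) = Cmp D (fobj F (k a)) (fobj F (k b)) (fobj F (k c)) (t b c g) (t a b f)"
    if o: "a \<in> Ob D" "b \<in> Ob D" "c \<in> Ob D" and m: "f \<in> Mor D a b" "g \<in> Mor D b c" for a b c f g
  proof (rule e_mono[of c "fobj F (k a)"])
    have "Cmp D (fobj F (k a)) (fobj F (k c)) c (e c) (t a c (Cmp D a b c g f)) =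
       Cmp D (fobj F (k a)) a c (Cmp D a b c g f) (e a)"
      using o m by (simp add: t_e D.cmp_mor[of a b c])
    also have "\<dots> = Cmp D (fobj F (k a)) b c g (Cmp D (fobj F (k a)) a b f (e a))"
      by (rule D.cmp_assoc) (use o m in \<open>auto simp: k Fo e'\<close>)
    also have "\<dots> = Cmp D (fobj F (k a)) b c g (Cmp D (fobj F (k a)) (fobj F (k b)) b (e b) (t a b f))"
      using o m by (simp add: t_e)
    also have "\<dots> = Cmp D (fobj F (k a)) (fobj F (k b)) c (Cmp D (fobj F (k b)) b c g (e b)) (t a b f)"
      by (rule D.cmp_assoc[symmetric]) (use o m in \<open>auto simp: k Fo e' t_mor\<close>)
    also have "\<dots> = Cmp D (fobj F (k a)) (fobj F (k b)) c (Cmp D (fobj F (k b)) (fobj F (k c)) c (e c) (t b c g)) (t a b f)"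
      using o m by (simp add: t_e)
    also have "\<dots> = Cmp D (fobj F (k a)) (fobj F (k c)) c (e c) (Cmp D (fobj F (k a)) (fobj F (k b)) (fobj F (k c)) (t b c g) (t a b f))"
      by (rule D.cmp_assoc) (use o m in \<open>auto simp: k Fo e' t_mor\<close>)
    finally show "Cmp D (fobj F (k a)) (fobj F (k c)) c (e c) (t a c (Cmp D a b c g f)) = \<dots>" .
  qed (use o m in \<open>auto simp: k Fo t_mor intro!: t_mor D.cmp_mor[of _ b] D.cmp_mor[of _ "fobj F (k b)"]\<close>)
  have K: "is_functor D C K"
    unfolding K_def
  proof (rule is_functor_restrictI)
    fix a assume "a \<in> Ob D"
    then show "G (k a) (k a) (t a a (Idn D a)) = Idn C (k a)"
      by (intro inj[of "k a" "k a"]) (auto simp: k FG G_mor t_idn Fi C.idn_mor D.idn_mor Fo)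
  next
    fix a b c f g assume o: "a \<in> Ob D" "b \<in> Ob D" "c \<in> Ob D" "f \<in> Mor D a b" "g \<in> Mor D b c"
    then have m: "Cmp D (fobj F (k a)) (fobj F (k b)) (fobj F (k c)) (t b c g) (t a b f) \<in> Mor D (fobj F (k a)) (fobj F (k c))"
      by (intro D.cmp_mor[of _ "fobj F (k b)"]) (auto simp: k Fo t_mor)
    with o show "G (k a) (k c) (t a c (Cmp D a b c g f)) = Cmp C (k a) (k b) (k c) (G (k b) (k c) (t b c g)) (G (k a) (k b) (t a b f))"
      by (intro inj[of "k a" "k c"])
        (auto simp: k FG G_mor t_cmp[of a b c] Fc t_mor D.cmp_mor[of a b c] Fo intro!: G_mor C.cmp_mor[of _ "k b"] D.cmp_mor[of _ "fobj F (k b)"])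
  qed (auto simp: k D.idn_mor D.cmp_mor t_mor G_mor)
  have KO: "fobj K d = k d" if "d \<in> Ob D" for d using that by (simp add: K_def)
  have KM: "fmor K a b f = G (k a) (k b) (t a b f)" if "a \<in> Ob D" "b \<in> Ob D" "f \<in> Mor D a b" for a b f
    using that by (simp add: K_def)
  \<comment> \<open>The unit is the preimage under \<open>F\<close> of the inverse isomorphism
    \<open>e'\<close>; the counit is \<open>e\<close> itself.\<close>
  define \<eta> where "\<eta> = (\<lambda>a\<in>Ob C. G a (k (fobj F a)) (e' (fobj F a)))"
  define \<eta>' where "\<eta>' = (\<lambda>a. G (k (fobj F a)) a (e (fobj F a)))"
  have eta_mor: "\<eta> a \<in> Mor C a (k (fobj F a))" "fmor F a (k (fobj F a)) (\<eta> a) = e' (fobj F a)"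
    "\<eta>' a \<in> Mor C (k (fobj F a)) a" "fmor F (k (fobj F a)) a (\<eta>' a) = e (fobj F a)" if "a \<in> Ob C" for a
    using that by (auto simp: \<eta>_def \<eta>'_def k Fo e' FG intro: G_mor)
  have "naturally_isomorphic C C (id_functor C) (comp_functor C K F)"
    unfolding naturally_isomorphic_def
  proof (intro bexI[of _ \<eta>] ballI)
    fix a assume a: "a \<in> Ob C"
    show "iso_mor C (fobj (id_functor C) a) (fobj (comp_functor C K F) a) (\<eta> a)"
    proof -
      have k': "k (fobj F a) \<in> Ob C" using a by (simp add: k Fo)
      have "Cmp C a (k (fobj F a)) a (\<eta>' a) (\<eta> a) = Idn C a"
        by (rule inj[OF a a]) (use a k' in \<open>auto simp: C.idn_mor eta_mor Fo k Fc[of a "k (fobj F a)" a] Fi e'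
            intro!: C.cmp_mor[of a "k (fobj F a)"]\<close>)
      moreover have "Cmp C (k (fobj F a)) a (k (fobj F a)) (\<eta> a) (\<eta>' a) = Idn C (k (fobj F a))"
        by (rule inj[OF k' k']) (use a k' in \<open>auto simp: C.idn_mor eta_mor Fo k Fc[of "k (fobj F a)" a] Fi e'
            intro!: C.cmp_mor[of "k (fobj F a)" a]\<close>)
      ultimately show ?thesis
        unfolding iso_mor_def id_functor_def comp_functor_def using a by (auto simp: KO Fo eta_mor)
    qed
  next
    have "Cmp C a b (k (fobj F b)) (\<eta> b) f =
       Cmp C a (k (fobj F a)) (k (fobj F b)) (G (k (fobj F a)) (k (fobj F b)) (t (fobj F a) (fobj F b) (fmor F a b f))) (\<eta> a)"
      if a: "a \<in> Ob C" "b \<in> Ob C" "f \<in> Mor C a b" for a b f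
    proof (rule inj[of a "k (fobj F b)"])
      let ?a = "fobj F a" let ?b = "fobj F b" let ?f = "fmor F a b f"
      have o: "?a \<in> Ob D" "?b \<in> Ob D" "?f \<in> Mor D ?a ?b" "k ?a \<in> Ob C" "k ?b \<in> Ob C" using a by (auto simp: Fo Fm k)
      note G1 = G_mor[OF o(4,5) t_mor[OF o(1,2,3)]] FG[OF o(4,5) t_mor[OF o(1,2,3)]]
      have l: "fmor F a (k ?b) (Cmp C a b (k ?b) (\<eta> b) f) = Cmp D ?a ?b (fobj F (k ?b)) (e' ?b) ?f"
        using a o by (simp add: Fc[of a b] eta_mor)
      have r: "fmor F a (k ?b) (Cmp C a (k ?a) (k ?b) (G (k ?a) (k ?b) (t ?a ?b ?f)) (\<eta> a)) =
         Cmp D ?a (fobj F (k ?a)) (fobj F (k ?b)) (t ?a ?b ?f) (e' ?a)"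
        using a o by (simp add: Fc[of a "k ?a"] eta_mor G1)
      have "Cmp D ?a (fobj F (k ?a)) (fobj F (k ?b)) (t ?a ?b ?f) (e' ?a) =
         Cmp D ?a ?a (fobj F (k ?b)) (Cmp D ?a ?b (fobj F (k ?b)) (e' ?b) ?f) (Cmp D ?a (fobj F (k ?a)) ?a (e ?a) (e' ?a))"
        unfolding t_def by (rule D.cmp_assoc) (use a o in \<open>auto simp: Fo e' intro: D.cmp_mor[of _ ?b]\<close>)
      also have "\<dots> = Cmp D ?a ?b (fobj F (k ?b)) (e' ?b) ?f"
        using o by (simp add: e' Fo D.idn_right D.cmp_mor[of ?a ?b])
      finally show "fmor F a (k ?b) (Cmp C a b (k ?b) (\<eta> b) f) =
        fmor F a (k ?b) (Cmp C a (k ?a) (k ?b) (G (k ?a) (k ?b) (t ?a ?b ?f)) (\<eta> a))"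
        using l r by simp
    qed (use a in \<open>auto simp: k Fo Fm eta_mor intro!: C.cmp_mor[of a b] C.cmp_mor[of a "k (fobj F a)"] G_mor t_mor\<close>)
    then show "\<eta> \<in> nat_trans C C (id_functor C) (comp_functor C K F)"
      unfolding nat_trans_def id_functor_def comp_functor_def
      by (auto simp: KO Fo Fm KM eta_mor) (auto simp: \<eta>_def)
  qed
  moreover have "naturally_isomorphic D D (comp_functor D F K) (id_functor D)"
    unfolding naturally_isomorphic_def
  proof (intro bexI[of _ "\<lambda>d\<in>Ob D. e d"] ballI)
    fix a assume a: "a \<in> Ob D"
    then show "iso_mor D (fobj (comp_functor D F K) a) (fobj (id_functor D) a) ((\<lambda>d\<in>Ob D. e d) a)"
      using e by (simp add: comp_functor_def id_functor_def KO)
  next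
    show "(\<lambda>d\<in>Ob D. e d) \<in> nat_trans D D (comp_functor D F K) (id_functor D)"
      unfolding nat_trans_def id_functor_def comp_functor_def
      by (auto simp: KO KM e' FG k t_mor t_e)
  qed
  ultimately show ?thesis unfolding equivalent_categories_def using C D F K by blast
qed

text \<open>Serves to transfer product preservation from a disjoint union, where it can be computed,
  to an arbitrary product cone; this is why compatibility with the projections is recorded.\<close>

lemma (in category) is_product_iso:
  assumes P: "is_product C I X P p" and Q: "is_product C I X Q q"
  obtains u where "iso_mor C P Q u" "\<And>i. i \<in> I \<Longrightarrow> Cmp C P Q (X i) (q i) u = p i"
proof -
  note PD = P[unfolded is_product_def] and QD = Q[unfolded is_product_def]
  obtain u where u: "u \<in> Mor C P Q" "\<And>i. i \<in> I \<Longrightarrow> Cmp C P Q (X i) (q i) u = p i"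
    using PD QD by metis
  obtain v where v: "v \<in> Mor C Q P" "\<And>i. i \<in> I \<Longrightarrow> Cmp C Q P (X i) (p i) v = q i"
    using PD QD by metis
  have "Cmp C P Q P v u = Idn C P"
  proof -
    have "\<exists>!w. w \<in> Mor C P P \<and> (\<forall>i \<in> I. Cmp C P P (X i) (p i) w = p i)" using PD by blast
    moreover have "Cmp C P Q P v u \<in> Mor C P P" using u v PD QD by (auto intro: cmp_mor)
    moreover have "Cmp C P P (X i) (p i) (Cmp C P Q P v u) = p i" if "i \<in> I" for i
      using cmp_assoc[of P Q P "X i" u v "p i"] u v PD QD that by simp
    moreover have "Idn C P \<in> Mor C P P" using PD by (auto intro: idn_mor)
    moreover have "Cmp C P P (X i) (p i) (Idn C P) = p i" if "i \<in> I" for i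
      using PD that by (simp add: idn_right)
    ultimately show ?thesis by blast
  qed
  moreover have "Cmp C Q P Q u v = Idn C Q"
  proof -
    have "\<exists>!w. w \<in> Mor C Q Q \<and> (\<forall>i \<in> I. Cmp C Q Q (X i) (q i) w = q i)" using QD by blast
    moreover have "Cmp C Q P Q u v \<in> Mor C Q Q" using u v PD QD by (auto intro: cmp_mor)
    moreover have "Cmp C Q Q (X i) (q i) (Cmp C Q P Q u v) = q i" if "i \<in> I" for i
      using cmp_assoc[of Q P Q "X i" v u "q i"] u v PD QD that by simp
    moreover have "Idn C Q \<in> Mor C Q Q" using QD by (auto intro: idn_mor)
    moreover have "Cmp C Q Q (X i) (q i) (Idn C Q) = q i" if "i \<in> I" for i
      using QD that by (simp add: idn_right)
    ultimately show ?thesis by blast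
  qed
  ultimately show ?thesis using u v that unfolding iso_mor_def by blast
qed

section \<open>Rational vector spaces\<close>

lemma rat_ring_simps [simp]:
  "carrier rat_ring = UNIV" "\<one>\<^bsub>rat_ring\<^esub> = 1" "\<zero>\<^bsub>rat_ring\<^esub> = 0"
  "x \<oplus>\<^bsub>rat_ring\<^esub> y = x + y" "x \<otimes>\<^bsub>rat_ring\<^esub> y = x * y"
  by (simp_all add: rat_ring_def)

lemma cring_rat_ring: "cring rat_ring"
proof (rule cringI)
  show "abelian_group rat_ring"
    by (rule abelian_groupI) (auto simp: intro: exI[of _ "- x" for x])
  show "comm_monoid rat_ring"
    by (rule comm_monoidI) auto
qed (auto simp: algebra_simps)

lemma rat_moduleI:
  fixes V (structure)
  assumes "\<zero> \<in> carrier V"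
    and "\<And>x y. \<lbrakk>x \<in> carrier V; y \<in> carrier V\<rbrakk> \<Longrightarrow> x \<oplus> y \<in> carrier V"
    and "\<And>r x. x \<in> carrier V \<Longrightarrow> r \<odot> x \<in> carrier V"
    and "\<And>x y z. \<lbrakk>x \<in> carrier V; y \<in> carrier V; z \<in> carrier V\<rbrakk> \<Longrightarrow> x \<oplus> y \<oplus> z = x \<oplus> (y \<oplus> z)"
    and "\<And>x y. \<lbrakk>x \<in> carrier V; y \<in> carrier V\<rbrakk> \<Longrightarrow> x \<oplus> y = y \<oplus> x"
    and "\<And>x. x \<in> carrier V \<Longrightarrow> \<zero> \<oplus> x = x"
    and "\<And>x. x \<in> carrier V \<Longrightarrow> (-1::rat) \<odot> x \<oplus> x = \<zero>"
    and "\<And>r s x. x \<in> carrier V \<Longrightarrow> (r + s) \<odot> x = r \<odot> x \<oplus> s \<odot> x"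
    and "\<And>r x y. \<lbrakk>x \<in> carrier V; y \<in> carrier V\<rbrakk> \<Longrightarrow> r \<odot> (x \<oplus> y) = r \<odot> x \<oplus> r \<odot> y"
    and "\<And>r s x. x \<in> carrier V \<Longrightarrow> (r * s) \<odot> x = r \<odot> (s \<odot> x)"
    and "\<And>x. x \<in> carrier V \<Longrightarrow> 1 \<odot> x = x"
  shows "module rat_ring V"
proof (rule moduleI)
  show "abelian_group V"
  proof (rule abelian_groupI)
    show "\<exists>y\<in>carrier V. y \<oplus> x = \<zero>" if "x \<in> carrier V" for x
      using assms(3,7) that by blast
  qed (use assms in blast)+
qed (use assms cring_rat_ring in auto)

locale rat_module = module rat_ring V for V (structure)

context rat_module
begin

lemma smult_simps [simp]:
  "x \<in> carrier V \<Longrightarrow> 0 \<odot> x = \<zero>"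
  "r \<odot> \<zero> = \<zero>"
  "x \<in> carrier V \<Longrightarrow> 1 \<odot> x = x"
  using smult_l_null[of x] smult_r_null[of r] smult_one[of x] by auto

lemma smult_closed' [simp, intro]: "x \<in> carrier V \<Longrightarrow> r \<odot> x \<in> carrier V"
  using smult_closed[of r x] by simp

lemma smult_l_distr': "x \<in> carrier V \<Longrightarrow> (r + s) \<odot> x = r \<odot> x \<oplus> s \<odot> x"
  using smult_l_distr[of r s x] by simp

lemma smult_r_distr': "x \<in> carrier V \<Longrightarrow> y \<in> carrier V \<Longrightarrow> r \<odot> (x \<oplus> y) = r \<odot> x \<oplus> r \<odot> y"
  using smult_r_distr[of r x y] by simp

lemma smult_smult: "x \<in> carrier V \<Longrightarrow> r \<odot> (s \<odot> x) = (r * s) \<odot> x"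
  using smult_assoc1[of r s x] by simp

lemma neg_one: "x \<in> carrier V \<Longrightarrow> (-1) \<odot> x = \<ominus> x"
  using M.minus_equality[of "(-1) \<odot> x" x] smult_l_distr'[of x "-1" 1] by simp

lemma add_facts:
  "\<zero> \<in> carrier V" "x \<in> carrier V \<Longrightarrow> y \<in> carrier V \<Longrightarrow> x \<oplus> y \<in> carrier V"
  "x \<in> carrier V \<Longrightarrow> y \<in> carrier V \<Longrightarrow> z \<in> carrier V \<Longrightarrow> x \<oplus> y \<oplus> z = x \<oplus> (y \<oplus> z)"
  "x \<in> carrier V \<Longrightarrow> y \<in> carrier V \<Longrightarrow> x \<oplus> y = y \<oplus> x"
  "x \<in> carrier V \<Longrightarrow> \<zero> \<oplus> x = x"
  "x \<in> carrier V \<Longrightarrow> (-1) \<odot> x \<oplus> x = \<zero>"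
  by (simp_all add: M.a_ac M.r_neg neg_one)

text \<open>The means by which the group orders accumulated in weighted sums are divided
  out.\<close>

lemma smult_cancel:
  assumes "r \<noteq> 0" "x \<in> carrier V" "y \<in> carrier V" "r \<odot> x = r \<odot> y"
  shows "x = y"
proof -
  have "z = inverse r \<odot> (r \<odot> z)" if "z \<in> carrier V" for z
    using assms(1) that by (simp add: smult_smult)
  then show ?thesis using assms(2-) by metis
qed

lemma smult_eq_zero:
  assumes "r \<noteq> 0" "x \<in> carrier V" "r \<odot> x = \<zero>" shows "x = \<zero>"
  using smult_cancel[of r x \<zero>] assms by simp

lemma smult_finsum:
  assumes "\<And>a. a \<in> A \<Longrightarrow> f a \<in> carrier V"
  shows "r \<odot> (finsum V f A) = finsum V (\<lambda>a. r \<odot> f a) A"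
proof (cases "finite A")
  case True
  then show ?thesis using assms
  proof induction
    case (insert x F)
    then show ?case by (simp add: smult_r_distr' M.finsum_insert Pi_iff)
  qed simp
qed simp

lemma finsum_const_rat:
  assumes "x \<in> carrier V" "finite A"
  shows "finsum V (\<lambda>a. x) A = of_nat (card A) \<odot> x"
  using assms(2)
  by induction (use assms(1) in \<open>simp_all add: M.finsum_insert smult_l_distr'\<close>)

lemma finsum_Sigma:
  assumes "finite A" "\<And>a. a \<in> A \<Longrightarrow> finite (B a)"
    "\<And>a b. a \<in> A \<Longrightarrow> b \<in> B a \<Longrightarrow> f a b \<in> carrier V"
  shows "finsum V (\<lambda>a. finsum V (f a) (B a)) A = finsum V (\<lambda>(a, b). f a b) (Sigma A B)"
  using assms
proof (induction A)
  case (insert a A)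
  have *: "Sigma (insert a A) B = (Pair a ` B a) \<union> Sigma A B" by auto
  have "finsum V (\<lambda>(a, b). f a b) (Pair a ` B a) = finsum V (f a) (B a)"
    by (subst M.finsum_reindex) (use insert in \<open>auto simp: inj_on_def\<close>)
  then show ?case
    unfolding * using insert
    by (subst M.finsum_Un_disjoint) (auto simp: M.finsum_insert Pi_iff intro!: M.finsum_closed)
qed simp

text \<open>A double sum and a sum over a single set \<open>C\<close> are matched by
  \<open>k\<close> and its inverse, the pair of \<open>p\<close> and \<open>q\<close>. The
  regroupings of points along maps further on are instances.\<close>

lemma finsum_Sigma_reindex:
  assumes "finite A" "\<And>a. a \<in> A \<Longrightarrow> finite (B a)"
    and "\<And>a b. a \<in> A \<Longrightarrow> b \<in> B a \<Longrightarrow> f a b \<in> carrier V"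
    and "\<And>a b. a \<in> A \<Longrightarrow> b \<in> B a \<Longrightarrow> k a b \<in> C \<and> p (k a b) = a \<and> q (k a b) = b"
    and "\<And>c. c \<in> C \<Longrightarrow> p c \<in> A \<and> q c \<in> B (p c) \<and> k (p c) (q c) = c"
  shows "finsum V (\<lambda>a. finsum V (f a) (B a)) A = finsum V (\<lambda>c. f (p c) (q c)) C"
proof -
  have C: "C = (\<lambda>(a, b). k a b) ` Sigma A B" using assms(4,5) by force
  have inj: "inj_on (\<lambda>(a, b). k a b) (Sigma A B)"
    by (rule inj_on_inverseI[of _ "\<lambda>c. (p c, q c)"]) (use assms(4) in auto)
  have "finsum V (\<lambda>c. f (p c) (q c)) C = finsum V (\<lambda>x. (\<lambda>c. f (p c) (q c)) ((\<lambda>(a, b). k a b) x)) (Sigma A B)"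
    unfolding C by (rule M.finsum_reindex) (use assms inj in auto)
  also have "\<dots> = finsum V (\<lambda>(a, b). f a b) (Sigma A B)"
    by (rule M.finsum_cong') (use assms in auto)
  finally show ?thesis using finsum_Sigma[of A B f] assms by simp
qed

lemma finsum_reindex_bij:
  assumes "bij_betw h A B" "\<And>b. b \<in> B \<Longrightarrow> f b \<in> carrier V"
  shows "finsum V (\<lambda>a. f (h a)) A = finsum V f B"
  using M.finsum_reindex[of f h A] assms by (auto simp: bij_betw_def)

lemma finsum_zero_eq:
  "(\<And>a. a \<in> A \<Longrightarrow> f a = \<zero>) \<Longrightarrow> finsum V f A = \<zero>"
  using M.finsum_cong'[of A A "\<lambda>_. \<zero>" f] by simp

lemma finsum_single:
  assumes "finite A" "a \<in> A" "\<And>b. b \<in> A \<Longrightarrow> b \<noteq> a \<Longrightarrow> f b = \<zero>" "f a \<in> carrier V"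
  shows "finsum V f A = f a"
proof -
  have "finsum V f A = finsum V f {a}"
    by (rule M.add.finprod_mono_neutral_cong_right) (use assms in \<open>auto, metis M.zero_closed\<close>)
  also have "\<dots> = f a" using assms by (simp add: M.finsum_insert)
  finally show ?thesis .
qed

text \<open>For nonzero \<open>x\<close> the multiples of \<open>x\<close> by the infinitely many
  rationals are distinct. This disposes of the degenerate case of a finite type of vectors.\<close>

lemma finite_carrier_trivial:
  assumes "finite (carrier V)" "x \<in> carrier V"
  shows "x = \<zero>"
proof (rule ccontr)
  assume x: "x \<noteq> \<zero>"
  have "inj (\<lambda>r. r \<odot> x)"
  proof (rule injI)
    fix r s assume restr: "r \<odot> x = s \<odot> x"
    have "(r - s) \<odot> x \<oplus> s \<odot> x = s \<odot> x"
      using smult_l_distr'[of x "r - s" s] assms(2) restr by simp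
    then have "(r - s) \<odot> x = \<zero>"
      using assms(2) by (simp add: M.add.l_cancel_one)
    then show "r = s" using smult_eq_zero[of "r - s" x] x assms(2) by auto
  qed
  then have "infinite (range (\<lambda>r. r \<odot> x))"
    using finite_imageD infinite_UNIV_char_0 by blast
  moreover have "range (\<lambda>r. r \<odot> x) \<subseteq> carrier V" using assms(2) by auto
  ultimately show False using assms(1) finite_subset by blast
qed

end

lemma rat_module_iff: "rat_module V \<longleftrightarrow> V \<in> Ob vect_cat"
  by (simp add: rat_module_def vect_cat_def)

abbreviation lin :: "(rat, 'v) module \<Rightarrow> (rat, 'w) module \<Rightarrow> ('v \<Rightarrow> 'w) \<Rightarrow> bool" where
  "lin V W f \<equiv> (\<forall>x \<in> carrier V. f x \<in> carrier W) \<and>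
     (\<forall>x \<in> carrier V. \<forall>y \<in> carrier V. f (x \<oplus>\<^bsub>V\<^esub> y) = f x \<oplus>\<^bsub>W\<^esub> f y) \<and>
     (\<forall>r. \<forall>x \<in> carrier V. f (r \<odot>\<^bsub>V\<^esub> x) = r \<odot>\<^bsub>W\<^esub> f x)"

lemma vect_mor_iff: "f \<in> Mor vect_cat V W \<longleftrightarrow> f \<in> extensional (carrier V) \<and> lin V W f"
  unfolding vect_cat_def by (auto simp: PiE_iff)

lemma lin_zero:
  assumes "rat_module V" "rat_module W" "lin V W f"
  shows "f \<zero>\<^bsub>V\<^esub> = \<zero>\<^bsub>W\<^esub>"
proof -
  interpret V: rat_module V by fact
  interpret W: rat_module W by fact
  have "f (0 \<odot>\<^bsub>V\<^esub> \<zero>\<^bsub>V\<^esub>) = 0 \<odot>\<^bsub>W\<^esub> f \<zero>\<^bsub>V\<^esub>" using assms(3) by blast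
  then show ?thesis using assms(3) by simp
qed

lemma lin_finsum:
  assumes "rat_module V" "rat_module W" "lin V W f" "\<And>a. a \<in> A \<Longrightarrow> g a \<in> carrier V"
  shows "f (finsum V g A) = finsum W (\<lambda>a. f (g a)) A"
proof -
  interpret V: rat_module V by fact
  interpret W: rat_module W by fact
  show ?thesis
  proof (cases "finite A")
    case True
    then show ?thesis using assms(4)
    proof induction
      case empty then show ?case using lin_zero[OF assms(1-3)] by simp
    next
      case (insert x F)
      have "g x \<in> carrier V" "finsum V g F \<in> carrier V" using insert by (auto intro!: V.finsum_closed)
      then show ?case using insert assms(3) by (simp add: V.finsum_insert W.finsum_insert Pi_iff)
    qed
  next
    case False then show ?thesis using lin_zero[OF assms(1-3)] by simp
  qed
qed

lemma lin_comp: "lin U V f \<Longrightarrow> lin V W g \<Longrightarrow> lin U W (\<lambda>x. g (f x))"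
  by simp

lemma lin_cong: "rat_module V \<Longrightarrow> (\<And>x. x \<in> carrier V \<Longrightarrow> f x = g x) \<Longrightarrow> lin V W f \<Longrightarrow> lin V W g"
proof -
  assume a: "rat_module V" "\<And>x. x \<in> carrier V \<Longrightarrow> f x = g x" "lin V W f"
  interpret rat_module V by fact
  show "lin V W g"
  proof (intro conjI ballI allI)
    fix x y assume xy: "x \<in> carrier V" "y \<in> carrier V"
    show "g (x \<oplus>\<^bsub>V\<^esub> y) = g x \<oplus>\<^bsub>W\<^esub> g y"
      using a(3) xy a(2)[OF xy(1)] a(2)[OF xy(2)] a(2)[OF M.a_closed[OF xy]] by auto
  next
    fix r x assume x: "x \<in> carrier V"
    show "g (r \<odot>\<^bsub>V\<^esub> x) = r \<odot>\<^bsub>W\<^esub> g x"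
      using a(3) x a(2)[OF x] a(2)[OF smult_closed'[OF x, of r]] by auto
  next
    fix x assume x: "x \<in> carrier V"
    show "g x \<in> carrier W" using a(3) x a(2)[OF x] by auto
  qed
qed

lemma category_vect_cat: "category vect_cat"
proof (unfold_locales, goal_cases)
  case (1 V)
  then interpret rat_module V by (simp add: rat_module_iff)
  show ?case by (auto simp: vect_cat_def)
next
  case (2 U V W f g)
  then show ?case
  proof -
    interpret rat_module U using 2 by (simp add: rat_module_iff)
    show ?thesis using 2 unfolding vect_mor_iff by (auto simp: vect_cat_def compose_def)
  qed
next
  case (3 V W f) then show ?case by (auto simp: vect_cat_def compose_def PiE_iff extensional_def fun_eq_iff)
next
  case (4 V W f) then show ?case by (auto simp: vect_cat_def compose_def PiE_iff extensional_def fun_eq_iff)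
next
  case (5 U V W X f g h) then show ?case
    by (auto simp: vect_cat_def compose_def PiE_iff intro!: restrict_ext)
qed

lemma vect_cat_simps [simp]:
  "Idn vect_cat V = (\<lambda>x\<in>carrier V. x)"
  "Cmp vect_cat U V W g f = compose (carrier U) g f"
  by (simp_all add: vect_cat_def)

lemma vect_isoI:
  assumes V: "rat_module V" and W: "rat_module W" and f: "f \<in> Mor vect_cat V W"
    and bij: "bij_betw f (carrier V) (carrier W)"
  shows "iso_mor vect_cat V W f"
proof -
  interpret V: rat_module V by fact
  interpret W: rat_module W by fact
  let ?g = "\<lambda>y\<in>carrier W. inv_into (carrier V) f y"
  have g: "inv_into (carrier V) f y \<in> carrier V" "f (inv_into (carrier V) f y) = y" if "y \<in> carrier W" for y
    using bij that by (auto simp: bij_betw_def inv_into_into f_inv_into_f)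
  have inj: "inj_on f (carrier V)" using bij by (simp add: bij_betw_def)
  have fl: "lin V W f" using f by (simp add: vect_mor_iff)
  have gl: "?g \<in> Mor vect_cat W V"
    unfolding vect_mor_iff
    using g fl by (auto intro!: inv_into_f_eq[OF inj])
  have "compose (carrier V) ?g f = (\<lambda>x\<in>carrier V. x)"
    using fl inj by (auto simp: compose_def intro!: restrict_ext)
  moreover have "compose (carrier W) f ?g = (\<lambda>x\<in>carrier W. x)"
    using g by (auto simp: compose_def intro!: restrict_ext)
  ultimately show ?thesis unfolding iso_mor_def using f gl by auto
qed

lemma vect_iso_bij:
  assumes "iso_mor vect_cat V W f"
  shows "bij_betw f (carrier V) (carrier W)"
proof -
  obtain g where f: "f \<in> Mor vect_cat V W" and g: "g \<in> Mor vect_cat W V"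
    and "compose (carrier V) g f = (\<lambda>x\<in>carrier V. x)" "compose (carrier W) f g = (\<lambda>x\<in>carrier W. x)"
    using assms unfolding iso_mor_def by auto
  then have "g (f x) = x" if "x \<in> carrier V" for x
    using that by (metis compose_eq restrict_apply')
  moreover have "f (g x) = x" if "x \<in> carrier W" for x
    using that \<open>compose (carrier W) f g = (\<lambda>x\<in>carrier W. x)\<close> by (metis compose_eq restrict_apply')
  ultimately show ?thesis
    by (intro bij_betwI[of _ _ _ g]) (use f g in \<open>auto simp: vect_mor_iff\<close>)
qed

text \<open>The mediating map is obtained pointwise from surjectivity of the map into the product of
  the carriers; its linearity and its uniqueness both follow from injectivity.\<close>

lemma vect_productI:
  assumes V: "rat_module V" and W: "\<And>i. i \<in> I \<Longrightarrow> rat_module (W i)"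
    and p: "\<And>i. i \<in> I \<Longrightarrow> p i \<in> Mor vect_cat V (W i)"
    and bij: "bij_betw (\<lambda>x. \<lambda>i\<in>I. p i x) (carrier V) (\<Pi>\<^sub>E i\<in>I. carrier (W i))"
  shows "is_product vect_cat I W V p"
  unfolding is_product_def
proof (intro conjI ballI allI impI)
  show "V \<in> Ob vect_cat" using V by (simp add: rat_module_iff)
  fix i assume "i \<in> I" then show "W i \<in> Ob vect_cat" "p i \<in> Mor vect_cat V (W i)"
    using W p by (simp_all add: rat_module_iff)
next
  interpret V: rat_module V by fact
  fix Z f assume Z: "Z \<in> Ob vect_cat" and f: "\<forall>i\<in>I. f i \<in> Mor vect_cat Z (W i)"
  interpret Z: rat_module Z using Z by (simp add: rat_module_iff)
  have inj: "x = y" if "x \<in> carrier V" "y \<in> carrier V" "\<And>i. i \<in> I \<Longrightarrow> p i x = p i y" for x y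
    using bij that by (auto simp: bij_betw_def intro!: inj_onD[of "\<lambda>x. \<lambda>i\<in>I. p i x" "carrier V" x y] restrict_ext)
  have "\<exists>x. x \<in> carrier V \<and> (\<forall>i\<in>I. p i x = f i z)" if "z \<in> carrier Z" for z
  proof -
    have "(\<lambda>i\<in>I. f i z) \<in> (\<Pi>\<^sub>E i\<in>I. carrier (W i))" using f that by (auto simp: vect_mor_iff)
    then have "(\<lambda>i\<in>I. f i z) \<in> (\<lambda>x. \<lambda>i\<in>I. p i x) ` carrier V" using bij by (simp add: bij_betw_def)
    then obtain x where x: "x \<in> carrier V" "(\<lambda>i\<in>I. f i z) = (\<lambda>i\<in>I. p i x)" by blast
    have "p i x = f i z" if "i \<in> I" for i using fun_cong[OF x(2), of i] that by simp
    then show ?thesis using x by blast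
  qed
  then obtain u where u: "\<And>z. z \<in> carrier Z \<Longrightarrow> u z \<in> carrier V"
    "\<And>z i. z \<in> carrier Z \<Longrightarrow> i \<in> I \<Longrightarrow> p i (u z) = f i z" by metis
  have u_mor: "(\<lambda>z\<in>carrier Z. u z) \<in> Mor vect_cat Z V"
    unfolding vect_mor_iff
  proof (intro conjI ballI allI)
    fix x y assume xy: "x \<in> carrier Z" "y \<in> carrier Z"
    then show "(\<lambda>z\<in>carrier Z. u z) (x \<oplus>\<^bsub>Z\<^esub> y) = (\<lambda>z\<in>carrier Z. u z) x \<oplus>\<^bsub>V\<^esub> (\<lambda>z\<in>carrier Z. u z) y"
      using u(1) by (simp, rule_tac inj) (use u f p xy in \<open>simp_all add: vect_mor_iff\<close>)
  next
    fix r x assume x: "x \<in> carrier Z"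
    then show "(\<lambda>z\<in>carrier Z. u z) (r \<odot>\<^bsub>Z\<^esub> x) = r \<odot>\<^bsub>V\<^esub> (\<lambda>z\<in>carrier Z. u z) x"
      using u(1) by (simp, rule_tac inj) (use u f p x in \<open>simp_all add: vect_mor_iff\<close>)
  qed (use u in auto)
  show "\<exists>!u. u \<in> Mor vect_cat Z V \<and> (\<forall>i\<in>I. Cmp vect_cat Z V (W i) (p i) u = f i)"
  proof (intro ex1I[of _ "\<lambda>z\<in>carrier Z. u z"] conjI ballI)
    fix i assume "i \<in> I"
    then have "f i \<in> extensional (carrier Z)" using f by (simp add: vect_mor_iff)
    then show "Cmp vect_cat Z V (W i) (p i) (\<lambda>z\<in>carrier Z. u z) = f i"
      using u \<open>i \<in> I\<close> by (auto simp: compose_def extensional_def fun_eq_iff)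
  next
    fix v assume v: "v \<in> Mor vect_cat Z V \<and> (\<forall>i\<in>I. Cmp vect_cat Z V (W i) (p i) v = f i)"
    then have "p i (v z) = f i z" if "z \<in> carrier Z" "i \<in> I" for z i
      using that by (metis compose_eq vect_cat_simps(2))
    then show "v = (\<lambda>z\<in>carrier Z. u z)"
      by (intro extensionalityI[of _ "carrier Z"])
        (use v in \<open>auto simp: vect_mor_iff intro!: inj[of "v z" "u z" for z] u(1) simp: u(2)\<close>)
  qed (rule u_mor)
qed

lemma rat_submodule:
  assumes V: "rat_module V" and "U \<subseteq> carrier V" "\<zero>\<^bsub>V\<^esub> \<in> U"
    "\<And>x y. x \<in> U \<Longrightarrow> y \<in> U \<Longrightarrow> x \<oplus>\<^bsub>V\<^esub> y \<in> U" "\<And>r x. x \<in> U \<Longrightarrow> r \<odot>\<^bsub>V\<^esub> x \<in> U"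
  shows "rat_module (V\<lparr>carrier := U\<rparr>)"
proof -
  interpret V: rat_module V by fact
  have [simp]: "x \<in> U \<Longrightarrow> x \<in> carrier V" for x using assms by blast
  show ?thesis
    unfolding rat_module_def
    by (rule rat_moduleI)
      (use assms in \<open>simp_all add: V.l_neg V.neg_one V.smult_l_distr' V.smult_r_distr' V.smult_smult\<close>,
        simp_all add: V.a_ac)
qed

section \<open>Finite products of vector spaces, copied into a single type\<close>

definition pi_mod :: "'i set \<Rightarrow> ('i \<Rightarrow> (rat, 'v) module) \<Rightarrow> (rat, 'i \<Rightarrow> 'v) module" where
  "pi_mod I V = \<lparr>carrier = (\<Pi>\<^sub>E i\<in>I. carrier (V i)), mult = (\<lambda>x y. x), one = (\<lambda>_. undefined),
     zero = (\<lambda>i\<in>I. \<zero>\<^bsub>V i\<^esub>), add = (\<lambda>x y. \<lambda>i\<in>I. x i \<oplus>\<^bsub>V i\<^esub> y i), smult = (\<lambda>r x. \<lambda>i\<in>I. r \<odot>\<^bsub>V i\<^esub> x i)\<rparr>"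

lemma pi_mod_simps [simp]:
  "carrier (pi_mod I V) = (\<Pi>\<^sub>E i\<in>I. carrier (V i))"
  "\<zero>\<^bsub>pi_mod I V\<^esub> = (\<lambda>i\<in>I. \<zero>\<^bsub>V i\<^esub>)"
  "x \<oplus>\<^bsub>pi_mod I V\<^esub> y = (\<lambda>i\<in>I. x i \<oplus>\<^bsub>V i\<^esub> y i)"
  "r \<odot>\<^bsub>pi_mod I V\<^esub> x = (\<lambda>i\<in>I. r \<odot>\<^bsub>V i\<^esub> x i)"
  by (simp_all add: pi_mod_def)

lemma rat_module_pi_mod:
  assumes "\<And>i. i \<in> I \<Longrightarrow> rat_module (V i)"
  shows "rat_module (pi_mod I V)"
proof -
  note f = rat_module.add_facts[OF assms] rat_module.smult_closed'[OF assms]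
    rat_module.smult_l_distr'[OF assms] rat_module.smult_r_distr'[OF assms] rat_module.smult_smult[OF assms]
    rat_module.smult_simps[OF assms]
  show ?thesis
    unfolding rat_module_def
  proof (rule rat_moduleI, goal_cases)
    case (4 x y z) show ?case by (rule ext) (use 4 f in \<open>auto simp: PiE_iff\<close>)
  next
    case (5 x y) show ?case by (rule ext) (use 5 f in \<open>auto simp: PiE_iff\<close>)
  next
    case (6 x) show ?case by (rule ext) (use 6 f in \<open>auto simp: PiE_iff extensional_def\<close>)
  next
    case (7 x) show ?case by (rule ext) (use 7 f in \<open>auto simp: PiE_iff\<close>)
  next
    case (11 x) show ?case by (rule ext) (use 11 f in \<open>auto simp: PiE_iff extensional_def\<close>)
  qed (use f in \<open>auto simp: PiE_iff intro!: restrict_ext\<close>)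
qed

text \<open>The values of the Mackey functor to be constructed are spaces of families and must be
  fitted into the type \<open>'v\<close> of the given spaces. If \<open>'v\<close> is infinite, its
  square injects into it and induction on \<open>I\<close> applies. If \<open>'v\<close> is finite,
  every rational vector space inside it is zero, and the product has at most one element.\<close>

lemma pi_mod_embeds:
  fixes V :: "'i \<Rightarrow> (rat, 'v) module"
  assumes "finite I" "\<And>i. i \<in> I \<Longrightarrow> rat_module (V i)"
  shows "\<exists>\<iota> :: ('i \<Rightarrow> 'v) \<Rightarrow> 'v. inj_on \<iota> (\<Pi>\<^sub>E i\<in>I. carrier (V i))"
proof (cases "finite (UNIV :: 'v set)")
  case True
  have fin: "finite A" for A :: "'v set" by (rule finite_subset[OF subset_UNIV True])
  have "x i = \<zero>\<^bsub>V i\<^esub>" if "i \<in> I" "x \<in> (\<Pi>\<^sub>E i\<in>I. carrier (V i))" for x i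
    using rat_module.finite_carrier_trivial[OF assms(2) fin] that by blast
  then have "x = y" if "x \<in> (\<Pi>\<^sub>E i\<in>I. carrier (V i))" "y \<in> (\<Pi>\<^sub>E i\<in>I. carrier (V i))" for x y
    using that(1) that(2) by (intro PiE_ext[OF that]) metis
  then show ?thesis by (intro exI[of _ "\<lambda>_. undefined"] inj_onI)
next
  case False
  have "\<exists>f. bij_betw f ((UNIV :: 'v set) \<times> (UNIV :: 'v set)) (UNIV :: 'v set)"
    unfolding card_of_ordIso by (rule card_of_Times_same_infinite[OF False])
  then obtain j :: "'v \<times> 'v \<Rightarrow> 'v" where j: "inj j"
    by (auto simp: bij_betw_def)
  show ?thesis
    using assms(1)
  proof induction
    case empty
    show ?case by auto
  next
    case (insert i I)
    then obtain \<iota> :: "('i \<Rightarrow> 'v) \<Rightarrow> 'v" where \<iota>: "inj_on \<iota> (\<Pi>\<^sub>E i\<in>I. carrier (V i))" by blast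
    show ?case
    proof (intro exI[of _ "\<lambda>x. j (x i, \<iota> (restrict x I))"] inj_onI)
      fix x y assume xy: "x \<in> (\<Pi>\<^sub>E i\<in>insert i I. carrier (V i))" "y \<in> (\<Pi>\<^sub>E i\<in>insert i I. carrier (V i))"
        "j (x i, \<iota> (restrict x I)) = j (y i, \<iota> (restrict y I))"
      then have i: "x i = y i" "\<iota> (restrict x I) = \<iota> (restrict y I)" using j by (auto dest: injD)
      have "restrict x I = restrict y I"
        using inj_on_eq_iff[OF \<iota>] i(2) xy by (auto simp: PiE_iff)
      then have "x k = y k" if "k \<in> I" for k using that by (metis restrict_apply')
      then show "x = y" using i xy by (intro PiE_ext[OF xy(1,2)]) auto
    qed
  qed
qed

text \<open>Transport of structure along a map that is injective only on the carrier, whence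
  \<open>inv_into\<close>.\<close>

definition copy_mod :: "('w \<Rightarrow> 'v) \<Rightarrow> (rat, 'w) module \<Rightarrow> (rat, 'v) module" where
  "copy_mod \<iota> V = (let \<rho> = inv_into (carrier V) \<iota> in
    \<lparr>carrier = \<iota> ` carrier V, mult = (\<lambda>x y. x), one = undefined,
     zero = \<iota> \<zero>\<^bsub>V\<^esub>, add = (\<lambda>x y. \<iota> (\<rho> x \<oplus>\<^bsub>V\<^esub> \<rho> y)), smult = (\<lambda>r x. \<iota> (r \<odot>\<^bsub>V\<^esub> \<rho> x))\<rparr>)"

lemma copy_mod:
  assumes V: "rat_module V" and \<iota>: "inj_on \<iota> (carrier V)"
  shows "rat_module (copy_mod \<iota> V)" "lin V (copy_mod \<iota> V) \<iota>"
    "lin (copy_mod \<iota> V) V (inv_into (carrier V) \<iota>)"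
    "carrier (copy_mod \<iota> V) = \<iota> ` carrier V"
proof -
  interpret V: rat_module V by fact
  note [simp] = inv_into_f_f[OF \<iota>]
  have c: "carrier (copy_mod \<iota> V) = \<iota> ` carrier V" "\<zero>\<^bsub>copy_mod \<iota> V\<^esub> = \<iota> \<zero>\<^bsub>V\<^esub>"
    "\<And>x y. x \<in> carrier V \<Longrightarrow> y \<in> carrier V \<Longrightarrow> \<iota> x \<oplus>\<^bsub>copy_mod \<iota> V\<^esub> \<iota> y = \<iota> (x \<oplus>\<^bsub>V\<^esub> y)"
    "\<And>r x. x \<in> carrier V \<Longrightarrow> r \<odot>\<^bsub>copy_mod \<iota> V\<^esub> \<iota> x = \<iota> (r \<odot>\<^bsub>V\<^esub> x)"
    by (simp_all add: copy_mod_def Let_def)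
  show "rat_module (copy_mod \<iota> V)"
    unfolding rat_module_def
    by (rule rat_moduleI)
      (auto simp: c V.a_ac V.r_neg V.neg_one V.smult_l_distr' V.smult_r_distr' V.smult_smult)
  show "lin V (copy_mod \<iota> V) \<iota>" "lin (copy_mod \<iota> V) V (inv_into (carrier V) \<iota>)" "carrier (copy_mod \<iota> V) = \<iota> ` carrier V"
    by (auto simp: c)
qed

section \<open>Conjugation and finite \<open>G\<close>-sets\<close>

context group
begin

section \<open>Conjugates of subgroups\<close>

definition conjg :: "'a \<Rightarrow> 'a set \<Rightarrow> 'a set" where
  "conjg g K = g <# K #> inv g"

lemma cj_eq: "conjg g K = (\<lambda>k. g \<otimes> k \<otimes> inv g) ` K"
  unfolding conjg_def l_coset_def r_coset_def by auto

lemma mem_cj: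
  assumes "K \<subseteq> carrier G" "g \<in> carrier G"
  shows "x \<in> conjg g K \<longleftrightarrow> x \<in> carrier G \<and> inv g \<otimes> x \<otimes> g \<in> K"
proof
  assume "x \<in> conjg g K"
  then obtain k where k: "k \<in> K" "x = g \<otimes> k \<otimes> inv g" by (auto simp: cj_eq)
  then have "k \<in> carrier G" using assms by auto
  moreover have "inv g \<otimes> x \<otimes> g = k" using k assms \<open>k \<in> carrier G\<close>
    by (metis inv_closed inv_solve_left inv_solve_right' m_assoc m_closed)
  ultimately show "x \<in> carrier G \<and> inv g \<otimes> x \<otimes> g \<in> K" using k assms by auto
next
  assume x: "x \<in> carrier G \<and> inv g \<otimes> x \<otimes> g \<in> K"
  then have "x = g \<otimes> (inv g \<otimes> x \<otimes> g) \<otimes> inv g" using assms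
    by (metis inv_closed inv_inv inv_solve_left inv_solve_right' m_assoc m_closed)
  then show "x \<in> conjg g K" using x unfolding cj_eq by blast
qed

lemma cj_carrier: "K \<subseteq> carrier G \<Longrightarrow> g \<in> carrier G \<Longrightarrow> conjg g K \<subseteq> carrier G"
  by (auto simp: mem_cj)

lemma cj_cj: "K \<subseteq> carrier G \<Longrightarrow> g \<in> carrier G \<Longrightarrow> h \<in> carrier G \<Longrightarrow> conjg g (conjg h K) = conjg (g \<otimes> h) K"
  by (auto simp: mem_cj cj_carrier inv_mult_group m_assoc)

lemma cj_one: "K \<subseteq> carrier G \<Longrightarrow> conjg \<one> K = K"
  by (subst set_eq_iff) (auto simp: mem_cj subset_iff)

lemma cj_inv: "K \<subseteq> carrier G \<Longrightarrow> g \<in> carrier G \<Longrightarrow> conjg (inv g) (conjg g K) = K"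
  "K \<subseteq> carrier G \<Longrightarrow> g \<in> carrier G \<Longrightarrow> conjg g (conjg (inv g) K) = K"
  by (simp_all add: cj_cj cj_one)

lemma cj_mono: "K \<subseteq> L \<Longrightarrow> conjg g K \<subseteq> conjg g L"
  by (auto simp: cj_eq)

lemma cj_mono_iff: "K \<subseteq> carrier G \<Longrightarrow> L \<subseteq> carrier G \<Longrightarrow> g \<in> carrier G \<Longrightarrow> conjg g K \<subseteq> L \<longleftrightarrow> K \<subseteq> conjg (inv g) L"
  using cj_mono[of "conjg g K" L "inv g"] cj_mono[of K "conjg (inv g) L" g] cj_inv by (metis inv_closed)

lemma cj_Int: "K \<subseteq> carrier G \<Longrightarrow> L \<subseteq> carrier G \<Longrightarrow> g \<in> carrier G \<Longrightarrow> conjg g (K \<inter> L) = conjg g K \<inter> conjg g L"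
  by (subst set_eq_iff) (auto simp: mem_cj subset_iff)

lemma cj_subgroup: "subgroup K G \<Longrightarrow> g \<in> carrier G \<Longrightarrow> subgroup (conjg g K) G"
  using subgroup_conjugation_is_surj1[of "inv g" K] by (simp add: conjg_def)

lemma cj_self: "subgroup K G \<Longrightarrow> g \<in> K \<Longrightarrow> conjg g K = K"
  using subgroup.mem_carrier[of K G g] subgroup.subset[of K G]
  apply (auto simp: mem_cj subgroup.m_closed subgroup.m_inv_closed)
  by (metis inv_closed inv_solve_left' inv_solve_right' m_closed subgroup.m_closed subgroup.m_inv_closed m_assoc inv_inv)

lemma cj_card: "K \<subseteq> carrier G \<Longrightarrow> g \<in> carrier G \<Longrightarrow> card (conjg g K) = card K"
  unfolding cj_eq
  by (rule card_image, rule inj_onI) (metis inv_closed m_closed right_cancel Units_eq Units_l_cancel subsetD)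

lemma cj_normalizer: "K \<subseteq> carrier G \<Longrightarrow> g \<in> normalizer G K \<longleftrightarrow> g \<in> carrier G \<and> conjg g K = K"
  by (auto simp: normalizer_def stabilizer_def conjg_def)

section \<open>Finite \<open>G\<close>-sets, stabilizers and equivariant maps\<close>

lemma finite_gsetI:
  assumes "finite (pts S)"
    and "\<And>g x. g \<in> carrier G \<Longrightarrow> x \<in> pts S \<Longrightarrow> act S g x \<in> pts S"
    and "\<And>x. x \<in> pts S \<Longrightarrow> act S \<one> x = x"
    and "\<And>g h x. g \<in> carrier G \<Longrightarrow> h \<in> carrier G \<Longrightarrow> x \<in> pts S \<Longrightarrow> act S (g \<otimes> h) x = act S g (act S h x)"
    and "act S \<in> extensional (carrier G)"
    and "\<And>g. g \<in> carrier G \<Longrightarrow> act S g \<in> extensional (pts S)"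
  shows "finite_gset G S"
proof -
  have inv: "act S (inv g) (act S g x) = x" "act S g (act S (inv g) x) = x"
    if "g \<in> carrier G" "x \<in> pts S" for g x
    using assms(3)[OF that(2)] assms(4)[of "inv g" g x] assms(4)[of g "inv g" x] that by auto
  \<comment> \<open>Actions are encoded as homomorphisms into \<open>BijGroup\<close>, whose
    elements are extensional bijections; the inverse of \<open>act S g\<close> is the action of
    \<open>inv g\<close>.\<close>
  have bij: "act S g \<in> Bij (pts S)" if "g \<in> carrier G" for g
    unfolding Bij_def using assms(6)[OF that]
    by (auto intro!: bij_betwI[of _ _ _ "act S (inv g)"] simp: that inv assms(2))
  have "group_action G (pts S) (act S)"
    unfolding group_action_def group_hom_def group_hom_axioms_def
  proof (intro conjI is_group group_BijGroup homI)
    fix g assume "g \<in> carrier G" then show "act S g \<in> carrier (BijGroup (pts S))"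
      using bij by (simp add: BijGroup_def)
  next
    fix g h assume gh: "g \<in> carrier G" "h \<in> carrier G"
    have "act S (g \<otimes> h) = compose (pts S) (act S g) (act S h)"
      by (rule extensionalityI[OF assms(6)]) (use gh assms(4) in \<open>auto simp: compose_eq\<close>)
    then show "act S (g \<otimes> h) = act S g \<otimes>\<^bsub>BijGroup (pts S)\<^esub> act S h"
      using bij gh by (simp add: BijGroup_def)
  qed
  then show ?thesis using assms by (simp add: finite_gset_def)
qed

abbreviation stab :: "('a, 's) gset \<Rightarrow> 's \<Rightarrow> 'a set" where
  "stab S s \<equiv> stabilizer G (act S) s"

context
  fixes S :: "('a, 's) gset"
  assumes S: "finite_gset G S"
begin

lemma gset_finite: "finite (pts S)"
  using S by (simp add: finite_gset_def)

lemma act_closed: "g \<in> carrier G \<Longrightarrow> x \<in> pts S \<Longrightarrow> act S g x \<in> pts S"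
  using S group_action.element_image unfolding finite_gset_def by fast

lemma act_one: "x \<in> pts S \<Longrightarrow> act S \<one> x = x"
  using S group_action.id_eq_one unfolding finite_gset_def by (metis restrict_apply')

lemma act_mult: "g \<in> carrier G \<Longrightarrow> h \<in> carrier G \<Longrightarrow> x \<in> pts S \<Longrightarrow> act S (g \<otimes> h) x = act S g (act S h x)"
  using S group_action.composition_rule unfolding finite_gset_def by metis

lemma act_inv:
  "g \<in> carrier G \<Longrightarrow> x \<in> pts S \<Longrightarrow> act S (inv g) (act S g x) = x"
  "g \<in> carrier G \<Longrightarrow> x \<in> pts S \<Longrightarrow> act S g (act S (inv g) x) = x"
  by (simp_all flip: act_mult add: act_one)

lemma act_ext: "act S \<in> extensional (carrier G)" "g \<in> carrier G \<Longrightarrow> act S g \<in> extensional (pts S)"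
  using S group_action.bij_prop0[of G "pts S" "act S" g] unfolding finite_gset_def by (auto simp: Bij_def)

lemma stab_subgroup: "x \<in> pts S \<Longrightarrow> subgroup (stab S x) G"
  using S group_action.stabilizer_subgroup unfolding finite_gset_def by metis

lemma mem_stab: "h \<in> stab S x \<longleftrightarrow> h \<in> carrier G \<and> act S h x = x"
  by (simp add: stabilizer_def)

lemma stab_carrier: "stab S x \<subseteq> carrier G"
  by (auto simp: stabilizer_def)

lemma stab_act: assumes "g \<in> carrier G" "x \<in> pts S" shows "stab S (act S g x) = conjg g (stab S x)"
proof -
  have "act S h (act S g x) = act S g x \<longleftrightarrow> act S (inv g \<otimes> h \<otimes> g) x = x" if "h \<in> carrier G" for h
  proof -
    have "act S (inv g \<otimes> h \<otimes> g) x = act S (inv g) (act S h (act S g x))"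
      using that assms by (simp add: act_mult act_closed)
    then show ?thesis using act_inv[of g x] act_inv(2)[of g "act S h (act S g x)"] assms that act_closed by metis
  qed
  then show ?thesis using assms by (auto simp: mem_cj stab_carrier mem_stab)
qed

lemma act_eq_iff: "g \<in> carrier G \<Longrightarrow> h \<in> carrier G \<Longrightarrow> x \<in> pts S \<Longrightarrow> act S g x = act S h x \<longleftrightarrow> inv h \<otimes> g \<in> stab S x"
  unfolding mem_stab using act_inv[of h] act_mult[of "inv h" g x] act_closed by (metis inv_closed m_closed)

end

lemma gset_homD:
  assumes "f \<in> gset_hom G S T"
  shows "x \<in> pts S \<Longrightarrow> f x \<in> pts T" "g \<in> carrier G \<Longrightarrow> x \<in> pts S \<Longrightarrow> f (act S g x) = act T g (f x)"
    "f \<in> extensional (pts S)"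
  using assms by (auto simp: gset_hom_def PiE_iff)

lemma gset_hom_eqI:
  assumes "f \<in> gset_hom G S T" "f' \<in> gset_hom G S T'" "\<And>x. x \<in> pts S \<Longrightarrow> f x = f' x"
  shows "f = f'"
  using assms gset_homD(3) by (metis extensionalityI)

lemma gset_hom_restrictI:
  assumes "finite_gset G S" "\<And>x. x \<in> pts S \<Longrightarrow> f x \<in> pts T"
    "\<And>g x. g \<in> carrier G \<Longrightarrow> x \<in> pts S \<Longrightarrow> f (act S g x) = act T g (f x)"
  shows "(\<lambda>x\<in>pts S. f x) \<in> gset_hom G S T"
  using assms by (auto simp: gset_hom_def act_closed)

lemma gset_hom_comp:
  assumes "finite_gset G S" "f \<in> gset_hom G S T" "g \<in> gset_hom G T U"
  shows "(\<lambda>x\<in>pts S. g (f x)) \<in> gset_hom G S U"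
  using assms by (intro gset_hom_restrictI) (auto simp: gset_homD)

lemma gset_hom_id: "finite_gset G S \<Longrightarrow> (\<lambda>x\<in>pts S. x) \<in> gset_hom G S S"
  by (intro gset_hom_restrictI) auto

lemma stab_hom:
  assumes "finite_gset G S" "f \<in> gset_hom G S T" "x \<in> pts S"
  shows "stab S x \<subseteq> stab T (f x)"
  using gset_homD(2)[OF assms(2) _ assms(3)] by (auto simp: stabilizer_def) metis

lemma stab_hom_inj:
  assumes "finite_gset G S" "f \<in> gset_hom G S T" "x \<in> pts S" "inj_on f (pts S)"
  shows "stab T (f x) = stab S x"
proof -
  have "act S h x = x" if "h \<in> carrier G" "act T h (f x) = f x" for h
    using gset_homD(2)[OF assms(2) that(1) assms(3)] that(2) assms(3) act_closed[OF assms(1) that(1) assms(3)]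
    using inj_onD[OF assms(4), of "act S h x" x] by simp
  then show ?thesis using stab_hom[OF assms(1-3)] by (auto simp: stabilizer_def)
qed

lemma gset_hom_inv:
  assumes "finite_gset G S" "finite_gset G T" "f \<in> gset_hom G S T" "bij_betw f (pts S) (pts T)"
  shows "(\<lambda>y\<in>pts T. inv_into (pts S) f y) \<in> gset_hom G T S"
proof -
  have inj: "inj_on f (pts S)" using assms by (simp add: bij_betw_def)
  have m: "inv_into (pts S) f y \<in> pts S" "f (inv_into (pts S) f y) = y" if "y \<in> pts T" for y
    using assms(4) that by (auto simp: bij_betw_def inv_into_into f_inv_into_f)
  show ?thesis
  proof (rule gset_hom_restrictI[OF assms(2)])
    fix g y assume gy: "g \<in> carrier G" "y \<in> pts T"
    show "inv_into (pts S) f (act T g y) = act S g (inv_into (pts S) f y)"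
      by (rule inv_into_f_eq[OF inj]) (use gy m assms in \<open>auto simp: gset_homD act_closed\<close>)
  qed (use m in auto)
qed

lemma orbit_card:
  assumes "finite_gset G S" "finite (carrier G)" "x \<in> pts S"
  shows "card ((\<lambda>g. act S g x) ` carrier G) * card (stab S x) = card (carrier G)"
proof -
  have "orbit G (act S) x = (\<lambda>g. act S g x) ` carrier G" by (auto simp: orbit_def)
  then show ?thesis
    using group_action.orbit_stabilizer_theorem[of G "pts S" "act S" x] assms
    by (simp add: finite_gset_def order_def mult.commute)
qed

lemma gset_coset:
  assumes K: "subgroup K G" and fin: "finite (carrier G)"
  shows "finite_gset G (coset_gset G K)" "K \<in> pts (coset_gset G K)"
    "stab (coset_gset G K) K = K" "p \<in> pts (coset_gset G K) \<Longrightarrow> \<exists>g\<in>carrier G. p = act (coset_gset G K) g K"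
proof -
  interpret K: subgroup K G by fact
  have P: "A \<subseteq> carrier G" if "A \<in> lcosets K" for A
    using that K.lcosets_carrier is_group by blast
  have cl: "g <# A \<in> lcosets K" if "g \<in> carrier G" "A \<in> lcosets K" for g A
    using that K.subset by (auto simp: LCOSETS_def lcos_m_assoc)
  have K1: "K \<in> lcosets K" using lcos_mult_one[OF K.subset] unfolding LCOSETS_def by force
  show "finite_gset G (coset_gset G K)"
  proof (rule finite_gsetI)
    show "finite (pts (coset_gset G K))" using fin by (simp add: coset_gset_def LCOSETS_def)
  qed (use P cl in \<open>auto simp: coset_gset_def lcos_mult_one lcos_m_assoc\<close>)
  show "K \<in> pts (coset_gset G K)" using K1 by (simp add: coset_gset_def)
  show "stab (coset_gset G K) K = K"
    using K1 by (auto simp: stabilizer_def coset_gset_def coset_join3[OF _ K] intro: lcos_self[OF _ K]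
       dest: lcos_self[OF _ K])
  show "\<exists>g\<in>carrier G. p = act (coset_gset G K) g K" if "p \<in> pts (coset_gset G K)"
    using that K1 by (auto simp: coset_gset_def LCOSETS_def)
qed

end

section \<open>Disk-like transfer systems\<close>

text \<open>\<open>emb\<close> expresses that the type of points is infinite, so that every finite
  set has a copy in it; \<open>rep\<close> is the choice of a subgroup in each conjugacy class on
  which the product of categories depends.\<close>

locale disk = group G for G (structure) +
  fixes TS :: "('a set \<times> 'a set) set" and rep :: "'a set set \<Rightarrow> 'a set" and emb :: "nat \<Rightarrow> 's"
  assumes fin: "finite (carrier G)" and dl: "disk_like G TS"
    and rep: "\<And>c. c \<in> Sub_O_classes G TS \<Longrightarrow> rep c \<in> c"
    and emb: "inj emb"
begin

abbreviation "SubO \<equiv> Sub_O G TS"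
abbreviation "hullO \<equiv> H_O G TS"
abbreviation "SubO_classes \<equiv> Sub_O_classes G TS"
abbreviation "norm_rep c \<equiv> normalizer G (rep c)"

lemma subgroup_carrier: "subgroup K G \<Longrightarrow> K \<subseteq> carrier G"
  by (rule subgroup.subset)

section \<open>Consequences of the transfer system axioms\<close>

lemma ts: "transfer_system G TS"
  using dl by (simp add: disk_like_def)

lemma O_subgroup: "(K, L) \<in> TS \<Longrightarrow> subgroup K G \<and> subgroup L G"
  using ts unfolding transfer_system_def by blast

lemma O_subset: "(K, L) \<in> TS \<Longrightarrow> K \<subseteq> L"
  using ts unfolding transfer_system_def by blast

lemma O_refl: "subgroup K G \<Longrightarrow> (K, K) \<in> TS"
  using ts unfolding transfer_system_def partial_order_on_def preorder_on_def refl_on_def by blast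

lemma O_trans: "(K, L) \<in> TS \<Longrightarrow> (L, M) \<in> TS \<Longrightarrow> (K, M) \<in> TS"
  using ts unfolding transfer_system_def partial_order_on_def preorder_on_def trans_def by blast

lemma O_restrict: "(K, L) \<in> TS \<Longrightarrow> subgroup M G \<Longrightarrow> M \<subseteq> L \<Longrightarrow> (K \<inter> M, M) \<in> TS"
  using ts unfolding transfer_system_def by blast

lemma O_cj: "(K, L) \<in> TS \<Longrightarrow> g \<in> carrier G \<Longrightarrow> (conjg g K, conjg g L) \<in> TS"
  using ts unfolding transfer_system_def conjg_def by blast

lemma SO_iff: "A \<in> SubO \<longleftrightarrow> (A, carrier G) \<in> TS"
  by (simp add: Sub_O_def)

lemma SO_subgroup: "A \<in> SubO \<Longrightarrow> subgroup A G"
  using O_subgroup SO_iff by blast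

lemma SO_carrier: "carrier G \<in> SubO"
  using O_refl subgroup_self SO_iff by blast

lemma SO_O: "A \<in> SubO \<Longrightarrow> subgroup L G \<Longrightarrow> (L \<inter> A, L) \<in> TS"
  using O_restrict[of A "carrier G" L] subgroup_carrier by (simp add: SO_iff Int_commute)

lemma SO_Int: "A \<in> SubO \<Longrightarrow> B \<in> SubO \<Longrightarrow> A \<inter> B \<in> SubO"
  using SO_O[of B A] O_trans SO_iff SO_subgroup by blast

lemma SO_cj: "A \<in> SubO \<Longrightarrow> g \<in> carrier G \<Longrightarrow> conjg g A \<in> SubO"
proof -
  assume "A \<in> SubO" "g \<in> carrier G"
  then have "(conjg g A, conjg g (carrier G)) \<in> TS" using O_cj SO_iff by blast
  then show ?thesis using cj_self[OF subgroup_self \<open>g \<in> carrier G\<close>] SO_iff by simp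
qed

text \<open>The right-hand side is itself a transfer system containing all the generating relations,
  so minimality of a disk-like system gives one inclusion; the restriction axiom gives the other.
  Transitivity of the right-hand side rests on closure of \<open>SubO\<close> under
  intersection.\<close>

lemma O_eq: "TS = {(L \<inter> A, L) | L A. subgroup L G \<and> A \<in> SubO}" (is "_ = ?T")
proof
  show "?T \<subseteq> TS" using SO_O by blast
  have "transfer_system G ?T"
    unfolding transfer_system_def
  proof (intro conjI ballI)
    show "?T \<subseteq> {H. subgroup H G} \<times> {H. subgroup H G}"
      using SO_subgroup subgroups_Inter_pair by auto
    have "refl_on {H. subgroup H G} ?T"
    proof -
      have "(K, K) \<in> ?T" if "subgroup K G" for K
      proof -
        have K: "K \<inter> carrier G = K" using subgroup_carrier[OF that] by blast
        have "(K \<inter> carrier G, K) \<in> ?T" using that SO_carrier by blast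
        then show ?thesis unfolding K .
      qed
      then show ?thesis unfolding refl_on_def by simp
    qed
    moreover have "trans ?T"
    proof (rule transI)
      fix K L M assume "(K, L) \<in> ?T" "(L, M) \<in> ?T"
      then obtain A B where "K = L \<inter> A" "L = M \<inter> B" "subgroup M G" "A \<in> SubO" "B \<in> SubO" by blast
      then have "K = M \<inter> (B \<inter> A)" "B \<inter> A \<in> SubO" using SO_Int by auto
      then show "(K, M) \<in> ?T" using \<open>subgroup M G\<close> by blast
    qed
    moreover have "antisym ?T" by (rule antisymI) blast
    ultimately show "partial_order_on {H. subgroup H G} ?T"
      using \<open>?T \<subseteq> {H. subgroup H G} \<times> {H. subgroup H G}\<close>
      unfolding partial_order_on_def preorder_on_def by simp
    fix p assume "p \<in> ?T"
    then obtain L A where p: "p = (L \<inter> A, L)" "subgroup L G" "A \<in> SubO" by blast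
    show "case p of (K, H) \<Rightarrow> K \<subseteq> H" using p by auto
    have "(conjg g (L \<inter> A), conjg g L) \<in> ?T" if g: "g \<in> carrier G" for g
    proof -
      have "conjg g (L \<inter> A) = conjg g L \<inter> conjg g A"
        using cj_Int[OF subgroup_carrier subgroup_carrier g] p SO_subgroup by blast
      then show ?thesis using SO_cj[OF p(3) g] cj_subgroup[OF p(2) g] by blast
    qed
    then show "case p of (K, H) \<Rightarrow> \<forall>g\<in>carrier G. (g <# K #> inv g, g <# H #> inv g) \<in> ?T"
      unfolding p(1) conjg_def by blast
    have "(L \<inter> A \<inter> M, M) \<in> ?T" if "subgroup M G" "M \<subseteq> L" for M
    proof -
      have "L \<inter> A \<inter> M = M \<inter> A" using that by blast
      then show ?thesis using that p by blast
    qed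
    then show "case p of (K, H) \<Rightarrow> \<forall>M. subgroup M G \<and> M \<subseteq> H \<longrightarrow> (K \<inter> M, M) \<in> ?T"
      unfolding p(1) by blast
  qed
  moreover have "{(H, carrier G) | H. (H, carrier G) \<in> TS} \<subseteq> ?T"
  proof
    fix p assume "p \<in> {(H, carrier G) | H. (H, carrier G) \<in> TS}"
    then obtain H where H: "p = (H, carrier G)" "H \<in> SubO" using SO_iff by blast
    then have "carrier G \<inter> H = H" using SO_subgroup subgroup_carrier by blast
    then show "p \<in> ?T" using H subgroup_self by blast
  qed
  ultimately show "TS \<subseteq> ?T" using dl unfolding disk_like_def by blast
qed

lemma O_D: "(K, L) \<in> TS \<Longrightarrow> \<exists>A \<in> SubO. K = L \<inter> A"
  using equalityD1[OF O_eq] by blast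

section \<open>Hulls\<close>

lemma finite_SO: "finite SubO"
  by (rule finite_subset[of _ "Pow (carrier G)"]) (use fin SO_subgroup subgroup_carrier in auto)

lemma hull_ex:
  assumes "J \<subseteq> carrier G"
  shows "\<exists>H. (H \<in> SubO \<and> J \<subseteq> H) \<and> (\<forall>A. A \<in> SubO \<and> J \<subseteq> A \<longrightarrow> H \<le> A)"
proof -
  \<comment> \<open>The extra factor \<open>carrier G\<close> makes the intersection of the empty
    family a member of \<open>SubO\<close>.\<close>
  have "finite \<A> \<Longrightarrow> \<A> \<subseteq> {A \<in> SubO. J \<subseteq> A} \<Longrightarrow> carrier G \<inter> \<Inter> \<A> \<in> SubO" for \<A>
  proof (induction \<A> rule: finite_induct)
    case empty then show ?case using SO_carrier by simp
  next
    case (insert A \<A>)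
    then have "A \<inter> (carrier G \<inter> \<Inter> \<A>) \<in> SubO" using SO_Int by simp
    then show ?case by (simp add: Int_left_commute)
  qed
  from this[of "{A \<in> SubO. J \<subseteq> A}"] have "carrier G \<inter> \<Inter> {A \<in> SubO. J \<subseteq> A} \<in> SubO" using finite_SO by simp
  then show ?thesis using assms by blast
qed

lemma hO_facts:
  assumes "J \<subseteq> carrier G"
  shows hull_SO: "hullO J \<in> SubO" and hull_sub: "J \<subseteq> hullO J"
    and hull_least: "\<And>A. A \<in> SubO \<Longrightarrow> J \<subseteq> A \<Longrightarrow> hullO J \<subseteq> A"
proof -
  obtain H where H: "H \<in> SubO \<and> J \<subseteq> H" "\<And>A. A \<in> SubO \<and> J \<subseteq> A \<Longrightarrow> H \<le> A" using hull_ex[OF assms] by blast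
  have "hullO J = H" unfolding H_O_def by (rule Least_equality) (use H in auto)
  then show "hullO J \<in> SubO" "J \<subseteq> hullO J" "\<And>A. A \<in> SubO \<Longrightarrow> J \<subseteq> A \<Longrightarrow> hullO J \<subseteq> A" using H by auto
qed

lemma SO_sub: "A \<in> SubO \<Longrightarrow> A \<subseteq> carrier G"
  using SO_subgroup subgroup_carrier by blast

lemma hull_carrier: "J \<subseteq> carrier G \<Longrightarrow> hullO J \<subseteq> carrier G"
  using hull_SO SO_sub by blast

lemma hull_eqI: "J \<subseteq> A \<Longrightarrow> A \<in> SubO \<Longrightarrow> A \<subseteq> hullO J \<Longrightarrow> hullO J = A"
  using hull_least[of J A] SO_sub[of A] by blast

lemma hull_of_SO: "A \<in> SubO \<Longrightarrow> hullO A = A"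
  using hull_eqI[of A A] hull_sub SO_sub by blast

lemma hull_mono: "J \<subseteq> K \<Longrightarrow> K \<subseteq> carrier G \<Longrightarrow> hullO J \<subseteq> hullO K"
  using hull_least[of J "hullO K"] hull_sub[of K] hull_SO[of K] by blast

lemma hull_cj:
  assumes "J \<subseteq> carrier G" "g \<in> carrier G" shows "hullO (conjg g J) = conjg g (hullO J)"
proof (rule hull_eqI)
  show "conjg g J \<subseteq> conjg g (hullO J)" using cj_mono hull_sub assms by blast
  show "conjg g (hullO J) \<in> SubO" using SO_cj hull_SO assms by blast
  have c: "conjg g J \<subseteq> carrier G" using assms by (rule cj_carrier)
  have "J \<subseteq> conjg (inv g) (hullO (conjg g J))"
    using cj_mono[OF hull_sub[OF c], of "inv g"] cj_inv(1)[OF assms] by simp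
  then have "hullO J \<subseteq> conjg (inv g) (hullO (conjg g J))"
    using hull_least[OF assms(1)] SO_cj[OF hull_SO[OF c]] assms(2) by simp
  then show "conjg g (hullO J) \<subseteq> hullO (conjg g J)"
    using cj_mono_iff[of "hullO J" "hullO (conjg g J)" g] hull_carrier[OF assms(1)] hull_carrier[OF c] assms(2) by simp
qed

section \<open>Conjugacy classes, representatives and normalizers\<close>

lemma Cl_eq: "SubO_classes = {{conjg g H | g. g \<in> carrier G} | H. H \<in> SubO}"
  unfolding Sub_O_classes_def orbits_def orbit_def conjg_def
  using SO_subgroup by (auto simp: cong: conj_cong)

lemma rep_class:
  assumes "c \<in> SubO_classes"
  shows rep_SO: "rep c \<in> SubO" and Cl_rep: "c = {conjg g (rep c) | g. g \<in> carrier G}"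
proof -
  obtain H where H: "H \<in> SubO" "c = {conjg g H | g. g \<in> carrier G}" using assms unfolding Cl_eq by blast
  obtain h where h: "h \<in> carrier G" "rep c = conjg h H" using rep[OF assms] H by blast
  show "rep c \<in> SubO" using h H SO_cj by simp
  have Hc: "H \<subseteq> carrier G" using H SO_sub by blast
  have 1: "conjg g (rep c) = conjg (g \<otimes> h) H" if "g \<in> carrier G" for g using that h Hc by (simp add: cj_cj)
  have 2: "conjg g H = conjg (g \<otimes> inv h) (rep c)" if "g \<in> carrier G" for g
    using that h Hc by (simp add: cj_cj m_assoc)
  have "{conjg g H | g. g \<in> carrier G} = {conjg g (rep c) | g. g \<in> carrier G}"
  proof (rule Set.set_eqI, rule iffI)
    fix x assume "x \<in> {conjg g H | g. g \<in> carrier G}"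
    then obtain g where "g \<in> carrier G" "x = conjg g H" by blast
    then show "x \<in> {conjg g (rep c) | g. g \<in> carrier G}" using 2[of g] h by blast
  next
    fix x assume "x \<in> {conjg g (rep c) | g. g \<in> carrier G}"
    then obtain g where "g \<in> carrier G" "x = conjg g (rep c)" by blast
    then show "x \<in> {conjg g H | g. g \<in> carrier G}" using 1[of g] h by blast
  qed
  then show "c = {conjg g (rep c) | g. g \<in> carrier G}" using H(2) by simp
qed

lemma rep_sub: "c \<in> SubO_classes \<Longrightarrow> rep c \<subseteq> carrier G"
  using rep_SO SO_sub by blast

lemma SO_Cl:
  assumes "A \<in> SubO"
  shows "\<exists>c\<in>SubO_classes. \<exists>g\<in>carrier G. conjg g A = rep c"
proof -
  let ?c = "{conjg g A | g. g \<in> carrier G}"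
  have "?c \<in> SubO_classes" using assms unfolding Cl_eq by blast
  then show ?thesis using rep[of ?c] by blast
qed

lemma rep_cj_eq:
  assumes "c \<in> SubO_classes" "d \<in> SubO_classes" "g \<in> carrier G" "conjg g (rep c) = rep d"
  shows "c = d"
proof -
  have 1: "conjg h (rep d) = conjg (h \<otimes> g) (rep c)" if "h \<in> carrier G" for h
    using cj_cj[OF rep_sub[OF assms(1)] that assms(3)] assms(4) by simp
  have 2: "conjg h (rep c) = conjg (h \<otimes> inv g) (rep d)" if "h \<in> carrier G" for h
    using cj_cj[OF rep_sub[OF assms(1)] _ assms(3), of "h \<otimes> inv g"] assms that by (simp add: m_assoc)
  note h = assms(3)
  have "{conjg g (rep c) | g. g \<in> carrier G} = {conjg g (rep d) | g. g \<in> carrier G}"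
  proof (rule Set.set_eqI, rule iffI)
    fix x assume "x \<in> {conjg g (rep c) | g. g \<in> carrier G}"
    then obtain g where "g \<in> carrier G" "x = conjg g (rep c)" by blast
    then show "x \<in> {conjg g (rep d) | g. g \<in> carrier G}" using 2[of g] h by blast
  next
    fix x assume "x \<in> {conjg g (rep d) | g. g \<in> carrier G}"
    then obtain g where "g \<in> carrier G" "x = conjg g (rep d)" by blast
    then show "x \<in> {conjg g (rep c) | g. g \<in> carrier G}" using 1[of g] h by blast
  qed
  then show ?thesis using Cl_rep[OF assms(1)] Cl_rep[OF assms(2)] by simp
qed

lemma finite_Cl: "finite SubO_classes"
proof -
  have "SubO_classes = (\<lambda>H. {conjg g H | g. g \<in> carrier G}) ` SubO" unfolding Cl_eq by blast
  then show ?thesis using finite_SO by simp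
qed

lemma nz_iff: "c \<in> SubO_classes \<Longrightarrow> a \<in> norm_rep c \<longleftrightarrow> a \<in> carrier G \<and> conjg a (rep c) = rep c"
  using cj_normalizer rep_sub by blast

lemma nz_subgroup: "c \<in> SubO_classes \<Longrightarrow> subgroup (norm_rep c) G"
  using normalizer_imp_subgroup rep_sub by blast

lemma nz_closed: "c \<in> SubO_classes \<Longrightarrow> a \<in> norm_rep c \<Longrightarrow> a \<in> carrier G"
  by (simp add: nz_iff)

lemma rep_nz: "c \<in> SubO_classes \<Longrightarrow> rep c \<subseteq> norm_rep c"
proof
  fix a assume c: "c \<in> SubO_classes" and a: "a \<in> rep c"
  have "subgroup (rep c) G" by (rule SO_subgroup[OF rep_SO[OF c]])
  from cj_self[OF this a] show "a \<in> norm_rep c" using nz_iff[OF c] rep_sub[OF c] a by blast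
qed

text \<open>If \<open>K\<close> lies in \<open>rep c\<close>, its hull lies in \<open>rep c\<close>;
  being conjugate to it, the hull has the same order, so by finiteness the two agree. The objects of
  the orbit category at \<open>c\<close> are thus described by an equation between hulls, without
  conjugation.\<close>

lemma insep_iff:
  assumes "c \<in> SubO_classes"
  shows "K \<in> insep_class G TS (rep c) \<and> K \<subseteq> rep c \<longleftrightarrow> subgroup K G \<and> hullO K = rep c"
proof
  assume *: "K \<in> insep_class G TS (rep c) \<and> K \<subseteq> rep c"
  then have K: "subgroup K G" "K \<subseteq> rep c" and "\<exists>g\<in>carrier G. conjg g (hullO (rep c)) = hullO K"
    by (auto simp: insep_class_def inseparable_def conjg_def)
  then obtain g where g: "g \<in> carrier G" "conjg g (rep c) = hullO K" using hull_of_SO rep_SO assms by auto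
  have "hullO K \<subseteq> rep c" using hull_least[OF subgroup_carrier] K rep_SO[OF assms] by blast
  moreover have "card (hullO K) = card (rep c)" using g cj_card[OF rep_sub[OF assms]] by metis
  ultimately have "hullO K = rep c"
    by (meson card_subset_eq fin finite_subset rep_sub assms)
  then show "subgroup K G \<and> hullO K = rep c" using K by blast
next
  assume *: "subgroup K G \<and> hullO K = rep c"
  have "conjg \<one> (hullO (rep c)) = hullO K" using * rep_SO[OF assms] rep_sub[OF assms] by (simp add: hull_of_SO cj_one)
  then show "K \<in> insep_class G TS (rep c) \<and> K \<subseteq> rep c"
    using * hull_sub[OF subgroup_carrier, of K] SO_subgroup[OF rep_SO[OF assms]]
    by (auto simp: insep_class_def inseparable_def simp flip: conjg_def intro!: bexI[of _ \<one>])
qed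

section \<open>Orbits\<close>

text \<open>Every finite \<open>G\<close>-set has an isomorphic copy with points in the type of \<open>emb\<close>, hence in the Lindner category.\<close>

definition copy_map :: "('a, 'u) gset \<Rightarrow> 'u \<Rightarrow> 's" where
  "copy_map S = (SOME f. inj_on f (pts S))"

definition copy_gset :: "('a, 'u) gset \<Rightarrow> ('a, 's) gset" where
  "copy_gset S = \<lparr>pts = copy_map S ` pts S, act = (\<lambda>g\<in>carrier G. \<lambda>p\<in>copy_map S ` pts S. copy_map S (act S g (inv_into (pts S) (copy_map S) p)))\<rparr>"

context
  fixes S :: "('a, 'u) gset"
  assumes S: "finite_gset G S"
begin

lemma cpm_inj: "inj_on (copy_map S) (pts S)"
  unfolding copy_map_def
proof (rule someI_ex[where P = "\<lambda>f. inj_on f (pts S)"])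
  obtain f :: "'u \<Rightarrow> nat" where "inj_on f (pts S)" using finite_imp_inj_to_nat_seg[OF gset_finite[OF S]] by blast
  then have "inj_on (emb \<circ> f) (pts S)" using emb by (auto intro: comp_inj_on inj_on_subset)
  then show "\<exists>f :: 'u \<Rightarrow> 's. inj_on f (pts S)" by blast
qed

lemma cp_pts: "pts (copy_gset S) = copy_map S ` pts S"
  by (simp add: copy_gset_def)

lemma cp_act: "g \<in> carrier G \<Longrightarrow> x \<in> pts S \<Longrightarrow> act (copy_gset S) g (copy_map S x) = copy_map S (act S g x)"
  by (simp add: copy_gset_def inv_into_f_f cpm_inj)

lemma cp_gset: "finite_gset G (copy_gset S)"
proof (rule finite_gsetI)
  show "finite (pts (copy_gset S))" by (simp add: cp_pts gset_finite[OF S])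
  show "act (copy_gset S) \<in> extensional (carrier G)" by (simp add: copy_gset_def)
  show "act (copy_gset S) g \<in> extensional (pts (copy_gset S))" if "g \<in> carrier G" for g using that by (simp add: copy_gset_def)
qed (auto simp: cp_pts cp_act act_closed[OF S] act_one[OF S] act_mult[OF S])

lemma cpm_hom: "(\<lambda>x\<in>pts S. copy_map S x) \<in> gset_hom G S (copy_gset S)"
  by (rule gset_hom_restrictI[OF S]) (auto simp: cp_pts cp_act)

lemma cpm_bij: "bij_betw (\<lambda>x\<in>pts S. copy_map S x) (pts S) (pts (copy_gset S))"
  using cpm_inj by (simp add: bij_betw_def cp_pts)

end

text \<open>\<open>orb K\<close> is a copy of \<open>G/K\<close> with base point \<open>base_pt K\<close>, and \<open>pt_map K T t\<close> is the map \<open>G/K \<rightarrow> T\<close>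
  that sends the base point to \<open>t\<close>.\<close>

definition orb :: "'a set \<Rightarrow> ('a, 's) gset" where
  "orb K = copy_gset (coset_gset G K)"

definition base_pt :: "'a set \<Rightarrow> 's" where
  "base_pt K = copy_map (coset_gset G K) K"

definition pt_map :: "'a set \<Rightarrow> ('a, 't) gset \<Rightarrow> 't \<Rightarrow> 's \<Rightarrow> 't" where
  "pt_map K T t = (\<lambda>p\<in>pts (orb K). act T (SOME g. g \<in> carrier G \<and> p = act (orb K) g (base_pt K)) t)"

context
  fixes K
  assumes K: "subgroup K G"
begin

lemma orb_gset: "finite_gset G (orb K)"
  unfolding orb_def by (rule cp_gset[OF gset_coset(1)[OF K fin]])

lemma bpt_mem: "base_pt K \<in> pts (orb K)"
  unfolding orb_def base_pt_def using gset_coset[OF K fin] by (simp add: cp_pts)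

lemma bpt_stab: "stab (orb K) (base_pt K) = K"
  using stab_hom_inj[OF gset_coset(1)[OF K fin] cpm_hom[OF gset_coset(1)[OF K fin]] gset_coset(2)[OF K fin]]
    gset_coset[OF K fin] cpm_inj[OF gset_coset(1)[OF K fin]]
  by (simp add: orb_def base_pt_def)

lemma orb_trans: "p \<in> pts (orb K) \<Longrightarrow> \<exists>g\<in>carrier G. p = act (orb K) g (base_pt K)"
  using gset_coset[OF K fin] by (auto simp: orb_def base_pt_def cp_pts cp_act)

lemma orb_card: "card (pts (orb K)) * card K = card (carrier G)"
proof -
  have "pts (orb K) = (\<lambda>g. act (orb K) g (base_pt K)) ` carrier G"
    using orb_trans act_closed[OF orb_gset _ bpt_mem] by blast
  then show ?thesis using orbit_card[OF orb_gset fin bpt_mem] bpt_stab by simp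
qed

lemma orb_hom_eqI:
  assumes "f \<in> gset_hom G (orb K) T" "f' \<in> gset_hom G (orb K) T" "f (base_pt K) = f' (base_pt K)"
  shows "f = f'"
proof (rule gset_hom_eqI[OF assms(1,2)])
  fix x assume "x \<in> pts (orb K)"
  then obtain g where "g \<in> carrier G" "x = act (orb K) g (base_pt K)" using orb_trans by blast
  then show "f x = f' x" using assms bpt_mem by (simp add: gset_homD)
qed

text \<open>The choice of a group element in \<open>pt_map\<close> is harmless: two choices differ
  by an element of \<open>K\<close>, which fixes \<open>t\<close>.\<close>

lemma pm_act:
  assumes T: "finite_gset G T" "t \<in> pts T" "K \<subseteq> stab T t" and g: "g \<in> carrier G"
  shows "pt_map K T t (act (orb K) g (base_pt K)) = act T g t"
proof -
  let ?P = "\<lambda>h. h \<in> carrier G \<and> act (orb K) g (base_pt K) = act (orb K) h (base_pt K)"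
  have "?P (SOME h. ?P h)" by (rule someI[of ?P g]) (simp add: g)
  then have h: "(SOME h. ?P h) \<in> carrier G" "act (orb K) g (base_pt K) = act (orb K) (SOME h. ?P h) (base_pt K)" by auto
  then have "inv (SOME h. ?P h) \<otimes> g \<in> K" using act_eq_iff[OF orb_gset g h(1) bpt_mem] bpt_stab by simp
  then have "act T g t = act T (SOME h. ?P h) t" using act_eq_iff[OF T(1) g h(1) T(2)] T(3) by blast
  then show ?thesis using act_closed[OF orb_gset g bpt_mem] by (simp add: pt_map_def)
qed

lemma pm_bpt: "finite_gset G T \<Longrightarrow> t \<in> pts T \<Longrightarrow> K \<subseteq> stab T t \<Longrightarrow> pt_map K T t (base_pt K) = t"
  using pm_act[of T t \<one>] by (simp add: act_one orb_gset bpt_mem)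

lemma pm_hom:
  assumes T: "finite_gset G T" "t \<in> pts T" "K \<subseteq> stab T t"
  shows "pt_map K T t \<in> gset_hom G (orb K) T"
proof -
  have "(\<lambda>p\<in>pts (orb K). pt_map K T t p) \<in> gset_hom G (orb K) T"
  proof (rule gset_hom_restrictI[OF orb_gset])
    fix g x assume gx: "g \<in> carrier G" "x \<in> pts (orb K)"
    then obtain h where h: "h \<in> carrier G" "x = act (orb K) h (base_pt K)" using orb_trans by blast
    have "act (orb K) g x = act (orb K) (g \<otimes> h) (base_pt K)" using h gx by (simp add: act_mult[OF orb_gset] bpt_mem)
    then show "pt_map K T t (act (orb K) g x) = act T g (pt_map K T t x)"
      using pm_act[OF T] h gx act_mult[OF T(1)] T(2) by simp
  next
    fix x assume "x \<in> pts (orb K)"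
    then obtain h where h: "h \<in> carrier G" "x = act (orb K) h (base_pt K)" using orb_trans by blast
    then show "pt_map K T t x \<in> pts T" using pm_act[OF T] act_closed[OF T(1)] T(2) by simp
  qed
  moreover have "(\<lambda>p\<in>pts (orb K). pt_map K T t p) = pt_map K T t" by (auto simp: pt_map_def)
  ultimately show ?thesis by simp
qed

lemma orb_hom_eq_pm:
  assumes "finite_gset G T" "f \<in> gset_hom G (orb K) T"
  shows "f = pt_map K T (f (base_pt K))"
proof (rule orb_hom_eqI[OF assms(2)])
  have *: "f (base_pt K) \<in> pts T" "K \<subseteq> stab T (f (base_pt K))"
    using assms bpt_mem stab_hom[OF orb_gset assms(2) bpt_mem] bpt_stab by (auto simp: gset_homD)
  show "pt_map K T (f (base_pt K)) \<in> gset_hom G (orb K) T" by (rule pm_hom[OF assms(1) *])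
  show "f (base_pt K) = pt_map K T (f (base_pt K)) (base_pt K)" using pm_bpt[OF assms(1) *] by simp
qed

lemma orb_stab: "p \<in> pts (orb K) \<Longrightarrow> \<exists>g\<in>carrier G. p = act (orb K) g (base_pt K) \<and> stab (orb K) p = conjg g K"
  using orb_trans stab_act[OF orb_gset _ bpt_mem] bpt_stab by metis

end

lemma pm_comp:
  assumes K: "subgroup K G" and S: "finite_gset G S" "s \<in> pts S" "K \<subseteq> stab S s" and T: "finite_gset G T" "f \<in> gset_hom G S T"
  shows "(\<lambda>p\<in>pts (orb K). f (pt_map K S s p)) = pt_map K T (f s)"
proof -
  have "(\<lambda>p\<in>pts (orb K). f (pt_map K S s p)) \<in> gset_hom G (orb K) T"
    by (rule gset_hom_comp[OF orb_gset[OF K] pm_hom[OF K S] T(2)])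
  from orb_hom_eq_pm[OF K T(1) this] show ?thesis
    using pm_bpt[OF K S] bpt_mem[OF K] by simp
qed

end

section \<open>The Lindner category\<close>

context disk
begin

section \<open>Fibre products and composition of spans\<close>

lemma fibre_product_simps:
  "pts (fibre_product G U V h k) = {(y, z). y \<in> pts U \<and> z \<in> pts V \<and> h y = k z}"
  "\<lbrakk>g \<in> carrier G; y \<in> pts U; z \<in> pts V; h y = k z\<rbrakk> \<Longrightarrow>
    act (fibre_product G U V h k) g (y, z) = (act U g y, act V g z)"
  by (simp_all add: fibre_product_def Let_def)

lemma fibre_product_gset:
  assumes "finite_gset G U" "finite_gset G V" "h \<in> gset_hom G U T" "k \<in> gset_hom G V T"
  shows "finite_gset G (fibre_product G U V h k)"
proof (rule finite_gsetI)
  have "pts (fibre_product G U V h k) \<subseteq> pts U \<times> pts V" by (auto simp: fibre_product_simps)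
  then show "finite (pts (fibre_product G U V h k))"
    using assms gset_finite finite_subset finite_SigmaI by metis
  show "act (fibre_product G U V h k) \<in> extensional (carrier G)"
    by (simp add: fibre_product_def Let_def)
  show "act (fibre_product G U V h k) g \<in> extensional (pts (fibre_product G U V h k))" if "g \<in> carrier G" for g
    using that by (simp add: fibre_product_def Let_def)
qed (use assms in \<open>auto simp: fibre_product_simps act_closed act_one act_mult gset_homD\<close>)

lemma fibre_product_stab:
  assumes "y \<in> pts U" "z \<in> pts V" "h y = k z"
  shows "stab (fibre_product G U V h k) (y, z) = stab U y \<inter> stab V z"
  using assms by (auto simp: stabilizer_def fibre_product_simps)

lemma spansD:
  assumes "w \<in> spans G TS R T"
  shows "finite_gset G (apex w)" "lleg w \<in> gset_hom G (apex w) R" "rleg w \<in> gset_hom G (apex w) T"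
    "x \<in> pts (apex w) \<Longrightarrow> (stab (apex w) x, stab T (rleg w x)) \<in> TS"
  using assms by (auto simp: spans_def Fin_O_hom_def)

lemma spansI:
  assumes "finite_gset G (apex w)" "lleg w \<in> gset_hom G (apex w) R" "rleg w \<in> gset_hom G (apex w) T"
    "\<And>x. x \<in> pts (apex w) \<Longrightarrow> (stab (apex w) x, stab T (rleg w x)) \<in> TS"
  shows "w \<in> spans G TS R T"
  using assms by (auto simp: spans_def Fin_O_hom_def)

lemma span_isoI:
  assumes "f \<in> gset_hom G (apex u) (apex v)" "bij_betw f (pts (apex u)) (pts (apex v))"
    "\<And>x. x \<in> pts (apex u) \<Longrightarrow> lleg v (f x) = lleg u x" "\<And>x. x \<in> pts (apex u) \<Longrightarrow> rleg v (f x) = rleg u x"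
  shows "span_iso G u v"
  using assms unfolding span_iso_def by blast

lemma span_iso_trans:
  assumes "span_iso G u v" "span_iso G v w" "finite_gset G (apex u)"
  shows "span_iso G u w"
proof -
  obtain f where f: "f \<in> gset_hom G (apex u) (apex v)" "bij_betw f (pts (apex u)) (pts (apex v))"
    "\<And>x. x \<in> pts (apex u) \<Longrightarrow> lleg v (f x) = lleg u x" "\<And>x. x \<in> pts (apex u) \<Longrightarrow> rleg v (f x) = rleg u x"
    using assms(1) unfolding span_iso_def by blast
  obtain g where g: "g \<in> gset_hom G (apex v) (apex w)" "bij_betw g (pts (apex v)) (pts (apex w))"
    "\<And>x. x \<in> pts (apex v) \<Longrightarrow> lleg w (g x) = lleg v x" "\<And>x. x \<in> pts (apex v) \<Longrightarrow> rleg w (g x) = rleg v x"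
    using assms(2) unfolding span_iso_def by blast
  show ?thesis
  proof (rule span_isoI[OF gset_hom_comp[OF assms(3) f(1) g(1)]])
    have "bij_betw (g \<circ> f) (pts (apex u)) (pts (apex w))" using f(2) g(2) by (rule bij_betw_trans)
    then show "bij_betw (\<lambda>x\<in>pts (apex u). g (f x)) (pts (apex u)) (pts (apex w))"
      by (rule bij_betw_cong[THEN iffD1, rotated]) simp
  qed (use f g in \<open>auto simp: gset_homD\<close>)
qed

lemma span_iso_sym:
  assumes "span_iso G u v" "finite_gset G (apex u)" "finite_gset G (apex v)"
  shows "span_iso G v u"
proof -
  obtain f where f: "f \<in> gset_hom G (apex u) (apex v)" "bij_betw f (pts (apex u)) (pts (apex v))"
    "\<And>x. x \<in> pts (apex u) \<Longrightarrow> lleg v (f x) = lleg u x" "\<And>x. x \<in> pts (apex u) \<Longrightarrow> rleg v (f x) = rleg u x"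
    using assms(1) unfolding span_iso_def by blast
  have m: "inv_into (pts (apex u)) f y \<in> pts (apex u)" "f (inv_into (pts (apex u)) f y) = y" if "y \<in> pts (apex v)" for y
    using f(2) that by (auto simp: bij_betw_def inv_into_into f_inv_into_f)
  show ?thesis
  proof (rule span_isoI[OF gset_hom_inv[OF assms(2,3) f(1,2)]])
    show "bij_betw (\<lambda>y\<in>pts (apex v). inv_into (pts (apex u)) f y) (pts (apex v)) (pts (apex u))"
      using bij_betw_inv_into[OF f(2)] by (rule bij_betw_cong[THEN iffD1, rotated]) simp
  qed (use m f in \<open>auto, metis+\<close>)
qed

lemma span_comp_simps:
  "apex (span_comp G u v) = fibre_product G (apex u) (apex v) (rleg u) (lleg v)"
  "\<lbrakk>y \<in> pts (apex u); z \<in> pts (apex v); rleg u y = lleg v z\<rbrakk> \<Longrightarrow> lleg (span_comp G u v) (y, z) = lleg u y"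
  "\<lbrakk>y \<in> pts (apex u); z \<in> pts (apex v); rleg u y = lleg v z\<rbrakk> \<Longrightarrow> rleg (span_comp G u v) (y, z) = rleg v z"
  by (simp_all add: span_comp_def Let_def fibre_product_simps)

text \<open>The right leg of the composite is a base change of that of \<open>u\<close> followed by
  that of \<open>v\<close>. At \<open>(y, z)\<close> the stabilizer is the intersection of both
  stabilizers, so the restriction axiom handles the base change and transitivity the rest.\<close>

lemma span_comp_spans:
  assumes u: "u \<in> spans G TS R S" and v: "v \<in> spans G TS S T"
  shows "span_comp G u v \<in> spans G TS R T"
proof (rule spansI)
  let ?P = "fibre_product G (apex u) (apex v) (rleg u) (lleg v)"
  note U = spansD[OF u] and V = spansD[OF v]
  have P: "finite_gset G ?P" by (rule fibre_product_gset[OF U(1) V(1) U(3) V(2)])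
  then show "finite_gset G (apex (span_comp G u v))" by (simp add: span_comp_simps)
  have "(\<lambda>p\<in>pts ?P. lleg u (fst p)) \<in> gset_hom G ?P R"
    by (rule gset_hom_restrictI[OF P]) (use U V in \<open>auto simp: fibre_product_simps gset_homD\<close>)
  then show "lleg (span_comp G u v) \<in> gset_hom G (apex (span_comp G u v)) R"
    by (simp add: span_comp_def Let_def)
  have "(\<lambda>p\<in>pts ?P. rleg v (snd p)) \<in> gset_hom G ?P T"
    by (rule gset_hom_restrictI[OF P]) (use U V in \<open>auto simp: fibre_product_simps gset_homD\<close>)
  then show "rleg (span_comp G u v) \<in> gset_hom G (apex (span_comp G u v)) T"
    by (simp add: span_comp_def Let_def)
  fix p assume "p \<in> pts (apex (span_comp G u v))"
  then obtain y z where p: "p = (y, z)" "y \<in> pts (apex u)" "z \<in> pts (apex v)" "rleg u y = lleg v z"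
    by (auto simp: span_comp_simps fibre_product_simps)
  have "(stab (apex u) y, stab S (lleg v z)) \<in> TS" using U(4)[OF p(2)] p by simp
  then have "(stab (apex u) y \<inter> stab (apex v) z, stab (apex v) z) \<in> TS"
    by (rule O_restrict) (rule stab_subgroup[OF V(1) p(3)], rule stab_hom[OF V(1,2) p(3)])
  then show "(stab (apex (span_comp G u v)) p, stab T (rleg (span_comp G u v) p)) \<in> TS"
    using O_trans[OF _ V(4)[OF p(3)]] p by (simp add: span_comp_simps fibre_product_stab)
qed

lemma span_comp_cong:
  assumes u: "u \<in> spans G TS R S" "u' \<in> spans G TS R S" "span_iso G u u'"
    and v: "v \<in> spans G TS S T" "v' \<in> spans G TS S T" "span_iso G v v'"
  shows "span_iso G (span_comp G u v) (span_comp G u' v')"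
proof -
  obtain f where f: "f \<in> gset_hom G (apex u) (apex u')" "bij_betw f (pts (apex u)) (pts (apex u'))"
    "\<And>x. x \<in> pts (apex u) \<Longrightarrow> lleg u' (f x) = lleg u x" "\<And>x. x \<in> pts (apex u) \<Longrightarrow> rleg u' (f x) = rleg u x"
    using u(3) unfolding span_iso_def by blast
  obtain g where g: "g \<in> gset_hom G (apex v) (apex v')" "bij_betw g (pts (apex v)) (pts (apex v'))"
    "\<And>x. x \<in> pts (apex v) \<Longrightarrow> lleg v' (g x) = lleg v x" "\<And>x. x \<in> pts (apex v) \<Longrightarrow> rleg v' (g x) = rleg v x"
    using v(3) unfolding span_iso_def by blast
  let ?P = "fibre_product G (apex u) (apex v) (rleg u) (lleg v)"
  let ?P' = "fibre_product G (apex u') (apex v') (rleg u') (lleg v')"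
  let ?k = "\<lambda>p\<in>pts ?P. (f (fst p), g (snd p))"
  have P: "finite_gset G ?P" using spansD(1)[OF span_comp_spans[OF u(1) v(1)]] by (simp add: span_comp_simps)
  show ?thesis
  proof (rule span_isoI)
    have "?k \<in> gset_hom G ?P ?P'"
      by (rule gset_hom_restrictI[OF P]) (use f g in \<open>auto simp: fibre_product_simps gset_homD\<close>)
    then show "?k \<in> gset_hom G (apex (span_comp G u v)) (apex (span_comp G u' v'))"
      by (simp add: span_comp_simps)
    have "bij_betw ?k (pts ?P) (pts ?P')"
    proof (rule bij_betw_imageI)
      show "inj_on ?k (pts ?P)"
        using f(2) g(2) by (auto simp: inj_on_def bij_betw_def fibre_product_simps)
      show "?k ` pts ?P = pts ?P'"
      proof
        show "?k ` pts ?P \<subseteq> pts ?P'" using f g by (auto simp: fibre_product_simps gset_homD)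
        show "pts ?P' \<subseteq> ?k ` pts ?P"
        proof
          fix q assume "q \<in> pts ?P'"
          then obtain y z where q: "q = (y, z)" "y \<in> pts (apex u')" "z \<in> pts (apex v')" "rleg u' y = lleg v' z"
            by (auto simp: fibre_product_simps)
          then have "y \<in> f ` pts (apex u)" "z \<in> g ` pts (apex v)" using f(2) g(2) by (simp_all add: bij_betw_def)
          then obtain y0 z0 where "y0 \<in> pts (apex u)" "f y0 = y" "z0 \<in> pts (apex v)" "g z0 = z" by blast
          then show "q \<in> ?k ` pts ?P" using q f g by (intro image_eqI[of _ _ "(y0, z0)"]) (auto simp: fibre_product_simps)
        qed
      qed
    qed
    then show "bij_betw ?k (pts (apex (span_comp G u v))) (pts (apex (span_comp G u' v')))"
      by (simp add: span_comp_simps)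
  qed (use f g in \<open>auto simp: span_comp_simps fibre_product_simps gset_homD\<close>)
qed

text \<open>The apex of \<open>w\<close> may live in any type, so a pullback represents a morphism
  without being copied first; the class itself collects only the spans with apex in
  \<open>'s\<close>.\<close>

definition cls :: "('a, 's) gset \<Rightarrow> ('a, 's) gset \<Rightarrow> ('a, 'u, 's) gspan \<Rightarrow> ('a, 's, 's) gspan set" where
  "cls R T w = {w' \<in> spans G TS R T. span_iso G w' w}"

abbreviation lindner :: "(('a, 's) gset, ('a, 's, 's) gspan set) cat" where
  "lindner \<equiv> lindner_cat G TS"

lemma lind_simps [simp]:
  "S \<in> Ob lindner \<longleftrightarrow> finite_gset G S"
  "Mor lindner R T = spans G TS R T // span_rel G TS R T"
  "Cmp lindner R S T \<beta> \<alpha> = {w \<in> spans G TS R T. \<exists>u \<in> \<alpha>. \<exists>v \<in> \<beta>. span_iso G w (span_comp G u v)}"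
  by (simp_all add: lindner_cat_def)

lemma cls_cong:
  assumes "span_iso G u v" "u \<in> spans G TS R T" "v \<in> spans G TS R T"
  shows "cls R T u = cls R T v"
proof -
  have vu: "span_iso G v u" by (rule span_iso_sym[OF assms(1)]) (use assms(2,3) spansD(1) in auto)
  show ?thesis
    unfolding cls_def
  proof (rule Collect_cong, rule conj_cong[OF refl])
    fix w :: "('a, 's, 's) gspan" assume "w \<in> spans G TS R T"
    then have "finite_gset G (apex w)" by (rule spansD(1))
    then show "span_iso G w u = span_iso G w v"
      using span_iso_trans[OF _ assms(1), of w] span_iso_trans[OF _ vu, of w] by blast
  qed
qed

text \<open>Copying the apex loses no isomorphism class, so \<open>cls R T w\<close> is nonempty for
  every span \<open>w\<close>.\<close>

lemma cp_span:
  assumes w: "w \<in> spans G TS R T"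
  shows "\<exists>w' :: ('a, 's, 's) gspan \<in> spans G TS R T. span_iso G w' w"
proof -
  note W = spansD[OF w]
  let ?b = "\<lambda>x\<in>pts (apex w). copy_map (apex w) x"
  let ?i = "\<lambda>y\<in>pts (copy_gset (apex w)). inv_into (pts (apex w)) ?b y"
  have i: "?i \<in> gset_hom G (copy_gset (apex w)) (apex w)"
    by (rule gset_hom_inv[OF W(1) cp_gset[OF W(1)] cpm_hom[OF W(1)] cpm_bij[OF W(1)]])
  have bij: "bij_betw ?i (pts (copy_gset (apex w))) (pts (apex w))"
    using bij_betw_inv_into[OF cpm_bij[OF W(1)]] by (rule bij_betw_cong[THEN iffD1, rotated]) simp
  define w' where "w' = \<lparr>apex = copy_gset (apex w), lleg = (\<lambda>p\<in>pts (copy_gset (apex w)). lleg w (?i p)),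
    rleg = (\<lambda>p\<in>pts (copy_gset (apex w)). rleg w (?i p))\<rparr>"
  have "w' \<in> spans G TS R T"
  proof (rule spansI)
    show "finite_gset G (apex w')" by (simp add: w'_def cp_gset[OF W(1)])
    show "lleg w' \<in> gset_hom G (apex w') R" "rleg w' \<in> gset_hom G (apex w') T"
      using gset_hom_comp[OF cp_gset[OF W(1)] i W(2)] gset_hom_comp[OF cp_gset[OF W(1)] i W(3)]
      by (simp_all add: w'_def)
    fix x assume x: "x \<in> pts (apex w')"
    then have "x \<in> pts (copy_gset (apex w))" by (simp add: w'_def)
    from stab_hom_inj[OF cp_gset[OF W(1)] i this] bij
    have "stab (apex w) (?i x) = stab (apex w') x"
      unfolding bij_betw_def w'_def by (simp only: gspan.simps)
    moreover have "?i x \<in> pts (apex w)" by (rule gset_homD(1)[OF i]) (use x in \<open>simp add: w'_def\<close>)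
    moreover have "rleg w' x = rleg w (?i x)" using x by (simp add: w'_def)
    ultimately show "(stab (apex w') x, stab T (rleg w' x)) \<in> TS"
      using W(4)[of "?i x"] by (simp only:)
  qed
  moreover have "span_iso G w' w" by (rule span_isoI[of ?i]) (use i bij in \<open>auto simp: w'_def\<close>)
  ultimately show ?thesis by blast
qed

lemma cls_eq_class:
  assumes "w \<in> spans G TS R T"
  shows "span_rel G TS R T `` {w} = cls R T w"
  unfolding span_rel_def cls_def using assms by (auto intro: span_iso_sym dest: spansD(1))

lemma cls_mor:
  assumes "w \<in> spans G TS R T"
  shows "cls R T w \<in> Mor lindner R T"
proof -
  obtain w' :: "('a, 's, 's) gspan" where w': "w' \<in> spans G TS R T" "span_iso G w' w" using cp_span[OF assms] by blast
  then have "cls R T w = span_rel G TS R T `` {w'}" using cls_cong[OF w'(2,1) assms] cls_eq_class by simp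
  then show ?thesis using w' by (auto intro: quotientI)
qed

lemma mor_cls:
  assumes "\<alpha> \<in> Mor lindner R T"
  shows "\<exists>w :: ('a, 's, 's) gspan \<in> spans G TS R T. \<alpha> = cls R T w"
  using assms cls_eq_class by (auto simp: quotient_def)

lemma cls_eqD:
  assumes "cls R T u = cls R T v" "u \<in> spans G TS R T" "v \<in> spans G TS R T"
  shows "span_iso G u v"
proof -
  obtain w :: "('a, 's, 's) gspan" where w: "w \<in> spans G TS R T" "span_iso G w u" using cp_span[OF assms(2)] by blast
  then have "span_iso G w v" using assms(1) by (auto simp: cls_def)
  then show ?thesis
    by (rule span_iso_trans[OF span_iso_sym[OF w(2) spansD(1)[OF w(1)] spansD(1)[OF assms(2)]] _ spansD(1)[OF assms(2)]])
qed

text \<open>Isomorphic spans have isomorphic composites, so representatives may be exchanged for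
  copies. This allows composition of classes to be computed by \<open>span_comp\<close>, whatever
  the types of the apexes.\<close>

lemma cmp_cls:
  assumes u: "u \<in> spans G TS R S" and v: "v \<in> spans G TS S T"
  shows "Cmp lindner R S T (cls S T v) (cls R S u) = cls R T (span_comp G u v)"
proof -
  have "span_iso G w (span_comp G u v)"
    if "w \<in> spans G TS R T" "u' \<in> cls R S u" "v' \<in> cls S T v" "span_iso G w (span_comp G u' v')" for w :: "('a, 's, 's) gspan" and u' v'
    using that span_comp_cong[of u' R S u v' T v] u v span_iso_trans[OF that(4)] spansD(1) unfolding cls_def by blast
  moreover have "\<exists>u' \<in> cls R S u. \<exists>v' \<in> cls S T v. span_iso G w (span_comp G u' v')"
    if w: "w \<in> spans G TS R T" "span_iso G w (span_comp G u v)" for w :: "('a, 's, 's) gspan"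
  proof -
    obtain u' :: "('a, 's, 's) gspan" where u': "u' \<in> spans G TS R S" "span_iso G u' u" using cp_span[OF u] by blast
    obtain v' :: "('a, 's, 's) gspan" where v': "v' \<in> spans G TS S T" "span_iso G v' v" using cp_span[OF v] by blast
    have "span_iso G (span_comp G u v) (span_comp G u' v')"
      by (rule span_comp_cong[OF u u'(1) span_iso_sym[OF u'(2)] v v'(1) span_iso_sym[OF v'(2)]])
        (rule spansD(1)[OF u] spansD(1)[OF u'(1)] spansD(1)[OF v] spansD(1)[OF v'(1)])+
    then show ?thesis using span_iso_trans[OF w(2)] u' v' spansD(1)[OF w(1)] unfolding cls_def by blast
  qed
  ultimately show ?thesis by (auto simp: cls_def[of R T])
qed

lemma id_span_spans: "finite_gset G S \<Longrightarrow> id_span S \<in> spans G TS S S"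
  by (rule spansI) (auto simp: id_span_def gset_hom_id intro!: O_refl stab_subgroup)

lemma idn_cls: "finite_gset G S \<Longrightarrow> Idn lindner S = cls S S (id_span S)"
  using cls_eq_class[OF id_span_spans] by (simp add: lindner_cat_def)

text \<open>Composing with a span \<open>S \<leftarrow> A = A\<close> or \<open>A = A \<rightarrow> T\<close> only changes one leg.\<close>

lemma span_comp_lleg:
  assumes A: "finite_gset G A" "f \<in> gset_hom G A S" and w: "w \<in> spans G TS A T"
    and l: "\<And>x. x \<in> pts (apex w) \<Longrightarrow> lleg w' x = f (lleg w x)" and "apex w' = apex w"
    "\<And>x. x \<in> pts (apex w) \<Longrightarrow> rleg w' x = rleg w x"
  shows "span_iso G w' (span_comp G \<lparr>apex = A, lleg = f, rleg = (\<lambda>x\<in>pts A. x)\<rparr> w)"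
proof -
  note W = spansD[OF w]
  let ?v = "\<lparr>apex = A, lleg = f, rleg = (\<lambda>x\<in>pts A. x)\<rparr>"
  let ?P = "fibre_product G A (apex w) (\<lambda>x\<in>pts A. x) (lleg w)"
  have "(\<lambda>x\<in>pts (apex w). (lleg w x, x)) \<in> gset_hom G (apex w) ?P"
    by (rule gset_hom_restrictI[OF W(1)]) (use W A in \<open>auto simp: fibre_product_simps gset_homD\<close>)
  moreover have "bij_betw (\<lambda>x\<in>pts (apex w). (lleg w x, x)) (pts (apex w)) (pts ?P)"
    by (rule bij_betw_imageI) (use W A in \<open>auto simp: inj_on_def fibre_product_simps gset_homD\<close>)
  ultimately show ?thesis
    by (intro span_isoI[of "\<lambda>x\<in>pts (apex w). (lleg w x, x)"])
      (use assms W in \<open>auto simp: span_comp_simps gset_homD\<close>)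
qed

lemma span_comp_rleg:
  assumes A: "finite_gset G A" "f \<in> gset_hom G A T" and w: "w \<in> spans G TS S A"
    and l: "\<And>x. x \<in> pts (apex w) \<Longrightarrow> lleg w' x = lleg w x" and "apex w' = apex w"
    "\<And>x. x \<in> pts (apex w) \<Longrightarrow> rleg w' x = f (rleg w x)"
  shows "span_iso G w' (span_comp G w \<lparr>apex = A, lleg = (\<lambda>x\<in>pts A. x), rleg = f\<rparr>)"
proof -
  note W = spansD[OF w]
  let ?v = "\<lparr>apex = A, lleg = (\<lambda>x\<in>pts A. x), rleg = f\<rparr>"
  let ?P = "fibre_product G (apex w) A (rleg w) (\<lambda>x\<in>pts A. x)"
  have "(\<lambda>x\<in>pts (apex w). (x, rleg w x)) \<in> gset_hom G (apex w) ?P"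
    by (rule gset_hom_restrictI[OF W(1)]) (use W A in \<open>auto simp: fibre_product_simps gset_homD\<close>)
  moreover have "bij_betw (\<lambda>x\<in>pts (apex w). (x, rleg w x)) (pts (apex w)) (pts ?P)"
    by (rule bij_betw_imageI) (use W A in \<open>auto simp: inj_on_def fibre_product_simps gset_homD\<close>)
  ultimately show ?thesis
    by (intro span_isoI[of "\<lambda>x\<in>pts (apex w). (x, rleg w x)"])
      (use assms W in \<open>auto simp: span_comp_simps gset_homD\<close>)
qed

lemma span_comp_assoc:
  assumes u: "u \<in> spans G TS R S" and v: "v \<in> spans G TS S T" and w: "w \<in> spans G TS T X"
  shows "span_iso G (span_comp G (span_comp G u v) w) (span_comp G u (span_comp G v w))"
proof -
  note U = spansD[OF u] and V = spansD[OF v] and W = spansD[OF w]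
  let ?L = "apex (span_comp G (span_comp G u v) w)"
  let ?R = "apex (span_comp G u (span_comp G v w))"
  let ?f = "\<lambda>p\<in>pts ?L. (fst (fst p), snd (fst p), snd p)"
  have L: "finite_gset G ?L" using spansD(1)[OF span_comp_spans[OF span_comp_spans[OF u v] w]] .
  have pL: "p \<in> pts ?L \<longleftrightarrow> (\<exists>x y z. p = ((x, y), z) \<and> x \<in> pts (apex u) \<and> y \<in> pts (apex v) \<and> z \<in> pts (apex w) \<and>
     rleg u x = lleg v y \<and> rleg v y = lleg w z)" for p
    by (cases p) (auto simp: span_comp_simps fibre_product_simps)
  have pR: "p \<in> pts ?R \<longleftrightarrow> (\<exists>x y z. p = (x, y, z) \<and> x \<in> pts (apex u) \<and> y \<in> pts (apex v) \<and> z \<in> pts (apex w) \<and>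
     rleg u x = lleg v y \<and> rleg v y = lleg w z)" for p
    by (cases p) (auto simp: span_comp_simps fibre_product_simps)
  show ?thesis
  proof (rule span_isoI[of ?f])
    show "?f \<in> gset_hom G ?L ?R"
    proof (rule gset_hom_restrictI[OF L])
      show "(fst (fst p), snd (fst p), snd p) \<in> pts ?R" if "p \<in> pts ?L" for p
        using that unfolding pL pR by auto
      fix g p assume g: "g \<in> carrier G" and "p \<in> pts ?L"
      then obtain x y z where p: "p = ((x, y), z)" "x \<in> pts (apex u)" "y \<in> pts (apex v)" "z \<in> pts (apex w)"
        "rleg u x = lleg v y" "rleg v y = lleg w z" unfolding pL by blast
      have "act (apex (span_comp G u v)) g (x, y) = (act (apex u) g x, act (apex v) g y)"
        "act (apex (span_comp G v w)) g (y, z) = (act (apex v) g y, act (apex w) g z)"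
        using p g by (simp_all add: span_comp_simps fibre_product_simps)
      then show "(fst (fst (act ?L g p)), snd (fst (act ?L g p)), snd (act ?L g p)) =
        act ?R g (fst (fst p), snd (fst p), snd p)"
        using p g by (simp add: span_comp_simps fibre_product_simps)
    qed
    show "bij_betw ?f (pts ?L) (pts ?R)"
      by (rule bij_betwI[of _ _ _ "\<lambda>(x, y, z). ((x, y), z)"]) (auto simp: pL pR)
  qed (auto simp: pL span_comp_simps fibre_product_simps)
qed

lemma category_lind: "category lindner"
proof (unfold_locales, goal_cases)
  case (1 a) then show ?case using idn_cls[of a] cls_mor[OF id_span_spans[of a]] by (simp del: lind_simps(2))
next
  case (2 a b c f g)
  obtain u v :: "('a, 's, 's) gspan" where  "u \<in> spans G TS a b" "f = cls a b u" "v \<in> spans G TS b c" "g = cls b c v"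
    using mor_cls[OF 2(4)] mor_cls[OF 2(5)] by blast
  then show ?case using cmp_cls[of u a b v c] cls_mor[OF span_comp_spans[of u a b v c]] by simp
next
  case (3 a b f)
  then have b: "finite_gset G b" by simp
  obtain u :: "('a, 's, 's) gspan" where  u: "u \<in> spans G TS a b" "f = cls a b u" using mor_cls[OF 3(3)] by blast
  have "span_iso G u (span_comp G u (id_span b))"
    unfolding id_span_def by (rule span_comp_rleg[OF b gset_hom_id[OF b] u(1)]) (use spansD[OF u(1)] in \<open>auto simp: gset_homD\<close>)
  from cls_cong[OF this u(1) span_comp_spans[OF u(1) id_span_spans[OF b]]]
  show ?case unfolding u(2) idn_cls[OF b] cmp_cls[OF u(1) id_span_spans[OF b]] by simp
next
  case (4 a b f)
  then have a: "finite_gset G a" by simp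
  obtain u :: "('a, 's, 's) gspan" where  u: "u \<in> spans G TS a b" "f = cls a b u" using mor_cls[OF 4(3)] by blast
  have "span_iso G u (span_comp G (id_span a) u)"
    unfolding id_span_def by (rule span_comp_lleg[OF a gset_hom_id[OF a] u(1)]) (use spansD[OF u(1)] in \<open>auto simp: gset_homD\<close>)
  from cls_cong[OF this u(1) span_comp_spans[OF id_span_spans[OF a] u(1)]]
  show ?case unfolding u(2) idn_cls[OF a] cmp_cls[OF id_span_spans[OF a] u(1)] by simp
next
  case (5 a b c d f g h)
  obtain u v w :: "('a, 's, 's) gspan" where  u: "u \<in> spans G TS a b" "f = cls a b u" and v: "v \<in> spans G TS b c" "g = cls b c v"
    and w: "w \<in> spans G TS c d" "h = cls c d w"
    using mor_cls[OF 5(5)] mor_cls[OF 5(6)] mor_cls[OF 5(7)] by blast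
  show ?case
    unfolding u(2) v(2) w(2) cmp_cls[OF u(1) v(1)] cmp_cls[OF v(1) w(1)]
      cmp_cls[OF u(1) span_comp_spans[OF v(1) w(1)]] cmp_cls[OF span_comp_spans[OF u(1) v(1)] w(1)]
    by (rule cls_cong[OF span_comp_assoc[OF u(1) v(1) w(1)], symmetric])
      (rule span_comp_spans[OF span_comp_spans[OF u(1) v(1)] w(1)] span_comp_spans[OF u(1) span_comp_spans[OF v(1) w(1)]])+
qed

section \<open>Finite products in the Lindner category\<close>

text \<open>The span \<open>U <- X = X\<close> along \<open>f\<close>; a Mackey functor acts on it
  as restriction along \<open>f\<close>.\<close>

definition restr_span :: "('a, 's) gset \<Rightarrow> ('s \<Rightarrow> 's) \<Rightarrow> ('a, 's, 's) gspan" where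
  "restr_span X f = \<lparr>apex = X, lleg = f, rleg = (\<lambda>x\<in>pts X. x)\<rparr>"

lemma rsp_spans: "finite_gset G X \<Longrightarrow> f \<in> gset_hom G X U \<Longrightarrow> restr_span X f \<in> spans G TS U X"
  by (rule spansI) (auto simp: restr_span_def gset_hom_id intro!: O_refl stab_subgroup)

text \<open>A span into a disjoint union splits according to the part over which a point of its apex
  lies, and composition with the restriction to \<open>X i\<close> extracts the \<open>i\<close>-th
  piece. Hence a disjoint union, with restrictions as projections, is a product although the
  morphisms are spans.\<close>

lemma lind_product:
  fixes I :: "nat set"
  assumes I: "finite I" and U: "finite_gset G U" and X: "\<And>i. i \<in> I \<Longrightarrow> finite_gset G (X i)"
    and j: "\<And>i. i \<in> I \<Longrightarrow> j i \<in> gset_hom G (X i) U"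
    and inj: "\<And>i i' x x'. \<lbrakk>i \<in> I; i' \<in> I; x \<in> pts (X i); x' \<in> pts (X i'); j i x = j i' x'\<rbrakk> \<Longrightarrow> i = i' \<and> x = x'"
    and cover: "\<And>u. u \<in> pts U \<Longrightarrow> \<exists>i\<in>I. \<exists>x\<in>pts (X i). u = j i x"
  shows "is_product lindner I X U (\<lambda>i. cls U (X i) (restr_span (X i) (j i)))"
  unfolding is_product_def
proof (intro conjI ballI allI impI)
  show "U \<in> Ob lindner" using U by simp
  fix i assume i: "i \<in> I"
  show "X i \<in> Ob lindner" using X i by simp
  show "cls U (X i) (restr_span (X i) (j i)) \<in> Mor lindner U (X i)" by (rule cls_mor[OF rsp_spans[OF X[OF i] j[OF i]]])
next
  fix Z f assume Z: "Z \<in> Ob lindner" and f: "\<forall>i\<in>I. f i \<in> Mor lindner Z (X i)"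
  have "\<forall>i. \<exists>w :: ('a, 's, 's) gspan. i \<in> I \<longrightarrow> w \<in> spans G TS Z (X i) \<and> f i = cls Z (X i) w"
    using f mor_cls by blast
  then obtain w :: "nat \<Rightarrow> ('a, 's, 's) gspan" where w: "\<And>i. i \<in> I \<Longrightarrow> w i \<in> spans G TS Z (X i)" "\<And>i. i \<in> I \<Longrightarrow> f i = cls Z (X i) (w i)"
    by metis
  note W = spansD[OF w(1)]
  \<comment> \<open>The mediating span is the disjoint union of the given ones, with right legs
    pushed into \<open>U\<close>.\<close>
  define P where "P = (SIGMA i:I. pts (apex (w i)))"
  define A where "A = \<lparr>pts = P, act = (\<lambda>g\<in>carrier G. \<lambda>p\<in>P. (fst p, act (apex (w (fst p))) g (snd p)))\<rparr>"
  have A: "finite_gset G A"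
  proof (rule finite_gsetI)
    show "finite (pts A)" using I gset_finite[OF W(1)] by (simp add: A_def P_def)
  qed (use W(1) in \<open>auto simp: A_def P_def act_closed act_one act_mult\<close>)
  define v where "v = \<lparr>apex = A, lleg = (\<lambda>p\<in>pts A. lleg (w (fst p)) (snd p)), rleg = (\<lambda>p\<in>pts A. j (fst p) (rleg (w (fst p)) (snd p)))\<rparr>"
  have v: "v \<in> spans G TS Z U"
  proof (rule spansI)
    show "finite_gset G (apex v)" using A by (simp add: v_def)
    show "lleg v \<in> gset_hom G (apex v) Z" unfolding v_def
      by (simp, rule gset_hom_restrictI[OF A]) (auto simp: A_def P_def gset_homD(2)[OF W(2)] gset_homD(1)[OF W(2)])
    show "rleg v \<in> gset_hom G (apex v) U" unfolding v_def
      by (simp, rule gset_hom_restrictI[OF A]) (auto simp: A_def P_def gset_homD(2)[OF W(3)] gset_homD(1)[OF W(3)] gset_homD(1,2)[OF j])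
    fix p assume "p \<in> pts (apex v)"
    then obtain i a where p: "p = (i, a)" "i \<in> I" "a \<in> pts (apex (w i))" by (auto simp: v_def A_def P_def)
    \<comment> \<open>Injectivity of \<open>j i\<close> preserves stabilizers, so the condition on
      the right leg carries over from \<open>w i\<close>.\<close>
    have "inj_on (j i) (pts (X i))" using inj p by (auto simp: inj_on_def)
    then have "stab U (j i (rleg (w i) a)) = stab (X i) (rleg (w i) a)"
      using stab_hom_inj[OF X[OF p(2)] j[OF p(2)]] W(3)[OF p(2)] p(3) by (simp add: gset_homD)
    moreover have "stab (apex v) p = stab (apex (w i)) a"
      using p by (auto simp: stabilizer_def v_def A_def P_def)
    ultimately show "(stab (apex v) p, stab U (rleg v p)) \<in> TS"
      using W(4)[OF p(2,3)] p by (simp add: v_def A_def P_def)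
  qed
  have viso: "span_iso G (w i) (span_comp G v (restr_span (X i) (j i)))" if i: "i \<in> I" for i
  proof (rule span_isoI)
    let ?k = "\<lambda>a\<in>pts (apex (w i)). ((i, a), rleg (w i) a)"
    let ?Q = "apex (span_comp G v (restr_span (X i) (j i)))"
    \<comment> \<open>Only the piece of \<open>v\<close> lying over \<open>X i\<close> survives the
      pullback along \<open>j i\<close>.\<close>
    have Q: "q \<in> pts ?Q \<longleftrightarrow> (\<exists>a\<in>pts (apex (w i)). q = ((i, a), rleg (w i) a))" for q
    proof -
      have "q \<in> pts ?Q \<longleftrightarrow> (\<exists>k\<in>I. \<exists>a\<in>pts (apex (w k)). \<exists>x\<in>pts (X i). q = ((k, a), x) \<and> j k (rleg (w k) a) = j i x)"
        using gset_homD(1)[OF j[OF i]]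
        by (cases q) (auto simp: span_comp_simps fibre_product_simps v_def restr_span_def A_def P_def)
      also have "\<dots> \<longleftrightarrow> (\<exists>a\<in>pts (apex (w i)). q = ((i, a), rleg (w i) a))"
        using i inj[OF _ i gset_homD(1)[OF W(3)]] gset_homD(1)[OF W(3)] by blast
      finally show ?thesis .
    qed
    show "?k \<in> gset_hom G (apex (w i)) ?Q"
    proof (rule gset_hom_restrictI[OF W(1)[OF i]])
      fix g a assume "g \<in> carrier G" "a \<in> pts (apex (w i))"
      then show "((i, act (apex (w i)) g a), rleg (w i) (act (apex (w i)) g a)) = act ?Q g ((i, a), rleg (w i) a)"
        using i W(3)[OF i] W(1)[OF i]
        by (simp add: span_comp_simps fibre_product_simps v_def restr_span_def A_def P_def gset_homD)
    qed (auto simp: Q)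
    show "bij_betw ?k (pts (apex (w i))) (pts ?Q)"
      by (rule bij_betw_imageI) (auto simp: inj_on_def Q)
    show "lleg (span_comp G v (restr_span (X i) (j i))) (?k x) = lleg (w i) x" if "x \<in> pts (apex (w i))" for x
      using that i W(3)[OF i] by (simp add: span_comp_simps v_def restr_span_def A_def P_def gset_homD)
    show "rleg (span_comp G v (restr_span (X i) (j i))) (?k x) = rleg (w i) x" if "x \<in> pts (apex (w i))" for x
      using that i W(3)[OF i] by (simp add: span_comp_simps v_def restr_span_def A_def P_def gset_homD)
  qed
  show "\<exists>!u. u \<in> Mor lindner Z U \<and> (\<forall>i\<in>I. Cmp lindner Z U (X i) (cls U (X i) (restr_span (X i) (j i))) u = f i)"
  proof (rule ex1I)
    show "cls Z U v \<in> Mor lindner Z U \<and> (\<forall>i\<in>I. Cmp lindner Z U (X i) (cls U (X i) (restr_span (X i) (j i))) (cls Z U v) = f i)"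
      using cls_mor[OF v] cmp_cls[OF v rsp_spans[OF X j]] w(2)
        cls_cong[OF viso w(1) span_comp_spans[OF v rsp_spans[OF X j]]] by simp
  next
    fix u assume u: "u \<in> Mor lindner Z U \<and> (\<forall>i\<in>I. Cmp lindner Z U (X i) (cls U (X i) (restr_span (X i) (j i))) u = f i)"
    then obtain b :: "('a, 's, 's) gspan" where b: "b \<in> spans G TS Z U" "u = cls Z U b" using mor_cls by blast
    note V = spansD[OF v] and B = spansD[OF b(1)]
    let ?P = "\<lambda>i. span_comp G v (restr_span (X i) (j i))"
    let ?P' = "\<lambda>i. span_comp G b (restr_span (X i) (j i))"
    have "span_iso G (?P i) (?P' i)" if i: "i \<in> I" for i
    proof -
      have "cls Z (X i) (?P' i) = f i" using u cmp_cls[OF b(1) rsp_spans[OF X[OF i] j[OF i]]] b(2) i by simp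
      then have "cls Z (X i) (?P i) = cls Z (X i) (?P' i)"
        using cls_cong[OF viso w(1) span_comp_spans[OF v rsp_spans[OF X j]]] w(2) i by simp
      then show ?thesis by (rule cls_eqD) (use span_comp_spans rsp_spans X j i v b in blast)+
    qed
    then have "\<forall>i. \<exists>\<phi>. i \<in> I \<longrightarrow> \<phi> \<in> gset_hom G (apex (?P i)) (apex (?P' i)) \<and> bij_betw \<phi> (pts (apex (?P i))) (pts (apex (?P' i))) \<and>
      (\<forall>x\<in>pts (apex (?P i)). lleg (?P' i) (\<phi> x) = lleg (?P i) x \<and> rleg (?P' i) (\<phi> x) = rleg (?P i) x)"
      unfolding span_iso_def by blast
    then obtain \<phi> where \<phi>: "\<And>i. i \<in> I \<Longrightarrow> \<phi> i \<in> gset_hom G (apex (?P i)) (apex (?P' i))"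
      "\<And>i. i \<in> I \<Longrightarrow> bij_betw (\<phi> i) (pts (apex (?P i))) (pts (apex (?P' i)))"
      "\<And>i x. i \<in> I \<Longrightarrow> x\<in>pts (apex (?P i)) \<Longrightarrow> lleg (?P' i) (\<phi> i x) = lleg (?P i) x"
      "\<And>i x. i \<in> I \<Longrightarrow> x\<in>pts (apex (?P i)) \<Longrightarrow> rleg (?P' i) (\<phi> i x) = rleg (?P i) x"
      by metis
    have P: "(a, x) \<in> pts (apex (?P i)) \<longleftrightarrow> a \<in> pts (apex v) \<and> x \<in> pts (X i) \<and> rleg v a = j i x" for a x i
      by (simp add: span_comp_simps fibre_product_simps restr_span_def)
    have P': "(a, x) \<in> pts (apex (?P' i)) \<longleftrightarrow> a \<in> pts (apex b) \<and> x \<in> pts (X i) \<and> rleg b a = j i x" for a x i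
      by (simp add: span_comp_simps fibre_product_simps restr_span_def)
    have actP: "act (apex (?P i)) g (a, x) = (act (apex v) g a, act (X i) g x)" if "(a, x) \<in> pts (apex (?P i))" "g \<in> carrier G" for i g a x
      using that unfolding P by (simp add: span_comp_simps fibre_product_simps restr_span_def)
    have actP': "act (apex (?P' i)) g (a, x) = (act (apex b) g a, act (X i) g x)" if "(a, x) \<in> pts (apex (?P' i))" "g \<in> carrier G" for i g a x
      using that unfolding P' by (simp add: span_comp_simps fibre_product_simps restr_span_def)
    have lP: "lleg (?P i) (a, x) = lleg v a" "rleg (?P i) (a, x) = x" if "(a, x) \<in> pts (apex (?P i))" for i a x
      using that unfolding P by (simp_all add: span_comp_simps fibre_product_simps restr_span_def)
    have lP': "lleg (?P' i) (a, x) = lleg b a" "rleg (?P' i) (a, x) = x" if "(a, x) \<in> pts (apex (?P' i))" for i a x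
      using that unfolding P' by (simp_all add: span_comp_simps fibre_product_simps restr_span_def)
    have \<phi>x: "\<phi> i (a, x) = (fst (\<phi> i (a, x)), x) \<and> fst (\<phi> i (a, x)) \<in> pts (apex b) \<and> rleg b (fst (\<phi> i (a, x))) = rleg v a
       \<and> lleg b (fst (\<phi> i (a, x))) = lleg v a" if i: "i \<in> I" and m: "(a, x) \<in> pts (apex (?P i))" for i a x
    proof -
      obtain a' x' where e: "\<phi> i (a, x) = (a', x')" by (cases "\<phi> i (a, x)")
      have m': "(a', x') \<in> pts (apex (?P' i))" using gset_homD(1)[OF \<phi>(1)[OF i] m] e by simp
      have "x' = x" using \<phi>(4)[OF i m] e lP(2)[OF m] lP'(2)[OF m'] by simp
      then show ?thesis using e m' m \<phi>(3)[OF i m] lP(1)[OF m] lP'(1)[OF m'] unfolding P P' by simp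
    qed
    \<comment> \<open>Each point of the apex of \<open>v\<close> lies over exactly one
      \<open>X i\<close>; the isomorphisms \<open>\<phi> i\<close> between the pieces are glued
      along this partition into one between \<open>v\<close> and \<open>b\<close>.\<close>
    have "\<forall>a. \<exists>i x. a \<in> pts (apex v) \<longrightarrow> i \<in> I \<and> x \<in> pts (X i) \<and> rleg v a = j i x"
      using cover gset_homD(1)[OF V(3)] by blast
    then obtain ix xx where ix: "\<And>a. a \<in> pts (apex v) \<Longrightarrow> ix a \<in> I \<and> xx a \<in> pts (X (ix a)) \<and> rleg v a = j (ix a) (xx a)"
      by metis
    then have m: "(a, xx a) \<in> pts (apex (?P (ix a)))" if "a \<in> pts (apex v)" for a using that P by simp
    let ?F = "\<lambda>a\<in>pts (apex v). fst (\<phi> (ix a) (a, xx a))"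
    have "span_iso G v b"
    proof (rule span_isoI)
      show "?F \<in> gset_hom G (apex v) (apex b)"
      proof (rule gset_hom_restrictI[OF V(1)])
        show "fst (\<phi> (ix a) (a, xx a)) \<in> pts (apex b)" if "a \<in> pts (apex v)" for a using \<phi>x m ix that by blast
        fix g a assume g: "g \<in> carrier G" and a: "a \<in> pts (apex v)"
        have ga: "act (apex v) g a \<in> pts (apex v)" by (rule act_closed[OF V(1) g a])
        have "j (ix (act (apex v) g a)) (xx (act (apex v) g a)) = j (ix a) (act (X (ix a)) g (xx a))"
          using ix[OF ga] ix[OF a] gset_homD(2)[OF V(3) g a] gset_homD(2)[OF j g] by simp
        then have e: "ix (act (apex v) g a) = ix a" "xx (act (apex v) g a) = act (X (ix a)) g (xx a)"
          using inj[of "ix (act (apex v) g a)" "ix a"] ix[OF ga] ix[OF a] act_closed[OF X g] by blast+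
        have i: "ix a \<in> I" using ix a by blast
        have "\<phi> (ix a) (act (apex (?P (ix a))) g (a, xx a)) = act (apex (?P' (ix a))) g (\<phi> (ix a) (a, xx a))"
          by (rule gset_homD(2)[OF \<phi>(1)[OF i] g m[OF a]])
        also have "\<dots> = act (apex (?P' (ix a))) g (fst (\<phi> (ix a) (a, xx a)), xx a)" using \<phi>x[OF i m[OF a]] by simp
        also have "\<dots> = (act (apex b) g (fst (\<phi> (ix a) (a, xx a))), act (X (ix a)) g (xx a))"
          using \<phi>x[OF i m[OF a]] gset_homD(1)[OF \<phi>(1)[OF i] m[OF a]] by (intro actP' g) simp
        finally show "fst (\<phi> (ix (act (apex v) g a)) (act (apex v) g a, xx (act (apex v) g a))) = act (apex b) g (fst (\<phi> (ix a) (a, xx a)))"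
          unfolding e actP[OF m[OF a] g] by simp
      qed
      show "bij_betw ?F (pts (apex v)) (pts (apex b))"
      proof (rule bij_betw_imageI)
        show "inj_on ?F (pts (apex v))"
        proof (rule inj_onI)
          fix a a' assume a: "a \<in> pts (apex v)" "a' \<in> pts (apex v)" and "?F a = ?F a'"
          then have F: "fst (\<phi> (ix a) (a, xx a)) = fst (\<phi> (ix a') (a', xx a'))" by simp
          then have "rleg v a = rleg v a'" using \<phi>x[OF _ m[OF a(1)]] \<phi>x[OF _ m[OF a(2)]] ix a by metis
          then have e: "ix a = ix a'" "xx a = xx a'" using inj[of "ix a" "ix a'"] ix a by metis+
          then have "\<phi> (ix a) (a, xx a) = \<phi> (ix a) (a', xx a)"
            using F \<phi>x[OF _ m[OF a(1)]] \<phi>x[OF _ m[OF a(2)]] ix a by metis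
          then have "(a, xx a) = (a', xx a)"
            using \<phi>(2)[of "ix a"] ix[OF a(1)] m[OF a(1)] m[OF a(2)] e by (auto simp: bij_betw_def dest!: inj_onD)
          then show "a = a'" by simp
        qed
        have "y \<in> ?F ` pts (apex v)" if y: "y \<in> pts (apex b)" for y
        proof -
          obtain i x where i: "i \<in> I" "x \<in> pts (X i)" "rleg b y = j i x" using cover gset_homD(1)[OF B(3) y] by blast
          then have "(y, x) \<in> \<phi> i ` pts (apex (?P i))" using \<phi>(2)[OF i(1)] y P' by (simp add: bij_betw_def)
          then obtain a x' where a: "(a, x') \<in> pts (apex (?P i))" "\<phi> i (a, x') = (y, x)" by force
          then have x: "x' = x" using \<phi>x[OF i(1) a(1)] by simp
          then have av: "a \<in> pts (apex v)" "rleg v a = j i x" using a P by auto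
          then have "ix a = i" "xx a = x" using inj[of "ix a" i] ix[OF av(1)] i by metis+
          then have "?F a = y" using a x av by simp
          then show ?thesis using av by blast
        qed
        then show "?F ` pts (apex v) = pts (apex b)" using \<phi>x m ix by auto
      qed
    qed (use \<phi>x m ix in auto)
    then have "cls Z U v = cls Z U b" by (rule cls_cong[OF _ v b(1)])
    then show "u = cls Z U v" using b by simp
  qed
qed

end

text \<open>The uniqueness half of the universal property, in the form used to recognize a sum of
  maps as the identity.\<close>

lemma is_product_unique:
  assumes "is_product C I X P p" "Z \<in> Ob C" "u \<in> Mor C Z P" "v \<in> Mor C Z P"
    and "\<And>i. i \<in> I \<Longrightarrow> Cmp C Z P (X i) (p i) u \<in> Mor C Z (X i)"
    and "\<And>i. i \<in> I \<Longrightarrow> Cmp C Z P (X i) (p i) v = Cmp C Z P (X i) (p i) u"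
  shows "u = v"
proof -
  have "\<exists>!w. w \<in> Mor C Z P \<and> (\<forall>i\<in>I. Cmp C Z P (X i) (p i) w = Cmp C Z P (X i) (p i) u)"
    using assms(1,2,5) unfolding is_product_def by simp
  then show ?thesis using assms(3,4,6) by blast
qed

lemma lin_finsum_maps:
  assumes V: "rat_module V" and W: "rat_module W" and f: "\<And>i. i \<in> A \<Longrightarrow> lin V W (f i)"
  shows "lin V W (\<lambda>v. finsum W (\<lambda>i. f i v) A)"
proof -
  interpret V: rat_module V by fact
  interpret W: rat_module W by fact
  have c: "f i x \<in> carrier W" if "i \<in> A" "x \<in> carrier V" for i x using f that by blast
  show ?thesis
  proof (intro conjI ballI allI)
    fix x assume x: "x \<in> carrier V"
    then show "finsum W (\<lambda>i. f i x) A \<in> carrier W" using c by (intro W.M.finsum_closed) auto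
    fix q
    have "finsum W (\<lambda>i. f i (q \<odot>\<^bsub>V\<^esub> x)) A = finsum W (\<lambda>i. q \<odot>\<^bsub>W\<^esub> f i x) A"
      by (rule W.M.finsum_cong') (use x c f in auto)
    then show "finsum W (\<lambda>i. f i (q \<odot>\<^bsub>V\<^esub> x)) A = q \<odot>\<^bsub>W\<^esub> finsum W (\<lambda>i. f i x) A"
      using W.smult_finsum[of A "\<lambda>i. f i x" q] c x by simp
  next
    fix x y assume x: "x \<in> carrier V" "y \<in> carrier V"
    have "finsum W (\<lambda>i. f i (x \<oplus>\<^bsub>V\<^esub> y)) A = finsum W (\<lambda>i. f i x \<oplus>\<^bsub>W\<^esub> f i y) A"
      by (rule W.M.finsum_cong') (use x c f in auto)
    then show "finsum W (\<lambda>i. f i (x \<oplus>\<^bsub>V\<^esub> y)) A = finsum W (\<lambda>i. f i x) A \<oplus>\<^bsub>W\<^esub> finsum W (\<lambda>i. f i y) A"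
      using W.M.finsum_addf[of "\<lambda>i. f i x" A "\<lambda>i. f i y"] c x by auto
  qed
qed

section \<open>Mackey functors\<close>

context disk
begin

text \<open>Surjectivity is transitivity of the action. The stabilizer of \<open>p\<close> is a
  conjugate of \<open>K\<close>, so both orbits have equally many points and injectivity follows by
  counting.\<close>

lemma orb_iso:
  assumes K: "subgroup K G" and p: "p \<in> pts (orb K)"
  shows "bij_betw (pt_map (stab (orb K) p) (orb K) p) (pts (orb (stab (orb K) p))) (pts (orb K))"
proof -
  let ?L = "stab (orb K) p"
  note O = orb_gset[OF K]
  have L: "subgroup ?L G" by (rule stab_subgroup[OF O p])
  obtain g where g: "g \<in> carrier G" "p = act (orb K) g (base_pt K)" "?L = conjg g K" using orb_stab[OF K p] by blast
  have cK: "card K > 0" using K fin subgroup.finite_imp_card_positive by blast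
  have cL: "card ?L = card K" using g cj_card subgroup_carrier[OF K] by simp
  have "card (pts (orb ?L)) * card K = card (pts (orb K)) * card K"
    using orb_card[OF L] orb_card[OF K] cL by simp
  then have c: "card (pts (orb ?L)) = card (pts (orb K))" using cK by simp
  have "pt_map ?L (orb K) p ` pts (orb ?L) = pts (orb K)"
  proof
    show "pt_map ?L (orb K) p ` pts (orb ?L) \<subseteq> pts (orb K)"
      using gset_homD(1)[OF pm_hom[OF L O p subset_refl]] by blast
    show "pts (orb K) \<subseteq> pt_map ?L (orb K) p ` pts (orb ?L)"
    proof
      fix q assume "q \<in> pts (orb K)"
      then obtain h where h: "h \<in> carrier G" "q = act (orb K) h (base_pt K)" using orb_trans[OF K] by blast
      have "q = act (orb K) (h \<otimes> inv g) p" using g h act_mult[OF O, of "h \<otimes> inv g" g "base_pt K"] bpt_mem[OF K]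
        by (simp add: m_assoc)
      then have "q = pt_map ?L (orb K) p (act (orb ?L) (h \<otimes> inv g) (base_pt ?L))"
        using pm_act[OF L O p subset_refl] g h by simp
      then show "q \<in> pt_map ?L (orb K) p ` pts (orb ?L)" using act_closed[OF orb_gset[OF L] _ bpt_mem[OF L]] g h by blast
    qed
  qed
  moreover have "inj_on (pt_map ?L (orb K) p) (pts (orb ?L))"
    using calculation c gset_finite[OF orb_gset[OF L]] by (intro eq_card_imp_inj_on) simp_all
  ultimately show ?thesis by (simp add: bij_betw_def)
qed

lemma pm_comp_apply:
  assumes "subgroup K G" "finite_gset G S" "s \<in> pts S" "K \<subseteq> stab S s" "finite_gset G T" "f \<in> gset_hom G S T"
    "p \<in> pts (orb K)"
  shows "f (pt_map K S s p) = pt_map K T (f s) p"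
  using fun_cong[OF pm_comp[OF assms(1-6)], of p] assms(7) by simp

text \<open>\<open>orbit_span K S T s t\<close> is the span \<open>S \<leftarrow> G/K \<rightarrow> T\<close> through \<open>s\<close> and \<open>t\<close>.\<close>

definition orbit_span :: "'a set \<Rightarrow> ('a, 't) gset \<Rightarrow> ('a, 't) gset \<Rightarrow> 't \<Rightarrow> 't \<Rightarrow> ('a, 's, 't) gspan" where
  "orbit_span K S T s t = \<lparr>apex = orb K, lleg = pt_map K S s, rleg = pt_map K T t\<rparr>"

lemma osp_spans:
  assumes "finite_gset G S" "s \<in> pts S" "K \<subseteq> stab S s" "finite_gset G T" "t \<in> pts T" "(K, stab T t) \<in> TS"
  shows "orbit_span K S T s t \<in> spans G TS S T"
proof (rule spansI)
  have K: "subgroup K G" using assms(6) O_subgroup by blast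
  have Kt: "K \<subseteq> stab T t" using assms(6) O_subset by blast
  show "finite_gset G (apex (orbit_span K S T s t))" by (simp add: orbit_span_def orb_gset[OF K])
  show "lleg (orbit_span K S T s t) \<in> gset_hom G (apex (orbit_span K S T s t)) S"
    using pm_hom[OF K assms(1-3)] by (simp add: orbit_span_def)
  show "rleg (orbit_span K S T s t) \<in> gset_hom G (apex (orbit_span K S T s t)) T"
    using pm_hom[OF K assms(4,5) Kt] by (simp add: orbit_span_def)
  fix x assume "x \<in> pts (apex (orbit_span K S T s t))"
  then obtain g where g: "g \<in> carrier G" "x = act (orb K) g (base_pt K)" "stab (orb K) x = conjg g K"
    using orb_stab[OF K] by (auto simp: orbit_span_def)
  have "stab T (pt_map K T t x) = conjg g (stab T t)"
    using pm_act[OF K assms(4,5) Kt g(1)] stab_act[OF assms(4) g(1) assms(5)] g by simp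
  then show "(stab (apex (orbit_span K S T s t)) x, stab T (rleg (orbit_span K S T s t) x)) \<in> TS"
    using g O_cj[OF assms(6) g(1)] by (simp add: orbit_span_def)
qed

text \<open>The isomorphism sends the base point of the first orbit to the
  \<open>g\<close>-translate of the base point of \<open>orb K\<close>, whose stabilizer is
  \<open>conjg g K\<close>.\<close>

lemma osp_conj:
  assumes S: "finite_gset G S" "s \<in> pts S" "K \<subseteq> stab S s" and T: "finite_gset G T" "t \<in> pts T" "K \<subseteq> stab T t"
    and K: "subgroup K G" and g: "g \<in> carrier G"
  shows "span_iso G (orbit_span (conjg g K) S T (act S g s) (act T g t)) (orbit_span K S T s t)"
proof -
  let ?p = "act (orb K) g (base_pt K)"
  note O = orb_gset[OF K]
  have p: "?p \<in> pts (orb K)" using act_closed[OF O g bpt_mem[OF K]] .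
  have st: "stab (orb K) ?p = conjg g K" using stab_act[OF O g bpt_mem[OF K]] bpt_stab[OF K] by simp
  have L: "subgroup (conjg g K) G" using cj_subgroup[OF K g] .
  have h: "pt_map (conjg g K) (orb K) ?p \<in> gset_hom G (orb (conjg g K)) (orb K)" using pm_hom[OF L O p] st by simp
  have e: "(\<lambda>q\<in>pts (orb (conjg g K)). pt_map K X x (pt_map (conjg g K) (orb K) ?p q)) = pt_map (conjg g K) X (act X g x)"
    if "finite_gset G X" "x \<in> pts X" "K \<subseteq> stab X x" for X :: "('a, 't) gset" and x
    using pm_comp[OF L O p _ that(1) pm_hom[OF K that]] st pm_act[OF K that g] by simp
  show ?thesis
  proof (rule span_isoI)
    show "pt_map (conjg g K) (orb K) ?p \<in> gset_hom G (apex (orbit_span (conjg g K) S T (act S g s) (act T g t))) (apex (orbit_span K S T s t))"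
      using h by (simp add: orbit_span_def)
    show "bij_betw (pt_map (conjg g K) (orb K) ?p) (pts (apex (orbit_span (conjg g K) S T (act S g s) (act T g t)))) (pts (apex (orbit_span K S T s t)))"
      using orb_iso[OF K p] st by (simp add: orbit_span_def)
  qed (use fun_cong[OF e[OF S]] fun_cong[OF e[OF T]] in \<open>auto simp: orbit_span_def\<close>, metis+)
qed

definition span_map :: "('a, 's, 'v) mackey_functor \<Rightarrow> ('a, 's) gset \<Rightarrow> ('a, 's) gset \<Rightarrow> ('a, 'u, 's) gspan \<Rightarrow> 'v \<Rightarrow> 'v" where
  "span_map M R T w = fmor M R T (cls R T w)"

abbreviation restr :: "('a, 's, 'v) mackey_functor \<Rightarrow> ('a, 's) gset \<Rightarrow> ('a, 's) gset \<Rightarrow> ('s \<Rightarrow> 's) \<Rightarrow> 'v \<Rightarrow> 'v" where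
  "restr M S X f \<equiv> span_map M S X (restr_span X f)"

text \<open>Restriction to \<open>G/K\<close> along \<open>s\<close> followed by transfer to
  \<open>T\<close> along \<open>t\<close>; every span will act as a rational combination of such
  maps.\<close>

definition orbit_map :: "('a, 's, 'v) mackey_functor \<Rightarrow> 'a set \<Rightarrow> ('a, 's) gset \<Rightarrow> ('a, 's) gset \<Rightarrow> 's \<Rightarrow> 's \<Rightarrow> 'v \<Rightarrow> 'v" where
  "orbit_map M K S T s t = span_map M S T (orbit_span K S T s t)"

abbreviation is_mackey :: "('a, 's, 'v) mackey_functor \<Rightarrow> bool" where
  "is_mackey M \<equiv> M \<in> Ob (mackey_cat G TS)"

lemma mk_iff: "is_mackey M \<longleftrightarrow> is_functor lindner vect_cat M \<and> product_preserving lindner vect_cat M"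
  by (auto simp: mackey_cat_def full_subcat_def functor_cat_def)

context
  fixes M :: "('a, 's, 'v) mackey_functor"
  assumes M: "is_mackey M"
begin

lemma mk_functor: "is_functor lindner vect_cat M"
  using M by (simp add: mk_iff)

lemma mk_mod: "finite_gset G S \<Longrightarrow> rat_module (fobj M S)"
  using is_functorD(1)[OF mk_functor, of S] by (simp add: rat_module_iff)

lemma mact_mor:
  assumes "finite_gset G R" "finite_gset G T" "w \<in> spans G TS R T"
  shows "span_map M R T w \<in> Mor vect_cat (fobj M R) (fobj M T)"
  unfolding span_map_def by (rule is_functorD(2)[OF mk_functor]) (use assms cls_mor[OF assms(3)] in auto)

lemma mact_lin:
  assumes "finite_gset G R" "finite_gset G T" "w \<in> spans G TS R T"
  shows "lin (fobj M R) (fobj M T) (span_map M R T w)"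
  using mact_mor[OF assms] by (simp add: vect_mor_iff)

lemma mact_closed:
  assumes "finite_gset G R" "finite_gset G T" "w \<in> spans G TS R T" "x \<in> carrier (fobj M R)"
  shows "span_map M R T w x \<in> carrier (fobj M T)"
  using mact_lin[OF assms(1-3)] assms(4) by blast

lemma mact_iso: "span_iso G u v \<Longrightarrow> u \<in> spans G TS R T \<Longrightarrow> v \<in> spans G TS R T \<Longrightarrow> span_map M R T u = span_map M R T v"
  unfolding span_map_def using cls_cong by metis

lemma mact_comp:
  assumes R: "finite_gset G R" and S: "finite_gset G S" and T: "finite_gset G T"
    and u: "u \<in> spans G TS R S" and v: "v \<in> spans G TS S T" and x: "x \<in> carrier (fobj M R)"
  shows "span_map M R T (span_comp G u v) x = span_map M S T v (span_map M R S u x)"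
proof -
  have "fmor M R T (Cmp lindner R S T (cls S T v) (cls R S u)) =
     Cmp vect_cat (fobj M R) (fobj M S) (fobj M T) (fmor M S T (cls S T v)) (fmor M R S (cls R S u))"
    by (rule is_functorD(4)[OF mk_functor]) (use R S T cls_mor[OF u] cls_mor[OF v] in auto)
  then show ?thesis unfolding cmp_cls[OF u v] span_map_def using x by (simp add: compose_eq)
qed

lemma mact_id: "finite_gset G R \<Longrightarrow> x \<in> carrier (fobj M R) \<Longrightarrow> span_map M R R (id_span R) x = x"
  using is_functorD(3)[OF mk_functor, of R] idn_cls[of R] by (simp add: span_map_def)

lemma rs_id: "finite_gset G R \<Longrightarrow> x \<in> carrier (fobj M R) \<Longrightarrow> restr M R R (\<lambda>x\<in>pts R. x) x = x"
  using mact_id by (simp add: restr_span_def id_span_def)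

text \<open>A left leg that factors through \<open>f\<close> splits off the restriction along
  \<open>f\<close>. With \<open>mact_rleg\<close>, the counterpart for transfers, this avoids much
  direct work with pullbacks.\<close>

lemma mact_lleg:
  assumes S: "finite_gset G S" and T: "finite_gset G T" and A: "finite_gset G A" "f \<in> gset_hom G A S"
    and w: "w \<in> spans G TS A T" "w' \<in> spans G TS S T"
    and l: "\<And>x. x \<in> pts (apex w) \<Longrightarrow> lleg w' x = f (lleg w x)" and a: "apex w' = apex w"
    and r: "\<And>x. x \<in> pts (apex w) \<Longrightarrow> rleg w' x = rleg w x" and x: "x \<in> carrier (fobj M S)"
  shows "span_map M S T w' x = span_map M A T w (restr M S A f x)"
proof -
  have "span_iso G w' (span_comp G (restr_span A f) w)"
    unfolding restr_span_def by (rule span_comp_lleg[OF A w(1) l a r])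
  then have "span_map M S T w' = span_map M S T (span_comp G (restr_span A f) w)"
    by (rule mact_iso[OF _ w(2) span_comp_spans[OF rsp_spans[OF A] w(1)]])
  then show ?thesis using mact_comp[OF S A(1) T rsp_spans[OF A] w(1) x] by simp
qed

lemma mact_rleg:
  assumes S: "finite_gset G S" and T: "finite_gset G T" and A: "finite_gset G A"
    "\<lparr>apex = A, lleg = (\<lambda>x\<in>pts A. x), rleg = f\<rparr> \<in> spans G TS A T"
    and w: "w \<in> spans G TS S A" "w' \<in> spans G TS S T"
    and l: "\<And>x. x \<in> pts (apex w) \<Longrightarrow> lleg w' x = lleg w x" and a: "apex w' = apex w"
    and r: "\<And>x. x \<in> pts (apex w) \<Longrightarrow> rleg w' x = f (rleg w x)" and x: "x \<in> carrier (fobj M S)"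
  shows "span_map M S T w' x = span_map M A T \<lparr>apex = A, lleg = (\<lambda>x\<in>pts A. x), rleg = f\<rparr> (span_map M S A w x)"
proof -
  let ?v = "\<lparr>apex = A, lleg = (\<lambda>x\<in>pts A. x), rleg = f\<rparr>"
  have f: "f \<in> gset_hom G A T" using spansD(3)[OF A(2)] by simp
  have "span_iso G w' (span_comp G w ?v)"
    by (rule span_comp_rleg[OF A(1) f w(1) l a r])
  then have "span_map M S T w' = span_map M S T (span_comp G w ?v)"
    by (rule mact_iso[OF _ w(2) span_comp_spans[OF w(1) A(2)]])
  then show ?thesis using mact_comp[OF S A(1) T w(1) A(2) x] by simp
qed

lemma rs_comp:
  assumes S: "finite_gset G S" and X: "finite_gset G X" "f \<in> gset_hom G X S"
    and Y: "finite_gset G Y" "h \<in> gset_hom G Y X" and x: "x \<in> carrier (fobj M S)"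
  shows "restr M X Y h (restr M S X f x) = restr M S Y (\<lambda>y\<in>pts Y. f (h y)) x"
  by (rule mact_lleg[symmetric, OF S Y(1) X rsp_spans[OF Y] rsp_spans[OF Y(1) gset_hom_comp[OF Y X(2)]] _ _ _ x])
    (auto simp: restr_span_def)

text \<open>Such a span factors through the empty \<open>G\<close>-set, which is the product of no
  objects; product preservation forces the value of \<open>M\<close> there to be the zero
  space.\<close>

lemma mact_empty:
  assumes R: "finite_gset G R" and T: "finite_gset G T" and w: "w \<in> spans G TS R T" and e: "pts (apex w) = {}"
    and x: "x \<in> carrier (fobj M R)"
  shows "span_map M R T w x = \<zero>\<^bsub>fobj M T\<^esub>"
proof -
  define E :: "('a, 's) gset" where "E = \<lparr>pts = {}, act = (\<lambda>g\<in>carrier G. \<lambda>x\<in>{}. x)\<rparr>"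
  have E: "finite_gset G E" by (rule finite_gsetI) (auto simp: E_def)
  interpret ME: rat_module "fobj M E" by (rule mk_mod[OF E])
  interpret MT: rat_module "fobj M T" by (rule mk_mod[OF T])
  have "is_product lindner ({} :: nat set) (\<lambda>_. E) E (\<lambda>i. cls E E (restr_span E (\<lambda>x. x)))"
    by (rule lind_product) (auto simp: E, simp add: E_def)
  then have "is_product vect_cat ({} :: nat set) (\<lambda>i. fobj M E) (fobj M E) (\<lambda>i. fmor M E E (cls E E (restr_span E (\<lambda>x. x))))"
    using M unfolding mk_iff product_preserving_def by blast
  \<comment> \<open>The universal property of the empty product leaves a single endomorphism, so
    that identity and zero map coincide.\<close>
  then have "\<exists>!u. u \<in> Mor vect_cat (fobj M E) (fobj M E)"
    unfolding is_product_def by (simp add: rat_module_iff[symmetric] ME.rat_module_axioms)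
  moreover have "(\<lambda>x\<in>carrier (fobj M E). x) \<in> Mor vect_cat (fobj M E) (fobj M E)"
    "(\<lambda>x\<in>carrier (fobj M E). \<zero>\<^bsub>fobj M E\<^esub>) \<in> Mor vect_cat (fobj M E) (fobj M E)"
    by (auto simp: vect_mor_iff)
  ultimately have "(\<lambda>x\<in>carrier (fobj M E). x) = (\<lambda>x\<in>carrier (fobj M E). \<zero>\<^bsub>fobj M E\<^esub>)" by blast
  then have triv: "y = \<zero>\<^bsub>fobj M E\<^esub>" if "y \<in> carrier (fobj M E)" for y
    using that by (metis restrict_apply')
  let ?w0 = "\<lparr>apex = apex w, lleg = lleg w, rleg = (\<lambda>x\<in>pts (apex w). undefined)\<rparr>"
  let ?t = "\<lparr>apex = E, lleg = (\<lambda>x\<in>pts E. x), rleg = (\<lambda>x. undefined)\<rparr>"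
  have u0: "u \<in> spans G TS X Y" if "apex u = E" "lleg u = (\<lambda>x. undefined)" "rleg u = (\<lambda>x. undefined)"
    for u :: "('a, 's, 's) gspan" and X Y
    by (rule spansI) (use that E in \<open>auto simp: E_def gset_hom_def\<close>)
  have w0: "?w0 \<in> spans G TS R E"
    by (rule spansI) (use e spansD[OF w] in \<open>auto simp: gset_hom_def\<close>)
  have t: "?t \<in> spans G TS E T" by (rule u0) (auto simp: E_def)
  have "span_map M R T w x = span_map M E T ?t (span_map M R E ?w0 x)"
    by (rule mact_rleg[OF R T E t w0 w _ _ _ x]) (auto simp: e)
  also have "\<dots> = \<zero>\<^bsub>fobj M T\<^esub>"
    using triv[OF mact_closed[OF R E w0 x]] lin_zero[OF ME.rat_module_axioms MT.rat_module_axioms mact_lin[OF E T t]] by simp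
  finally show ?thesis .
qed

text \<open>Lets a term be moved along an orbit: since conjugate subgroups have equal order, all
  points of an orbit contribute the same weighted term to a sum over points.\<close>

lemma ot_conj:
  assumes S: "finite_gset G S" "s \<in> pts S" "K \<subseteq> stab S s" and T: "finite_gset G T" "t \<in> pts T" "(K, stab T t) \<in> TS"
    and g: "g \<in> carrier G"
  shows "orbit_map M (conjg g K) S T (act S g s) (act T g t) = orbit_map M K S T s t"
proof -
  have K: "subgroup K G" "K \<subseteq> stab T t" using T(3) O_subgroup O_subset by auto
  show ?thesis
    unfolding orbit_map_def
  proof (rule mact_iso[OF osp_conj[OF S T(1,2) K(2,1) g]])
    show "orbit_span (conjg g K) S T (act S g s) (act T g t) \<in> spans G TS S T"
      using stab_act[OF S(1) g S(2)] stab_act[OF T(1) g T(2)] O_cj[OF T(3) g] cj_mono[OF S(3)]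
      by (intro osp_spans act_closed S T g) simp_all
  qed (rule osp_spans[OF S T])
qed

lemma ot_closed:
  assumes S: "finite_gset G S" "s \<in> pts S" "K \<subseteq> stab S s" and T: "finite_gset G T" "t \<in> pts T" "(K, stab T t) \<in> TS"
    and x: "x \<in> carrier (fobj M S)"
  shows "orbit_map M K S T s t x \<in> carrier (fobj M T)"
  unfolding orbit_map_def by (rule mact_closed[OF S(1) T(1) osp_spans[OF S T] x])

end

section \<open>Decomposition into orbits and the double coset formula\<close>

context
  fixes M :: "('a, 's, 'v) mackey_functor"
  assumes M: "is_mackey M"
begin

text \<open>Summing over all points, weighted by the orders of their stabilizers, replaces a sum over orbits and
  avoids the choice of representatives. The same holds for the double coset formula below.\<close>

lemma orbit_decomposition:
  assumes U: "finite_gset G U" and y: "y \<in> carrier (fobj M U)"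
  shows "of_nat (card (carrier G)) \<odot>\<^bsub>fobj M U\<^esub> y =
    finsum (fobj M U) (\<lambda>u. of_nat (card (stab U u)) \<odot>\<^bsub>fobj M U\<^esub> orbit_map M (stab U u) U U u u y) (pts U)"
proof -
  interpret V: rat_module "fobj M U" by (rule mk_mod[OF M U])
  let ?V = "fobj M U"
  have otc: "orbit_map M (stab U u) U U u u z \<in> carrier ?V" if "u \<in> pts U" "z \<in> carrier ?V" for u z
    by (rule ot_closed[OF M U that(1) subset_refl U that(1) O_refl[OF stab_subgroup[OF U that(1)]] that(2)])
  \<comment> \<open>\<open>r\<close> depends only on the orbit as a set, so it selects one point in
    each orbit.\<close>
  define r where "r u = (SOME v. v \<in> (\<lambda>g. act U g u) ` carrier G)" for u
  define R where "R = r ` pts U"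
  have r: "r u \<in> (\<lambda>g. act U g u) ` carrier G" for u
    unfolding r_def by (rule someI_ex) auto
  have r_pts: "r u \<in> pts U" if "u \<in> pts U" for u using r[of u] act_closed[OF U _ that] by auto
  have orb_eq: "(\<lambda>h. act U h (act U g u)) ` carrier G = (\<lambda>h. act U h u) ` carrier G" if u: "u \<in> pts U" and g: "g \<in> carrier G" for u g
  proof
    show "(\<lambda>h. act U h (act U g u)) ` carrier G \<subseteq> (\<lambda>h. act U h u) ` carrier G"
      using u g by (auto simp flip: act_mult[OF U])
    show "(\<lambda>h. act U h u) ` carrier G \<subseteq> (\<lambda>h. act U h (act U g u)) ` carrier G"
    proof
      fix x assume "x \<in> (\<lambda>h. act U h u) ` carrier G"
      then obtain h where h: "h \<in> carrier G" "x = act U h u" by blast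
      have "x = act U (h \<otimes> inv g) (act U g u)" using h g u by (simp flip: act_mult[OF U] add: m_assoc)
      then show "x \<in> (\<lambda>h. act U h (act U g u)) ` carrier G" using h g by blast
    qed
  qed
  have r_act: "r (act U g u) = r u" if "u \<in> pts U" "g \<in> carrier G" for u g
    unfolding r_def orb_eq[OF that] ..
  have rr: "r (r u) = r u" if "u \<in> pts U" for u using r[of u] r_act[OF that] by auto
  have R_r: "r e = e" "e \<in> pts U" if "e \<in> R" for e using that rr r_pts unfolding R_def by auto
  have finR: "finite R" unfolding R_def using gset_finite[OF U] by simp
  \<comment> \<open>Products are indexed by sets of natural numbers, hence the enumeration of the
    selected points.\<close>
  obtain n and e :: "nat \<Rightarrow> 's" where e: "bij_betw e {..<n} R"
    using ex_bij_betw_nat_finite[OF finR] by (auto simp: atLeast0LessThan)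
  have eR: "e i \<in> R" "r (e i) = e i" "e i \<in> pts U" if "i < n" for i using e that R_r by (auto simp: bij_betw_def)
  define K where "K i = stab U (e i)" for i
  have K: "subgroup (K i) G" if "i < n" for i unfolding K_def by (rule stab_subgroup[OF U eR(3)[OF that]])
  define j where "j i = pt_map (K i) U (e i)" for i
  have j: "j i \<in> gset_hom G (orb (K i)) U" if "i < n" for i
    unfolding j_def by (rule pm_hom[OF K[OF that] U eR(3)[OF that]]) (simp add: K_def)
  have j_act: "j i (act (orb (K i)) g (base_pt (K i))) = act U g (e i)" if "i < n" "g \<in> carrier G" for i g
    unfolding j_def by (rule pm_act[OF K[OF that(1)] U eR(3)[OF that(1)] _ that(2)]) (simp add: K_def)
  have inj: "i = i' \<and> x = x'" if a: "i < n" "i' < n" "x \<in> pts (orb (K i))" "x' \<in> pts (orb (K i'))" "j i x = j i' x'" for i i' x x'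
  proof -
    obtain g where g: "g \<in> carrier G" "x = act (orb (K i)) g (base_pt (K i))" using orb_trans[OF K a(3)] a by blast
    obtain g' where g': "g' \<in> carrier G" "x' = act (orb (K i')) g' (base_pt (K i'))" using orb_trans[OF K a(4)] a by blast
    have eq: "act U g (e i) = act U g' (e i')" using a g g' j_act by simp
    then have "e i = e i'" using r_act[OF eR(3)[OF a(1)] g(1)] r_act[OF eR(3)[OF a(2)] g'(1)] eR a by simp
    then have i: "i = i'" using e a by (auto simp: bij_betw_def inj_on_def)
    then have "inv g' \<otimes> g \<in> K i" using eq act_eq_iff[OF U g(1) g'(1) eR(3)[OF a(1)]] by (simp add: K_def)
    then have "x = x'" using i g g' act_eq_iff[OF orb_gset[OF K[OF a(1)]] g(1) g'(1) bpt_mem[OF K[OF a(1)]]] bpt_stab[OF K[OF a(1)]] by simp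
    then show ?thesis using i by simp
  qed
  have cover: "\<exists>i\<in>{..<n}. \<exists>x\<in>pts (orb (K i)). u = j i x" if u: "u \<in> pts U" for u
  proof -
    have "r u \<in> R" using u unfolding R_def by simp
    then obtain i where i: "i < n" "e i = r u" using e by (auto simp: bij_betw_def)
    obtain g where g: "g \<in> carrier G" "r u = act U g u" using r[of u] by blast
    have "u = act U (inv g) (e i)" using act_inv(1)[OF U g(1) u] g i by simp
    then have "u = j i (act (orb (K i)) (inv g) (base_pt (K i)))" using j_act i g by simp
    then show ?thesis using i g act_closed[OF orb_gset[OF K] _ bpt_mem[OF K]] by blast
  qed
  have prod: "is_product lindner {..<n} (\<lambda>i. orb (K i)) U (\<lambda>i. cls U (orb (K i)) (restr_span (orb (K i)) (j i)))"
    by (rule lind_product) (use U orb_gset[OF K] j inj cover in auto)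
  then have "is_product vect_cat {..<n} (\<lambda>i. fobj M (orb (K i))) ?V (\<lambda>i. fmor M U (orb (K i)) (cls U (orb (K i)) (restr_span (orb (K i)) (j i))))"
    using M unfolding mk_iff product_preserving_def by blast
  then have vprod: "is_product vect_cat {..<n} (\<lambda>i. fobj M (orb (K i))) ?V (\<lambda>i. restr M U (orb (K i)) (j i))"
    unfolding span_map_def .
  let ?o = "\<lambda>i. orbit_map M (K i) U U (e i) (e i)"
  \<comment> \<open>\<open>?s\<close> sums the orbit maps over one point per orbit. It is the
    identity, because both have the same composites with all projections to the orbits.\<close>
  let ?s = "\<lambda>v\<in>carrier ?V. finsum ?V (\<lambda>i. ?o i v) {..<n}"
  have o_spans: "orbit_span (K i) U U (e i) (e i) \<in> spans G TS U U" if "i < n" for i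
    using osp_spans[OF U eR(3)[OF that] subset_refl U eR(3)[OF that] O_refl[OF K[OF that, unfolded K_def]]] by (simp add: K_def)
  have oc: "?o i v \<in> carrier ?V" if "i < n" "v \<in> carrier ?V" for i v
    unfolding orbit_map_def by (rule mact_closed[OF M U U o_spans[OF that(1)] that(2)])
  have o_lin: "lin ?V ?V (?o i)" if "i < n" for i
    unfolding orbit_map_def by (rule mact_lin[OF M U U o_spans[OF that]])
  have s: "?s \<in> Mor vect_cat ?V ?V"
    unfolding vect_mor_iff
  proof (rule conjI[OF restrict_extensional])
    have "lin ?V ?V (\<lambda>v. finsum ?V (\<lambda>i. ?o i v) {..<n})"
      by (rule lin_finsum_maps[OF V.rat_module_axioms V.rat_module_axioms]) (use o_lin in simp)
    then show "lin ?V ?V ?s" by (rule lin_cong[OF V.rat_module_axioms, rotated]) simp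
  qed
  have proj: "restr M U (orb (K k)) (j k) (?s v) = restr M U (orb (K k)) (j k) v" if k: "k < n" and v: "v \<in> carrier ?V" for k v
  proof -
    note Ok = orb_gset[OF K[OF k]]
    have sp: "restr_span (orb (K k)) (j k) \<in> spans G TS U (orb (K k))" by (rule rsp_spans[OF Ok j[OF k]])
    interpret W: rat_module "fobj M (orb (K k))" by (rule mk_mod[OF M Ok])
    have comp: "restr M U (orb (K k)) (j k) (?o i v) = span_map M U (orb (K k)) (span_comp G (orbit_span (K i) U U (e i) (e i)) (restr_span (orb (K k)) (j k))) v" if i: "i < n" for i
      unfolding orbit_map_def by (rule mact_comp[OF M U U Ok o_spans[OF i] sp v, symmetric])
    have ap: "apex (span_comp G (orbit_span (K i) U U (e i) (e i)) (restr_span (orb (K k)) (j k))) = fibre_product G (orb (K i)) (orb (K k)) (j i) (j k)" for i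
      by (simp add: span_comp_simps orbit_span_def restr_span_def j_def)
    have "restr M U (orb (K k)) (j k) (?s v) = finsum (fobj M (orb (K k))) (\<lambda>i. restr M U (orb (K k)) (j k) (?o i v)) {..<n}"
      using lin_finsum[OF V.rat_module_axioms W.rat_module_axioms mact_lin[OF M U Ok sp], of "{..<n}" "\<lambda>i. ?o i v"] oc v by simp
    also have "\<dots> = restr M U (orb (K k)) (j k) (?o k v)"
    proof (rule W.finsum_single)
      show "restr M U (orb (K k)) (j k) (?o i v) = \<zero>\<^bsub>fobj M (orb (K k))\<^esub>" if i: "i \<in> {..<n}" "i \<noteq> k" for i
      proof -
        \<comment> \<open>Distinct orbits do not meet in \<open>U\<close>, so their pullback is
          empty and contributes zero.\<close>
        have "pts (fibre_product G (orb (K i)) (orb (K k)) (j i) (j k)) = {}"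
          using inj[of i k] i k by (auto simp: fibre_product_simps)
        then show ?thesis using comp[of i] i mact_empty[OF M U Ok span_comp_spans[OF o_spans sp] _ v] ap by simp
      qed
    qed (use k mact_closed[OF M U Ok sp oc[OF k v]] in auto)
    also have "\<dots> = restr M U (orb (K k)) (j k) v"
    proof -
      \<comment> \<open>The pullback of an orbit with itself is the diagonal, since
        \<open>j k\<close> is injective.\<close>
      let ?P = "fibre_product G (orb (K k)) (orb (K k)) (j k) (j k)"
      have P: "p \<in> pts ?P \<longleftrightarrow> (\<exists>x\<in>pts (orb (K k)). p = (x, x))" for p
        using inj[of k k] k by (cases p) (auto simp: fibre_product_simps)
      have "span_iso G (restr_span (orb (K k)) (j k)) (span_comp G (orbit_span (K k) U U (e k) (e k)) (restr_span (orb (K k)) (j k)))"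
      proof (rule span_isoI)
        let ?d = "\<lambda>x\<in>pts (orb (K k)). (x, x)"
        have "?d \<in> gset_hom G (orb (K k)) ?P"
          by (rule gset_hom_restrictI[OF Ok]) (auto simp: fibre_product_simps)
        then show "?d \<in> gset_hom G (apex (restr_span (orb (K k)) (j k))) (apex (span_comp G (orbit_span (K k) U U (e k) (e k)) (restr_span (orb (K k)) (j k))))"
          unfolding ap by (simp add: restr_span_def)
        have "bij_betw ?d (pts (orb (K k))) (pts ?P)"
          by (rule bij_betw_imageI) (auto simp: inj_on_def P)
        then show "bij_betw ?d (pts (apex (restr_span (orb (K k)) (j k)))) (pts (apex (span_comp G (orbit_span (K k) U U (e k) (e k)) (restr_span (orb (K k)) (j k)))))"
          unfolding ap by (simp add: restr_span_def)
      qed (auto simp: span_comp_simps orbit_span_def restr_span_def j_def)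
      then show ?thesis
        using comp[OF k] mact_iso[OF M _ sp span_comp_spans[OF o_spans[OF k] sp]] by simp
    qed
    finally show ?thesis .
  qed
  have ys: "y = finsum ?V (\<lambda>i. ?o i y) {..<n}"
  proof -
    let ?id = "\<lambda>v\<in>carrier ?V. v"
    let ?p = "\<lambda>i. restr M U (orb (K i)) (j i)"
    have p: "?p i \<in> Mor vect_cat ?V (fobj M (orb (K i)))" if "i < n" for i
      by (rule mact_mor[OF M U orb_gset[OF K[OF that]] rsp_spans[OF orb_gset[OF K[OF that]] j[OF that]]])
    have idm: "?id \<in> Mor vect_cat ?V ?V" by (auto simp: vect_mor_iff)
    have c1: "compose (carrier ?V) (?p i) ?id = ?p i" if "i < n" for i
      using p[OF that] by (auto simp: compose_def vect_mor_iff extensional_def fun_eq_iff)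
    have c2: "compose (carrier ?V) (?p i) ?s = ?p i" if "i < n" for i
      using p[OF that] proj[OF that] by (auto simp: compose_def vect_mor_iff extensional_def fun_eq_iff)
    have "?id = ?s"
    proof (rule is_product_unique[OF vprod])
      show "?V \<in> Ob vect_cat" using V.rat_module_axioms by (simp add: rat_module_iff)
    qed (use s p idm c1 c2 in simp_all)
    from fun_cong[OF this, of y] show ?thesis using y by simp
  qed
  have F: "orbit_map M (stab U u) U U u u y = ?o i y \<and> card (stab U u) = card (K i)"
    if "i < n" and g: "g \<in> carrier G" "u = act U g (e i)" for i u g
  proof -
    have "stab U u = conjg g (K i)" using stab_act[OF U g(1) eR(3)[OF that(1)]] g by (simp add: K_def)
    then show ?thesis
      using ot_conj[OF M U eR(3)[OF that(1)] subset_refl U eR(3)[OF that(1)] O_refl[OF K[OF that(1), unfolded K_def]] g(1)]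
        cj_card[OF stab_carrier[OF U] g(1)] g(2) by (simp add: K_def)
  qed
  let ?f = "\<lambda>u. of_nat (card (stab U u)) \<odot>\<^bsub>?V\<^esub> orbit_map M (stab U u) U U u u y"
  let ?B = "\<lambda>i. (\<lambda>g. act U g (e i)) ` carrier G"
  have Bu: "u \<in> pts U" "r u = e i" if "i < n" "u \<in> ?B i" for i u
    using that eR r_act act_closed[OF U] by auto
  \<comment> \<open>Sorting the points of \<open>U\<close> by their orbits, each orbit being
    recognized by its selected point.\<close>
  have E1: "finsum ?V (\<lambda>i. finsum ?V ?f (?B i)) {..<n} = finsum ?V ?f (pts U)"
  proof (rule V.finsum_Sigma_reindex[where p="\<lambda>u. inv_into {..<n} e (r u)" and q="\<lambda>u. u" and k="\<lambda>i u. u"])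
    show "finite (?B i)" for i using fin by simp
    show "?f b \<in> carrier ?V" if "a \<in> {..<n}" "b \<in> ?B a" for a b
      using Bu[of a b] that otc[OF _ y] by simp
    show "b \<in> pts U \<and> inv_into {..<n} e (r b) = a \<and> b = b" if "a \<in> {..<n}" "b \<in> ?B a" for a b
      using Bu[of a b] that e by (simp add: bij_betw_def inv_into_f_f)
    fix c assume c: "c \<in> pts U"
    then obtain i x where i: "i < n" "x \<in> pts (orb (K i))" "c = j i x" using cover by blast
    then obtain g where "g \<in> carrier G" "x = act (orb (K i)) g (base_pt (K i))" using orb_trans[OF K] by blast
    then have cB: "c \<in> ?B i" using i j_act by simp
    then have "inv_into {..<n} e (r c) = i" using Bu[OF i(1) cB] e i by (simp add: bij_betw_def inv_into_f_f)
    then show "inv_into {..<n} e (r c) \<in> {..<n} \<and> c \<in> ?B (inv_into {..<n} e (r c)) \<and> c = c" using i cB by simp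
  qed simp
  \<comment> \<open>All points of an orbit contribute equally, and the size of the orbit times the
    order of the stabilizer is the order of \<open>G\<close>.\<close>
  have E2: "finsum ?V ?f (?B i) = of_nat (card (carrier G)) \<odot>\<^bsub>?V\<^esub> ?o i y" if i: "i < n" for i
  proof -
    have "finsum ?V ?f (?B i) = finsum ?V (\<lambda>u. of_nat (card (K i)) \<odot>\<^bsub>?V\<^esub> ?o i y) (?B i)"
      by (rule V.M.finsum_cong') (use F[OF i] oc[OF i y] in auto)
    also have "\<dots> = of_nat (card (?B i)) \<odot>\<^bsub>?V\<^esub> (of_nat (card (K i)) \<odot>\<^bsub>?V\<^esub> ?o i y)"
      by (rule V.finsum_const_rat) (use oc[OF i y] fin in auto)
    also have "\<dots> = of_nat (card (?B i) * card (K i)) \<odot>\<^bsub>?V\<^esub> ?o i y"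
      using oc[OF i y] by (simp add: V.smult_smult)
    also have "card (?B i) * card (K i) = card (carrier G)"
      using orbit_card[OF U fin eR(3)[OF i]] by (simp add: K_def)
    finally show ?thesis .
  qed
  have "finsum ?V ?f (pts U) = finsum ?V (\<lambda>i. of_nat (card (carrier G)) \<odot>\<^bsub>?V\<^esub> ?o i y) {..<n}"
    unfolding E1[symmetric] by (rule V.M.finsum_cong') (use E2 oc[OF _ y] in auto)
  also have "\<dots> = of_nat (card (carrier G)) \<odot>\<^bsub>?V\<^esub> finsum ?V (\<lambda>i. ?o i y) {..<n}"
    by (rule V.smult_finsum[symmetric]) (use oc[OF _ y] in simp)
  finally show ?thesis using ys by simp
qed

text \<open>A span acts as restriction to its apex followed by transfer along its right leg. The
  decomposition of the restricted element over the points of the apex is pushed through that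
  transfer, term by term.\<close>

lemma span_decomposition:
  fixes w :: "('a, 'u, 's) gspan"
  assumes S: "finite_gset G S" and T: "finite_gset G T" and w: "w \<in> spans G TS S T" and x: "x \<in> carrier (fobj M S)"
  shows "of_nat (card (carrier G)) \<odot>\<^bsub>fobj M T\<^esub> span_map M S T w x =
    finsum (fobj M T) (\<lambda>u. of_nat (card (stab (apex w) u)) \<odot>\<^bsub>fobj M T\<^esub>
      orbit_map M (stab (apex w) u) S T (lleg w u) (rleg w u) x) (pts (apex w))"
proof -
  obtain w' :: "('a, 's, 's) gspan" where w': "w' \<in> spans G TS S T" "span_iso G w' w" using cp_span[OF w] by blast
  then obtain f where f: "f \<in> gset_hom G (apex w') (apex w)" "bij_betw f (pts (apex w')) (pts (apex w))"
    "\<And>x. x \<in> pts (apex w') \<Longrightarrow> lleg w (f x) = lleg w' x" "\<And>x. x \<in> pts (apex w') \<Longrightarrow> rleg w (f x) = rleg w' x"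
    unfolding span_iso_def by blast
  define U where "U = apex w'"
  note W = spansD[OF w'(1), folded U_def]
  interpret VT: rat_module "fobj M T" by (rule mk_mod[OF M T])
  interpret VU: rat_module "fobj M U" by (rule mk_mod[OF M W(1)])
  define y where "y = restr M S U (lleg w') x"
  have y: "y \<in> carrier (fobj M U)" unfolding y_def by (rule mact_closed[OF M S W(1) rsp_spans[OF W(1,2)] x])
  let ?t = "\<lparr>apex = U, lleg = (\<lambda>x\<in>pts U. x), rleg = rleg w'\<rparr>"
  have t: "?t \<in> spans G TS U T" by (rule spansI) (use W gset_hom_id in auto)
  note tl = mact_lin[OF M W(1) T t]
  have 1: "span_map M S T w x = span_map M U T ?t y"
    unfolding y_def mact_iso[OF M w'(2) w'(1) w, symmetric]
    by (rule mact_lleg[OF M S T W(1,2) t w'(1) _ _ _ x]) (auto simp: U_def)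
  have su: "(stab U u, stab U u) \<in> TS" if "u \<in> pts U" for u using O_refl stab_subgroup[OF W(1) that] .
  have oc: "orbit_map M (stab U u) U U u u y \<in> carrier (fobj M U)" if "u \<in> pts U" for u
    by (rule ot_closed[OF M W(1) that subset_refl W(1) that su[OF that] y])
  have 2: "span_map M U T ?t (orbit_map M (stab U u) U U u u y) = orbit_map M (stab U u) S T (lleg w' u) (rleg w' u) x" if u: "u \<in> pts U" for u
  proof -
    note K = stab_subgroup[OF W(1) u]
    have l: "lleg w' u \<in> pts S" "stab U u \<subseteq> stab S (lleg w' u)" using W(2) u stab_hom[OF W(1,2) u] by (auto simp: gset_homD)
    have r: "rleg w' u \<in> pts T" using W(3) u by (auto simp: gset_homD)
    have o1: "orbit_span (stab U u) S U (lleg w' u) u \<in> spans G TS S U" by (rule osp_spans[OF S l W(1) u su[OF u]])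
    have o2: "orbit_span (stab U u) U U u u \<in> spans G TS U U" by (rule osp_spans[OF W(1) u subset_refl W(1) u su[OF u]])
    have o3: "orbit_span (stab U u) S T (lleg w' u) (rleg w' u) \<in> spans G TS S T" by (rule osp_spans[OF S l T r W(4)[OF u]])
    have "orbit_map M (stab U u) U U u u y = span_map M S U (orbit_span (stab U u) S U (lleg w' u) u) x"
      unfolding orbit_map_def y_def
      by (rule mact_lleg[OF M S W(1) W(1,2) o2 o1 _ _ _ x, symmetric])
        (use pm_comp_apply[OF K W(1) u subset_refl S W(2)] in \<open>simp_all add: orbit_span_def\<close>)
    moreover have "span_map M S T (orbit_span (stab U u) S T (lleg w' u) (rleg w' u)) x = span_map M U T ?t (span_map M S U (orbit_span (stab U u) S U (lleg w' u) u) x)"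
      by (rule mact_rleg[OF M S T W(1) t o1 o3 _ _ _ x])
        (use pm_comp_apply[OF K W(1) u subset_refl T W(3)] in \<open>simp_all add: orbit_span_def\<close>)
    ultimately show ?thesis unfolding orbit_map_def by simp
  qed
  let ?F = "\<lambda>u. of_nat (card (stab (apex w) u)) \<odot>\<^bsub>fobj M T\<^esub> orbit_map M (stab (apex w) u) S T (lleg w u) (rleg w u) x"
  have F: "?F (f u) = span_map M U T ?t (of_nat (card (stab U u)) \<odot>\<^bsub>fobj M U\<^esub> orbit_map M (stab U u) U U u u y)" if u: "u \<in> pts U" for u
  proof -
    have "stab (apex w) (f u) = stab U u"
      using stab_hom_inj[OF W(1) f(1)[folded U_def] u] f(2) by (simp add: U_def bij_betw_def)
    then show ?thesis using tl 2[OF u] oc[OF u] f(3,4) u by (simp add: U_def)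
  qed
  have Fc: "?F (f u) \<in> carrier (fobj M T)" if "u \<in> pts U" for u
    unfolding F[OF that] by (rule mact_closed[OF M W(1) T t VU.smult_closed'[OF oc[OF that]]])
  have fb: "bij_betw f (pts U) (pts (apex w))" using f(2) by (simp add: U_def)
  have "of_nat (card (carrier G)) \<odot>\<^bsub>fobj M T\<^esub> span_map M S T w x = span_map M U T ?t (of_nat (card (carrier G)) \<odot>\<^bsub>fobj M U\<^esub> y)"
    unfolding 1 using tl y by simp
  also have "\<dots> = span_map M U T ?t (finsum (fobj M U) (\<lambda>u. of_nat (card (stab U u)) \<odot>\<^bsub>fobj M U\<^esub> orbit_map M (stab U u) U U u u y) (pts U))"
    unfolding orbit_decomposition[OF W(1) y] ..
  also have "\<dots> = finsum (fobj M T) (\<lambda>u. span_map M U T ?t (of_nat (card (stab U u)) \<odot>\<^bsub>fobj M U\<^esub> orbit_map M (stab U u) U U u u y)) (pts U)"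
    by (rule lin_finsum[OF VU.rat_module_axioms VT.rat_module_axioms tl]) (use oc in auto)
  also have "\<dots> = finsum (fobj M T) (\<lambda>u. ?F (f u)) (pts U)"
    by (rule VT.M.finsum_cong') (use F Fc in auto)
  also have "\<dots> = finsum (fobj M T) ?F (pts (apex w))"
  proof (rule VT.finsum_reindex_bij[OF fb])
    fix b assume "b \<in> pts (apex w)"
    then obtain u where "u \<in> pts U" "b = f u" using fb unfolding bij_betw_def by blast
    then show "?F b \<in> carrier (fobj M T)" using Fc by simp
  qed
  finally show ?thesis .
qed

text \<open>Decomposing the composite of the orbit span with \<open>w\<close> gives a sum over pairs
  \<open>(p, u)\<close> with \<open>p\<close> in \<open>G/L\<close>. Translation by the group makes
  the inner sum over \<open>u\<close> independent of \<open>p\<close>, so the total is the number of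
  cosets times the part over the base point. Dividing by that number turns the order of
  \<open>G\<close> into the order of \<open>L\<close>.\<close>

lemma double_coset:
  fixes w :: "('a, 'u, 's) gspan"
  assumes R: "finite_gset G R" "r \<in> pts R" "L \<subseteq> stab R r" and S: "finite_gset G S" "s \<in> pts S" "(L, stab S s) \<in> TS"
    and T: "finite_gset G T" and w: "w \<in> spans G TS S T" and x: "x \<in> carrier (fobj M R)"
  shows "of_nat (card L) \<odot>\<^bsub>fobj M T\<^esub> span_map M S T w (orbit_map M L R S r s x) =
    finsum (fobj M T) (\<lambda>u. of_nat (card (L \<inter> stab (apex w) u)) \<odot>\<^bsub>fobj M T\<^esub>
      orbit_map M (L \<inter> stab (apex w) u) R T r (rleg w u) x) {u \<in> pts (apex w). lleg w u = s}"
proof -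
  have L: "subgroup L G" "L \<subseteq> stab S s" using S(3) O_subgroup O_subset by auto
  note OL = orb_gset[OF L(1)] and W = spansD[OF w]
  interpret V: rat_module "fobj M T" by (rule mk_mod[OF M T])
  let ?V = "fobj M T"
  let ?o = "orbit_span L R S r s"
  let ?U = "apex w"
  have o: "?o \<in> spans G TS R S" by (rule osp_spans[OF R S])
  let ?c = "span_comp G ?o w"
  have c: "?c \<in> spans G TS R T" by (rule span_comp_spans[OF o w])
  note C = spansD[OF c]
  let ?P = "pts (apex ?c)"
  have P: "(p, u) \<in> ?P \<longleftrightarrow> p \<in> pts (orb L) \<and> u \<in> pts ?U \<and> pt_map L S s p = lleg w u" for p u
    by (simp add: span_comp_simps fibre_product_simps orbit_span_def)
  let ?F = "\<lambda>q. of_nat (card (stab (apex ?c) q)) \<odot>\<^bsub>?V\<^esub> orbit_map M (stab (apex ?c) q) R T (lleg ?c q) (rleg ?c q) x"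
  have Fc: "?F q \<in> carrier ?V" if "q \<in> ?P" for q
    by (rule V.smult_closed', rule ot_closed[OF M R(1) _ _ T _ C(4)[OF that] x])
      (use that C stab_hom[OF C(1,2) that] in \<open>auto simp: gset_homD\<close>)
  have Finv: "?F (act (apex ?c) g q) = ?F q" if q: "q \<in> ?P" and g: "g \<in> carrier G" for q g
    using ot_conj[OF M R(1) gset_homD(1)[OF C(2) q] stab_hom[OF C(1,2) q] T gset_homD(1)[OF C(3) q] C(4)[OF q] g]
      stab_act[OF C(1) g q] cj_card[OF stab_carrier[OF C(1)] g] gset_homD(2)[OF C(2) g q] gset_homD(2)[OF C(3) g q] by simp
  let ?B = "\<lambda>p. {u \<in> pts ?U. lleg w u = pt_map L S s p}"
  have pmb: "pt_map L S s (base_pt L) = s" by (rule pm_bpt[OF L(1) S(1,2) L(2)])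
  \<comment> \<open>The element that moves the base point to \<open>p\<close> also maps the fibre
    over the base point bijectively onto the fibre over \<open>p\<close>.\<close>
  have inner: "finsum ?V (\<lambda>u. ?F (p, u)) (?B p) = finsum ?V (\<lambda>u. ?F (base_pt L, u)) (?B (base_pt L))" if p: "p \<in> pts (orb L)" for p
  proof -
    obtain g where g: "g \<in> carrier G" "p = act (orb L) g (base_pt L)" using orb_trans[OF L(1) p] by blast
    have pmp: "pt_map L S s p = act S g s" unfolding g(2) by (rule pm_act[OF L(1) S(1,2) L(2) g(1)])
    have bij: "bij_betw (act ?U g) (?B (base_pt L)) (?B p)"
      unfolding pmb pmp
      by (rule bij_betwI[of _ _ _ "act ?U (inv g)"])
        (use g(1) W S in \<open>auto simp: act_closed[OF W(1)] act_inv[OF W(1)] act_inv[OF S(1)] gset_homD\<close>)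
    have "finsum ?V (\<lambda>u. ?F (p, u)) (?B p) = finsum ?V (\<lambda>u. ?F (p, act ?U g u)) (?B (base_pt L))"
      by (rule V.finsum_reindex_bij[OF bij, symmetric]) (rule Fc, use p P in auto)
    also have "\<dots> = finsum ?V (\<lambda>u. ?F (base_pt L, u)) (?B (base_pt L))"
    proof (rule V.M.finsum_cong'[OF refl])
      show "(\<lambda>u. ?F (base_pt L, u)) \<in> ?B (base_pt L) \<rightarrow> carrier ?V" by (rule funcsetI, rule Fc) (use P bpt_mem[OF L(1)] in auto)
      fix u assume u: "u \<in> ?B (base_pt L)"
      then have m: "(base_pt L, u) \<in> ?P" using P bpt_mem[OF L(1)] by auto
      have "act (apex ?c) g (base_pt L, u) = (p, act ?U g u)"
        using u bpt_mem[OF L(1)] g by (simp add: span_comp_simps fibre_product_simps orbit_span_def)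
      then show "?F (p, act ?U g u) = ?F (base_pt L, u)" using Finv[OF m g(1)] by metis
    qed
    finally show ?thesis .
  qed
  let ?I = "finsum ?V (\<lambda>u. ?F (base_pt L, u)) (?B (base_pt L))"
  have Ic: "?I \<in> carrier ?V" by (rule V.M.finsum_closed, rule funcsetI, rule Fc) (use P bpt_mem[OF L(1)] in auto)
  have otc: "orbit_map M L R S r s x \<in> carrier (fobj M S)" by (rule ot_closed[OF M R S x])
  have mc: "span_map M S T w (orbit_map M L R S r s x) \<in> carrier ?V" by (rule mact_closed[OF M S(1) T w otc])
  have "of_nat (card (carrier G)) \<odot>\<^bsub>?V\<^esub> span_map M S T w (orbit_map M L R S r s x) = finsum ?V ?F ?P"
    using span_decomposition[OF R(1) T c x] mact_comp[OF M R(1) S(1) T o w x] unfolding orbit_map_def by simp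
  also have "\<dots> = finsum ?V (\<lambda>p. finsum ?V (\<lambda>u. ?F (p, u)) (?B p)) (pts (orb L))"
  proof -
    have "finsum ?V (\<lambda>p. finsum ?V (\<lambda>u. ?F (p, u)) (?B p)) (pts (orb L)) = finsum ?V (\<lambda>c. ?F (fst c, snd c)) ?P"
      by (rule V.finsum_Sigma_reindex[where k = Pair])
        (use gset_finite[OF OL] gset_finite[OF W(1)] P in \<open>auto intro!: Fc simp del: of_nat_eq_iff\<close>)
    then show ?thesis by simp
  qed
  also have "\<dots> = finsum ?V (\<lambda>p. ?I) (pts (orb L))"
    by (rule V.M.finsum_cong') (use inner Ic in auto)
  also have "\<dots> = of_nat (card (pts (orb L))) \<odot>\<^bsub>?V\<^esub> ?I"
    by (rule V.finsum_const_rat[OF Ic gset_finite[OF OL]])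
  \<comment> \<open>The order of \<open>G\<close> is split as
    \<open>card (pts (orb L)) * card L\<close>, so that the number of cosets can be
    cancelled.\<close>
  finally have "of_nat (card (pts (orb L))) \<odot>\<^bsub>?V\<^esub> (of_nat (card L) \<odot>\<^bsub>?V\<^esub> span_map M S T w (orbit_map M L R S r s x)) = of_nat (card (pts (orb L))) \<odot>\<^bsub>?V\<^esub> ?I"
    using mc by (simp add: V.smult_smult flip: orb_card[OF L(1)])
  then have "of_nat (card L) \<odot>\<^bsub>?V\<^esub> span_map M S T w (orbit_map M L R S r s x) = ?I"
    by (rule V.smult_cancel[rotated 3]) (use mc Ic gset_finite[OF OL] bpt_mem[OF L(1)] in auto)
  also have "\<dots> = finsum ?V (\<lambda>u. of_nat (card (L \<inter> stab ?U u)) \<odot>\<^bsub>?V\<^esub>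
      orbit_map M (L \<inter> stab ?U u) R T r (rleg w u) x) {u \<in> pts ?U. lleg w u = s}"
  proof -
    have "?F (base_pt L, u) = of_nat (card (L \<inter> stab ?U u)) \<odot>\<^bsub>?V\<^esub> orbit_map M (L \<inter> stab ?U u) R T r (rleg w u) x" if u: "u \<in> pts ?U" "lleg w u = s" for u
    proof -
      have "stab (apex ?c) (base_pt L, u) = L \<inter> stab ?U u"
        using fibre_product_stab[of "base_pt L" "orb L" u ?U "pt_map L S s" "lleg w"] bpt_mem[OF L(1)] u pmb bpt_stab[OF L(1)]
        by (simp add: span_comp_simps orbit_span_def)
      moreover have "lleg ?c (base_pt L, u) = r" "rleg ?c (base_pt L, u) = rleg w u"
        using u pmb bpt_mem[OF L(1)] pm_bpt[OF L(1) R] by (simp_all add: span_comp_simps orbit_span_def)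
      ultimately show ?thesis by simp
    qed
    moreover have "?F (base_pt L, u) \<in> carrier ?V" if "u \<in> pts ?U" "lleg w u = s" for u
      by (rule Fc) (use that P pmb bpt_mem[OF L(1)] in auto)
    ultimately show ?thesis unfolding pmb by (intro V.M.finsum_cong') auto
  qed
  finally show ?thesis .
qed

end

end

section \<open>Coefficient systems\<close>

context group
begin

text \<open>Counterpart of \<open>pt_map\<close> for the coset space itself, stated for an arbitrary
  group because it is applied to normalizers.\<close>

definition coset_map :: "'a set \<Rightarrow> ('a, 't) gset \<Rightarrow> 't \<Rightarrow> 'a set \<Rightarrow> 't" where
  "coset_map K T t = (\<lambda>C\<in>pts (coset_gset G K). act T (SOME g. g \<in> carrier G \<and> C = act (coset_gset G K) g K) t)"

context
  fixes K
  assumes K: "subgroup K G" and fin: "finite (carrier G)"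
begin

lemma ctm_act:
  assumes T: "finite_gset G T" "t \<in> pts T" "K \<subseteq> stab T t" and g: "g \<in> carrier G"
  shows "coset_map K T t (act (coset_gset G K) g K) = act T g t"
proof -
  note C = gset_coset[OF K fin]
  let ?P = "\<lambda>h. h \<in> carrier G \<and> act (coset_gset G K) g K = act (coset_gset G K) h K"
  have "?P (SOME h. ?P h)" by (rule someI[of ?P g]) (simp add: g)
  then have h: "(SOME h. ?P h) \<in> carrier G" "act (coset_gset G K) g K = act (coset_gset G K) (SOME h. ?P h) K" by auto
  then have "inv (SOME h. ?P h) \<otimes> g \<in> K" using act_eq_iff[OF C(1) g h(1) C(2)] C(3) by simp
  then have "act T g t = act T (SOME h. ?P h) t" using act_eq_iff[OF T(1) g h(1) T(2)] T(3) by blast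
  then show ?thesis using act_closed[OF C(1) g C(2)] by (simp add: coset_map_def)
qed

lemma ctm_base: "finite_gset G T \<Longrightarrow> t \<in> pts T \<Longrightarrow> K \<subseteq> stab T t \<Longrightarrow> coset_map K T t K = t"
  using ctm_act[of T t \<one>] gset_coset[OF K fin] by (simp add: act_one)

lemma ctm_hom:
  assumes T: "finite_gset G T" "t \<in> pts T" "K \<subseteq> stab T t"
  shows "coset_map K T t \<in> gset_hom G (coset_gset G K) T"
proof -
  note C = gset_coset[OF K fin]
  have "(\<lambda>p\<in>pts (coset_gset G K). coset_map K T t p) \<in> gset_hom G (coset_gset G K) T"
  proof (rule gset_hom_restrictI[OF C(1)])
    fix g x assume gx: "g \<in> carrier G" "x \<in> pts (coset_gset G K)"
    then obtain h where h: "h \<in> carrier G" "x = act (coset_gset G K) h K" using C(4) by blast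
    have "act (coset_gset G K) g x = act (coset_gset G K) (g \<otimes> h) K" using h gx C(2) by (simp add: act_mult[OF C(1)])
    then show "coset_map K T t (act (coset_gset G K) g x) = act T g (coset_map K T t x)"
      using ctm_act[OF T] h gx act_mult[OF T(1)] T(2) by simp
  next
    fix x assume "x \<in> pts (coset_gset G K)"
    then obtain h where h: "h \<in> carrier G" "x = act (coset_gset G K) h K" using C(4) by blast
    then show "coset_map K T t x \<in> pts T" using ctm_act[OF T] act_closed[OF T(1)] T(2) by simp
  qed
  moreover have "(\<lambda>p\<in>pts (coset_gset G K). coset_map K T t p) = coset_map K T t" by (auto simp: coset_map_def)
  ultimately show ?thesis by simp
qed

lemma coset_hom_eqI:
  assumes "f \<in> gset_hom G (coset_gset G K) T" "f' \<in> gset_hom G (coset_gset G K) T" "f K = f' K"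
  shows "f = f'"
proof (rule gset_hom_eqI[OF assms(1,2)])
  fix x assume "x \<in> pts (coset_gset G K)"
  then obtain g where "g \<in> carrier G" "x = act (coset_gset G K) g K" using gset_coset(4)[OF K fin] by blast
  then show "f x = f' x" using assms gset_coset(2)[OF K fin] by (simp add: gset_homD)
qed

text \<open>Cosets of \<open>K\<close> are disjoint or equal, so only \<open>K\<close> contains the
  unit. This is how a subgroup is read off from its coset space, the objects of the orbit category
  being coset spaces rather than subgroups.\<close>

lemma coset_base: "C \<in> pts (coset_gset G K) \<Longrightarrow> \<one> \<in> C \<longleftrightarrow> C = K"
proof -
  assume C: "C \<in> pts (coset_gset G K)"
  have 1: "\<one> \<in> K" by (rule subgroup.one_closed[OF K])
  have "C \<inter> K = {} \<or> C = K"
    using lcos_disjoint[OF K, of C K] C gset_coset(2)[OF K fin] by (auto simp: coset_gset_def)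
  then show ?thesis using 1 by blast
qed

end

end

section \<open>Orbit categories of the normalizers\<close>

context disk
begin

definition norm_grp :: "'a set set \<Rightarrow> ('a, 'b) monoid_scheme" where
  "norm_grp c = G\<lparr>carrier := norm_rep c\<rparr>"

text \<open>Source category of the coefficient systems at \<open>c\<close>. Contravariance is
  absorbed by \<open>op_cat\<close>, so \<open>Mor (osrc c) Z' Z\<close> consists of the equivariant
  maps from \<open>Z\<close> to \<open>Z'\<close>.\<close>

definition osrc :: "'a set set \<Rightarrow> (('a, 'a set) gset, 'a set \<Rightarrow> 'a set) cat" where
  "osrc c = op_cat (full_subcat (orbit_cat (norm_grp c)) {coset_gset (norm_grp c) K | K. K \<in> insep_class G TS (rep c) \<and> K \<subseteq> rep c})"

text \<open>By \<open>insep_iff\<close> these are the subgroups of \<open>rep c\<close> that are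
  inseparable from it.\<close>

definition hull_rep :: "'a set set \<Rightarrow> 'a set \<Rightarrow> bool" where
  "hull_rep c K \<longleftrightarrow> subgroup K G \<and> hullO K = rep c"

definition ncoset :: "'a set set \<Rightarrow> 'a set \<Rightarrow> ('a, 'a set) gset" where
  "ncoset c K = coset_gset (norm_grp c) K"

lemma coeff_cat_eq: "coeff_cat G TS (rep c) = functor_cat (osrc c) vect_cat"
  by (simp add: coeff_cat_def osrc_def norm_grp_def Let_def)

lemma vs_sub: "hull_rep c K \<Longrightarrow> K \<subseteq> rep c"
  unfolding hull_rep_def using hO_facts(2) subgroup_carrier by metis

lemma vs_subgroup: "hull_rep c K \<Longrightarrow> subgroup K G"
  by (simp add: hull_rep_def)

lemma vs_hO: "hull_rep c K \<Longrightarrow> hullO K = rep c"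
  by (simp add: hull_rep_def)

context
  fixes c
  assumes c: "c \<in> SubO_classes"
begin

lemma N_group: "group (norm_grp c)"
  unfolding norm_grp_def by (rule subgroup_imp_group[OF nz_subgroup[OF c]])

lemma N_fin: "finite (carrier (norm_grp c))"
  unfolding norm_grp_def using fin nz_subgroup[OF c] subgroup.subset finite_subset by fastforce

lemma N_simps [simp]: "carrier (norm_grp c) = norm_rep c" "x \<otimes>\<^bsub>norm_grp c\<^esub> y = x \<otimes> y" "\<one>\<^bsub>norm_grp c\<^esub> = \<one>"
  by (simp_all add: norm_grp_def)

lemma N_inv: "x \<in> norm_rep c \<Longrightarrow> inv\<^bsub>norm_grp c\<^esub> x = inv x"
  unfolding norm_grp_def using m_inv_consistent[OF nz_subgroup[OF c]] by simp

lemma N_cj: "a \<in> norm_rep c \<Longrightarrow> group.conjg (norm_grp c) a K = conjg a K"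
  unfolding group.cj_eq[OF N_group] cj_eq using N_inv by simp

lemma nz_cl: "a \<in> norm_rep c \<Longrightarrow> a \<in> carrier G"
  by (rule nz_closed[OF c])

lemma nz_mult: "a \<in> norm_rep c \<Longrightarrow> b \<in> norm_rep c \<Longrightarrow> a \<otimes> b \<in> norm_rep c"
  using subgroup.m_closed[OF nz_subgroup[OF c]] .

lemma nz_inv: "a \<in> norm_rep c \<Longrightarrow> inv a \<in> norm_rep c"
  using subgroup.m_inv_closed[OF nz_subgroup[OF c]] .

lemma nz_one: "\<one> \<in> norm_rep c"
  using subgroup.one_closed[OF nz_subgroup[OF c]] .

lemma vs_N: "hull_rep c K \<Longrightarrow> subgroup K (norm_grp c)"
  unfolding norm_grp_def by (rule subgroup_incl[OF vs_subgroup nz_subgroup[OF c]]) (use vs_sub rep_nz[OF c] in blast)+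

lemma osrc_Ob: "Ob (osrc c) = {ncoset c K | K. hull_rep c K}"
proof -
  have "{coset_gset (norm_grp c) K | K. subgroup K (norm_grp c)} \<inter> {coset_gset (norm_grp c) K | K. hull_rep c K} = {coset_gset (norm_grp c) K | K. hull_rep c K}"
    using vs_N by blast
  then show ?thesis
    using insep_iff[OF c] by (simp add: osrc_def op_cat_def full_subcat_def orbit_cat_def ncoset_def hull_rep_def)
qed

lemma osrc_simps:
  "Mor (osrc c) Z' Z = gset_hom (norm_grp c) Z Z'"
  "Cmp (osrc c) Z Z' Z'' g f = compose (pts Z'') f g"
  "Idn (osrc c) Z = (\<lambda>x\<in>pts Z. x)"
  by (simp_all add: osrc_def op_cat_def full_subcat_def orbit_cat_def)

lemma co_facts:
  assumes "hull_rep c K"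
  shows "finite_gset (norm_grp c) (ncoset c K)" "K \<in> pts (ncoset c K)" "stabilizer (norm_grp c) (act (ncoset c K)) K = K"
    "p \<in> pts (ncoset c K) \<Longrightarrow> \<exists>g\<in>norm_rep c. p = act (ncoset c K) g K"
  using group.gset_coset[OF N_group vs_N[OF assms] N_fin] by (simp_all add: ncoset_def)

text \<open>The morphism of cosets with \<open>K \<mapsto> a K'\<close>.\<close>

definition nmap :: "'a set \<Rightarrow> 'a set \<Rightarrow> 'a \<Rightarrow> 'a set \<Rightarrow> 'a set" where
  "nmap K K' a = group.coset_map (norm_grp c) K (ncoset c K') (act (ncoset c K') a K')"

lemma co_stab:
  assumes K: "hull_rep c K" and a: "a \<in> norm_rep c"
  shows "act (ncoset c K) a K \<in> pts (ncoset c K)" "stabilizer (norm_grp c) (act (ncoset c K)) (act (ncoset c K) a K) = conjg a K"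
proof -
  show "act (ncoset c K) a K \<in> pts (ncoset c K)"
    by (rule group.act_closed[OF N_group co_facts(1)[OF K] _ co_facts(2)[OF K]]) (simp add: a)
  show "stabilizer (norm_grp c) (act (ncoset c K)) (act (ncoset c K) a K) = conjg a K"
    using group.stab_act[OF N_group co_facts(1)[OF K] _ co_facts(2)[OF K], of a] co_facts(3)[OF K] N_cj[OF a] a by simp
qed

lemma nmap_hom:
  assumes K: "hull_rep c K" "hull_rep c K'" and a: "a \<in> norm_rep c" "K \<subseteq> conjg a K'"
  shows "nmap K K' a \<in> gset_hom (norm_grp c) (ncoset c K) (ncoset c K')" "nmap K K' a K = act (ncoset c K') a K'"
  using group.ctm_hom[OF N_group vs_N[OF K(1)] N_fin co_facts(1)[OF K(2)] co_stab(1)[OF K(2) a(1)]]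
    group.ctm_base[OF N_group vs_N[OF K(1)] N_fin co_facts(1)[OF K(2)] co_stab(1)[OF K(2) a(1)]]
    co_stab(2)[OF K(2) a(1)] a(2)
  by (simp_all add: nmap_def flip: ncoset_def)

lemma co_hom_eqI:
  assumes "hull_rep c K" "f \<in> gset_hom (norm_grp c) (ncoset c K) T" "f' \<in> gset_hom (norm_grp c) (ncoset c K) T" "f K = f' K"
  shows "f = f'"
  using group.coset_hom_eqI[OF N_group vs_N[OF assms(1)] N_fin, of f T f'] assms(2-) by (simp add: ncoset_def)

text \<open>An equivariant map is determined by the coset \<open>a K'\<close> that receives
  \<open>K\<close>, and the stabilizer \<open>conjg a K'\<close> of that coset must contain the
  stabilizer \<open>K\<close> of its preimage.\<close>

lemma hom_nmap:
  assumes K: "hull_rep c K" "hull_rep c K'" and f: "f \<in> gset_hom (norm_grp c) (ncoset c K) (ncoset c K')"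
  shows "\<exists>a\<in>norm_rep c. K \<subseteq> conjg a K' \<and> f K = act (ncoset c K') a K' \<and> f = nmap K K' a"
proof -
  have "f K \<in> pts (ncoset c K')" by (rule group.gset_homD(1)[OF N_group f co_facts(2)[OF K(1)]])
  then obtain a where a: "a \<in> norm_rep c" "f K = act (ncoset c K') a K'" using co_facts(4)[OF K(2)] by blast
  have "K \<subseteq> stabilizer (norm_grp c) (act (ncoset c K')) (f K)"
    using group.stab_hom[OF N_group co_facts(1)[OF K(1)] f co_facts(2)[OF K(1)]] co_facts(3)[OF K(1)] by simp
  then have s: "K \<subseteq> conjg a K'" using a co_stab(2)[OF K(2) a(1)] by simp
  have "f = nmap K K' a" by (rule co_hom_eqI[OF K(1) f]) (use nmap_hom[OF K a(1) s] a in simp_all)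
  then show ?thesis using a s by blast
qed

text \<open>The element of the map applied first stands on the left: \<open>K\<close> goes to
  \<open>a K'\<close>, which equivariance sends on to \<open>a (b K'')\<close>.\<close>

lemma nmap_comp:
  assumes K: "hull_rep c K" "hull_rep c K'" "hull_rep c K''" and a: "a \<in> norm_rep c" "K \<subseteq> conjg a K'" and b: "b \<in> norm_rep c" "K' \<subseteq> conjg b K''"
  shows "K \<subseteq> conjg (a \<otimes> b) K''" "compose (pts (ncoset c K)) (nmap K' K'' b) (nmap K K' a) = nmap K K'' (a \<otimes> b)"
proof -
  have c'': "K'' \<subseteq> carrier G" using K(3) vs_subgroup subgroup_carrier by blast
  have "conjg a K' \<subseteq> conjg a (conjg b K'')" by (rule cj_mono[OF b(2)])
  then show s: "K \<subseteq> conjg (a \<otimes> b) K''" using a(2) cj_cj[OF c'' nz_cl[OF a(1)] nz_cl[OF b(1)]] by simp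
  note A = nmap_hom[OF K(1,2) a] and B = nmap_hom[OF K(2,3) b] and AB = nmap_hom[OF K(1,3) nz_mult[OF a(1) b(1)] s]
  have "compose (pts (ncoset c K)) (nmap K' K'' b) (nmap K K' a) \<in> gset_hom (norm_grp c) (ncoset c K) (ncoset c K'')"
    using group.gset_hom_comp[OF N_group co_facts(1)[OF K(1)] A(1) B(1)] by (simp add: compose_def)
  then show "compose (pts (ncoset c K)) (nmap K' K'' b) (nmap K K' a) = nmap K K'' (a \<otimes> b)"
  proof (rule co_hom_eqI[OF K(1) _ AB(1)])
    have "nmap K' K'' b (act (ncoset c K') a K') = act (ncoset c K'') a (act (ncoset c K'') b K'')"
      using group.gset_homD(2)[OF N_group B(1) _ co_facts(2)[OF K(2)], of a] a(1) B(2) by simp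
    then show "compose (pts (ncoset c K)) (nmap K' K'' b) (nmap K K' a) K = nmap K K'' (a \<otimes> b) K"
      using group.act_mult[OF N_group co_facts(1)[OF K(3)] _ _ co_facts(2)[OF K(3)], of a b] a(1) b(1) co_facts(2)[OF K(1)] A(2) AB(2)
      by (simp add: compose_def)
  qed
qed

lemma nmap_id:
  assumes K: "hull_rep c K" and a: "a \<in> K"
  shows "nmap K K a = (\<lambda>x\<in>pts (ncoset c K). x)"
proof (rule co_hom_eqI[OF K])
  have an: "a \<in> norm_rep c" using a vs_sub[OF K] rep_nz[OF c] by blast
  have "K \<subseteq> conjg a K" using cj_self[OF vs_subgroup[OF K] a] by simp
  note A = nmap_hom[OF K K an this]
  show "nmap K K a \<in> gset_hom (norm_grp c) (ncoset c K) (ncoset c K)" by (rule A(1))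
  show "(\<lambda>x\<in>pts (ncoset c K). x) \<in> gset_hom (norm_grp c) (ncoset c K) (ncoset c K)" by (rule group.gset_hom_id[OF N_group co_facts(1)[OF K]])
  have "a \<in> stabilizer (norm_grp c) (act (ncoset c K)) K" using co_facts(3)[OF K] a by simp
  then show "nmap K K a K = (\<lambda>x\<in>pts (ncoset c K). x) K"
    using A(2) co_facts(2)[OF K] by (simp add: stabilizer_def)
qed

end

section \<open>Families of coefficient systems\<close>

abbreviation coeffs :: "('a set set \<Rightarrow> ('a, 'v) coeff_system, 'a set set \<Rightarrow> ('a, 'v) coeff_map) cat" where
  "coeffs \<equiv> prod_cat SubO_classes (\<lambda>c. coeff_cat G TS (rep c))"

definition coeff_mod :: "('a set set \<Rightarrow> ('a, 'v) coeff_system) \<Rightarrow> 'a set set \<Rightarrow> 'a set \<Rightarrow> (rat, 'v) module" where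
  "coeff_mod X c K = fobj (X c) (ncoset c K)"

text \<open>The map from the value at \<open>K'\<close> to the value at \<open>K\<close> induced by
  \<open>K \<mapsto> a K'\<close>. For \<open>a = \<one>\<close> it is the restriction along an
  inclusion of \<open>K\<close> in \<open>K'\<close>; for \<open>K = conjg a K'\<close> it is a
  conjugation.\<close>

definition coeff_res :: "('a set set \<Rightarrow> ('a, 'v) coeff_system) \<Rightarrow> 'a set set \<Rightarrow> 'a set \<Rightarrow> 'a set \<Rightarrow> 'a \<Rightarrow> 'v \<Rightarrow> 'v" where
  "coeff_res X c K K' a = fmor (X c) (ncoset c K') (ncoset c K) (nmap c K K' a)"

lemma PC_Ob: "X \<in> Ob coeffs \<longleftrightarrow> X \<in> extensional SubO_classes \<and> (\<forall>c\<in>SubO_classes. is_functor (osrc c) vect_cat (X c))"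
  by (auto simp: prod_cat_def coeff_cat_eq functor_cat_def PiE_iff)

context
  fixes X :: "'a set set \<Rightarrow> ('a, 'v) coeff_system"
  assumes X: "X \<in> Ob coeffs"
begin

lemma X_functor: "c \<in> SubO_classes \<Longrightarrow> is_functor (osrc c) vect_cat (X c)"
  using X by (simp add: PC_Ob)

lemma xo_mod: "c \<in> SubO_classes \<Longrightarrow> hull_rep c K \<Longrightarrow> rat_module (coeff_mod X c K)"
  unfolding coeff_mod_def rat_module_iff by (rule is_functorD(1)[OF X_functor]) (auto simp: osrc_Ob)

lemma xm_mor:
  assumes "c \<in> SubO_classes" "hull_rep c K" "hull_rep c K'" "a \<in> norm_rep c" "K \<subseteq> conjg a K'"
  shows "coeff_res X c K K' a \<in> Mor vect_cat (coeff_mod X c K') (coeff_mod X c K)"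
  unfolding coeff_mod_def coeff_res_def
  by (rule is_functorD(2)[OF X_functor]) (use assms nmap_hom(1)[OF assms] in \<open>auto simp: osrc_Ob osrc_simps\<close>)

lemma xm_lin:
  assumes "c \<in> SubO_classes" "hull_rep c K" "hull_rep c K'" "a \<in> norm_rep c" "K \<subseteq> conjg a K'"
  shows "lin (coeff_mod X c K') (coeff_mod X c K) (coeff_res X c K K' a)"
  using xm_mor[OF assms] by (simp add: vect_mor_iff)

lemma xm_id:
  assumes "c \<in> SubO_classes" "hull_rep c K" "a \<in> K" "x \<in> carrier (coeff_mod X c K)"
  shows "coeff_res X c K K a x = x"
proof -
  have "ncoset c K \<in> Ob (osrc c)" using osrc_Ob[OF assms(1)] assms(2) by auto
  from is_functorD(3)[OF X_functor[OF assms(1)] this] show ?thesis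
    using assms(4) nmap_id[OF assms(1-3)] by (simp add: coeff_res_def coeff_mod_def osrc_simps[OF assms(1)])
qed

lemma xm_comp:
  assumes c: "c \<in> SubO_classes" and K: "hull_rep c K" "hull_rep c K'" "hull_rep c K''" and a: "a \<in> norm_rep c" "K \<subseteq> conjg a K'" and b: "b \<in> norm_rep c" "K' \<subseteq> conjg b K''"
    and x: "x \<in> carrier (coeff_mod X c K'')"
  shows "coeff_res X c K K' a (coeff_res X c K' K'' b x) = coeff_res X c K K'' (a \<otimes> b) x"
proof -
  have "fmor (X c) (ncoset c K'') (ncoset c K) (Cmp (osrc c) (ncoset c K'') (ncoset c K') (ncoset c K) (nmap c K K' a) (nmap c K' K'' b)) =
     Cmp vect_cat (fobj (X c) (ncoset c K'')) (fobj (X c) (ncoset c K')) (fobj (X c) (ncoset c K)) (coeff_res X c K K' a) (coeff_res X c K' K'' b)"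
    unfolding coeff_res_def
    by (rule is_functorD(4)[OF X_functor[OF c]])
      (use K nmap_hom(1)[OF c K(1,2) a] nmap_hom(1)[OF c K(2,3) b] in \<open>auto simp: osrc_Ob[OF c] osrc_simps[OF c]\<close>)
  then have "coeff_res X c K K'' (a \<otimes> b) = Cmp vect_cat (fobj (X c) (ncoset c K'')) (fobj (X c) (ncoset c K')) (fobj (X c) (ncoset c K)) (coeff_res X c K K' a) (coeff_res X c K' K'' b)"
    using nmap_comp(2)[OF c K a b] by (simp add: osrc_simps[OF c] coeff_res_def)
  then show ?thesis using x by (simp add: compose_eq coeff_mod_def)
qed

end

section \<open>The Mackey functor of a family of coefficient systems\<close>

text \<open>The subgroups \<open>L \<rightarrow> Stab s\<close> with hull \<open>rep c\<close> are determined by \<open>c\<close> and \<open>s\<close>: necessarily \<open>L = cut_stab c S s\<close>,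
  and such an \<open>L\<close> exists iff \<open>(c, s) \<in> index S\<close>. Up to conjugation these are all \<open>L \<rightarrow> Stab s\<close>.\<close>

definition cut_stab :: "'a set set \<Rightarrow> ('a, 't) gset \<Rightarrow> 't \<Rightarrow> 'a set" where
  "cut_stab c S s = stab S s \<inter> rep c"

definition index :: "('a, 't) gset \<Rightarrow> ('a set set \<times> 't) set" where
  "index S = {(c, s). c \<in> SubO_classes \<and> s \<in> pts S \<and> hull_rep c (cut_stab c S s)}"

lemma ks_subgroup: "finite_gset G S \<Longrightarrow> s \<in> pts S \<Longrightarrow> c \<in> SubO_classes \<Longrightarrow> subgroup (cut_stab c S s) G"
  unfolding cut_stab_def by (rule subgroups_Inter_pair) (simp_all add: stab_subgroup SO_subgroup rep_SO)

lemma idxD: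
  assumes "(c, s) \<in> index S" shows "c \<in> SubO_classes" "s \<in> pts S" "hull_rep c (cut_stab c S s)"
  using assms by (auto simp: index_def)

lemma idx_finite: "finite_gset G S \<Longrightarrow> finite (index S)"
  by (rule finite_subset[of _ "SubO_classes \<times> pts S"]) (auto simp: index_def finite_Cl gset_finite)

text \<open>Conjugation by an element of the normalizer fixes \<open>rep c\<close> and therefore
  passes through the intersection with it.\<close>

lemma ks_act:
  assumes "finite_gset G S" "s \<in> pts S" "c \<in> SubO_classes" "a \<in> norm_rep c"
  shows "cut_stab c S (act S a s) = conjg a (cut_stab c S s)"
  using stab_act[OF assms(1) nz_cl[OF assms(3,4)] assms(2)] nz_iff[OF assms(3), of a] assms(4)
    cj_Int[OF stab_carrier[OF assms(1)] rep_sub[OF assms(3)]] by (simp add: cut_stab_def)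

lemma vs_cj: "c \<in> SubO_classes \<Longrightarrow> a \<in> norm_rep c \<Longrightarrow> hull_rep c K \<Longrightarrow> hull_rep c (conjg a K)"
  unfolding hull_rep_def using hull_cj[OF subgroup_carrier nz_cl] cj_subgroup nz_cl nz_iff by metis

lemma vs_between:
  assumes "c \<in> SubO_classes" "hull_rep c K" "K \<subseteq> L" "L \<subseteq> rep c" "subgroup L G" shows "hull_rep c L"
proof -
  have Lc: "L \<subseteq> carrier G" using assms(5) by (rule subgroup_carrier)
  have "rep c \<subseteq> hullO L" using hull_mono[OF assms(3) Lc] vs_hO[OF assms(2)] by simp
  then have "hullO L = rep c" by (rule hull_eqI[OF assms(4) rep_SO[OF assms(1)]])
  then show ?thesis using assms(5) by (simp add: hull_rep_def)
qed

lemma idx_act: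
  assumes "finite_gset G S" "(c, s) \<in> index S" "a \<in> norm_rep c" shows "(c, act S a s) \<in> index S"
  using idxD[OF assms(2)] vs_cj assms ks_act[OF assms(1)] act_closed[OF assms(1)] nz_cl by (simp add: index_def)

lemma ks_hom:
  assumes "finite_gset G S" "f \<in> gset_hom G S T" "s \<in> pts S"
  shows "cut_stab c S s \<subseteq> cut_stab c T (f s)"
  using stab_hom[OF assms] by (auto simp: cut_stab_def)

text \<open>An equivariant map can only enlarge the subgroup that is cut out, and this subgroup
  stays inside \<open>rep c\<close>; by monotonicity its hull remains \<open>rep c\<close>.\<close>

lemma idx_hom:
  assumes S: "finite_gset G S" and T: "finite_gset G T" and f: "f \<in> gset_hom G S T" and s: "(c, s) \<in> index S"
  shows "(c, f s) \<in> index T"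
proof -
  note i = idxD[OF s]
  have ft: "f s \<in> pts T" using f i(2) by (rule gset_homD)
  have "hull_rep c (cut_stab c T (f s))"
    by (rule vs_between[OF i(1,3) ks_hom[OF S f i(2)] _ ks_subgroup[OF T ft i(1)]]) (simp add: cut_stab_def)
  then show ?thesis using i(1) ft by (simp add: index_def)
qed

text \<open>Stabilizers only grow along \<open>rleg w\<close>, so the equation says that
  \<open>cut_stab c T t\<close> fixes \<open>u\<close>: these are the fixed points of that subgroup
  in the fibre over \<open>t\<close>.\<close>

definition fixed_fibre :: "'a set set \<Rightarrow> ('a, 'u, 't) gspan \<Rightarrow> ('a, 't) gset \<Rightarrow> 't \<Rightarrow> 'u set" where
  "fixed_fibre c w T t = {u \<in> pts (apex w). rleg w u = t \<and> cut_stab c (apex w) u = cut_stab c T t}"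

lemma wset_finite: "w \<in> spans G TS S T \<Longrightarrow> finite (fixed_fibre c w T t)"
  unfolding fixed_fibre_def by (rule finite_subset[OF _ gset_finite[OF spansD(1)]]) auto

lemma wset_D:
  assumes S: "finite_gset G S" and w: "w \<in> spans G TS S T" and t: "(c, t) \<in> index T" and u: "u \<in> fixed_fibre c w T t"
  shows "u \<in> pts (apex w)" "rleg w u = t" "(c, u) \<in> index (apex w)" "(c, lleg w u) \<in> index S" "cut_stab c T t \<subseteq> cut_stab c S (lleg w u)"
proof -
  show 1: "u \<in> pts (apex w)" "rleg w u = t" and 2: "(c, u) \<in> index (apex w)" using u idxD[OF t] by (auto simp: fixed_fibre_def index_def)
  show "(c, lleg w u) \<in> index S" by (rule idx_hom[OF spansD(1)[OF w] S spansD(2)[OF w] 2])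
  show "cut_stab c T t \<subseteq> cut_stab c S (lleg w u)" using ks_hom[OF spansD(1)[OF w] spansD(2)[OF w] 1(1), of c] u by (simp add: fixed_fibre_def)
qed

text \<open>This is where disk-likeness enters: the map to the target is in \<open>Fin_O\<close>, so the stabilizer of \<open>u\<close>
  is cut out of that of its image by an element of \<open>Sub_O\<close>, which contains \<open>rep c\<close>.\<close>

lemma wset_idx:
  assumes w: "w \<in> spans G TS S T" and u: "(c, u) \<in> index (apex w)"
  shows "u \<in> fixed_fibre c w T (rleg w u)"
proof -
  note i = idxD[OF u] and W = spansD[OF w]
  obtain A where A: "A \<in> SubO" "stab (apex w) u = stab T (rleg w u) \<inter> A" using O_D[OF W(4)[OF i(2)]] by blast
  have "cut_stab c (apex w) u \<subseteq> A" using A by (auto simp: cut_stab_def)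
  then have "rep c \<subseteq> A" using hO_facts(3)[OF subgroup_carrier[OF vs_subgroup[OF i(3)]] A(1)] vs_hO[OF i(3)] by simp
  then show ?thesis using A i by (auto simp: fixed_fibre_def cut_stab_def)
qed

section \<open>Compatible families and the action of spans on them\<close>

context
  fixes X :: "'a set set \<Rightarrow> ('a, 'v) coeff_system"
  assumes X: "X \<in> Ob coeffs"
begin

text \<open>Compatibility with conjugation by all of \<open>G\<close> has become equivariance under
  the normalizer, because only subgroups whose hull is the chosen representative are
  recorded.\<close>

definition family :: "('a, 't) gset \<Rightarrow> ('a set set \<times> 't \<Rightarrow> 'v) set" where
  "family S = {x \<in> \<Pi>\<^sub>E p\<in>index S. carrier (coeff_mod X (fst p) (cut_stab (fst p) S (snd p))).
     \<forall>c s a. (c, s) \<in> index S \<longrightarrow> a \<in> norm_rep c \<longrightarrow>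
       x (c, act S a s) = coeff_res X c (cut_stab c S (act S a s)) (cut_stab c S s) a (x (c, s))}"

definition family_mod :: "('a, 't) gset \<Rightarrow> (rat, 'a set set \<times> 't \<Rightarrow> 'v) module" where
  "family_mod S = (pi_mod (index S) (\<lambda>p. coeff_mod X (fst p) (cut_stab (fst p) S (snd p))))\<lparr>carrier := family S\<rparr>"

text \<open>The sum over fixed points is unweighted; weights appear only in the comparison map
  \<open>assemble\<close>. The element \<open>\<one>\<close> indicates that the subgroups involved
  are nested, so no conjugation takes place.\<close>

definition span_act :: "('a, 't) gset \<Rightarrow> ('a, 't) gset \<Rightarrow> ('a, 'u, 't) gspan \<Rightarrow> ('a set set \<times> 't \<Rightarrow> 'v) \<Rightarrow> 'a set set \<times> 't \<Rightarrow> 'v" where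
  "span_act S T w x = (\<lambda>p\<in>index T. finsum (coeff_mod X (fst p) (cut_stab (fst p) T (snd p)))
     (\<lambda>u. coeff_res X (fst p) (cut_stab (fst p) T (snd p)) (cut_stab (fst p) S (lleg w u)) \<one> (x (fst p, lleg w u)))
     (fixed_fibre (fst p) w T (snd p)))"

lemma xo_idx: "(c, s) \<in> index S \<Longrightarrow> rat_module (coeff_mod X c (cut_stab c S s))"
  using xo_mod[OF X idxD(1,3)] .

lemma famD:
  assumes "x \<in> family S"
  shows "(c, s) \<in> index S \<Longrightarrow> x (c, s) \<in> carrier (coeff_mod X c (cut_stab c S s))"
    "(c, s) \<in> index S \<Longrightarrow> a \<in> norm_rep c \<Longrightarrow> x (c, act S a s) = coeff_res X c (cut_stab c S (act S a s)) (cut_stab c S s) a (x (c, s))"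
    "x \<in> extensional (index S)"
  using assms by (auto simp: family_def PiE_iff)

lemma famI:
  assumes "x \<in> extensional (index S)" "\<And>c s. (c, s) \<in> index S \<Longrightarrow> x (c, s) \<in> carrier (coeff_mod X c (cut_stab c S s))"
    "\<And>c s a. (c, s) \<in> index S \<Longrightarrow> a \<in> norm_rep c \<Longrightarrow> x (c, act S a s) = coeff_res X c (cut_stab c S (act S a s)) (cut_stab c S s) a (x (c, s))"
  shows "x \<in> family S"
  using assms by (auto simp: family_def PiE_iff)

lemma xm_idx:
  assumes S: "finite_gset G S" and s: "(c, s) \<in> index S" "a \<in> norm_rep c"
  shows "lin (coeff_mod X c (cut_stab c S s)) (coeff_mod X c (cut_stab c S (act S a s))) (coeff_res X c (cut_stab c S (act S a s)) (cut_stab c S s) a)"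
  by (rule xm_lin[OF X]) (use idxD[OF s(1)] idxD[OF idx_act[OF S s]] s ks_act[OF S] in auto)

lemma fmod_simps [simp]:
  "carrier (family_mod S) = family S"
  "x \<oplus>\<^bsub>family_mod S\<^esub> y = (\<lambda>p\<in>index S. x p \<oplus>\<^bsub>coeff_mod X (fst p) (cut_stab (fst p) S (snd p))\<^esub> y p)"
  "r \<odot>\<^bsub>family_mod S\<^esub> x = (\<lambda>p\<in>index S. r \<odot>\<^bsub>coeff_mod X (fst p) (cut_stab (fst p) S (snd p))\<^esub> x p)"
  "\<zero>\<^bsub>family_mod S\<^esub> = (\<lambda>p\<in>index S. \<zero>\<^bsub>coeff_mod X (fst p) (cut_stab (fst p) S (snd p))\<^esub>)"
  by (simp_all add: family_mod_def pi_mod_def)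

lemma fmod_mod:
  assumes S: "finite_gset G S" shows "rat_module (family_mod S)"
  unfolding family_mod_def
proof (rule rat_submodule)
  let ?V = "\<lambda>p. coeff_mod X (fst p) (cut_stab (fst p) S (snd p))"
  have V: "rat_module (?V p)" if "p \<in> index S" for p using that xo_idx[of "fst p" "snd p"] by simp
  show "rat_module (pi_mod (index S) ?V)" by (rule rat_module_pi_mod[OF V])
  show "family S \<subseteq> carrier (pi_mod (index S) ?V)" by (auto simp: family_def)
  note f = rat_module.add_facts[OF xo_idx] rat_module.smult_closed'[OF xo_idx]
  note l = xm_idx[OF S] and i = idx_act[OF S]
  show "\<zero>\<^bsub>pi_mod (index S) ?V\<^esub> \<in> family S"
  proof (rule famI)
    fix c s a assume s: "(c, s) \<in> index S" "a \<in> norm_rep c"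
    show "\<zero>\<^bsub>pi_mod (index S) ?V\<^esub> (c, act S a s) = coeff_res X c (cut_stab c S (act S a s)) (cut_stab c S s) a (\<zero>\<^bsub>pi_mod (index S) ?V\<^esub> (c, s))"
      using lin_zero[OF xo_idx[OF s(1)] xo_idx[OF i[OF s]] l[OF s]] s i[OF s] by simp
  qed (use f in auto)
  show "x \<oplus>\<^bsub>pi_mod (index S) ?V\<^esub> y \<in> family S" if "x \<in> family S" "y \<in> family S" for x y
  proof (rule famI)
    fix c s a assume s: "(c, s) \<in> index S" "a \<in> norm_rep c"
    show "(x \<oplus>\<^bsub>pi_mod (index S) ?V\<^esub> y) (c, act S a s) = coeff_res X c (cut_stab c S (act S a s)) (cut_stab c S s) a ((x \<oplus>\<^bsub>pi_mod (index S) ?V\<^esub> y) (c, s))"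
      using famD(1,2)[OF that(1) s(1)] famD(1,2)[OF that(2) s(1)] l[OF s] s i[OF s] by simp
  qed (use f(2)[OF _ famD(1)[OF that(1)] famD(1)[OF that(2)]] in auto)
  show "r \<odot>\<^bsub>pi_mod (index S) ?V\<^esub> x \<in> family S" if "x \<in> family S" for x r
  proof (rule famI)
    fix c s a assume s: "(c, s) \<in> index S" "a \<in> norm_rep c"
    show "(r \<odot>\<^bsub>pi_mod (index S) ?V\<^esub> x) (c, act S a s) = coeff_res X c (cut_stab c S (act S a s)) (cut_stab c S s) a ((r \<odot>\<^bsub>pi_mod (index S) ?V\<^esub> x) (c, s))"
      using famD(1,2)[OF that(1) s(1)] l[OF s] s i[OF s] by simp
  qed (use f(7)[OF _ famD(1)[OF that]] in auto)
qed

lemma xm_res: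
  assumes S: "finite_gset G S" and w: "w \<in> spans G TS S T" and t: "(c, t) \<in> index T" and u: "u \<in> fixed_fibre c w T t"
  shows "lin (coeff_mod X c (cut_stab c S (lleg w u))) (coeff_mod X c (cut_stab c T t)) (coeff_res X c (cut_stab c T t) (cut_stab c S (lleg w u)) \<one>)"
  by (rule xm_lin[OF X])
    (use idxD[OF t] wset_D[OF S w t u] idxD[OF wset_D(4)[OF S w t u]] nz_one cj_one[OF subgroup_carrier[OF vs_subgroup]] in auto)

lemma wact_term:
  assumes S: "finite_gset G S" and w: "w \<in> spans G TS S T" and t: "(c, t) \<in> index T" and u: "u \<in> fixed_fibre c w T t" and x: "x \<in> family S"
  shows "coeff_res X c (cut_stab c T t) (cut_stab c S (lleg w u)) \<one> (x (c, lleg w u)) \<in> carrier (coeff_mod X c (cut_stab c T t))"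
  using xm_res[OF S w t u] famD(1)[OF x wset_D(4)[OF S w t u]] by blast

lemma wact_apply:
  "(c, t) \<in> index T \<Longrightarrow> span_act S T w x (c, t) = finsum (coeff_mod X c (cut_stab c T t))
     (\<lambda>u. coeff_res X c (cut_stab c T t) (cut_stab c S (lleg w u)) \<one> (x (c, lleg w u))) (fixed_fibre c w T t)"
  by (simp add: span_act_def)

lemma xm_one_comp:
  assumes c: "c \<in> SubO_classes" and K: "hull_rep c K" "hull_rep c K'" "hull_rep c K''" and s: "K \<subseteq> K'" "K' \<subseteq> K''" and x: "x \<in> carrier (coeff_mod X c K'')"
  shows "coeff_res X c K K' \<one> (coeff_res X c K' K'' \<one> x) = coeff_res X c K K'' \<one> x"
  using xm_comp[OF X c K nz_one[OF c] _ nz_one[OF c] _ x] s cj_one subgroup_carrier vs_subgroup K by simp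

text \<open>An element \<open>a\<close> of the normalizer maps the fixed points over
  \<open>t\<close> bijectively onto those over the translate of \<open>t\<close>. Corresponding
  terms agree since restricting after translating and translating after restricting are both the map
  with element \<open>a\<close>.\<close>

lemma wact_fam:
  assumes S: "finite_gset G S" and T: "finite_gset G T" and w: "w \<in> spans G TS S T" and x: "x \<in> family S"
  shows "span_act S T w x \<in> family T"
proof (rule famI)
  show "span_act S T w x \<in> extensional (index T)" by (simp add: span_act_def)
  fix c t assume t: "(c, t) \<in> index T"
  interpret V: rat_module "coeff_mod X c (cut_stab c T t)" by (rule xo_idx[OF t])
  show "span_act S T w x (c, t) \<in> carrier (coeff_mod X c (cut_stab c T t))"
    unfolding wact_apply[OF t] by (rule V.M.finsum_closed, rule funcsetI) (rule wact_term[OF S w t _ x])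
  fix a assume a: "a \<in> norm_rep c"
  note c = idxD(1)[OF t] and W = spansD[OF w]
  note ac = nz_cl[OF c a] and at = idx_act[OF T t a]
  interpret V': rat_module "coeff_mod X c (cut_stab c T (act T a t))" by (rule xo_idx[OF at])
  have wb: "act (apex w) b u \<in> fixed_fibre c w T (act T b t')"
    if "b \<in> norm_rep c" "u \<in> fixed_fibre c w T t'" "t' \<in> pts T" for b u t'
    using that act_closed[OF W(1) nz_cl[OF c that(1)]] ks_act[OF W(1) _ c that(1)] ks_act[OF T _ c that(1)] gset_homD(2)[OF W(3) nz_cl[OF c that(1)]]
    by (auto simp: fixed_fibre_def)
  have bij: "bij_betw (act (apex w) a) (fixed_fibre c w T t) (fixed_fibre c w T (act T a t))"
  proof (rule bij_betwI[of _ _ _ "act (apex w) (inv a)"])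
    show "act (apex w) (inv a) \<in> fixed_fibre c w T (act T a t) \<rightarrow> fixed_fibre c w T t"
      using wb[OF nz_inv[OF c a], of _ "act T a t"] act_closed[OF T ac] idxD(2)[OF t] act_inv(1)[OF T ac] by auto
  qed (use wb[OF a _ idxD(2)[OF t]] act_inv[OF W(1) ac] in \<open>auto simp: fixed_fibre_def\<close>)
  have tm: "coeff_res X c (cut_stab c T (act T a t)) (cut_stab c S (lleg w (act (apex w) a u))) \<one> (x (c, lleg w (act (apex w) a u)))
     = coeff_res X c (cut_stab c T (act T a t)) (cut_stab c T t) a (coeff_res X c (cut_stab c T t) (cut_stab c S (lleg w u)) \<one> (x (c, lleg w u)))" if u: "u \<in> fixed_fibre c w T t" for u
  proof -
    note D = wset_D[OF S w t u] and D' = wset_D[OF S w at wb[OF a u idxD(2)[OF t]]]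
    have l: "lleg w (act (apex w) a u) = act S a (lleg w u)" by (rule gset_homD(2)[OF W(2) ac D(1)])
    have v: "hull_rep c (cut_stab c T (act T a t))" "hull_rep c (cut_stab c T t)" "hull_rep c (cut_stab c S (act S a (lleg w u)))" "hull_rep c (cut_stab c S (lleg w u))"
      using idxD(3)[OF at] idxD(3)[OF t] idxD(3)[OF D(4)] idxD(3)[OF D'(4)] l by simp_all
    have g: "\<And>K. hull_rep c K \<Longrightarrow> K \<subseteq> carrier G" using subgroup_carrier vs_subgroup by blast
    have xu: "x (c, lleg w u) \<in> carrier (coeff_mod X c (cut_stab c S (lleg w u)))" by (rule famD(1)[OF x D(4)])
    have "coeff_res X c (cut_stab c T (act T a t)) (cut_stab c S (act S a (lleg w u))) \<one> (coeff_res X c (cut_stab c S (act S a (lleg w u))) (cut_stab c S (lleg w u)) a (x (c, lleg w u)))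
      = coeff_res X c (cut_stab c T (act T a t)) (cut_stab c S (lleg w u)) (\<one> \<otimes> a) (x (c, lleg w u))"
      by (rule xm_comp[OF X c v(1,3,4) nz_one[OF c] _ a _ xu])
        (use D'(5) cj_one[OF g[OF v(3)]] ks_act[OF S idxD(2)[OF D(4)] c a] l in simp_all)
    also have "\<dots> = coeff_res X c (cut_stab c T (act T a t)) (cut_stab c S (lleg w u)) (a \<otimes> \<one>) (x (c, lleg w u))" using ac by simp
    also have "\<dots> = coeff_res X c (cut_stab c T (act T a t)) (cut_stab c T t) a (coeff_res X c (cut_stab c T t) (cut_stab c S (lleg w u)) \<one> (x (c, lleg w u)))"
      by (rule xm_comp[OF X c v(1,2,4) a _ nz_one[OF c] _ xu, symmetric])
        (use D(5) cj_one[OF g[OF v(4)]] ks_act[OF T idxD(2)[OF t] c a] in simp_all)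
    finally show ?thesis unfolding l famD(2)[OF x D(4) a] .
  qed
  have "span_act S T w x (c, act T a t) = finsum (coeff_mod X c (cut_stab c T (act T a t)))
     (\<lambda>u. coeff_res X c (cut_stab c T (act T a t)) (cut_stab c S (lleg w (act (apex w) a u))) \<one> (x (c, lleg w (act (apex w) a u)))) (fixed_fibre c w T t)"
    unfolding wact_apply[OF at] by (rule V'.finsum_reindex_bij[OF bij, symmetric]) (rule wact_term[OF S w at _ x])
  also have "\<dots> = finsum (coeff_mod X c (cut_stab c T (act T a t)))
     (\<lambda>u. coeff_res X c (cut_stab c T (act T a t)) (cut_stab c T t) a (coeff_res X c (cut_stab c T t) (cut_stab c S (lleg w u)) \<one> (x (c, lleg w u)))) (fixed_fibre c w T t)"
    by (rule V'.M.finsum_cong') (use tm wact_term[OF S w t _ x] xm_idx[OF T t a] in auto)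
  also have "\<dots> = coeff_res X c (cut_stab c T (act T a t)) (cut_stab c T t) a (span_act S T w x (c, t))"
    unfolding wact_apply[OF t]
    by (rule lin_finsum[OF V.rat_module_axioms V'.rat_module_axioms xm_idx[OF T t a], symmetric]) (rule wact_term[OF S w t _ x])
  finally show "span_act S T w x (c, act T a t) = coeff_res X c (cut_stab c T (act T a t)) (cut_stab c T t) a (span_act S T w x (c, t))" .
qed

lemma wact_lin:
  assumes S: "finite_gset G S" and T: "finite_gset G T" and w: "w \<in> spans G TS S T"
  shows "lin (family_mod S) (family_mod T) (span_act S T w)"
proof (intro conjI ballI allI)
  show "span_act S T w x \<in> carrier (family_mod T)" if "x \<in> carrier (family_mod S)" for x using wact_fam[OF S T w] that by simp
  fix x assume x: "x \<in> carrier (family_mod S)"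
  then have xf: "x \<in> family S" by simp
  show "span_act S T w (r \<odot>\<^bsub>family_mod S\<^esub> x) = r \<odot>\<^bsub>family_mod T\<^esub> span_act S T w x" for r
  proof (rule extensionalityI[of _ "index T"])
    fix p assume p: "p \<in> index T"
    then obtain c t where t: "p = (c, t)" "(c, t) \<in> index T" by (cases p) auto
    interpret V: rat_module "coeff_mod X c (cut_stab c T t)" by (rule xo_idx[OF t(2)])
    have "span_act S T w (r \<odot>\<^bsub>family_mod S\<^esub> x) (c, t) = finsum (coeff_mod X c (cut_stab c T t))
     (\<lambda>u. r \<odot>\<^bsub>coeff_mod X c (cut_stab c T t)\<^esub> coeff_res X c (cut_stab c T t) (cut_stab c S (lleg w u)) \<one> (x (c, lleg w u))) (fixed_fibre c w T t)"
      unfolding wact_apply[OF t(2)]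
      by (rule V.M.finsum_cong') (use xm_res[OF S w t(2)] wset_D(4)[OF S w t(2)] famD(1)[OF xf] in auto)
    also have "\<dots> = r \<odot>\<^bsub>coeff_mod X c (cut_stab c T t)\<^esub> span_act S T w x (c, t)"
      unfolding wact_apply[OF t(2)] by (rule V.smult_finsum[symmetric]) (rule wact_term[OF S w t(2) _ xf])
    finally show "span_act S T w (r \<odot>\<^bsub>family_mod S\<^esub> x) p = (r \<odot>\<^bsub>family_mod T\<^esub> span_act S T w x) p" using t by simp
  qed (simp_all add: span_act_def)
  fix y assume y: "y \<in> carrier (family_mod S)"
  then have yf: "y \<in> family S" by simp
  show "span_act S T w (x \<oplus>\<^bsub>family_mod S\<^esub> y) = span_act S T w x \<oplus>\<^bsub>family_mod T\<^esub> span_act S T w y"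
  proof (rule extensionalityI[of _ "index T"])
    fix p assume p: "p \<in> index T"
    then obtain c t where t: "p = (c, t)" "(c, t) \<in> index T" by (cases p) auto
    interpret V: rat_module "coeff_mod X c (cut_stab c T t)" by (rule xo_idx[OF t(2)])
    have "span_act S T w (x \<oplus>\<^bsub>family_mod S\<^esub> y) (c, t) = finsum (coeff_mod X c (cut_stab c T t))
     (\<lambda>u. coeff_res X c (cut_stab c T t) (cut_stab c S (lleg w u)) \<one> (x (c, lleg w u)) \<oplus>\<^bsub>coeff_mod X c (cut_stab c T t)\<^esub>
        coeff_res X c (cut_stab c T t) (cut_stab c S (lleg w u)) \<one> (y (c, lleg w u))) (fixed_fibre c w T t)"
      unfolding wact_apply[OF t(2)]
      by (rule V.M.finsum_cong') (use xm_res[OF S w t(2)] wset_D(4)[OF S w t(2)] famD(1)[OF xf] famD(1)[OF yf] in auto)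
    also have "\<dots> = span_act S T w x (c, t) \<oplus>\<^bsub>coeff_mod X c (cut_stab c T t)\<^esub> span_act S T w y (c, t)"
      unfolding wact_apply[OF t(2)] by (rule V.M.finsum_addf; rule funcsetI) (rule wact_term[OF S w t(2) _ xf] wact_term[OF S w t(2) _ yf], assumption)+
    finally show "span_act S T w (x \<oplus>\<^bsub>family_mod S\<^esub> y) p = (span_act S T w x \<oplus>\<^bsub>family_mod T\<^esub> span_act S T w y) p" using t by simp
  qed (simp_all add: span_act_def)
qed

lemma wact_iso:
  assumes S: "finite_gset G S" and iso: "span_iso G w w'" and w: "w \<in> spans G TS S T" "w' \<in> spans G TS S T" and x: "x \<in> family S"
  shows "span_act S T w x = span_act S T w' x"
proof (rule extensionalityI[of _ "index T"])
  obtain f where f: "f \<in> gset_hom G (apex w) (apex w')" "bij_betw f (pts (apex w)) (pts (apex w'))"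
    "\<And>x. x \<in> pts (apex w) \<Longrightarrow> lleg w' (f x) = lleg w x" "\<And>x. x \<in> pts (apex w) \<Longrightarrow> rleg w' (f x) = rleg w x"
    using iso unfolding span_iso_def by blast
  have st: "stab (apex w') (f u) = stab (apex w) u" if "u \<in> pts (apex w)" for u
    using stab_hom_inj[OF spansD(1)[OF w(1)] f(1) that] f(2) by (simp add: bij_betw_def)
  fix p assume "p \<in> index T"
  then obtain c t where t: "p = (c, t)" "(c, t) \<in> index T" by (cases p) auto
  interpret V: rat_module "coeff_mod X c (cut_stab c T t)" by (rule xo_idx[OF t(2)])
  have "f ` fixed_fibre c w T t = fixed_fibre c w' T t"
  proof
    show "f ` fixed_fibre c w T t \<subseteq> fixed_fibre c w' T t" using f st by (auto simp: fixed_fibre_def cut_stab_def gset_homD)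
    show "fixed_fibre c w' T t \<subseteq> f ` fixed_fibre c w T t"
    proof
      fix v assume v: "v \<in> fixed_fibre c w' T t"
      then have "v \<in> f ` pts (apex w)" using f(2) by (simp add: fixed_fibre_def bij_betw_def)
      then obtain u where "u \<in> pts (apex w)" "v = f u" by blast
      then show "v \<in> f ` fixed_fibre c w T t" using v st f by (auto simp: fixed_fibre_def cut_stab_def)
    qed
  qed
  moreover have "inj_on f (fixed_fibre c w T t)" using f(2) by (auto simp: bij_betw_def fixed_fibre_def inj_on_def)
  ultimately have bij: "bij_betw f (fixed_fibre c w T t) (fixed_fibre c w' T t)" by (simp add: bij_betw_def)
  have "span_act S T w' x (c, t) = finsum (coeff_mod X c (cut_stab c T t))
     (\<lambda>u. coeff_res X c (cut_stab c T t) (cut_stab c S (lleg w' (f u))) \<one> (x (c, lleg w' (f u)))) (fixed_fibre c w T t)"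
    unfolding wact_apply[OF t(2)] by (rule V.finsum_reindex_bij[OF bij, symmetric]) (rule wact_term[OF S w(2) t(2) _ x])
  also have "\<dots> = span_act S T w x (c, t)"
    unfolding wact_apply[OF t(2)]
    by (rule V.M.finsum_cong') (use wact_term[OF S w(1) t(2) _ x] f(3) in \<open>auto simp: fixed_fibre_def\<close>)
  finally show "span_act S T w x p = span_act S T w' x p" using t by simp
qed (simp_all add: span_act_def)

lemma wact_id:
  assumes S: "finite_gset G S" and x: "x \<in> family S"
  shows "span_act S S (id_span S) x = x"
proof (rule extensionalityI[of _ "index S"])
  fix p assume "p \<in> index S"
  then obtain c t where t: "p = (c, t)" "(c, t) \<in> index S" by (cases p) auto
  interpret V: rat_module "coeff_mod X c (cut_stab c S t)" by (rule xo_idx[OF t(2)])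
  note i = idxD[OF t(2)]
  have 1: "\<one> \<in> cut_stab c S t" by (rule subgroup.one_closed[OF ks_subgroup[OF S i(2,1)]])
  have "fixed_fibre c (id_span S) S t = {t}" using i by (auto simp: fixed_fibre_def id_span_def)
  then show "span_act S S (id_span S) x p = x p"
    unfolding t(1) wact_apply[OF t(2)]
    using xm_id[OF X i(1,3) 1 famD(1)[OF x t(2)]] famD(1)[OF x t(2)] i(2)
    by (simp add: id_span_def V.M.finsum_insert)
qed (use famD(3)[OF x] in \<open>simp_all add: span_act_def\<close>)

text \<open>A subgroup fixes a point \<open>(y, z)\<close> of the pullback exactly if it fixes
  \<open>y\<close> and \<open>z\<close>, so both sides sum over the same pairs. What needs an
  argument is that \<open>y\<close> is fixed by the possibly larger subgroup cut out at
  \<open>lleg v z\<close>.\<close>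

lemma wact_comp:
  assumes R: "finite_gset G R" and S: "finite_gset G S" and T: "finite_gset G T"
    and u: "u \<in> spans G TS R S" and v: "v \<in> spans G TS S T" and x: "x \<in> family R"
  shows "span_act R T (span_comp G u v) x = span_act S T v (span_act R S u x)"
proof (rule extensionalityI[of _ "index T"])
  let ?w = "span_comp G u v"
  have w: "?w \<in> spans G TS R T" by (rule span_comp_spans[OF u v])
  fix p assume "p \<in> index T"
  then obtain c t where t: "p = (c, t)" "(c, t) \<in> index T" by (cases p) auto
  interpret V: rat_module "coeff_mod X c (cut_stab c T t)" by (rule xo_idx[OF t(2)])
  note i = idxD[OF t(2)]
  let ?f = "\<lambda>z y. coeff_res X c (cut_stab c T t) (cut_stab c R (lleg u y)) \<one> (x (c, lleg u y))"
  have zt: "coeff_res X c (cut_stab c T t) (cut_stab c S (lleg v z)) \<one> (span_act R S u x (c, lleg v z)) =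
      finsum (coeff_mod X c (cut_stab c T t)) (?f z) (fixed_fibre c u S (lleg v z))" and
     yt: "\<And>y. y \<in> fixed_fibre c u S (lleg v z) \<Longrightarrow> ?f z y \<in> carrier (coeff_mod X c (cut_stab c T t))" if z: "z \<in> fixed_fibre c v T t" for z
  proof -
    note Z = wset_D[OF S v t(2) z]
    interpret W: rat_module "coeff_mod X c (cut_stab c S (lleg v z))" by (rule xo_idx[OF Z(4)])
    have tm: "coeff_res X c (cut_stab c T t) (cut_stab c S (lleg v z)) \<one> (coeff_res X c (cut_stab c S (lleg v z)) (cut_stab c R (lleg u y)) \<one> (x (c, lleg u y))) = ?f z y"
      if y: "y \<in> fixed_fibre c u S (lleg v z)" for y
      by (rule xm_one_comp[OF i(1,3) idxD(3)[OF Z(4)] idxD(3)[OF wset_D(4)[OF R u Z(4) y]] Z(5) wset_D(5)[OF R u Z(4) y] famD(1)[OF x wset_D(4)[OF R u Z(4) y]]])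
    show yt: "?f z y \<in> carrier (coeff_mod X c (cut_stab c T t))" if y: "y \<in> fixed_fibre c u S (lleg v z)" for y
      using xm_res[OF S v t(2) z] wact_term[OF R u Z(4) y x] tm[OF y] by auto
    have "coeff_res X c (cut_stab c T t) (cut_stab c S (lleg v z)) \<one> (span_act R S u x (c, lleg v z)) = finsum (coeff_mod X c (cut_stab c T t))
       (\<lambda>y. coeff_res X c (cut_stab c T t) (cut_stab c S (lleg v z)) \<one> (coeff_res X c (cut_stab c S (lleg v z)) (cut_stab c R (lleg u y)) \<one> (x (c, lleg u y)))) (fixed_fibre c u S (lleg v z))"
      unfolding wact_apply[OF Z(4)]
      by (rule lin_finsum[OF W.rat_module_axioms V.rat_module_axioms xm_res[OF S v t(2) z]]) (rule wact_term[OF R u Z(4) _ x])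
    also have "\<dots> = finsum (coeff_mod X c (cut_stab c T t)) (?f z) (fixed_fibre c u S (lleg v z))"
      by (rule V.M.finsum_cong') (use tm yt in auto)
    finally show "coeff_res X c (cut_stab c T t) (cut_stab c S (lleg v z)) \<one> (span_act R S u x (c, lleg v z)) =
      finsum (coeff_mod X c (cut_stab c T t)) (?f z) (fixed_fibre c u S (lleg v z))" .
  qed
  have "span_act S T v (span_act R S u x) (c, t) = finsum (coeff_mod X c (cut_stab c T t)) (\<lambda>z. finsum (coeff_mod X c (cut_stab c T t)) (?f z) (fixed_fibre c u S (lleg v z))) (fixed_fibre c v T t)"
    unfolding wact_apply[OF t(2)]
    by (rule V.M.finsum_cong') (use zt yt in \<open>auto intro!: V.M.finsum_closed\<close>)
  also have "\<dots> = finsum (coeff_mod X c (cut_stab c T t)) (\<lambda>q. ?f (snd q) (fst q)) (fixed_fibre c ?w T t)"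
  proof (rule V.finsum_Sigma_reindex[where k = "\<lambda>z y. (y, z)"])
    show "finite (fixed_fibre c v T t)" by (rule wset_finite[OF v])
    show "finite (fixed_fibre c u S (lleg v z))" for z by (rule wset_finite[OF u])
    show "?f z y \<in> carrier (coeff_mod X c (cut_stab c T t))" if "z \<in> fixed_fibre c v T t" "y \<in> fixed_fibre c u S (lleg v z)" for z y
      by (rule yt[OF that])
    have kw: "cut_stab c (apex ?w) (y, z) = cut_stab c (apex u) y \<inter> cut_stab c (apex v) z" if "y \<in> pts (apex u)" "z \<in> pts (apex v)" "rleg u y = lleg v z" for y z
      using fibre_product_stab[OF that(1,2), of "rleg u" "lleg v"] that(3) by (auto simp: cut_stab_def span_comp_simps)
    have mw: "(y, z) \<in> fixed_fibre c ?w T t \<longleftrightarrow> y \<in> pts (apex u) \<and> z \<in> pts (apex v) \<and> rleg u y = lleg v z \<and> rleg v z = t \<and> cut_stab c (apex u) y \<inter> cut_stab c (apex v) z = cut_stab c T t" for y z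
      using kw[of y z] unfolding fixed_fibre_def by (auto simp: span_comp_simps fibre_product_simps)
    show "(y, z) \<in> fixed_fibre c ?w T t \<and> snd (y, z) = z \<and> fst (y, z) = y" if z: "z \<in> fixed_fibre c v T t" and y: "y \<in> fixed_fibre c u S (lleg v z)" for z y
      using wset_D[OF S v t(2) z] y z unfolding mw by (auto simp: fixed_fibre_def)
    fix q assume q: "q \<in> fixed_fibre c ?w T t"
    obtain y z where yz: "q = (y, z)" by (cases q)
    have m: "y \<in> pts (apex u)" "z \<in> pts (apex v)" "rleg u y = lleg v z" "rleg v z = t" "cut_stab c (apex u) y \<inter> cut_stab c (apex v) z = cut_stab c T t"
      using q unfolding yz mw by auto
    note U' = spansD[OF u] and V' = spansD[OF v]
    have "cut_stab c (apex v) z \<subseteq> cut_stab c T t" using ks_hom[OF V'(1,3) m(2), of c] m(4) by simp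
    then have kz: "cut_stab c (apex v) z = cut_stab c T t" and ky: "cut_stab c T t \<subseteq> cut_stab c (apex u) y" using m(5) by auto
    \<comment> \<open>So far only \<open>cut_stab c T t\<close> is known to fix \<open>y\<close>.
      This suffices for the subgroup cut out at \<open>y\<close> to have hull \<open>rep c\<close>,
      and then \<open>wset_idx\<close> shows that all of \<open>cut_stab c S (lleg v z)\<close>
      fixes \<open>y\<close>.\<close>
    have "hull_rep c (cut_stab c (apex u) y)"
      by (rule vs_between[OF i(1,3) ky _ ks_subgroup[OF U'(1) m(1) i(1)]]) (simp add: cut_stab_def)
    then have "(c, y) \<in> index (apex u)" using i(1) m(1) by (simp add: index_def)
    from wset_idx[OF u this] have "y \<in> fixed_fibre c u S (lleg v z)" unfolding m(3) .
    moreover have "z \<in> fixed_fibre c v T t" using m kz by (simp add: fixed_fibre_def)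
    ultimately show "snd q \<in> fixed_fibre c v T t \<and> fst q \<in> fixed_fibre c u S (lleg v (snd q)) \<and> (fst q, snd q) = q" using yz by simp
  qed
  also have "\<dots> = span_act R T ?w x (c, t)"
    unfolding wact_apply[OF t(2)]
  proof (rule V.M.finsum_cong'[OF refl])
    fix q assume q: "q \<in> fixed_fibre c ?w T t"
    have l: "lleg ?w q = lleg u (fst q)" using q by (auto simp: fixed_fibre_def span_comp_simps fibre_product_simps)
    show "?f (snd q) (fst q) = coeff_res X c (cut_stab c T t) (cut_stab c R (lleg ?w q)) \<one> (x (c, lleg ?w q))" using l by simp
  qed (use wact_term[OF R w t(2) _ x] in auto)
  finally show "span_act R T (span_comp G u v) x p = span_act S T v (span_act R S u x) p" using t by simp
qed (simp_all add: span_act_def)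

end

section \<open>Copies of the spaces of families, functoriality and preservation of products\<close>

definition family_embed :: "('a set set \<Rightarrow> ('a, 'v) coeff_system) \<Rightarrow> ('a, 's) gset \<Rightarrow> ('a set set \<times> 's \<Rightarrow> 'v) \<Rightarrow> 'v" where
  "family_embed X S = (SOME \<iota>. inj_on \<iota> (family X S))"

text \<open>A class of spans acts through an arbitrary member, which is legitimate by
  \<open>wact_iso\<close>.\<close>

definition mackey_of :: "('a set set \<Rightarrow> ('a, 'v) coeff_system) \<Rightarrow> ('a, 's, 'v) mackey_functor" where
  "mackey_of X = \<lparr>fobj = (\<lambda>S\<in>Ob lindner. copy_mod (family_embed X S) (family_mod X S)),
     fmor = (\<lambda>S\<in>Ob lindner. \<lambda>T\<in>Ob lindner. \<lambda>\<alpha>\<in>Mor lindner S T. \<lambda>v\<in>family_embed X S ` family X S.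
       family_embed X T (span_act X S T (SOME w. w \<in> \<alpha>) (inv_into (family X S) (family_embed X S) v)))\<rparr>"

context
  fixes X :: "'a set set \<Rightarrow> ('a, 'v) coeff_system"
  assumes X: "X \<in> Ob coeffs"
begin

text \<open>\<open>family X S\<close> lies in a product of values of \<open>X\<close> over the
  finite set \<open>index S\<close>, so \<open>pi_mod_embeds\<close> supplies the injection.\<close>

lemma io_inj: assumes S: "finite_gset G S" shows "inj_on (family_embed X S) (family X S)"
  unfolding family_embed_def
proof (rule someI_ex[where P = "\<lambda>\<iota>. inj_on \<iota> (family X S)"])
  have "rat_module (coeff_mod X (fst p) (cut_stab (fst p) S (snd p)))" if "p \<in> index S" for p
    using xo_idx[OF X, of "fst p" "snd p" S] that by simp
  then obtain \<iota> :: "('a set set \<times> 's \<Rightarrow> 'v) \<Rightarrow> 'v" where "inj_on \<iota> (\<Pi>\<^sub>E p\<in>index S. carrier (coeff_mod X (fst p) (cut_stab (fst p) S (snd p))))"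
    using pi_mod_embeds[OF idx_finite[OF S], of "\<lambda>p. coeff_mod X (fst p) (cut_stab (fst p) S (snd p))"] by blast
  then show "\<exists>\<iota> :: ('a set set \<times> 's \<Rightarrow> 'v) \<Rightarrow> 'v. inj_on \<iota> (family X S)"
    by (auto intro: inj_on_subset simp: family_def[OF X])
qed

lemma mx_obj: "finite_gset G S \<Longrightarrow> fobj (mackey_of X) S = copy_mod (family_embed X S) (family_mod X S)"
  by (simp add: mackey_of_def)

lemma io_facts:
  assumes S: "finite_gset G S"
  shows "rat_module (fobj (mackey_of X) S)" "lin (family_mod X S) (fobj (mackey_of X) S) (family_embed X S)"
    "lin (fobj (mackey_of X) S) (family_mod X S) (inv_into (family X S) (family_embed X S))" "carrier (fobj (mackey_of X) S) = family_embed X S ` family X S"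
  using copy_mod[OF fmod_mod[OF X S], of "family_embed X S"] io_inj[OF S] by (simp_all add: mx_obj[OF S] fmod_simps[OF X])

lemma mx_mor:
  assumes S: "finite_gset G S" and T: "finite_gset G T" and w: "w \<in> spans G TS S T" and x: "x \<in> family X S"
  shows "fmor (mackey_of X) S T (cls S T w) (family_embed X S x) = family_embed X T (span_act X S T w x)"
proof -
  obtain w0 :: "('a, 's, 's) gspan" where w0: "w0 \<in> spans G TS S T" "span_iso G w0 w" using cp_span[OF w] by blast
  then have "w0 \<in> cls S T w" by (simp add: cls_def)
  then have "(SOME w'. w' \<in> cls S T w) \<in> cls S T w" by (rule someI[of "\<lambda>w'. w' \<in> cls S T w"])
  moreover define w1 where "w1 = (SOME w'. w' \<in> cls S T w)"
  ultimately have "w1 \<in> spans G TS S T" "span_iso G w1 w" by (simp_all add: cls_def)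
  then have "span_act X S T (SOME w'. w' \<in> cls S T w) x = span_act X S T w x"
    using wact_iso[OF X S _ _ w x] unfolding w1_def by blast
  moreover have "inv_into (family X S) (family_embed X S) (family_embed X S x) = x" by (rule inv_into_f_f[OF io_inj[OF S] x])
  ultimately show ?thesis using S T x cls_mor[OF w] by (simp add: mackey_of_def)
qed

lemma mx_functor: "is_functor lindner vect_cat (mackey_of X)"
proof -
  have E: "mackey_of X = \<lparr>fobj = (\<lambda>S\<in>Ob lindner. fobj (mackey_of X) S),
     fmor = (\<lambda>S\<in>Ob lindner. \<lambda>T\<in>Ob lindner. \<lambda>\<alpha>\<in>Mor lindner S T. fmor (mackey_of X) S T \<alpha>)\<rparr>"
    by (auto simp: mackey_of_def intro!: restrict_ext)
  show ?thesis
  proof (subst E, rule is_functor_restrictI)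
    fix S assume "S \<in> Ob lindner"
    then have S: "finite_gset G S" by simp
    show "fobj (mackey_of X) S \<in> Ob vect_cat" using io_facts(1)[OF S] by (simp add: rat_module_iff)
    show "Idn lindner S \<in> Mor lindner S S" using category.idn_mor[OF category_lind] S by (simp del: lind_simps(2))
    show "fmor (mackey_of X) S S (Idn lindner S) = Idn vect_cat (fobj (mackey_of X) S)"
    proof (rule extensionalityI[of _ "carrier (fobj (mackey_of X) S)"])
      show "fmor (mackey_of X) S S (Idn lindner S) \<in> extensional (carrier (fobj (mackey_of X) S))"
        using S io_facts(4)[OF S] cls_mor[OF id_span_spans[OF S]] unfolding idn_cls[OF S] by (simp add: mackey_of_def)
      fix v assume "v \<in> carrier (fobj (mackey_of X) S)"
      then obtain x where x: "x \<in> family X S" "v = family_embed X S x" using io_facts(4)[OF S] by blast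
      then show "fmor (mackey_of X) S S (Idn lindner S) v = Idn vect_cat (fobj (mackey_of X) S) v"
        using mx_mor[OF S S id_span_spans[OF S] x(1)] wact_id[OF X S x(1)] io_facts(4)[OF S] by (simp add: idn_cls[OF S])
    qed simp
  next
    fix S T \<alpha> assume o: "S \<in> Ob lindner" "T \<in> Ob lindner" "\<alpha> \<in> Mor lindner S T"
    then have S: "finite_gset G S" and T: "finite_gset G T" by simp_all
    obtain w :: "('a, 's, 's) gspan" where w: "w \<in> spans G TS S T" "\<alpha> = cls S T w" using mor_cls[OF o(3)] by blast
    show "fmor (mackey_of X) S T \<alpha> \<in> Mor vect_cat (fobj (mackey_of X) S) (fobj (mackey_of X) T)"
      unfolding vect_mor_iff
    proof (rule conjI)
      show "fmor (mackey_of X) S T \<alpha> \<in> extensional (carrier (fobj (mackey_of X) S))"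
        using S T io_facts(4)[OF S] o(3) by (simp add: mackey_of_def)
      have "lin (fobj (mackey_of X) S) (fobj (mackey_of X) T) (\<lambda>v. family_embed X T (span_act X S T w (inv_into (family X S) (family_embed X S) v)))"
        using lin_comp[OF lin_comp[OF io_facts(3)[OF S] wact_lin[OF X S T w(1)]] io_facts(2)[OF T]] .
      then show "lin (fobj (mackey_of X) S) (fobj (mackey_of X) T) (fmor (mackey_of X) S T \<alpha>)"
      proof (rule lin_cong[OF io_facts(1)[OF S], rotated])
        fix v assume "v \<in> carrier (fobj (mackey_of X) S)"
        then obtain x where x: "x \<in> family X S" "v = family_embed X S x" using io_facts(4)[OF S] by blast
        show "family_embed X T (span_act X S T w (inv_into (family X S) (family_embed X S) v)) = fmor (mackey_of X) S T \<alpha> v"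
          using mx_mor[OF S T w(1) x(1)] x inv_into_f_f[OF io_inj[OF S] x(1)] w(2) by simp
      qed
    qed
  next
    fix R S T \<alpha> \<beta> assume o: "R \<in> Ob lindner" "S \<in> Ob lindner" "T \<in> Ob lindner" "\<alpha> \<in> Mor lindner R S" "\<beta> \<in> Mor lindner S T"
    show "Cmp lindner R S T \<beta> \<alpha> \<in> Mor lindner R T" by (rule category.cmp_mor[OF category_lind o])
    have R: "finite_gset G R" and S: "finite_gset G S" and T: "finite_gset G T" using o by simp_all
    obtain u :: "('a, 's, 's) gspan" where u: "u \<in> spans G TS R S" "\<alpha> = cls R S u" using mor_cls[OF o(4)] by blast
    obtain w :: "('a, 's, 's) gspan" where w: "w \<in> spans G TS S T" "\<beta> = cls S T w" using mor_cls[OF o(5)] by blast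
    note uw = span_comp_spans[OF u(1) w(1)]
    show "fmor (mackey_of X) R T (Cmp lindner R S T \<beta> \<alpha>) = Cmp vect_cat (fobj (mackey_of X) R) (fobj (mackey_of X) S) (fobj (mackey_of X) T) (fmor (mackey_of X) S T \<beta>) (fmor (mackey_of X) R S \<alpha>)"
    proof (rule extensionalityI[of _ "carrier (fobj (mackey_of X) R)"])
      show "fmor (mackey_of X) R T (Cmp lindner R S T \<beta> \<alpha>) \<in> extensional (carrier (fobj (mackey_of X) R))"
        using R T io_facts(4)[OF R] cls_mor[OF uw] unfolding u(2) w(2) cmp_cls[OF u(1) w(1)] by (simp add: mackey_of_def)
      fix v assume v: "v \<in> carrier (fobj (mackey_of X) R)"
      then obtain x where x: "x \<in> family X R" "v = family_embed X R x" using io_facts(4)[OF R] by blast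
      show "fmor (mackey_of X) R T (Cmp lindner R S T \<beta> \<alpha>) v = Cmp vect_cat (fobj (mackey_of X) R) (fobj (mackey_of X) S) (fobj (mackey_of X) T) (fmor (mackey_of X) S T \<beta>) (fmor (mackey_of X) R S \<alpha>) v"
        unfolding u(2) w(2) cmp_cls[OF u(1) w(1)] vect_cat_simps compose_eq[OF v]
        unfolding x(2) mx_mor[OF R T uw x(1)] mx_mor[OF R S u(1) x(1)] mx_mor[OF S T w(1) wact_fam[OF X R S u(1) x(1)]]
          wact_comp[OF X R S T u(1) w(1) x(1)] ..
    qed (simp add: compose_def)
  qed
qed

text \<open>An injective map preserves stabilizers, so each sum has a single term and restriction
  along the map merely reindexes a family.\<close>

lemma wact_rsp:
  assumes S: "finite_gset G S" and U: "finite_gset G U" and j: "j \<in> gset_hom G S U" "inj_on j (pts S)" and x: "x \<in> family X U" and t: "(c, t) \<in> index S"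
  shows "span_act X U S (restr_span S j) x (c, t) = x (c, j t)" "cut_stab c U (j t) = cut_stab c S t" "(c, j t) \<in> index U"
proof -
  note i = idxD[OF t]
  show k: "cut_stab c U (j t) = cut_stab c S t" using stab_hom_inj[OF S j(1) i(2) j(2)] by (simp add: cut_stab_def)
  show jt: "(c, j t) \<in> index U" by (rule idx_hom[OF S U j(1) t])
  interpret V: rat_module "coeff_mod X c (cut_stab c S t)" by (rule xo_idx[OF X t])
  have "fixed_fibre c (restr_span S j) S t = {t}" using i by (auto simp: fixed_fibre_def restr_span_def)
  moreover have "\<one> \<in> cut_stab c S t" by (rule subgroup.one_closed[OF ks_subgroup[OF S i(2,1)]])
  ultimately show "span_act X U S (restr_span S j) x (c, t) = x (c, j t)"
    unfolding wact_apply[OF X t] using famD(1)[OF X x jt] k xm_id[OF X i(1,3), of \<one> "x (c, j t)"]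
    by (simp add: restr_span_def V.M.finsum_insert)
qed

text \<open>Every element of \<open>index U\<close> comes from exactly one of the parts, with the
  same stabilizer, so a family on a disjoint union amounts to a tuple of families on the
  parts.\<close>

lemma fam_product:
  fixes I :: "nat set"
  assumes U: "finite_gset G U" and Y: "\<And>i. i \<in> I \<Longrightarrow> finite_gset G (Y i)"
    and j: "\<And>i. i \<in> I \<Longrightarrow> j i \<in> gset_hom G (Y i) U"
    and inj: "\<And>i i' x x'. \<lbrakk>i \<in> I; i' \<in> I; x \<in> pts (Y i); x' \<in> pts (Y i'); j i x = j i' x'\<rbrakk> \<Longrightarrow> i = i' \<and> x = x'"
    and cover: "\<And>u. u \<in> pts U \<Longrightarrow> \<exists>i\<in>I. \<exists>x\<in>pts (Y i). u = j i x"
  shows "bij_betw (\<lambda>x. \<lambda>i\<in>I. span_act X U (Y i) (restr_span (Y i) (j i)) x) (family X U) (\<Pi>\<^sub>E i\<in>I. family X (Y i))"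
proof (rule bij_betw_imageI)
  let ?r = "\<lambda>i. span_act X U (Y i) (restr_span (Y i) (j i))"
  have inji: "inj_on (j i) (pts (Y i))" if "i \<in> I" for i using inj that by (auto simp: inj_on_def)
  note r = wact_rsp[OF Y U j inji]
  have cov: "\<exists>i\<in>I. \<exists>x. (c, x) \<in> index (Y i) \<and> u = j i x" if u: "(c, u) \<in> index U" for c u
  proof -
    obtain i x where i: "i \<in> I" "x \<in> pts (Y i)" "u = j i x" using cover idxD(2)[OF u] by blast
    have "cut_stab c U u = cut_stab c (Y i) x" using stab_hom_inj[OF Y j i(2) inji] i by (simp add: cut_stab_def)
    then show ?thesis using i u by (auto simp: index_def)
  qed
  show "inj_on (\<lambda>x. \<lambda>i\<in>I. ?r i x) (family X U)"
  proof (rule inj_onI)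
    fix x y assume x: "x \<in> family X U" and y: "y \<in> family X U" and e: "(\<lambda>i\<in>I. ?r i x) = (\<lambda>i\<in>I. ?r i y)"
    have e': "?r i x = ?r i y" if "i \<in> I" for i using fun_cong[OF e, of i] that by simp
    show "x = y"
    proof (rule extensionalityI[OF famD(3)[OF X x] famD(3)[OF X y]])
      fix p assume "p \<in> index U"
      then obtain c u where p: "p = (c, u)" "(c, u) \<in> index U" by (cases p) auto
      obtain i t where i: "i \<in> I" "(c, t) \<in> index (Y i)" "u = j i t" using cov[OF p(2)] by blast
      show "x p = y p" using r(1)[OF i(1) i(1) i(1) x i(2)] r(1)[OF i(1) i(1) i(1) y i(2)] e'[OF i(1)] p i by simp
    qed
  qed
  show "(\<lambda>x. \<lambda>i\<in>I. ?r i x) ` family X U = (\<Pi>\<^sub>E i\<in>I. family X (Y i))"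
  proof
    show "(\<lambda>x. \<lambda>i\<in>I. ?r i x) ` family X U \<subseteq> (\<Pi>\<^sub>E i\<in>I. family X (Y i))"
      using wact_fam[OF X U Y rsp_spans[OF Y j]] by auto
    show "(\<Pi>\<^sub>E i\<in>I. family X (Y i)) \<subseteq> (\<lambda>x. \<lambda>i\<in>I. ?r i x) ` family X U"
    proof
      fix z assume z: "z \<in> (\<Pi>\<^sub>E i\<in>I. family X (Y i))"
      have "\<forall>q. \<exists>i t. q \<in> index U \<longrightarrow> i \<in> I \<and> (fst q, t) \<in> index (Y i) \<and> snd q = j i t"
        using cov by (metis prod.collapse)
      then obtain ix tx where ix: "\<And>q. q \<in> index U \<Longrightarrow> ix q \<in> I \<and> (fst q, tx q) \<in> index (Y (ix q)) \<and> snd q = j (ix q) (tx q)"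
        by metis
      define x where "x = (\<lambda>q\<in>index U. z (ix q) (fst q, tx q))"
      have zf: "z i \<in> family X (Y i)" if "i \<in> I" for i using z that by auto
      have xj: "x (c, j i t) = z i (c, t)" if i: "i \<in> I" "(c, t) \<in> index (Y i)" for c i t
      proof -
        have q: "(c, j i t) \<in> index U" by (rule idx_hom[OF Y[OF i(1)] U j[OF i(1)] i(2)])
        have "ix (c, j i t) = i \<and> tx (c, j i t) = t"
          using inj[of "ix (c, j i t)" i "tx (c, j i t)" t] ix[OF q] i idxD(2)[OF i(2)] idxD(2)[of c "tx (c, j i t)"] by simp
        then show ?thesis using q by (simp add: x_def)
      qed
      have xf: "x \<in> family X U"
      proof (rule famI[OF X])
        show "x \<in> extensional (index U)" by (simp add: x_def)
        fix c u assume q: "(c, u) \<in> index U"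
        obtain i t where i: "i \<in> I" "(c, t) \<in> index (Y i)" "u = j i t" using cov[OF q] by blast
        have kk: "cut_stab c U (j i t) = cut_stab c (Y i) t" using stab_hom_inj[OF Y j idxD(2)[OF i(2)] inji] i(1) by (simp add: cut_stab_def)
        show "x (c, u) \<in> carrier (coeff_mod X c (cut_stab c U u))" using xj[OF i(1,2)] famD(1)[OF X zf[OF i(1)] i(2)] i(3) kk by simp
        fix a assume a: "a \<in> norm_rep c"
        have ac: "a \<in> carrier G" by (rule nz_cl[OF idxD(1)[OF q] a])
        have au: "act U a u = j i (act (Y i) a t)" using gset_homD(2)[OF j[OF i(1)] ac idxD(2)[OF i(2)]] i(3) by simp
        note ia = idx_act[OF Y[OF i(1)] i(2) a]
        have kk': "cut_stab c U (j i (act (Y i) a t)) = cut_stab c (Y i) (act (Y i) a t)" using stab_hom_inj[OF Y j idxD(2)[OF ia] inji] i(1) by (simp add: cut_stab_def)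
        show "x (c, act U a u) = coeff_res X c (cut_stab c U (act U a u)) (cut_stab c U u) a (x (c, u))"
          unfolding au unfolding i(3) xj[OF i(1) ia] xj[OF i(1,2)] kk kk' by (rule famD(2)[OF X zf[OF i(1)] i(2) a])
      qed
      have "(\<lambda>i\<in>I. ?r i x) = z"
      proof (rule PiE_ext[OF _ z])
        show "(\<lambda>i\<in>I. ?r i x) \<in> (\<Pi>\<^sub>E i\<in>I. family X (Y i))" using wact_fam[OF X U Y rsp_spans[OF Y j]] xf by auto
        fix i assume i: "i \<in> I"
        have "?r i x = z i"
        proof (rule extensionalityI[OF famD(3)[OF X wact_fam[OF X U Y[OF i] rsp_spans[OF Y[OF i] j[OF i]] xf]] famD(3)[OF X zf[OF i]]])
          fix p assume "p \<in> index (Y i)"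
          then obtain c t where p: "p = (c, t)" "(c, t) \<in> index (Y i)" by (cases p) auto
          show "?r i x p = z i p" using r(1)[OF i i i xf p(2)] xj[OF i p(2)] p by simp
        qed
        then show "(\<lambda>i\<in>I. ?r i x) i = z i" using i by simp
      qed
      then show "z \<in> (\<lambda>x. \<lambda>i\<in>I. ?r i x) ` family X U" using xf by blast
    qed
  qed
qed

lemma coproduct_ex:
  fixes Y :: "nat \<Rightarrow> ('a, 's) gset"
  assumes "finite I" and Y: "\<And>i. i \<in> I \<Longrightarrow> finite_gset G (Y i)"
  obtains U :: "('a, 's) gset" and j where "finite_gset G U" "\<And>i. i \<in> I \<Longrightarrow> j i \<in> gset_hom G (Y i) U"
    "\<And>i i' x x'. \<lbrakk>i \<in> I; i' \<in> I; x \<in> pts (Y i); x' \<in> pts (Y i'); j i x = j i' x'\<rbrakk> \<Longrightarrow> i = i' \<and> x = x'"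
    "\<And>u. u \<in> pts U \<Longrightarrow> \<exists>i\<in>I. \<exists>x\<in>pts (Y i). u = j i x"
proof -
  define P where "P = (SIGMA i:I. pts (Y i))"
  define A where "A = \<lparr>pts = P, act = (\<lambda>g\<in>carrier G. \<lambda>p\<in>P. (fst p, act (Y (fst p)) g (snd p)))\<rparr>"
  have A: "finite_gset G A"
  proof (rule finite_gsetI)
    show "finite (pts A)" using assms(1) gset_finite[OF Y] by (simp add: A_def P_def)
  qed (use Y in \<open>auto simp: A_def P_def act_closed act_one act_mult\<close>)
  show ?thesis
  proof (rule that[of "copy_gset A" "\<lambda>i. \<lambda>x\<in>pts (Y i). copy_map A (i, x)"])
    show "finite_gset G (copy_gset A)" by (rule cp_gset[OF A])
    show "(\<lambda>x\<in>pts (Y i). copy_map A (i, x)) \<in> gset_hom G (Y i) (copy_gset A)" if i: "i \<in> I" for i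
    proof (rule gset_hom_restrictI[OF Y[OF i]])
      show "copy_map A (i, x) \<in> pts (copy_gset A)" if "x \<in> pts (Y i)" for x
        unfolding cp_pts[OF A] by (rule imageI) (use that i in \<open>simp add: A_def P_def\<close>)
      show "copy_map A (i, act (Y i) g x) = act (copy_gset A) g (copy_map A (i, x))" if "g \<in> carrier G" "x \<in> pts (Y i)" for g x
        using cp_act[OF A that(1), of "(i, x)"] that i by (simp add: A_def P_def)
    qed
    show "i = i' \<and> x = x'" if "i \<in> I" "i' \<in> I" "x \<in> pts (Y i)" "x' \<in> pts (Y i')"
      "(\<lambda>x\<in>pts (Y i). copy_map A (i, x)) x = (\<lambda>x\<in>pts (Y i'). copy_map A (i', x)) x'" for i i' x x'
      using inj_onD[OF cpm_inj[OF A], of "(i, x)" "(i', x')"] that by (simp add: A_def P_def)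
    show "\<exists>i\<in>I. \<exists>x\<in>pts (Y i). u = (\<lambda>x\<in>pts (Y i). copy_map A (i, x)) x" if "u \<in> pts (copy_gset A)" for u
    proof -
      note u = that
      obtain q where "q \<in> pts A" "u = copy_map A q" using u unfolding cp_pts[OF A] by blast
      moreover from this obtain i x where "q = (i, x)" "i \<in> I" "x \<in> pts (Y i)" by (auto simp: A_def P_def)
      ultimately show ?thesis by auto
    qed
  qed
qed

text \<open>An arbitrary product \<open>P\<close> is compared with the disjoint union of its factors
  by \<open>is_product_iso\<close>; the functor carries this isomorphism to a bijection, and for the
  disjoint union \<open>fam_product\<close> applies.\<close>

lemma mx_mackey: "is_mackey (mackey_of X)"
  unfolding mk_iff
proof (rule conjI[OF mx_functor])
  note F = mx_functor
  show "product_preserving lindner vect_cat (mackey_of X)"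
    unfolding product_preserving_def
  proof (intro allI impI)
    fix I :: "nat set" and Y P p assume I: "finite I" and prod: "is_product lindner I Y P p"
    have Y: "finite_gset G (Y i)" "p i \<in> Mor lindner P (Y i)" if "i \<in> I" for i using prod that unfolding is_product_def by auto
    have P: "finite_gset G P" using prod by (simp add: is_product_def)
    obtain U :: "('a, 's) gset" and j where U: "finite_gset G U" and j: "\<And>i. i \<in> I \<Longrightarrow> j i \<in> gset_hom G (Y i) U"
      and inj: "\<And>i i' x x'. \<lbrakk>i \<in> I; i' \<in> I; x \<in> pts (Y i); x' \<in> pts (Y i'); j i x = j i' x'\<rbrakk> \<Longrightarrow> i = i' \<and> x = x'"
      and cover: "\<And>u. u \<in> pts U \<Longrightarrow> \<exists>i\<in>I. \<exists>x\<in>pts (Y i). u = j i x"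
      using coproduct_ex[where Y = Y, OF I Y(1)] by blast
    let ?q = "\<lambda>i. cls U (Y i) (restr_span (Y i) (j i))"
    have "is_product lindner I Y U ?q" by (rule lind_product[OF I U Y(1) j inj cover])
    then obtain u where u: "iso_mor lindner P U u" "\<And>i. i \<in> I \<Longrightarrow> Cmp lindner P U (Y i) (?q i) u = p i"
      using category.is_product_iso[OF category_lind prod] by blast
    then obtain v where v: "v \<in> Mor lindner U P" "Cmp lindner P U P v u = Idn lindner P" "Cmp lindner U P U u v = Idn lindner U"
      and um: "u \<in> Mor lindner P U" unfolding iso_mor_def by blast
    have Po: "P \<in> Ob lindner" and Uo: "U \<in> Ob lindner" and Yo: "\<And>i. i \<in> I \<Longrightarrow> Y i \<in> Ob lindner" using P U Y by simp_all
    have qm: "?q i \<in> Mor lindner U (Y i)" if "i \<in> I" for i by (rule cls_mor[OF rsp_spans[OF Y(1)[OF that] j[OF that]]])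
    have "iso_mor vect_cat (fobj (mackey_of X) P) (fobj (mackey_of X) U) (fmor (mackey_of X) P U u)"
      unfolding iso_mor_def
      using is_functorD(2)[OF F Po Uo um] is_functorD(2)[OF F Uo Po v(1)] is_functorD(4)[OF F Po Uo Po um v(1)]
        is_functorD(4)[OF F Uo Po Uo v(1) um] is_functorD(3)[OF F Po] is_functorD(3)[OF F Uo] v(2,3) by metis
    then have bu: "bij_betw (fmor (mackey_of X) P U u) (carrier (fobj (mackey_of X) P)) (carrier (fobj (mackey_of X) U))" by (rule vect_iso_bij)
    let ?Z = "\<Pi>\<^sub>E i\<in>I. carrier (fobj (mackey_of X) (Y i))"
    have bq: "bij_betw (\<lambda>x. \<lambda>i\<in>I. fmor (mackey_of X) U (Y i) (?q i) x) (carrier (fobj (mackey_of X) U)) ?Z"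
    proof -
      have 1: "bij_betw (inv_into (family X U) (family_embed X U)) (family_embed X U ` family X U) (family X U)"
        by (rule bij_betw_inv_into) (simp add: bij_betw_def io_inj[OF U])
      note 2 = fam_product[OF U Y(1) j inj cover]
      have 3: "bij_betw (\<lambda>z. \<lambda>i\<in>I. family_embed X (Y i) (z i)) (\<Pi>\<^sub>E i\<in>I. family X (Y i)) ?Z"
      proof (rule bij_betwI[of _ _ _ "\<lambda>z. \<lambda>i\<in>I. inv_into (family X (Y i)) (family_embed X (Y i)) (z i)"])
        show "(\<lambda>z. \<lambda>i\<in>I. family_embed X (Y i) (z i)) \<in> (\<Pi>\<^sub>E i\<in>I. family X (Y i)) \<rightarrow> ?Z"
          using io_facts(4)[OF Y(1)] by (auto simp: PiE_iff)
        show "(\<lambda>z. \<lambda>i\<in>I. inv_into (family X (Y i)) (family_embed X (Y i)) (z i)) \<in> ?Z \<rightarrow> (\<Pi>\<^sub>E i\<in>I. family X (Y i))"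
          using io_facts(4)[OF Y(1)] by (auto simp: PiE_iff intro!: inv_into_into)
      qed (use io_facts(4)[OF Y(1)] io_inj[OF Y(1)] in \<open>auto simp: PiE_iff extensional_def fun_eq_iff f_inv_into_f\<close>)
      have "bij_betw ((\<lambda>z. \<lambda>i\<in>I. family_embed X (Y i) (z i)) \<circ> ((\<lambda>x. \<lambda>i\<in>I. span_act X U (Y i) (restr_span (Y i) (j i)) x) \<circ> inv_into (family X U) (family_embed X U)))
        (family_embed X U ` family X U) ?Z"
        by (rule bij_betw_trans[OF bij_betw_trans[OF 1 2] 3])
      then show ?thesis
        unfolding io_facts(4)[OF U]
      proof (rule bij_betw_cong[THEN iffD1, rotated])
        fix y assume "y \<in> family_embed X U ` family X U"
        then obtain x where x: "x \<in> family X U" "y = family_embed X U x" by blast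
        show "((\<lambda>z. \<lambda>i\<in>I. family_embed X (Y i) (z i)) \<circ> ((\<lambda>x. \<lambda>i\<in>I. span_act X U (Y i) (restr_span (Y i) (j i)) x) \<circ> inv_into (family X U) (family_embed X U))) y
          = (\<lambda>i\<in>I. fmor (mackey_of X) U (Y i) (?q i) y)"
          using mx_mor[OF U Y(1) rsp_spans[OF Y(1) j] x(1)] x inv_into_f_f[OF io_inj[OF U] x(1)]
          by (auto intro!: restrict_ext)
      qed
    qed
    show "is_product vect_cat I (\<lambda>i. fobj (mackey_of X) (Y i)) (fobj (mackey_of X) P) (\<lambda>i. fmor (mackey_of X) P (Y i) (p i))"
    proof (rule vect_productI)
      show "rat_module (fobj (mackey_of X) P)" by (rule io_facts(1)[OF P])
      show "rat_module (fobj (mackey_of X) (Y i))" if "i \<in> I" for i by (rule io_facts(1)[OF Y(1)[OF that]])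
      show "fmor (mackey_of X) P (Y i) (p i) \<in> Mor vect_cat (fobj (mackey_of X) P) (fobj (mackey_of X) (Y i))" if "i \<in> I" for i
        by (rule is_functorD(2)[OF F Po Yo[OF that] Y(2)[OF that]])
      show "bij_betw (\<lambda>x. \<lambda>i\<in>I. fmor (mackey_of X) P (Y i) (p i) x) (carrier (fobj (mackey_of X) P)) ?Z"
        using bij_betw_trans[OF bu bq]
      proof (rule bij_betw_cong[THEN iffD1, rotated])
        fix x assume x: "x \<in> carrier (fobj (mackey_of X) P)"
        have "fmor (mackey_of X) P (Y i) (p i) x = fmor (mackey_of X) U (Y i) (?q i) (fmor (mackey_of X) P U u x)" if i: "i \<in> I" for i
          using is_functorD(4)[OF F Po Uo Yo[OF i] um qm[OF i]] u(2)[OF i] x by (simp add: compose_eq)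
        then show "((\<lambda>x. \<lambda>i\<in>I. fmor (mackey_of X) U (Y i) (?q i) x) \<circ> fmor (mackey_of X) P U u) x = (\<lambda>i\<in>I. fmor (mackey_of X) P (Y i) (p i) x)"
          by (auto intro!: restrict_ext)
      qed
    qed
  qed
qed

end

section \<open>The coefficient systems of a Mackey functor\<close>

text \<open>Rationally, the elements that restrict to zero on the proper subgroups \<open>K \<inter> A\<close> form a complement of
  the image of the transfers from these subgroups. Unlike the quotient by that image, they are visibly
  closed under restriction.\<close>

abbreviation restr_orb :: "('a, 's, 'v) mackey_functor \<Rightarrow> 'a set \<Rightarrow> 'a set \<Rightarrow> 's \<Rightarrow> 'v \<Rightarrow> 'v" where
  "restr_orb M K K' p \<equiv> restr M (orb K') (orb K) (pt_map K (orb K') p)"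

definition phi :: "('a, 's, 'v) mackey_functor \<Rightarrow> 'a set \<Rightarrow> 'v set" where
  "phi M K = {x \<in> carrier (fobj M (orb K)). \<forall>A\<in>SubO. \<not> K \<subseteq> A \<longrightarrow> restr_orb M (K \<inter> A) K (base_pt K) x = \<zero>\<^bsub>fobj M (orb (K \<inter> A))\<^esub>}"

definition phimod :: "('a, 's, 'v) mackey_functor \<Rightarrow> 'a set \<Rightarrow> (rat, 'v) module" where
  "phimod M K = (fobj M (orb K))\<lparr>carrier := phi M K\<rparr>"

lemma phimod_simps [simp]:
  "carrier (phimod M K) = phi M K" "x \<oplus>\<^bsub>phimod M K\<^esub> y = x \<oplus>\<^bsub>fobj M (orb K)\<^esub> y"
  "r \<odot>\<^bsub>phimod M K\<^esub> x = r \<odot>\<^bsub>fobj M (orb K)\<^esub> x" "\<zero>\<^bsub>phimod M K\<^esub> = \<zero>\<^bsub>fobj M (orb K)\<^esub>"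
  by (simp_all add: phimod_def)

lemma phi_carrier: "x \<in> phi M K \<Longrightarrow> x \<in> carrier (fobj M (orb K))"
  by (simp add: phi_def)

lemma pm_orb_bpt:
  assumes K: "subgroup K G" shows "pt_map K (orb K) (base_pt K) = (\<lambda>p\<in>pts (orb K). p)"
  by (rule orb_hom_eqI[OF K pm_hom[OF K orb_gset[OF K] bpt_mem[OF K]] gset_hom_id[OF orb_gset[OF K]]])
    (simp_all add: bpt_stab[OF K] pm_bpt[OF K orb_gset[OF K] bpt_mem[OF K]] bpt_mem[OF K])

lemma SO_inter: "subgroup K G \<Longrightarrow> A \<in> SubO \<Longrightarrow> subgroup (K \<inter> A) G"
  by (rule subgroups_Inter_pair) (simp_all add: SO_subgroup)

section \<open>Restriction between orbits and the subspaces \<open>phi\<close>\<close>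

context
  fixes M :: "('a, 's, 'v) mackey_functor"
  assumes M: "is_mackey M"
begin

lemma rsm_lin:
  assumes K: "subgroup K G" and K': "subgroup K' G" and p: "p \<in> pts (orb K')" "K \<subseteq> stab (orb K') p"
  shows "lin (fobj M (orb K')) (fobj M (orb K)) (restr_orb M K K' p)"
  by (rule mact_lin[OF M orb_gset[OF K'] orb_gset[OF K] rsp_spans[OF orb_gset[OF K] pm_hom[OF K orb_gset[OF K'] p]]])

lemma orb_mod: "subgroup K G \<Longrightarrow> rat_module (fobj M (orb K))"
  by (rule mk_mod[OF M orb_gset])

lemma rsm_comp:
  assumes K: "subgroup K G" and K': "subgroup K' G" and T: "finite_gset G T" "t \<in> pts T" "K' \<subseteq> stab T t"
    and p: "p \<in> pts (orb K')" "K \<subseteq> stab (orb K') p"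
    and x: "x \<in> carrier (fobj M T)"
  shows "restr_orb M K K' p (restr M T (orb K') (pt_map K' T t) x) = restr M T (orb K) (pt_map K T (pt_map K' T t p)) x"
  using rs_comp[OF M T(1) orb_gset[OF K'] pm_hom[OF K' T] orb_gset[OF K] pm_hom[OF K orb_gset[OF K'] p] x]
    pm_comp[OF K orb_gset[OF K'] p T(1) pm_hom[OF K' T]] by simp

lemma rsm_id: "subgroup K G \<Longrightarrow> x \<in> carrier (fobj M (orb K)) \<Longrightarrow> restr_orb M K K (base_pt K) x = x"
  using rs_id[OF M orb_gset] pm_orb_bpt by simp

text \<open>Moved to the base point, \<open>hullO J\<close> becomes an element \<open>B\<close> of
  \<open>SubO\<close> that does not contain \<open>K\<close>. The restriction to \<open>J\<close>
  factors through \<open>K \<inter> B\<close>, where \<open>x\<close> vanishes by definition of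
  \<open>phi\<close>.\<close>

lemma phi_vanish:
  assumes K: "subgroup K G" and x: "x \<in> phi M K" and p: "p \<in> pts (orb K)" and J: "subgroup J G" "J \<subseteq> stab (orb K) p"
    and n: "\<not> stab (orb K) p \<subseteq> hullO J"
  shows "restr_orb M J K p x = \<zero>\<^bsub>fobj M (orb J)\<^esub>"
proof -
  note OK = orb_gset[OF K]
  obtain g where g: "g \<in> carrier G" "p = act (orb K) g (base_pt K)" "stab (orb K) p = conjg g K" using orb_stab[OF K p] by blast
  have Kc: "K \<subseteq> carrier G" and Jc: "J \<subseteq> carrier G" using K J(1) subgroup_carrier by auto
  define B where "B = conjg (inv g) (hullO J)"
  have hc: "hullO J \<subseteq> carrier G" by (rule hull_carrier[OF Jc])
  have B: "B \<in> SubO" unfolding B_def by (rule SO_cj[OF hull_SO[OF Jc]]) (simp add: g)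
  have KB: "\<not> K \<subseteq> B" using n cj_mono_iff[OF Kc hc g(1)] g(3) by (simp add: B_def)
  note KBs = SO_inter[OF K B]
  have cB: "conjg g B = hullO J" unfolding B_def by (rule cj_inv(2)[OF hc g(1)])
  have J2: "J \<subseteq> conjg g (K \<inter> B)" using cj_Int[OF Kc SO_sub[OF B] g(1)] J(2) g(3) cB hull_sub[OF Jc] by simp
  let ?p1 = "act (orb (K \<inter> B)) g (base_pt (K \<inter> B))"
  have p1: "?p1 \<in> pts (orb (K \<inter> B))" by (rule act_closed[OF orb_gset[OF KBs] g(1) bpt_mem[OF KBs]])
  have s1: "J \<subseteq> stab (orb (K \<inter> B)) ?p1"
    using stab_act[OF orb_gset[OF KBs] g(1) bpt_mem[OF KBs]] bpt_stab[OF KBs] J2 by simp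
  have i: "K \<inter> B \<subseteq> stab (orb K) (base_pt K)" using bpt_stab[OF K] by simp
  have "restr_orb M J K p x = restr_orb M J (K \<inter> B) ?p1 (restr_orb M (K \<inter> B) K (base_pt K) x)"
    using rsm_comp[OF J(1) KBs OK bpt_mem[OF K] i p1 s1 phi_carrier[OF x]] pm_act[OF KBs OK bpt_mem[OF K] i g(1)] g(2) by simp
  also have "restr_orb M (K \<inter> B) K (base_pt K) x = \<zero>\<^bsub>fobj M (orb (K \<inter> B))\<^esub>" using x B KB by (simp add: phi_def)
  also have "restr_orb M J (K \<inter> B) ?p1 \<zero>\<^bsub>fobj M (orb (K \<inter> B))\<^esub> = \<zero>\<^bsub>fobj M (orb J)\<^esub>"
    by (rule lin_zero[OF orb_mod[OF KBs] orb_mod[OF J(1)] rsm_lin[OF J(1) KBs p1 s1]])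
  finally show ?thesis .
qed

text \<open>The hull of \<open>K \<inter> A\<close> lies in \<open>A\<close>, which does not contain
  \<open>K\<close> and all the less the larger stabilizer of \<open>p\<close>; so
  \<open>phi_vanish\<close> applies to the composite restriction.\<close>

lemma phi_res:
  assumes K: "subgroup K G" and K': "subgroup K' G" and p: "p \<in> pts (orb K')" "K \<subseteq> stab (orb K') p" and x: "x \<in> phi M K'"
  shows "restr_orb M K K' p x \<in> phi M K"
  unfolding phi_def mem_Collect_eq
proof (intro conjI ballI impI)
  show "restr_orb M K K' p x \<in> carrier (fobj M (orb K))" using rsm_lin[OF K K' p] phi_carrier[OF x] by blast
  fix A assume A: "A \<in> SubO" "\<not> K \<subseteq> A"
  note KA = SO_inter[OF K A(1)]
  have i: "K \<inter> A \<subseteq> stab (orb K) (base_pt K)" using bpt_stab[OF K] by simp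
  have "restr_orb M (K \<inter> A) K (base_pt K) (restr_orb M K K' p x) = restr_orb M (K \<inter> A) K' p x"
    using rsm_comp[OF KA K orb_gset[OF K'] p bpt_mem[OF K] i phi_carrier[OF x]] pm_bpt[OF K orb_gset[OF K'] p] by simp
  also have "\<dots> = \<zero>\<^bsub>fobj M (orb (K \<inter> A))\<^esub>"
  proof (rule phi_vanish[OF K' x p(1) KA])
    show "K \<inter> A \<subseteq> stab (orb K') p" using p(2) by blast
    have "hullO (K \<inter> A) \<subseteq> A" by (rule hull_least[OF subgroup_carrier[OF KA] A(1)]) simp
    then show "\<not> stab (orb K') p \<subseteq> hullO (K \<inter> A)" using A(2) p(2) by blast
  qed
  finally show "restr_orb M (K \<inter> A) K (base_pt K) (restr_orb M K K' p x) = \<zero>\<^bsub>fobj M (orb (K \<inter> A))\<^esub>" .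
qed

lemma phi_mod:
  assumes K: "subgroup K G" shows "rat_module (phimod M K)"
  unfolding phimod_def
proof (rule rat_submodule[OF orb_mod[OF K]])
  interpret V: rat_module "fobj M (orb K)" by (rule orb_mod[OF K])
  have l: "lin (fobj M (orb K)) (fobj M (orb (K \<inter> A))) (restr_orb M (K \<inter> A) K (base_pt K))" if "A \<in> SubO" for A
    by (rule rsm_lin[OF SO_inter[OF K that] K bpt_mem[OF K]]) (simp add: bpt_stab[OF K])
  have m: "rat_module (fobj M (orb (K \<inter> A)))" if "A \<in> SubO" for A by (rule orb_mod[OF SO_inter[OF K that]])
  show "phi M K \<subseteq> carrier (fobj M (orb K))" by (auto simp: phi_def)
  show "\<zero>\<^bsub>fobj M (orb K)\<^esub> \<in> phi M K"
    using lin_zero[OF V.rat_module_axioms m l] by (simp add: phi_def)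
  show "x \<oplus>\<^bsub>fobj M (orb K)\<^esub> y \<in> phi M K" if "x \<in> phi M K" "y \<in> phi M K" for x y
    using that l rat_module.add_facts(5)[OF m] rat_module.add_facts(1)[OF m] by (auto simp: phi_def)
  show "r \<odot>\<^bsub>fobj M (orb K)\<^esub> x \<in> phi M K" if "x \<in> phi M K" for x r
    using that l rat_module.smult_simps(2)[OF m] by (auto simp: phi_def)
qed

end

text \<open>Recovers \<open>K\<close> from \<open>ncoset c K\<close>, since a functor on the orbit
  category receives a coset space and not the subgroup it came from.\<close>

definition base_subgroup :: "('a, 'a set) gset \<Rightarrow> 'a set" where
  "base_subgroup Z = (THE C. C \<in> pts Z \<and> \<one> \<in> C)"

definition coeff_at :: "('a, 's, 'v) mackey_functor \<Rightarrow> 'a set set \<Rightarrow> ('a, 'v) coeff_system" where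
  "coeff_at M c = \<lparr>fobj = (\<lambda>Z\<in>Ob (osrc c). phimod M (base_subgroup Z)),
     fmor = (\<lambda>Z'\<in>Ob (osrc c). \<lambda>Z\<in>Ob (osrc c). \<lambda>\<phi>\<in>Mor (osrc c) Z' Z. \<lambda>x\<in>phi M (base_subgroup Z').
       restr_orb M (base_subgroup Z) (base_subgroup Z') (act (orb (base_subgroup Z')) (SOME a. a \<in> norm_rep c \<and> \<phi> (base_subgroup Z) = act Z' a (base_subgroup Z')) (base_pt (base_subgroup Z'))) x)\<rparr>"

definition coeff_of :: "('a, 's, 'v) mackey_functor \<Rightarrow> 'a set set \<Rightarrow> ('a, 'v) coeff_system" where
  "coeff_of M = (\<lambda>c\<in>SubO_classes. coeff_at M c)"

lemma sb_co:
  assumes "c \<in> SubO_classes" "hull_rep c K" shows "base_subgroup (ncoset c K) = K"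
  unfolding base_subgroup_def
proof (rule the_equality)
  have b: "C \<in> pts (ncoset c K) \<Longrightarrow> \<one> \<in> C \<longleftrightarrow> C = K" for C
    using group.coset_base[OF N_group[OF assms(1)] vs_N[OF assms] N_fin[OF assms(1)]] N_simps(3)[OF assms(1)] by (simp add: ncoset_def)
  show "K \<in> pts (ncoset c K) \<and> \<one> \<in> K" using b co_facts(2)[OF assms] by blast
  show "\<And>C. C \<in> pts (ncoset c K) \<and> \<one> \<in> C \<Longrightarrow> C = K" using b by blast
qed

lemma orb_nz_stab:
  assumes "c \<in> SubO_classes" "hull_rep c K'" "a \<in> norm_rep c"
  shows "act (orb K') a (base_pt K') \<in> pts (orb K')" "stab (orb K') (act (orb K') a (base_pt K')) = conjg a K'"
proof -
  note K = vs_subgroup[OF assms(2)] and a = nz_cl[OF assms(1,3)]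
  show "act (orb K') a (base_pt K') \<in> pts (orb K')" by (rule act_closed[OF orb_gset[OF K] a bpt_mem[OF K]])
  show "stab (orb K') (act (orb K') a (base_pt K')) = conjg a K'"
    using stab_act[OF orb_gset[OF K] a bpt_mem[OF K]] bpt_stab[OF K] by simp
qed

text \<open>A map of coset spaces determines \<open>a\<close> up to right multiplication by
  \<open>K'\<close>, which fixes the base point of \<open>orb K'\<close>; the choice made in
  \<open>coeff_at\<close> is therefore immaterial.\<close>

lemma pfun_mor:
  assumes c: "c \<in> SubO_classes" and K: "hull_rep c K" "hull_rep c K'" and a: "a \<in> norm_rep c" "K \<subseteq> conjg a K'" and x: "x \<in> phi M K'"
  shows "fmor (coeff_at M c) (ncoset c K') (ncoset c K) (nmap c K K' a) x = restr_orb M K K' (act (orb K') a (base_pt K')) x"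
proof -
  have o: "ncoset c K \<in> Ob (osrc c)" "ncoset c K' \<in> Ob (osrc c)" using osrc_Ob[OF c] K by auto
  note h = nmap_hom[OF c K a]
  let ?P = "\<lambda>b. b \<in> norm_rep c \<and> nmap c K K' a K = act (ncoset c K') b K'"
  define b where "b = (SOME b. ?P b)"
  have "?P b" unfolding b_def by (rule someI[of ?P a]) (use a h in simp)
  then have b: "b \<in> norm_rep c" "act (ncoset c K') b K' = act (ncoset c K') a K'" using h(2) by simp_all
  note K's = vs_subgroup[OF K(2)]
  have "inv a \<otimes> b \<in> K'"
    using group.act_eq_iff[OF N_group[OF c] co_facts(1)[OF c K(2)], of b a K'] b a(1) co_facts(2,3)[OF c K(2)]
    by (simp add: c N_inv)
  then have "act (orb K') b (base_pt K') = act (orb K') a (base_pt K')"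
    using act_eq_iff[OF orb_gset[OF K's] nz_cl[OF c b(1)] nz_cl[OF c a(1)] bpt_mem[OF K's]] bpt_stab[OF K's] by simp
  then show ?thesis using o h(1) x unfolding b_def by (simp add: coeff_at_def osrc_simps[OF c] sb_co[OF c] K)
qed

context
  fixes M :: "('a, 's, 'v) mackey_functor"
  assumes M: "is_mackey M"
begin

lemma pfun_functor:
  assumes c: "c \<in> SubO_classes" shows "is_functor (osrc c) vect_cat (coeff_at M c)"
proof -
  have E: "coeff_at M c = \<lparr>fobj = (\<lambda>Z\<in>Ob (osrc c). phimod M (base_subgroup Z)),
     fmor = (\<lambda>Z'\<in>Ob (osrc c). \<lambda>Z\<in>Ob (osrc c). \<lambda>\<phi>\<in>Mor (osrc c) Z' Z. fmor (coeff_at M c) Z' Z \<phi>)\<rparr>"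
    by (auto simp: coeff_at_def intro!: restrict_ext)
  have ext: "fmor (coeff_at M c) Z' Z \<phi> \<in> extensional (phi M (base_subgroup Z'))" if "Z' \<in> Ob (osrc c)" "Z \<in> Ob (osrc c)" "\<phi> \<in> Mor (osrc c) Z' Z" for Z Z' \<phi>
    using that by (simp add: coeff_at_def)
  show ?thesis
  proof (subst E, rule is_functor_restrictI)
    fix Z assume "Z \<in> Ob (osrc c)"
    then obtain K where K: "Z = ncoset c K" "hull_rep c K" using osrc_Ob[OF c] by blast
    note Ks = vs_subgroup[OF K(2)]
    show "phimod M (base_subgroup Z) \<in> Ob vect_cat"
      using phi_mod[OF M Ks] K sb_co[OF c K(2)] by (simp add: rat_module_iff)
    show id: "Idn (osrc c) Z \<in> Mor (osrc c) Z Z"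
      using group.gset_hom_id[OF N_group[OF c] co_facts(1)[OF c K(2)]] K by (simp add: osrc_simps[OF c])
    have 1: "\<one> \<in> K" by (rule subgroup.one_closed[OF Ks])
    have i: "Idn (osrc c) Z = nmap c K K \<one>" using nmap_id[OF c K(2) 1] K by (simp add: osrc_simps[OF c])
    show "fmor (coeff_at M c) Z Z (Idn (osrc c) Z) = Idn vect_cat (phimod M (base_subgroup Z))"
    proof (rule extensionalityI[of _ "phi M K"])
      show "fmor (coeff_at M c) Z Z (Idn (osrc c) Z) \<in> extensional (phi M K)"
        using ext[OF \<open>Z \<in> Ob (osrc c)\<close> \<open>Z \<in> Ob (osrc c)\<close> id] sb_co[OF c K(2)] K(1) by simp
      fix x assume x: "x \<in> phi M K"
      have "fmor (coeff_at M c) Z Z (Idn (osrc c) Z) x = restr_orb M K K (act (orb K) \<one> (base_pt K)) x"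
        unfolding i unfolding K(1) by (rule pfun_mor[OF c K(2,2) nz_one[OF c] _ x]) (simp add: cj_one subgroup_carrier[OF Ks])
      also have "\<dots> = x" using act_one[OF orb_gset[OF Ks] bpt_mem[OF Ks]] rsm_id[OF M Ks phi_carrier[OF x]] by simp
      finally show "fmor (coeff_at M c) Z Z (Idn (osrc c) Z) x = Idn vect_cat (phimod M (base_subgroup Z)) x"
        using x sb_co[OF c K(2)] K(1) by simp
    qed (use sb_co[OF c K(2)] K(1) in simp)
  next
    fix Z' Z \<phi> assume o: "Z' \<in> Ob (osrc c)" "Z \<in> Ob (osrc c)" "\<phi> \<in> Mor (osrc c) Z' Z"
    obtain K K' where K: "Z = ncoset c K" "hull_rep c K" "Z' = ncoset c K'" "hull_rep c K'" using o osrc_Ob[OF c] by blast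
    obtain a where a: "a \<in> norm_rep c" "K \<subseteq> conjg a K'" "\<phi> = nmap c K K' a"
      using hom_nmap[OF c K(2,4)] o(3) K by (auto simp: osrc_simps[OF c])
    have l: "lin (phimod M K') (phimod M K) (restr_orb M K K' (act (orb K') a (base_pt K')))"
      using rsm_lin[OF M vs_subgroup[OF K(2)] vs_subgroup[OF K(4)] orb_nz_stab(1)[OF c K(4) a(1)]]
        phi_res[OF M vs_subgroup[OF K(2)] vs_subgroup[OF K(4)] orb_nz_stab(1)[OF c K(4) a(1)]] orb_nz_stab(2)[OF c K(4) a(1)] a(2) phi_carrier
      by (simp add: phi_def[of M K'])
    have "lin (phimod M K') (phimod M K) (fmor (coeff_at M c) Z' Z \<phi>)"
      by (intro lin_cong[OF phi_mod[OF M vs_subgroup[OF K(4)]] _ l])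
        (simp add: K(1,3) a(3) pfun_mor[OF c K(2,4) a(1,2)])
    then show "fmor (coeff_at M c) Z' Z \<phi> \<in> Mor vect_cat (phimod M (base_subgroup Z')) (phimod M (base_subgroup Z))"
      using ext[OF o] K by (simp add: vect_mor_iff sb_co[OF c])
  next
    fix Z'' Z' Z \<psi> \<phi> assume o: "Z'' \<in> Ob (osrc c)" "Z' \<in> Ob (osrc c)" "Z \<in> Ob (osrc c)" "\<psi> \<in> Mor (osrc c) Z'' Z'" "\<phi> \<in> Mor (osrc c) Z' Z"
    obtain K K' K'' where K: "Z = ncoset c K" "hull_rep c K" "Z' = ncoset c K'" "hull_rep c K'" "Z'' = ncoset c K''" "hull_rep c K''" using o osrc_Ob[OF c] by blast
    obtain a where a: "a \<in> norm_rep c" "K \<subseteq> conjg a K'" "\<phi> = nmap c K K' a"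
      using hom_nmap[OF c K(2,4)] o(5) K by (auto simp: osrc_simps[OF c])
    obtain b where b: "b \<in> norm_rep c" "K' \<subseteq> conjg b K''" "\<psi> = nmap c K' K'' b"
      using hom_nmap[OF c K(4,6)] o(4) K by (auto simp: osrc_simps[OF c])
    note nc = nmap_comp[OF c K(2,4,6) a(1,2) b(1,2)] and ab = nz_mult[OF c a(1) b(1)]
    have E2: "Cmp (osrc c) Z'' Z' Z \<phi> \<psi> = nmap c K K'' (a \<otimes> b)"
      using nc(2) K a b by (simp add: osrc_simps[OF c])
    show m: "Cmp (osrc c) Z'' Z' Z \<phi> \<psi> \<in> Mor (osrc c) Z'' Z"
      unfolding E2 using nmap_hom(1)[OF c K(2,6) ab nc(1)] K by (simp add: osrc_simps[OF c])
    show "fmor (coeff_at M c) Z'' Z (Cmp (osrc c) Z'' Z' Z \<phi> \<psi>) =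
       Cmp vect_cat (phimod M (base_subgroup Z'')) (phimod M (base_subgroup Z')) (phimod M (base_subgroup Z)) (fmor (coeff_at M c) Z' Z \<phi>) (fmor (coeff_at M c) Z'' Z' \<psi>)"
    proof (rule extensionalityI[of _ "phi M K''"])
      show "fmor (coeff_at M c) Z'' Z (Cmp (osrc c) Z'' Z' Z \<phi> \<psi>) \<in> extensional (phi M K'')"
        using ext[OF o(1,3) m] K sb_co[OF c K(6)] by simp
      fix x assume x: "x \<in> phi M K''"
      note s = vs_subgroup[OF K(2)] vs_subgroup[OF K(4)] vs_subgroup[OF K(6)]
      note pa = orb_nz_stab[OF c K(4) a(1)] and pb = orb_nz_stab[OF c K(6) b(1)]
      have "pt_map K' (orb K'') (act (orb K'') b (base_pt K'')) (act (orb K') a (base_pt K')) = act (orb K'') a (act (orb K'') b (base_pt K''))"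
        by (rule pm_act[OF s(2) orb_gset[OF s(3)] pb(1) _ nz_cl[OF c a(1)]]) (simp add: pb(2) b(2))
      also have "\<dots> = act (orb K'') (a \<otimes> b) (base_pt K'')"
        by (rule act_mult[OF orb_gset[OF s(3)] nz_cl[OF c a(1)] nz_cl[OF c b(1)] bpt_mem[OF s(3)], symmetric])
      finally have "restr_orb M K K' (act (orb K') a (base_pt K')) (restr_orb M K' K'' (act (orb K'') b (base_pt K'')) x) = restr_orb M K K'' (act (orb K'') (a \<otimes> b) (base_pt K'')) x"
        using rsm_comp[OF M s(1,2) orb_gset[OF s(3)] pb(1) _ pa(1) _ phi_carrier[OF x]] pa(2) pb(2) a(2) b(2) by simp
      moreover have "restr_orb M K' K'' (act (orb K'') b (base_pt K'')) x \<in> phi M K'"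
        by (rule phi_res[OF M s(2,3) pb(1) _ x]) (simp add: pb(2) b(2))
      ultimately show "fmor (coeff_at M c) Z'' Z (Cmp (osrc c) Z'' Z' Z \<phi> \<psi>) x =
       Cmp vect_cat (phimod M (base_subgroup Z'')) (phimod M (base_subgroup Z')) (phimod M (base_subgroup Z)) (fmor (coeff_at M c) Z' Z \<phi>) (fmor (coeff_at M c) Z'' Z' \<psi>) x"
        unfolding E2 using x pfun_mor[OF c K(2,6) ab nc(1) x] pfun_mor[OF c K(4,6) b(1,2) x]
        by (simp add: K sb_co[OF c] compose_eq a(3) b(3) pfun_mor[OF c K(2,4) a(1,2)])
    qed (simp add: K sb_co[OF c] compose_def)
  qed
qed

lemma PF_Ob: "coeff_of M \<in> Ob coeffs"
  unfolding PC_Ob by (simp add: coeff_of_def pfun_functor)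

lemma xo_PF: "c \<in> SubO_classes \<Longrightarrow> hull_rep c K \<Longrightarrow> coeff_mod (coeff_of M) c K = phimod M K"
  using sb_co[of c K] osrc_Ob[of c] by (auto simp: coeff_mod_def coeff_of_def coeff_at_def)

lemma xm_PF:
  assumes "c \<in> SubO_classes" "hull_rep c K" "hull_rep c K'" "a \<in> norm_rep c" "K \<subseteq> conjg a K'" "x \<in> phi M K'"
  shows "coeff_res (coeff_of M) c K K' a x = restr_orb M K K' (act (orb K') a (base_pt K')) x"
  using pfun_mor[OF assms] assms(1) by (simp add: coeff_res_def coeff_of_def)

end

section \<open>Reconstructing a Mackey functor from its coefficient systems\<close>

lemma ks_O: "finite_gset G S \<Longrightarrow> s \<in> pts S \<Longrightarrow> c \<in> SubO_classes \<Longrightarrow> (cut_stab c S s, stab S s) \<in> TS"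
  unfolding cut_stab_def by (rule SO_O[OF rep_SO stab_subgroup])

lemma ks_sub: "cut_stab c S s \<subseteq> stab S s"
  by (simp add: cut_stab_def)

text \<open>The weights make up for the passage from double cosets to points, so that \<open>assemble\<close> is natural.\<close>

definition assemble :: "('a, 's, 'v) mackey_functor \<Rightarrow> ('a, 's) gset \<Rightarrow> ('a set set \<times> 's \<Rightarrow> 'v) \<Rightarrow> 'v" where
  "assemble M S x = finsum (fobj M S) (\<lambda>(c, s). of_nat (card (cut_stab c S s)) \<odot>\<^bsub>fobj M S\<^esub>
     orbit_map M (cut_stab c S s) (orb (cut_stab c S s)) S (base_pt (cut_stab c S s)) s (x (c, s))) (index S)"

text \<open>The subgroup cut out at \<open>u\<close> lies in a conjugate of \<open>K\<close>, so its
  hull \<open>rep d\<close> lies in a conjugate of \<open>rep c\<close>. Restriction to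
  \<open>G/K\<close> thus meets only \<open>c\<close> and classes of smaller order, on which the
  inductions over the order of the hull rest.\<close>

lemma idx_orb:
  assumes c: "c \<in> SubO_classes" and K: "hull_rep c K" and u: "(d, u) \<in> index (orb K)"
  shows "card (rep d) \<le> card (rep c)"
    "card (rep d) = card (rep c) \<Longrightarrow> d = c"
    "d = c \<Longrightarrow> \<exists>g\<in>norm_rep c. u = act (orb K) g (base_pt K)"
proof -
  note Ks = vs_subgroup[OF K] and i = idxD[OF u]
  obtain g where g: "g \<in> carrier G" "u = act (orb K) g (base_pt K)" "stab (orb K) u = conjg g K" using orb_stab[OF Ks i(2)] by blast
  have "rep d = hullO (cut_stab d (orb K) u)" using vs_hO[OF i(3)] by simp
  also have "\<dots> \<subseteq> hullO (conjg g K)" by (rule hull_mono) (use g ks_sub[of d "orb K" u] cj_carrier[OF subgroup_carrier[OF Ks] g(1)] in auto)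
  also have "\<dots> = conjg g (rep c)" using hull_cj[OF subgroup_carrier[OF Ks] g(1)] vs_hO[OF K] by simp
  finally have sub: "rep d \<subseteq> conjg g (rep c)" .
  have fc: "finite (conjg g (rep c))" using finite_subset[OF cj_carrier[OF rep_sub[OF c] g(1)] fin] .
  have cc: "card (conjg g (rep c)) = card (rep c)" by (rule cj_card[OF rep_sub[OF c] g(1)])
  show "card (rep d) \<le> card (rep c)" using card_mono[OF fc sub] cc by simp
  have eq: "card (rep d) = card (rep c) \<Longrightarrow> conjg g (rep c) = rep d" using card_subset_eq[OF fc sub] cc by simp
  show "card (rep d) = card (rep c) \<Longrightarrow> d = c" using rep_cj_eq[OF c i(1) g(1)] eq by blast
  show "d = c \<Longrightarrow> \<exists>g\<in>norm_rep c. u = act (orb K) g (base_pt K)" using eq g nz_iff[OF c] by blast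
qed

lemma idx_orb_nz:
  assumes c: "c \<in> SubO_classes" and K: "hull_rep c K" and a: "a \<in> norm_rep c"
  shows "(c, act (orb K) a (base_pt K)) \<in> index (orb K)" "cut_stab c (orb K) (act (orb K) a (base_pt K)) = conjg a K"
proof -
  show k: "cut_stab c (orb K) (act (orb K) a (base_pt K)) = conjg a K"
    using orb_nz_stab(2)[OF c K a] vs_sub[OF vs_cj[OF c a K]] by (auto simp: cut_stab_def)
  show "(c, act (orb K) a (base_pt K)) \<in> index (orb K)"
    using orb_nz_stab(1)[OF c K a] vs_cj[OF c a K] k c by (simp add: index_def)
qed

text \<open>The normalizer acts transitively on these points with stabilizer \<open>K\<close>. With
  weight \<open>card K\<close> on each point the total weight is the order of the normalizer, the
  integer to be divided out.\<close>

lemma idx_orb_card: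
  assumes c: "c \<in> SubO_classes" and K: "hull_rep c K"
  shows "card {u. (c, u) \<in> index (orb K)} * card K = card (norm_rep c)"
proof -
  note Ks = vs_subgroup[OF K]
  let ?O = "orb K"
  let ?R = "\<lparr>pts = pts ?O, act = (\<lambda>g\<in>norm_rep c. act ?O g)\<rparr>"
  have R: "finite_gset (norm_grp c) ?R"
    by (rule group.finite_gsetI[OF N_group[OF c]])
      (use c orb_gset[OF Ks] nz_cl[OF c] nz_mult[OF c] nz_one[OF c] in \<open>auto simp: gset_finite act_closed act_one act_mult act_ext\<close>)
  have "{u. (c, u) \<in> index ?O} = (\<lambda>g. act ?R g (base_pt K)) ` norm_rep c"
    using idx_orb(3)[OF c K] idx_orb_nz(1)[OF c K] by auto
  moreover have "stabilizer (norm_grp c) (act ?R) (base_pt K) = K"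
    using bpt_stab[OF Ks] vs_sub[OF K] rep_nz[OF c] nz_cl[OF c] by (auto simp: stabilizer_def c)
  ultimately show ?thesis
    using group.orbit_card[OF N_group[OF c] R N_fin[OF c], of "base_pt K"] bpt_mem[OF Ks] by (simp add: c)
qed

section \<open>Naturality of \<open>assemble\<close>\<close>

context
  fixes M :: "('a, 's, 'v) mackey_functor"
  assumes M: "is_mackey M"
begin

lemma PF_fam:
  assumes "x \<in> family (coeff_of M) S" "(c, s) \<in> index S"
  shows "x (c, s) \<in> phi M (cut_stab c S s)"
  using famD(1)[OF PF_Ob[OF M] assms] xo_PF[OF M idxD(1,3)[OF assms(2)]] by simp

lemma PF_fam_act:
  assumes S: "finite_gset G S" and x: "x \<in> family (coeff_of M) S" and s: "(c, s) \<in> index S" and a: "a \<in> norm_rep c"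
  shows "x (c, act S a s) = restr_orb M (cut_stab c S (act S a s)) (cut_stab c S s) (act (orb (cut_stab c S s)) a (base_pt (cut_stab c S s))) (x (c, s))"
  unfolding famD(2)[OF PF_Ob[OF M] x s a]
  by (rule xm_PF[OF M _ _ _ a _ PF_fam[OF x s]])
    (use idxD[OF s] idxD[OF idx_act[OF S s a]] ks_act[OF S idxD(2,1)[OF s] a] in auto)

lemma PF_famI:
  assumes S: "finite_gset G S" and e: "x \<in> extensional (index S)" and p: "\<And>c s. (c, s) \<in> index S \<Longrightarrow> x (c, s) \<in> phi M (cut_stab c S s)"
    and a: "\<And>c s a. (c, s) \<in> index S \<Longrightarrow> a \<in> norm_rep c \<Longrightarrow>
      x (c, act S a s) = restr_orb M (cut_stab c S (act S a s)) (cut_stab c S s) (act (orb (cut_stab c S s)) a (base_pt (cut_stab c S s))) (x (c, s))"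
  shows "x \<in> family (coeff_of M) S"
proof (rule famI[OF PF_Ob[OF M] e])
  fix c s assume s: "(c, s) \<in> index S"
  show "x (c, s) \<in> carrier (coeff_mod (coeff_of M) c (cut_stab c S s))" using p[OF s] xo_PF[OF M idxD(1,3)[OF s]] by simp
  fix a assume an: "a \<in> norm_rep c"
  show "x (c, act S a s) = coeff_res (coeff_of M) c (cut_stab c S (act S a s)) (cut_stab c S s) a (x (c, s))"
    unfolding a[OF s an]
    by (rule xm_PF[OF M _ _ _ an _ p[OF s], symmetric])
      (use idxD[OF s] idxD[OF idx_act[OF S s an]] ks_act[OF S idxD(2,1)[OF s] an] in auto)
qed

text \<open>Separates the restriction to \<open>G/K\<close> from the transfer, so that what is known
  about restrictions can be used under a transfer.\<close>

lemma ot_factor: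
  assumes S: "finite_gset G S" "s \<in> pts S" "K \<subseteq> stab S s" and T: "finite_gset G T" "t \<in> pts T" "(K, stab T t) \<in> TS"
    and x: "x \<in> carrier (fobj M S)"
  shows "orbit_map M K S T s t x = orbit_map M K (orb K) T (base_pt K) t (restr M S (orb K) (pt_map K S s) x)"
proof -
  have K: "subgroup K G" using T(3) O_subgroup by blast
  have b: "K \<subseteq> stab (orb K) (base_pt K)" by (simp add: bpt_stab[OF K])
  show ?thesis
    unfolding orbit_map_def
    by (rule mact_lleg[OF M S(1) T(1) orb_gset[OF K] pm_hom[OF K S] osp_spans[OF orb_gset[OF K] bpt_mem[OF K] b T] osp_spans[OF S T] _ _ _ x])
      (simp_all add: orbit_span_def pm_orb_bpt[OF K])
qed

lemma ot_lin:
  assumes S: "finite_gset G S" "s \<in> pts S" "K \<subseteq> stab S s" and T: "finite_gset G T" "t \<in> pts T" "(K, stab T t) \<in> TS"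
  shows "lin (fobj M S) (fobj M T) (orbit_map M K S T s t)"
  unfolding orbit_map_def by (rule mact_lin[OF M S(1) T(1) osp_spans[OF S T]])

lemma ot_bpt:
  assumes K: "subgroup K G" and x: "x \<in> carrier (fobj M (orb K))"
  shows "orbit_map M K (orb K) (orb K) (base_pt K) (base_pt K) x = x"
  using mact_id[OF M orb_gset[OF K] x] by (simp add: orbit_map_def orbit_span_def id_span_def pm_orb_bpt[OF K])

lemma ks_ot:
  assumes S: "finite_gset G S" and s: "(c, s) \<in> index S"
  shows "lin (fobj M (orb (cut_stab c S s))) (fobj M S) (orbit_map M (cut_stab c S s) (orb (cut_stab c S s)) S (base_pt (cut_stab c S s)) s)"
  by (rule ot_lin[OF orb_gset bpt_mem _ S _ ks_O[OF S]])
    (use idxD[OF s] vs_subgroup[OF idxD(3)[OF s]] bpt_stab in auto)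

lemma psi_term:
  assumes S: "finite_gset G S" and x: "x \<in> family (coeff_of M) S" and s: "(c, s) \<in> index S"
  shows "orbit_map M (cut_stab c S s) (orb (cut_stab c S s)) S (base_pt (cut_stab c S s)) s (x (c, s)) \<in> carrier (fobj M S)"
  using ks_ot[OF S s] phi_carrier[OF PF_fam[OF x s]] by blast

lemma psi_lin:
  assumes S: "finite_gset G S"
  shows "lin (family_mod (coeff_of M) S) (fobj M S) (assemble M S)"
proof -
  note X = PF_Ob[OF M]
  interpret V: rat_module "fobj M S" by (rule mk_mod[OF M S])
  have "lin (family_mod (coeff_of M) S) (fobj M S) (\<lambda>x. case p of (c, s) \<Rightarrow> of_nat (card (cut_stab c S s)) \<odot>\<^bsub>fobj M S\<^esub>
     orbit_map M (cut_stab c S s) (orb (cut_stab c S s)) S (base_pt (cut_stab c S s)) s (x (c, s)))" if p: "p \<in> index S" for p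
  proof -
    obtain c s where cs: "p = (c, s)" "(c, s) \<in> index S" using p by (cases p) auto
    note o = xo_PF[OF M idxD(1,3)[OF cs(2)]]
    show ?thesis
      using ks_ot[OF S cs(2)] phi_carrier[OF PF_fam[OF _ cs(2)]] psi_term[OF S _ cs(2)]
      by (simp add: cs fmod_simps[OF X] o V.smult_r_distr' V.smult_smult mult.commute)
  qed
  then show ?thesis unfolding assemble_def by (rule lin_finsum_maps[OF fmod_mod[OF X S] V.rat_module_axioms])
qed

lemma psi_closed: "finite_gset G S \<Longrightarrow> x \<in> family (coeff_of M) S \<Longrightarrow> assemble M S x \<in> carrier (fobj M S)"
  using psi_lin fmod_simps(1)[OF PF_Ob[OF M]] by blast

text \<open>The double coset formula, applied to each summand of \<open>assemble\<close>, yields a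
  term for each class and each point of the apex. Where the hull has become smaller than
  \<open>rep c\<close> the term vanishes by \<open>phi_vanish\<close>; the others are indexed by
  \<open>index (apex w)\<close>.\<close>

lemma mact_psi:
  fixes w :: "('a, 'u, 's) gspan"
  assumes S: "finite_gset G S" and T: "finite_gset G T" and w: "w \<in> spans G TS S T" and x: "x \<in> family (coeff_of M) S"
  shows "span_map M S T w (assemble M S x) = finsum (fobj M T) (\<lambda>(c, u). of_nat (card (cut_stab c (apex w) u)) \<odot>\<^bsub>fobj M T\<^esub>
     orbit_map M (cut_stab c (apex w) u) (orb (cut_stab c S (lleg w u))) T (base_pt (cut_stab c S (lleg w u))) (rleg w u) (x (c, lleg w u))) (index (apex w))"
proof -
  interpret VS: rat_module "fobj M S" by (rule mk_mod[OF M S])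
  interpret VT: rat_module "fobj M T" by (rule mk_mod[OF M T])
  note W = spansD[OF w]
  let ?U = "apex w"
  note wl = mact_lin[OF M S T w]
  let ?F = "\<lambda>(c, u). of_nat (card (cut_stab c ?U u)) \<odot>\<^bsub>fobj M T\<^esub>
     orbit_map M (cut_stab c ?U u) (orb (cut_stab c S (lleg w u))) T (base_pt (cut_stab c S (lleg w u))) (rleg w u) (x (c, lleg w u))"
  \<comment> \<open>Indices before cancellation: the condition on the hull holds at
    \<open>lleg w u\<close> but not necessarily at \<open>u\<close>.\<close>
  let ?C = "{(c, u). (c, lleg w u) \<in> index S \<and> u \<in> pts ?U}"
  have KU: "cut_stab c S (lleg w u) \<inter> stab ?U u = cut_stab c ?U u" if "u \<in> pts ?U" for c u
    using stab_hom[OF W(1,2) that] by (auto simp: cut_stab_def)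
  have ok: "cut_stab c ?U u \<subseteq> stab (orb (cut_stab c S (lleg w u))) (base_pt (cut_stab c S (lleg w u)))" "(cut_stab c ?U u, stab T (rleg w u)) \<in> TS"
    "rleg w u \<in> pts T" "subgroup (cut_stab c S (lleg w u)) G" "subgroup (cut_stab c ?U u) G" if "(c, u) \<in> ?C" for c u
  proof -
    have i: "(c, lleg w u) \<in> index S" "u \<in> pts ?U" using that by auto
    note d = idxD[OF i(1)]
    show s: "subgroup (cut_stab c S (lleg w u)) G" by (rule vs_subgroup[OF d(3)])
    show "subgroup (cut_stab c ?U u) G" by (rule ks_subgroup[OF W(1) i(2) d(1)])
    show "cut_stab c ?U u \<subseteq> stab (orb (cut_stab c S (lleg w u))) (base_pt (cut_stab c S (lleg w u)))"
      unfolding bpt_stab[OF s] by (rule ks_hom[OF W(1,2) i(2)])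
    show "(cut_stab c ?U u, stab T (rleg w u)) \<in> TS" by (rule O_trans[OF ks_O[OF W(1) i(2) d(1)] W(4)[OF i(2)]])
    show "rleg w u \<in> pts T" by (rule gset_homD(1)[OF W(3) i(2)])
  qed
  have Fc: "?F q \<in> carrier (fobj M T)" if "q \<in> ?C" for q
  proof -
    note q0 = that
    obtain c u where q: "q = (c, u)" "(c, u) \<in> ?C" "(c, lleg w u) \<in> index S" using q0 by (cases q) auto
    show ?thesis
      using ot_closed[OF M orb_gset[OF ok(4)[OF q(2)]] bpt_mem[OF ok(4)[OF q(2)]] ok(1)[OF q(2)] T ok(3)[OF q(2)] ok(2)[OF q(2)] phi_carrier[OF PF_fam[OF x q(3)]]]
      by (simp add: q(1))
  qed
  note Fc' = Fc[of "(c, u)" for c u, simplified]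
  have "span_map M S T w (assemble M S x) = finsum (fobj M T) (\<lambda>p. span_map M S T w (case p of (c, s) \<Rightarrow> of_nat (card (cut_stab c S s)) \<odot>\<^bsub>fobj M S\<^esub>
     orbit_map M (cut_stab c S s) (orb (cut_stab c S s)) S (base_pt (cut_stab c S s)) s (x (c, s)))) (index S)"
    unfolding assemble_def
    by (rule lin_finsum[OF VS.rat_module_axioms VT.rat_module_axioms wl]) (use psi_term[OF S x] in auto)
  also have "\<dots> = finsum (fobj M T) (\<lambda>p. finsum (fobj M T) (\<lambda>u. ?F (fst p, u)) {u \<in> pts ?U. lleg w u = snd p}) (index S)"
  proof (rule VT.M.finsum_cong'[OF refl])
    show "(\<lambda>p. finsum (fobj M T) (\<lambda>u. ?F (fst p, u)) {u \<in> pts ?U. lleg w u = snd p}) \<in> index S \<rightarrow> carrier (fobj M T)"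
      by (rule funcsetI, rule VT.M.finsum_closed, rule funcsetI, rule Fc) auto
    fix p assume "p \<in> index S"
    then obtain c s where p: "p = (c, s)" "(c, s) \<in> index S" by (cases p) auto
    note d = idxD[OF p(2)] and Ks = vs_subgroup[OF idxD(3)[OF p(2)]]
    let ?K = "cut_stab c S s"
    have b: "?K \<subseteq> stab (orb ?K) (base_pt ?K)" by (simp add: bpt_stab[OF Ks])
    have "span_map M S T w (of_nat (card ?K) \<odot>\<^bsub>fobj M S\<^esub> orbit_map M ?K (orb ?K) S (base_pt ?K) s (x (c, s)))
      = of_nat (card ?K) \<odot>\<^bsub>fobj M T\<^esub> span_map M S T w (orbit_map M ?K (orb ?K) S (base_pt ?K) s (x (c, s)))"
      using wl psi_term[OF S x p(2)] by blast
    also have "\<dots> = finsum (fobj M T) (\<lambda>u. of_nat (card (?K \<inter> stab ?U u)) \<odot>\<^bsub>fobj M T\<^esub>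
      orbit_map M (?K \<inter> stab ?U u) (orb ?K) T (base_pt ?K) (rleg w u) (x (c, s))) {u \<in> pts ?U. lleg w u = s}"
      by (rule double_coset[OF M orb_gset[OF Ks] bpt_mem[OF Ks] b S d(2) ks_O[OF S d(2,1)] T w phi_carrier[OF PF_fam[OF x p(2)]]])
    also have "\<dots> = finsum (fobj M T) (\<lambda>u. ?F (c, u)) {u \<in> pts ?U. lleg w u = s}"
      by (rule VT.M.finsum_cong'[OF refl], rule funcsetI, rule Fc) (use p KU in auto)
    finally show "span_map M S T w (case p of (c, s) \<Rightarrow> of_nat (card (cut_stab c S s)) \<odot>\<^bsub>fobj M S\<^esub>
     orbit_map M (cut_stab c S s) (orb (cut_stab c S s)) S (base_pt (cut_stab c S s)) s (x (c, s))) =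
      finsum (fobj M T) (\<lambda>u. ?F (fst p, u)) {u \<in> pts ?U. lleg w u = snd p}" by (simp add: p)
  qed
  also have "\<dots> = finsum (fobj M T) (\<lambda>q. ?F (fst (fst q, lleg w (snd q)), snd q)) ?C"
    by (rule VT.finsum_Sigma_reindex[where k = "\<lambda>p u. (fst p, u)"])
      (use idx_finite[OF S] gset_finite[OF W(1)] in \<open>auto intro!: Fc'\<close>)
  also have "\<dots> = finsum (fobj M T) ?F ?C" by (simp add: split_def)
  also have "\<dots> = finsum (fobj M T) ?F (index ?U)"
  proof (rule VT.M.add.finprod_mono_neutral_cong_right)
    have "?C \<subseteq> SubO_classes \<times> pts ?U" by (auto simp: index_def)
    then show "finite ?C" using finite_Cl gset_finite[OF W(1)] finite_subset by blast
    show "index ?U \<subseteq> ?C" using idx_hom[OF W(1) S W(2)] idxD(2) by fast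
    show "?F \<in> ?C \<rightarrow> carrier (fobj M T)" by (rule funcsetI) (rule Fc)
    show "?F q = \<zero>\<^bsub>fobj M T\<^esub>" if "q \<in> ?C - index ?U" for q
    proof -
      note q0 = that
      obtain c u where q: "q = (c, u)" "(c, u) \<in> ?C" "(c, u) \<notin> index ?U" using q0 by (cases q) auto
      have i: "(c, lleg w u) \<in> index S" "u \<in> pts ?U" using q(2) by auto
      note d = idxD[OF i(1)] and o = ok[OF q(2)]
      let ?K = "cut_stab c S (lleg w u)" and ?J = "cut_stab c ?U u"
      have J: "?J \<subseteq> ?K" by (rule ks_hom[OF W(1,2) i(2)])
      have "\<not> ?K \<subseteq> hullO ?J"
      proof
        assume "?K \<subseteq> hullO ?J"
        then have "hullO ?K \<subseteq> hullO ?J" by (rule hull_least[OF subgroup_carrier[OF o(4)] hull_SO[OF subgroup_carrier[OF o(5)]]])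
        moreover have "hullO ?J \<subseteq> hullO ?K" by (rule hull_mono[OF J subgroup_carrier[OF o(4)]])
        ultimately have "hull_rep c ?J" using vs_hO[OF d(3)] o(5) by (simp add: hull_rep_def)
        then show False using q(3) d(1) i(2) by (simp add: index_def)
      qed
      then have z: "restr_orb M ?J ?K (base_pt ?K) (x (c, lleg w u)) = \<zero>\<^bsub>fobj M (orb ?J)\<^esub>"
        by (intro phi_vanish[OF M o(4) PF_fam[OF x i(1)] bpt_mem[OF o(4)] o(5) o(1)]) (simp add: bpt_stab[OF o(4)])
      have b: "?J \<subseteq> stab (orb ?J) (base_pt ?J)" by (simp add: bpt_stab[OF o(5)])
      have "orbit_map M ?J (orb ?K) T (base_pt ?K) (rleg w u) (x (c, lleg w u)) = \<zero>\<^bsub>fobj M T\<^esub>"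
        unfolding ot_factor[OF orb_gset[OF o(4)] bpt_mem[OF o(4)] o(1) T o(3,2) phi_carrier[OF PF_fam[OF x i(1)]]] z
        by (rule lin_zero[OF orb_mod[OF M o(5)] VT.rat_module_axioms ot_lin[OF orb_gset[OF o(5)] bpt_mem[OF o(5)] b T o(3,2)]])
      then show ?thesis by (simp add: q)
    qed
  qed simp
  finally show ?thesis .
qed

text \<open>Both sides equal the sum over \<open>index (apex w)\<close> of \<open>mact_psi\<close>.
  Grouping it by images under the right leg yields the terms of \<open>span_act\<close>, because by
  \<open>wset_idx\<close> every indexed point is a fixed point of its fibre.\<close>

lemma psi_natural:
  assumes S: "finite_gset G S" and T: "finite_gset G T" and w: "w \<in> spans G TS S T" and x: "x \<in> family (coeff_of M) S"
  shows "assemble M T (span_act (coeff_of M) S T w x) = span_map M S T w (assemble M S x)"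
proof -
  note X = PF_Ob[OF M] and W = spansD[OF w]
  let ?U = "apex w"
  interpret VT: rat_module "fobj M T" by (rule mk_mod[OF M T])
  let ?F = "\<lambda>(c, u). of_nat (card (cut_stab c ?U u)) \<odot>\<^bsub>fobj M T\<^esub>
     orbit_map M (cut_stab c ?U u) (orb (cut_stab c S (lleg w u))) T (base_pt (cut_stab c S (lleg w u))) (rleg w u) (x (c, lleg w u))"
  have t: "(c, rleg w u) \<in> index T" "u \<in> fixed_fibre c w T (rleg w u)" if "(c, u) \<in> index ?U" for c u
    using idx_hom[OF W(1) T W(3) that] wset_idx[OF w that] by auto
  \<comment> \<open>On \<open>fixed_fibre\<close> the subgroups cut out at \<open>u\<close> and at
    \<open>t\<close> coincide, so weight and transfer can be taken inside the sum that defines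
    \<open>span_act\<close>.\<close>
  have E: "of_nat (card (cut_stab c T t)) \<odot>\<^bsub>fobj M T\<^esub> orbit_map M (cut_stab c T t) (orb (cut_stab c T t)) T (base_pt (cut_stab c T t)) t (span_act (coeff_of M) S T w x (c, t))
    = finsum (fobj M T) (\<lambda>u. ?F (c, u)) (fixed_fibre c w T t)" and Fc: "\<And>u. u \<in> fixed_fibre c w T t \<Longrightarrow> ?F (c, u) \<in> carrier (fobj M T)" if t: "(c, t) \<in> index T" for c t
  proof -
    note d = idxD[OF t] and Ks = vs_subgroup[OF idxD(3)[OF t]]
    let ?K = "cut_stab c T t"
    let ?r = "\<lambda>u. restr_orb M ?K (cut_stab c S (lleg w u)) (base_pt (cut_stab c S (lleg w u))) (x (c, lleg w u))"
    have r: "coeff_res (coeff_of M) c ?K (cut_stab c S (lleg w u)) \<one> (x (c, lleg w u)) = ?r u" "?r u \<in> phi M ?K"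
      "orbit_map M ?K (orb ?K) T (base_pt ?K) t (?r u) = orbit_map M ?K (orb (cut_stab c S (lleg w u))) T (base_pt (cut_stab c S (lleg w u))) t (x (c, lleg w u))"
      if u: "u \<in> fixed_fibre c w T t" for u
    proof -
      note D = wset_D[OF S w t u]
      note e = idxD[OF D(4)] and Ls = vs_subgroup[OF idxD(3)[OF D(4)]]
      have cj1: "conjg \<one> (cut_stab c S (lleg w u)) = cut_stab c S (lleg w u)" by (rule cj_one[OF subgroup_carrier[OF Ls]])
      have b: "?K \<subseteq> stab (orb (cut_stab c S (lleg w u))) (base_pt (cut_stab c S (lleg w u)))" using D(5) by (simp add: bpt_stab[OF Ls])
      show "coeff_res (coeff_of M) c ?K (cut_stab c S (lleg w u)) \<one> (x (c, lleg w u)) = ?r u"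
        using xm_PF[OF M d(1,3) e(3) nz_one[OF d(1)] _ PF_fam[OF x D(4)]] cj1 D(5) act_one[OF orb_gset[OF Ls] bpt_mem[OF Ls]] by simp
      show "?r u \<in> phi M ?K" by (rule phi_res[OF M Ks Ls bpt_mem[OF Ls] b PF_fam[OF x D(4)]])
      show "orbit_map M ?K (orb ?K) T (base_pt ?K) t (?r u) = orbit_map M ?K (orb (cut_stab c S (lleg w u))) T (base_pt (cut_stab c S (lleg w u))) t (x (c, lleg w u))"
        by (rule ot_factor[OF orb_gset[OF Ls] bpt_mem[OF Ls] b T d(2) ks_O[OF T d(2,1)] phi_carrier[OF PF_fam[OF x D(4)]], symmetric])
    qed
    have kl: "lin (phimod M ?K) (fobj M T) (orbit_map M ?K (orb ?K) T (base_pt ?K) t)"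
      using ks_ot[OF T t] phi_carrier[of _ M] by simp
    have F: "?F (c, u) = of_nat (card ?K) \<odot>\<^bsub>fobj M T\<^esub> orbit_map M ?K (orb ?K) T (base_pt ?K) t (?r u)" if u: "u \<in> fixed_fibre c w T t" for u
      using r(3)[OF u] u by (simp add: fixed_fibre_def)
    show Fc: "?F (c, u) \<in> carrier (fobj M T)" if u: "u \<in> fixed_fibre c w T t" for u
      unfolding F[OF u] using kl r(2)[OF u] by simp
    have "span_act (coeff_of M) S T w x (c, t) = finsum (phimod M ?K) ?r (fixed_fibre c w T t)"
      unfolding wact_apply[OF X t] xo_PF[OF M d(1,3)]
      by (rule abelian_monoid.finsum_cong')
        (use r phi_mod[OF M Ks] in \<open>auto simp: rat_module_def module_def abelian_group_def\<close>)
    then have "orbit_map M ?K (orb ?K) T (base_pt ?K) t (span_act (coeff_of M) S T w x (c, t)) = finsum (fobj M T) (\<lambda>u. orbit_map M ?K (orb ?K) T (base_pt ?K) t (?r u)) (fixed_fibre c w T t)"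
      using lin_finsum[OF phi_mod[OF M Ks] VT.rat_module_axioms kl, of "fixed_fibre c w T t" ?r] r(2) by simp
    then have "of_nat (card ?K) \<odot>\<^bsub>fobj M T\<^esub> orbit_map M ?K (orb ?K) T (base_pt ?K) t (span_act (coeff_of M) S T w x (c, t)) =
       finsum (fobj M T) (\<lambda>u. of_nat (card ?K) \<odot>\<^bsub>fobj M T\<^esub> orbit_map M ?K (orb ?K) T (base_pt ?K) t (?r u)) (fixed_fibre c w T t)"
      using VT.smult_finsum[of "fixed_fibre c w T t" "\<lambda>u. orbit_map M ?K (orb ?K) T (base_pt ?K) t (?r u)"] kl r(2) by simp
    also have "\<dots> = finsum (fobj M T) (\<lambda>u. ?F (c, u)) (fixed_fibre c w T t)"
      by (rule VT.M.finsum_cong'[OF refl], rule funcsetI, rule Fc) (simp_all only: F)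
    finally show "of_nat (card ?K) \<odot>\<^bsub>fobj M T\<^esub> orbit_map M ?K (orb ?K) T (base_pt ?K) t (span_act (coeff_of M) S T w x (c, t)) =
       finsum (fobj M T) (\<lambda>u. ?F (c, u)) (fixed_fibre c w T t)" .
  qed
  have "assemble M T (span_act (coeff_of M) S T w x) = finsum (fobj M T) (\<lambda>p. finsum (fobj M T) (\<lambda>u. ?F (fst p, u)) (fixed_fibre (fst p) w T (snd p))) (index T)"
    unfolding assemble_def
  proof (rule VT.M.finsum_cong'[OF refl])
    show "(\<lambda>p. finsum (fobj M T) (\<lambda>u. ?F (fst p, u)) (fixed_fibre (fst p) w T (snd p))) \<in> index T \<rightarrow> carrier (fobj M T)"
      by (rule funcsetI, rule VT.M.finsum_closed, rule funcsetI) (rule Fc, auto)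
  qed (use E in auto)
  also have "\<dots> = finsum (fobj M T) (\<lambda>q. ?F (fst (fst q, rleg w (snd q)), snd q)) (index ?U)"
  proof (rule VT.finsum_Sigma_reindex[where k = "\<lambda>p u. (fst p, u)"])
    show "finite (index T)" by (rule idx_finite[OF T])
    show "finite (fixed_fibre (fst p) w T (snd p))" for p by (rule wset_finite[OF w])
    show "?F (fst p, u) \<in> carrier (fobj M T)" if "p \<in> index T" "u \<in> fixed_fibre (fst p) w T (snd p)" for p u
      by (rule Fc[of _ "snd p"]) (use that in auto)
    show "(fst p, u) \<in> index ?U \<and> (fst (fst p, u), rleg w (snd (fst p, u))) = p \<and> snd (fst p, u) = u"
      if "p \<in> index T" "u \<in> fixed_fibre (fst p) w T (snd p)" for p u
      using wset_D(2,3)[OF S w, of "fst p" "snd p" u] that by simp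
    show "(fst q, rleg w (snd q)) \<in> index T \<and> snd q \<in> fixed_fibre (fst (fst q, rleg w (snd q))) w T (snd (fst q, rleg w (snd q))) \<and>
       (fst (fst q, rleg w (snd q)), snd q) = q" if "q \<in> index ?U" for q
      using t[of "fst q" "snd q"] that by simp
  qed
  also have "\<dots> = span_map M S T w (assemble M S x)"
    unfolding mact_psi[OF S T w x] by (simp add: split_def)
  finally show ?thesis .
qed

end

section \<open>Bijectivity of \<open>assemble\<close>\<close>

context
  fixes M :: "('a, 's, 'v) mackey_functor"
  assumes M: "is_mackey M"
begin

lemma nz_card_pos: "c \<in> SubO_classes \<Longrightarrow> card (norm_rep c) > 0"
  using subgroup.finite_imp_card_positive[OF nz_subgroup fin] by blast

text \<open>Such a point is a translate of the base point by the normalizer, and at the base point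
  the orbit span is the identity span.\<close>

lemma orb_idx_term:
  assumes c: "c \<in> SubO_classes" and K: "hull_rep c K" and u: "(c, u) \<in> index (orb K)" and z: "z \<in> carrier (fobj M (orb K))"
  shows "orbit_map M (cut_stab c (orb K) u) (orb K) (orb K) u u z = z" "card (cut_stab c (orb K) u) = card K"
proof -
  note Ks = vs_subgroup[OF K]
  obtain g where g: "g \<in> norm_rep c" "u = act (orb K) g (base_pt K)" using idx_orb(3)[OF c K u] by blast
  have k: "cut_stab c (orb K) u = conjg g K" using idx_orb_nz(2)[OF c K g(1)] g(2) by simp
  note gc = nz_cl[OF c g(1)]
  show "card (cut_stab c (orb K) u) = card K" unfolding k by (rule cj_card[OF subgroup_carrier[OF Ks] gc])
  have "orbit_map M (conjg g K) (orb K) (orb K) (act (orb K) g (base_pt K)) (act (orb K) g (base_pt K)) = orbit_map M K (orb K) (orb K) (base_pt K) (base_pt K)"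
    by (rule ot_conj[OF M orb_gset[OF Ks] bpt_mem[OF Ks] _ orb_gset[OF Ks] bpt_mem[OF Ks] _ gc])
      (simp_all add: bpt_stab[OF Ks] O_refl[OF Ks])
  then show "orbit_map M (cut_stab c (orb K) u) (orb K) (orb K) u u z = z" unfolding k unfolding g(2) using ot_bpt[OF M Ks z] by simp
qed

text \<open>Each point of class \<open>c\<close> contributes \<open>card K\<close> times
  \<open>z\<close>, and by \<open>idx_orb_card\<close> these contributions add up to the order of
  the normalizer times \<open>z\<close>.\<close>

lemma finsum_idx_orb:
  assumes c: "c \<in> SubO_classes" and K: "hull_rep c K" and z: "z \<in> carrier (fobj M (orb K))"
    and F: "\<And>u. (c, u) \<in> index (orb K) \<Longrightarrow> F (c, u) = of_nat (card (cut_stab c (orb K) u)) \<odot>\<^bsub>fobj M (orb K)\<^esub> orbit_map M (cut_stab c (orb K) u) (orb K) (orb K) u u z"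
    and F0: "\<And>d u. (d, u) \<in> index (orb K) \<Longrightarrow> d \<noteq> c \<Longrightarrow> F (d, u) = \<zero>\<^bsub>fobj M (orb K)\<^esub>"
  shows "finsum (fobj M (orb K)) F (index (orb K)) = of_nat (card (norm_rep c)) \<odot>\<^bsub>fobj M (orb K)\<^esub> z"
proof -
  note Ks = vs_subgroup[OF K]
  interpret V: rat_module "fobj M (orb K)" by (rule orb_mod[OF M Ks])
  let ?V = "fobj M (orb K)"
  let ?B = "{u. (c, u) \<in> index (orb K)}"
  have F1: "F (c, u) = of_nat (card K) \<odot>\<^bsub>?V\<^esub> z" if "u \<in> ?B" for u
    using F[of u] orb_idx_term[OF c K _ z, of u] that by simp
  have fi: "finite (index (orb K))" by (rule idx_finite[OF orb_gset[OF Ks]])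
  have sub: "Pair c ` ?B \<subseteq> index (orb K)" by auto
  have fB: "finite ?B"
    by (rule finite_subset[of _ "snd ` index (orb K)"]) (use fi in force)+
  have "finsum ?V F (index (orb K)) = finsum ?V F (Pair c ` ?B)"
  proof (rule V.M.add.finprod_mono_neutral_cong_right[OF fi sub])
    show "F q = \<zero>\<^bsub>?V\<^esub>" if "q \<in> index (orb K) - Pair c ` ?B" for q
      using F0[of "fst q" "snd q"] that by (cases q) auto
    show "F \<in> index (orb K) \<rightarrow> carrier ?V"
    proof (rule funcsetI)
      fix q assume "q \<in> index (orb K)"
      then obtain d u where q: "q = (d, u)" "(d, u) \<in> index (orb K)" by (cases q) auto
      then show "F q \<in> carrier ?V" using F0[OF q(2)] F1[of u] z by (cases "d = c") auto
    qed
  qed simp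
  also have "\<dots> = finsum ?V (\<lambda>u. F (c, u)) ?B"
    by (rule V.M.finsum_reindex) (use F1 z in \<open>auto simp: inj_on_def\<close>)
  also have "\<dots> = finsum ?V (\<lambda>u. of_nat (card K) \<odot>\<^bsub>?V\<^esub> z) ?B"
    by (rule V.M.finsum_cong') (use F1 z in auto)
  also have "\<dots> = of_nat (card ?B) \<odot>\<^bsub>?V\<^esub> (of_nat (card K) \<odot>\<^bsub>?V\<^esub> z)"
    by (rule V.finsum_const_rat) (use z fB in auto)
  also have "\<dots> = of_nat (card (norm_rep c)) \<odot>\<^bsub>?V\<^esub> z"
    using z by (simp add: V.smult_smult flip: idx_orb_card[OF c K])
  finally show ?thesis .
qed

text \<open>The triangular shape with its diagonal entry: classes other than \<open>c\<close> on
  \<open>G/K\<close> have smaller hulls, where \<open>y\<close> vanishes by hypothesis, and the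
  terms of class \<open>c\<close> add up to the order of the normalizer times
  \<open>y (c, t)\<close>.\<close>

lemma psi_res:
  assumes S: "finite_gset G S" and y: "y \<in> family (coeff_of M) S" and t: "(c, t) \<in> index S"
    and z: "\<And>d s. (d, s) \<in> index S \<Longrightarrow> card (rep d) < card (rep c) \<Longrightarrow> y (d, s) = \<zero>\<^bsub>fobj M (orb (cut_stab d S s))\<^esub>"
  shows "restr M S (orb (cut_stab c S t)) (pt_map (cut_stab c S t) S t) (assemble M S y) = of_nat (card (norm_rep c)) \<odot>\<^bsub>fobj M (orb (cut_stab c S t))\<^esub> y (c, t)"
proof -
  note d = idxD[OF t]
  let ?K = "cut_stab c S t"
  note Ks = vs_subgroup[OF d(3)]
  note OK = orb_gset[OF Ks]
  let ?V = "fobj M (orb ?K)"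
  interpret V: rat_module ?V by (rule orb_mod[OF M Ks])
  have pmh: "pt_map ?K S t \<in> gset_hom G (orb ?K) S" by (rule pm_hom[OF Ks S d(2) ks_sub])
  let ?w = "restr_span (orb ?K) (pt_map ?K S t)"
  have w: "?w \<in> spans G TS S (orb ?K)" by (rule rsp_spans[OF OK pmh])
  let ?F = "\<lambda>(d, u). of_nat (card (cut_stab d (orb ?K) u)) \<odot>\<^bsub>?V\<^esub>
     orbit_map M (cut_stab d (orb ?K) u) (orb (cut_stab d S (pt_map ?K S t u))) (orb ?K) (base_pt (cut_stab d S (pt_map ?K S t u))) ((\<lambda>x\<in>pts (orb ?K). x) u) (y (d, pt_map ?K S t u))"
  have yt: "y (c, t) \<in> carrier ?V" by (rule phi_carrier[OF PF_fam[OF M y t]])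
  have "restr M S (orb ?K) (pt_map ?K S t) (assemble M S y) = finsum ?V ?F (index (orb ?K))"
    using mact_psi[OF M S OK w y] by (simp add: restr_span_def)
  also have "\<dots> = of_nat (card (norm_rep c)) \<odot>\<^bsub>?V\<^esub> y (c, t)"
  proof (rule finsum_idx_orb[OF d(1,3) yt])
    fix u assume u: "(c, u) \<in> index (orb ?K)"
    obtain g where g: "g \<in> norm_rep c" "u = act (orb ?K) g (base_pt ?K)" using idx_orb(3)[OF d(1,3) u] by blast
    note gc = nz_cl[OF d(1) g(1)]
    have pu: "pt_map ?K S t u = act S g t" unfolding g(2) by (rule pm_act[OF Ks S d(2) ks_sub gc])
    have k1: "cut_stab c (orb ?K) u = conjg g ?K" using idx_orb_nz(2)[OF d(1,3) g(1)] g(2) by simp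
    have k2: "cut_stab c S (act S g t) = conjg g ?K" by (rule ks_act[OF S d(2,1) g(1)])
    note L = cj_subgroup[OF Ks gc]
    have up: "u \<in> pts (orb ?K)" "stab (orb ?K) u = conjg g ?K" using orb_nz_stab[OF d(1,3) g(1)] g(2) by auto
    \<comment> \<open>By equivariance the value of \<open>y\<close> at the translate of
      \<open>t\<close> is a restriction of \<open>y (c, t)\<close>, so the term takes the form that
      \<open>finsum_idx_orb\<close> expects.\<close>
    have "orbit_map M (conjg g ?K) (orb (conjg g ?K)) (orb ?K) (base_pt (conjg g ?K)) u (restr_orb M (conjg g ?K) ?K u (y (c, t))) = orbit_map M (conjg g ?K) (orb ?K) (orb ?K) u u (y (c, t))"
      by (rule ot_factor[OF M OK up(1) _ OK up(1) _ yt, symmetric]) (simp_all add: up(2) O_refl[OF L])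
    then show "?F (c, u) = of_nat (card (cut_stab c (orb ?K) u)) \<odot>\<^bsub>?V\<^esub> orbit_map M (cut_stab c (orb ?K) u) (orb ?K) (orb ?K) u u (y (c, t))"
      using PF_fam_act[OF M S y t g(1)] up(1) by (simp add: pu k1 k2 g(2)[symmetric])
  next
    fix e u assume u: "(e, u) \<in> index (orb ?K)" and ne: "e \<noteq> c"
    note f = idxD[OF u] and Js = vs_subgroup[OF idxD(3)[OF u]]
    have lt: "card (rep e) < card (rep c)" using idx_orb(1,2)[OF d(1,3) u] ne by fastforce
    have pu: "(e, pt_map ?K S t u) \<in> index S" by (rule idx_hom[OF OK S pmh u])
    note Ls = vs_subgroup[OF idxD(3)[OF pu]]
    have "lin (fobj M (orb (cut_stab e S (pt_map ?K S t u)))) ?V (orbit_map M (cut_stab e (orb ?K) u) (orb (cut_stab e S (pt_map ?K S t u))) (orb ?K) (base_pt (cut_stab e S (pt_map ?K S t u))) u)"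
      by (rule ot_lin[OF M orb_gset[OF Ls] bpt_mem[OF Ls] _ OK f(2) ks_O[OF OK f(2,1)]])
        (simp add: bpt_stab[OF Ls] ks_hom[OF OK pmh f(2)])
    from lin_zero[OF orb_mod[OF M Ls] V.rat_module_axioms this] show "?F (e, u) = \<zero>\<^bsub>?V\<^esub>"
      using z[OF pu lt] f(2) by simp
  qed
  finally show ?thesis .
qed

text \<open>The family on \<open>G/K\<close> generated by an element of \<open>phi M K\<close>. It
  exhibits \<open>x\<close>, up to the order of the normalizer, as a value of
  \<open>assemble\<close>.\<close>

definition top_fam :: "'a set set \<Rightarrow> 'a set \<Rightarrow> 'v \<Rightarrow> 'a set set \<times> 's \<Rightarrow> 'v" where
  "top_fam c K x = (\<lambda>(d, u)\<in>index (orb K). if d = c then restr_orb M (cut_stab c (orb K) u) K u x else \<zero>\<^bsub>fobj M (orb (cut_stab d (orb K) u))\<^esub>)"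

lemma rsm_zero:
  assumes "subgroup K G" "subgroup K' G" "p \<in> pts (orb K')" "K \<subseteq> stab (orb K') p"
  shows "restr_orb M K K' p \<zero>\<^bsub>fobj M (orb K')\<^esub> = \<zero>\<^bsub>fobj M (orb K)\<^esub>"
  by (rule lin_zero[OF orb_mod[OF M assms(2)] orb_mod[OF M assms(1)] rsm_lin[OF M assms]])

lemma ks_nz:
  assumes S: "finite_gset G S" and s: "(c, s) \<in> index S" and a: "a \<in> norm_rep c"
  shows "act (orb (cut_stab c S s)) a (base_pt (cut_stab c S s)) \<in> pts (orb (cut_stab c S s))"
    "cut_stab c S (act S a s) \<subseteq> stab (orb (cut_stab c S s)) (act (orb (cut_stab c S s)) a (base_pt (cut_stab c S s)))"
    "subgroup (cut_stab c S (act S a s)) G"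
  using orb_nz_stab[OF idxD(1,3)[OF s] a] ks_act[OF S idxD(2,1)[OF s] a] vs_subgroup[OF idxD(3)[OF idx_act[OF S s a]]] by auto

text \<open>The restrictions of one element of \<open>M(S)\<close> satisfy the equivariance required
  of a family; \<open>top_fam\<close> and the corrections in \<open>psi_surj\<close> are built in
  this way.\<close>

lemma rs_family_compat:
  assumes S: "finite_gset G S" and s: "(c, s) \<in> index S" and a: "a \<in> norm_rep c" and x: "x \<in> carrier (fobj M S)"
  shows "restr M S (orb (cut_stab c S (act S a s))) (pt_map (cut_stab c S (act S a s)) S (act S a s)) x =
    restr_orb M (cut_stab c S (act S a s)) (cut_stab c S s) (act (orb (cut_stab c S s)) a (base_pt (cut_stab c S s))) (restr M S (orb (cut_stab c S s)) (pt_map (cut_stab c S s) S s) x)"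
  using rsm_comp[OF M ks_nz(3)[OF S s a] vs_subgroup[OF idxD(3)[OF s]] S idxD(2)[OF s] ks_sub ks_nz(1,2)[OF S s a] x]
    pm_act[OF vs_subgroup[OF idxD(3)[OF s]] S idxD(2)[OF s] ks_sub nz_cl[OF idxD(1)[OF s] a]] by simp

lemma top_fam:
  assumes c: "c \<in> SubO_classes" and K: "hull_rep c K" and x: "x \<in> phi M K"
  shows "top_fam c K x \<in> family (coeff_of M) (orb K)" "assemble M (orb K) (top_fam c K x) = of_nat (card (norm_rep c)) \<odot>\<^bsub>fobj M (orb K)\<^esub> x"
proof -
  note Ks = vs_subgroup[OF K]
  note OK = orb_gset[OF Ks]
  let ?V = "fobj M (orb K)"
  interpret V: rat_module ?V by (rule orb_mod[OF M Ks])
  have T: "top_fam c K x (d, u) = (if d = c then restr_orb M (cut_stab c (orb K) u) K u x else \<zero>\<^bsub>fobj M (orb (cut_stab d (orb K) u))\<^esub>)"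
    if "(d, u) \<in> index (orb K)" for d u using that by (simp add: top_fam_def)
  have Tp: "top_fam c K x (d, u) \<in> phi M (cut_stab d (orb K) u)" if u: "(d, u) \<in> index (orb K)" for d u
  proof -
    note f = idxD[OF u] and Js = vs_subgroup[OF idxD(3)[OF u]]
    interpret W: rat_module "phimod M (cut_stab d (orb K) u)" by (rule phi_mod[OF M Js])
    show ?thesis unfolding T[OF u] using phi_res[OF M Js Ks f(2) ks_sub x] W.M.zero_closed by auto
  qed
  show "top_fam c K x \<in> family (coeff_of M) (orb K)"
  proof (rule PF_famI[OF M OK _ Tp])
    show "top_fam c K x \<in> extensional (index (orb K))" by (simp add: top_fam_def)
    fix d u a assume u: "(d, u) \<in> index (orb K)" and a: "a \<in> norm_rep d"
    note n = ks_nz[OF OK u a] and Js = vs_subgroup[OF idxD(3)[OF u]]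
    show "top_fam c K x (d, act (orb K) a u) = restr_orb M (cut_stab d (orb K) (act (orb K) a u)) (cut_stab d (orb K) u) (act (orb (cut_stab d (orb K) u)) a (base_pt (cut_stab d (orb K) u))) (top_fam c K x (d, u))"
      unfolding T[OF u] T[OF idx_act[OF OK u a]]
      using rsm_zero[OF n(3) Js n(1,2)] rs_family_compat[OF OK u a phi_carrier[OF x]] by (cases "d = c") simp_all
  qed
  show "assemble M (orb K) (top_fam c K x) = of_nat (card (norm_rep c)) \<odot>\<^bsub>?V\<^esub> x"
    unfolding assemble_def
  proof (rule finsum_idx_orb[OF c K phi_carrier[OF x]])
    fix u assume u: "(c, u) \<in> index (orb K)"
    note f = idxD[OF u]
    show "(case (c, u) of (e, s) \<Rightarrow> of_nat (card (cut_stab e (orb K) s)) \<odot>\<^bsub>?V\<^esub> orbit_map M (cut_stab e (orb K) s) (orb (cut_stab e (orb K) s)) (orb K) (base_pt (cut_stab e (orb K) s)) s (top_fam c K x (e, s)))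
       = of_nat (card (cut_stab c (orb K) u)) \<odot>\<^bsub>?V\<^esub> orbit_map M (cut_stab c (orb K) u) (orb K) (orb K) u u x"
      using ot_factor[OF M OK f(2) ks_sub OK f(2) ks_O[OF OK f(2,1)] phi_carrier[OF x]] T[OF u] by simp
  next
    fix d u assume u: "(d, u) \<in> index (orb K)" and ne: "d \<noteq> c"
    show "(case (d, u) of (e, s) \<Rightarrow> of_nat (card (cut_stab e (orb K) s)) \<odot>\<^bsub>?V\<^esub> orbit_map M (cut_stab e (orb K) s) (orb (cut_stab e (orb K) s)) (orb K) (base_pt (cut_stab e (orb K) s)) s (top_fam c K x (e, s)))
       = \<zero>\<^bsub>?V\<^esub>"
      using lin_zero[OF orb_mod[OF M vs_subgroup[OF idxD(3)[OF u]]] V.rat_module_axioms ks_ot[OF M OK u]] T[OF u] ne by simp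
  qed
qed

text \<open>Induction over the order of \<open>rep c\<close>: once the values at smaller hulls
  vanish, \<open>psi_res\<close> shows that restricting \<open>assemble M S y\<close> returns a
  nonzero multiple of \<open>y (c, t)\<close>.\<close>

lemma psi_inj:
  assumes S: "finite_gset G S" and y: "y \<in> family (coeff_of M) S" and z: "assemble M S y = \<zero>\<^bsub>fobj M S\<^esub>"
  shows "(c, t) \<in> index S \<Longrightarrow> y (c, t) = \<zero>\<^bsub>fobj M (orb (cut_stab c S t))\<^esub>"
proof (induction "card (rep c)" arbitrary: c t rule: less_induct)
  case less
  note t = less.prems
  note Ks = vs_subgroup[OF idxD(3)[OF t]]
  interpret V: rat_module "fobj M (orb (cut_stab c S t))" by (rule orb_mod[OF M Ks])
  have "restr M S (orb (cut_stab c S t)) (pt_map (cut_stab c S t) S t) (assemble M S y) = \<zero>\<^bsub>fobj M (orb (cut_stab c S t))\<^esub>"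
    unfolding z by (rule lin_zero[OF mk_mod[OF M S] V.rat_module_axioms mact_lin[OF M S orb_gset[OF Ks] rsp_spans[OF orb_gset[OF Ks] pm_hom[OF Ks S idxD(2)[OF t] ks_sub]]]])
  then have "of_nat (card (norm_rep c)) \<odot>\<^bsub>fobj M (orb (cut_stab c S t))\<^esub> y (c, t) = \<zero>\<^bsub>fobj M (orb (cut_stab c S t))\<^esub>"
    using psi_res[OF S y t less.hyps] by simp
  then show ?case
    by (rule V.smult_eq_zero[rotated 2]) (use nz_card_pos[OF idxD(1)[OF t]] phi_carrier[OF PF_fam[OF M y t]] in auto)
qed

text \<open>In the orbit decomposition of \<open>x\<close> each term factors through the restriction
  to a full stabilizer. After conjugating the hull of the stabilizer to its representative, the
  stabilizer equals the subgroup cut out by \<open>rep c\<close>, so only restrictions covered by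
  the hypothesis occur.\<close>

lemma rs_zero_imp_zero:
  assumes S: "finite_gset G S" and x: "x \<in> carrier (fobj M S)"
    and z: "\<And>c s. (c, s) \<in> index S \<Longrightarrow> restr M S (orb (cut_stab c S s)) (pt_map (cut_stab c S s) S s) x = \<zero>\<^bsub>fobj M (orb (cut_stab c S s))\<^esub>"
  shows "x = \<zero>\<^bsub>fobj M S\<^esub>"
proof -
  interpret V: rat_module "fobj M S" by (rule mk_mod[OF M S])
  have "orbit_map M (stab S u) S S u u x = \<zero>\<^bsub>fobj M S\<^esub>" if u: "u \<in> pts S" for u
  proof -
    let ?L = "stab S u"
    have L: "subgroup ?L G" by (rule stab_subgroup[OF S u])
    note Lc = subgroup_carrier[OF L]
    obtain c g where c: "c \<in> SubO_classes" and g: "g \<in> carrier G" "conjg g (hullO ?L) = rep c" using SO_Cl[OF hull_SO[OF Lc]] by blast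
    let ?s = "act S g u"
    have s: "?s \<in> pts S" "stab S ?s = conjg g ?L" using act_closed[OF S g(1) u] stab_act[OF S g(1) u] by auto
    have "conjg g ?L \<subseteq> rep c" using cj_mono[OF hull_sub[OF Lc], of g] g(2) by simp
    then have k: "cut_stab c S ?s = conjg g ?L" using s(2) by (auto simp: cut_stab_def)
    have "hull_rep c (conjg g ?L)" unfolding hull_rep_def using cj_subgroup[OF L g(1)] hull_cj[OF Lc g(1)] g(2) by simp
    then have i: "(c, ?s) \<in> index S" using c s(1) k by (simp add: index_def)
    note Ks = vs_subgroup[OF idxD(3)[OF i]]
    have "orbit_map M ?L S S u u x = orbit_map M (conjg g ?L) S S ?s ?s x"
      using ot_conj[OF M S u subset_refl S u O_refl[OF L] g(1)] by simp
    also have "\<dots> = orbit_map M (cut_stab c S ?s) (orb (cut_stab c S ?s)) S (base_pt (cut_stab c S ?s)) ?s (restr M S (orb (cut_stab c S ?s)) (pt_map (cut_stab c S ?s) S ?s) x)"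
      unfolding k[symmetric] by (rule ot_factor[OF M S s(1) ks_sub S s(1) ks_O[OF S s(1) c] x])
    also have "\<dots> = \<zero>\<^bsub>fobj M S\<^esub>"
      unfolding z[OF i] by (rule lin_zero[OF orb_mod[OF M Ks] V.rat_module_axioms ks_ot[OF M S i]])
    finally show ?thesis .
  qed
  then have "of_nat (card (carrier G)) \<odot>\<^bsub>fobj M S\<^esub> x = \<zero>\<^bsub>fobj M S\<^esub>"
    unfolding orbit_decomposition[OF M S x] by (intro V.finsum_zero_eq) simp
  then show ?thesis by (rule V.smult_eq_zero[rotated 2]) (use x fin one_closed in \<open>auto simp: card_eq_0_iff\<close>)
qed

text \<open>Further restriction to \<open>?K \<inter> A\<close>, with \<open>A\<close> not
  containing \<open>?K\<close>, strictly shrinks the hull; after conjugation it factors through one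
  of the restrictions assumed to vanish.\<close>

lemma rs_phi:
  assumes S: "finite_gset G S" and x: "x \<in> carrier (fobj M S)" and s: "(c, s) \<in> index S"
    and z: "\<And>d u. (d, u) \<in> index S \<Longrightarrow> card (rep d) < card (rep c) \<Longrightarrow> restr M S (orb (cut_stab d S u)) (pt_map (cut_stab d S u) S u) x = \<zero>\<^bsub>fobj M (orb (cut_stab d S u))\<^esub>"
  shows "restr M S (orb (cut_stab c S s)) (pt_map (cut_stab c S s) S s) x \<in> phi M (cut_stab c S s)"
  unfolding phi_def mem_Collect_eq
proof (intro conjI ballI impI)
  note i = idxD[OF s]
  let ?K = "cut_stab c S s"
  note Ks = vs_subgroup[OF i(3)]
  show "restr M S (orb ?K) (pt_map ?K S s) x \<in> carrier (fobj M (orb ?K))"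
    by (rule mact_closed[OF M S orb_gset[OF Ks] rsp_spans[OF orb_gset[OF Ks] pm_hom[OF Ks S i(2) ks_sub]] x])
  fix A assume A: "A \<in> SubO" "\<not> ?K \<subseteq> A"
  let ?J = "?K \<inter> A"
  note J = SO_inter[OF Ks A(1)]
  note Jc = subgroup_carrier[OF J]
  have Jb: "?J \<subseteq> stab (orb ?K) (base_pt ?K)" using bpt_stab[OF Ks] by simp
  have Js: "?J \<subseteq> stab S s" using ks_sub[of c S s] by blast
  have e: "restr_orb M ?J ?K (base_pt ?K) (restr M S (orb ?K) (pt_map ?K S s) x) = restr M S (orb ?J) (pt_map ?J S s) x"
    using rsm_comp[OF M J Ks S i(2) ks_sub bpt_mem[OF Ks] Jb x] pm_bpt[OF Ks S i(2) ks_sub] by simp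
  have h1: "hullO ?J \<subseteq> rep c" using hull_mono[OF _ subgroup_carrier[OF Ks], of ?J] vs_hO[OF i(3)] by simp
  \<comment> \<open>Otherwise \<open>A\<close> would contain \<open>rep c\<close> and with it
    \<open>?K\<close>.\<close>
  have "hullO ?J \<noteq> rep c" using hull_least[OF Jc A(1)] vs_sub[OF i(3)] A(2) by blast
  then have lt: "card (hullO ?J) < card (rep c)"
    using h1 psubset_card_mono[OF finite_subset[OF rep_sub[OF i(1)] fin]] by blast
  obtain d g where d: "d \<in> SubO_classes" and g: "g \<in> carrier G" "conjg g (hullO ?J) = rep d" using SO_Cl[OF hull_SO[OF Jc]] by blast
  have ltd: "card (rep d) < card (rep c)" using lt cj_card[OF hull_carrier[OF Jc] g(1)] g(2) by simp
  let ?u = "act S g s"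
  have u: "?u \<in> pts S" "stab S ?u = conjg g (stab S s)" using act_closed[OF S g(1) i(2)] stab_act[OF S g(1) i(2)] by auto
  have JL: "conjg g ?J \<subseteq> cut_stab d S ?u"
    using cj_mono[OF Js, of g] cj_mono[OF hull_sub[OF Jc], of g] g(2) u(2) by (simp add: cut_stab_def)
  note L = ks_subgroup[OF S u(1) d]
  have "hull_rep d (conjg g ?J)" unfolding hull_rep_def using cj_subgroup[OF J g(1)] hull_cj[OF Jc g(1)] g(2) by simp
  then have "hull_rep d (cut_stab d S ?u)" by (rule vs_between[OF d _ JL _ L]) (simp add: cut_stab_def)
  then have du: "(d, ?u) \<in> index S" using d u(1) by (simp add: index_def)
  let ?L = "cut_stab d S ?u"
  \<comment> \<open>The translate by \<open>inv g\<close> is chosen so that \<open>?p\<close> maps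
    back to \<open>s\<close>.\<close>
  let ?p = "act (orb ?L) (inv g) (base_pt ?L)"
  have gi: "inv g \<in> carrier G" using g(1) by simp
  have p: "?p \<in> pts (orb ?L)" by (rule act_closed[OF orb_gset[OF L] gi bpt_mem[OF L]])
  have "?J \<subseteq> conjg (inv g) ?L" using JL cj_mono_iff[OF Jc subgroup_carrier[OF L] g(1)] by simp
  then have ps: "?J \<subseteq> stab (orb ?L) ?p" using stab_act[OF orb_gset[OF L] gi bpt_mem[OF L]] bpt_stab[OF L] by simp
  have "pt_map ?L S ?u ?p = s" using pm_act[OF L S u(1) ks_sub gi] act_inv(1)[OF S g(1) i(2)] by simp
  then have "restr M S (orb ?J) (pt_map ?J S s) x = restr_orb M ?J ?L ?p (restr M S (orb ?L) (pt_map ?L S ?u) x)"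
    using rsm_comp[OF M J L S u(1) ks_sub p ps x] by simp
  also have "\<dots> = \<zero>\<^bsub>fobj M (orb ?J)\<^esub>" unfolding z[OF du ltd] by (rule rsm_zero[OF J L p ps])
  finally show "restr_orb M ?J ?K (base_pt ?K) (restr M S (orb ?K) (pt_map ?K S s) x) = \<zero>\<^bsub>fobj M (orb ?J)\<^esub>" using e by simp
qed

text \<open>The restrictions of \<open>x\<close> are killed one hull size after the other, smallest first: then those of the current
  size lie in \<open>phi\<close> by \<open>rs_phi\<close>, and by \<open>psi_res\<close> the correction does not disturb the smaller ones.\<close>

lemma psi_surj:
  assumes S: "finite_gset G S" and x: "x \<in> carrier (fobj M S)"
  shows "\<exists>y\<in>family (coeff_of M) S. assemble M S y = x"
proof -
  let ?V = "fobj M S"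
  interpret V: rat_module ?V by (rule mk_mod[OF M S])
  note X = PF_Ob[OF M]
  interpret W: rat_module "family_mod (coeff_of M) S" by (rule fmod_mod[OF X S])
  let ?r = "\<lambda>c s. restr M S (orb (cut_stab c S s)) (pt_map (cut_stab c S s) S s)"
  have rl: "lin ?V (fobj M (orb (cut_stab c S s))) (?r c s)" if "(c, s) \<in> index S" for c s
    using that by (intro mact_lin[OF M S orb_gset rsp_spans[OF orb_gset pm_hom[OF _ S _ ks_sub]]]) (auto dest: idxD vs_subgroup)
  note pl = psi_lin[OF M S] and pc = psi_closed[OF M S]
  have "\<exists>y\<in>family (coeff_of M) S. \<forall>c s. (c, s) \<in> index S \<longrightarrow> card (rep c) < h \<longrightarrow> ?r c s (x \<ominus>\<^bsub>?V\<^esub> assemble M S y) = \<zero>\<^bsub>fobj M (orb (cut_stab c S s))\<^esub>" for h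
  proof (induction h)
    case 0 show ?case using W.M.zero_closed fmod_simps(1)[OF X] by auto
  next
    case (Suc h)
    then obtain y where y: "y \<in> family (coeff_of M) S"
      and z: "\<And>c s. (c, s) \<in> index S \<Longrightarrow> card (rep c) < h \<Longrightarrow> ?r c s (x \<ominus>\<^bsub>?V\<^esub> assemble M S y) = \<zero>\<^bsub>fobj M (orb (cut_stab c S s))\<^esub>" by blast
    define x' where "x' = x \<ominus>\<^bsub>?V\<^esub> assemble M S y"
    have x': "x' \<in> carrier ?V" unfolding x'_def using x pc[OF y] by simp
    \<comment> \<open>Restricting an assembled family multiplies by the order of the normalizer, so
      the correction is scaled by its inverse.\<close>
    define q :: "'a set set \<Rightarrow> rat" where "q c = inverse (of_nat (card (norm_rep c)))" for c
    define y' where "y' = (\<lambda>(c, s)\<in>index S. if card (rep c) = h then ?r c s (q c \<odot>\<^bsub>?V\<^esub> x') else \<zero>\<^bsub>fobj M (orb (cut_stab c S s))\<^esub>)"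
    have y'e: "y' (c, s) = (if card (rep c) = h then ?r c s (q c \<odot>\<^bsub>?V\<^esub> x') else \<zero>\<^bsub>fobj M (orb (cut_stab c S s))\<^esub>)" if "(c, s) \<in> index S" for c s
      using that by (simp add: y'_def)
    have y': "y' \<in> family (coeff_of M) S"
    proof (rule PF_famI[OF M S])
      show "y' \<in> extensional (index S)" by (simp add: y'_def)
      fix c s assume s: "(c, s) \<in> index S"
      note Ks = vs_subgroup[OF idxD(3)[OF s]]
      interpret P: rat_module "phimod M (cut_stab c S s)" by (rule phi_mod[OF M Ks])
      have "?r c s (q c \<odot>\<^bsub>?V\<^esub> x') \<in> phi M (cut_stab c S s)" if h: "card (rep c) = h"
      proof (rule rs_phi[OF S _ s])
        show "q c \<odot>\<^bsub>?V\<^esub> x' \<in> carrier ?V" using x' by simp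
        fix d u assume u: "(d, u) \<in> index S" "card (rep d) < card (rep c)"
        have "?r d u (q c \<odot>\<^bsub>?V\<^esub> x') = q c \<odot>\<^bsub>fobj M (orb (cut_stab d S u))\<^esub> ?r d u x'" using rl[OF u(1)] x' by blast
        also have "\<dots> = \<zero>\<^bsub>fobj M (orb (cut_stab d S u))\<^esub>"
          using z[OF u(1)] u(2) h rat_module.smult_simps(2)[OF orb_mod[OF M vs_subgroup[OF idxD(3)[OF u(1)]]]] by (simp add: x'_def)
        finally show "?r d u (q c \<odot>\<^bsub>?V\<^esub> x') = \<zero>\<^bsub>fobj M (orb (cut_stab d S u))\<^esub>" .
      qed
      then show "y' (c, s) \<in> phi M (cut_stab c S s)" using P.M.zero_closed by (simp add: y'e[OF s])
      fix a assume a: "a \<in> norm_rep c"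
      show "y' (c, act S a s) = restr_orb M (cut_stab c S (act S a s)) (cut_stab c S s) (act (orb (cut_stab c S s)) a (base_pt (cut_stab c S s))) (y' (c, s))"
        using rs_family_compat[OF S s a, of "q c \<odot>\<^bsub>?V\<^esub> x'"] x' rsm_zero[OF ks_nz(3)[OF S s a] Ks ks_nz(1,2)[OF S s a]]
        by (simp add: y'e[OF s] y'e[OF idx_act[OF S s a]])
    qed
    have s1: "y \<oplus>\<^bsub>family_mod (coeff_of M) S\<^esub> y' \<in> family (coeff_of M) S"
      unfolding fmod_simps(1)[OF X, symmetric] by (rule W.M.a_closed; unfold fmod_simps(1)[OF X]; rule y y')
    have p1: "x \<ominus>\<^bsub>?V\<^esub> assemble M S (y \<oplus>\<^bsub>family_mod (coeff_of M) S\<^esub> y') = x' \<oplus>\<^bsub>?V\<^esub> (-1) \<odot>\<^bsub>?V\<^esub> assemble M S y'"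
    proof -
      have "assemble M S (y \<oplus>\<^bsub>family_mod (coeff_of M) S\<^esub> y') = assemble M S y \<oplus>\<^bsub>?V\<^esub> assemble M S y'" using pl y y' fmod_simps(1)[OF X] by blast
      then show ?thesis
        using x pc[OF y] pc[OF y'] by (simp add: x'_def a_minus_def V.neg_one V.M.minus_add V.M.a_assoc)
    qed
    have "?r c s (x \<ominus>\<^bsub>?V\<^esub> assemble M S (y \<oplus>\<^bsub>family_mod (coeff_of M) S\<^esub> y')) = \<zero>\<^bsub>fobj M (orb (cut_stab c S s))\<^esub>"
      if s: "(c, s) \<in> index S" and h: "card (rep c) < Suc h" for c s
    proof -
      note Ks = vs_subgroup[OF idxD(3)[OF s]]
      interpret P: rat_module "fobj M (orb (cut_stab c S s))" by (rule orb_mod[OF M Ks])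
      have "?r c s (assemble M S y') = of_nat (card (norm_rep c)) \<odot>\<^bsub>fobj M (orb (cut_stab c S s))\<^esub> y' (c, s)"
        by (rule psi_res[OF S y' s]) (use h y'e in auto)
      also have "\<dots> = ?r c s x'"
      proof (cases "card (rep c) = h")
        case True
        have "?r c s (q c \<odot>\<^bsub>?V\<^esub> x') = q c \<odot>\<^bsub>fobj M (orb (cut_stab c S s))\<^esub> ?r c s x'" "?r c s x' \<in> carrier (fobj M (orb (cut_stab c S s)))"
          using rl[OF s] x' by blast+
        then show ?thesis using True nz_card_pos[OF idxD(1)[OF s]] by (simp add: y'e[OF s] P.smult_smult q_def)
      next
        case False
        then show ?thesis using z[OF s] h by (simp add: y'e[OF s] x'_def)
      qed
      finally have e: "?r c s (assemble M S y') = ?r c s x'" .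
      have rc: "?r c s x' \<in> carrier (fobj M (orb (cut_stab c S s)))" using rl[OF s] x' by blast
      have "?r c s (x' \<oplus>\<^bsub>?V\<^esub> (-1) \<odot>\<^bsub>?V\<^esub> assemble M S y') = ?r c s x' \<oplus>\<^bsub>fobj M (orb (cut_stab c S s))\<^esub> ((-1) \<odot>\<^bsub>fobj M (orb (cut_stab c S s))\<^esub> ?r c s (assemble M S y'))"
        using rl[OF s] x' V.smult_closed'[OF pc[OF y'], of "-1"] pc[OF y'] by auto
      then show ?thesis unfolding p1 e using rc by (simp add: P.neg_one P.M.r_neg)
    qed
    then show ?case using s1 by blast
  qed
  \<comment> \<open>No representative has more elements than \<open>G\<close>, so at this stage all
    restrictions of the difference vanish.\<close>
  then obtain y where y: "y \<in> family (coeff_of M) S"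
    and z: "\<And>c s. (c, s) \<in> index S \<Longrightarrow> card (rep c) < Suc (card (carrier G)) \<Longrightarrow> ?r c s (x \<ominus>\<^bsub>?V\<^esub> assemble M S y) = \<zero>\<^bsub>fobj M (orb (cut_stab c S s))\<^esub>" by blast
  have "card (rep c) < Suc (card (carrier G))" if "(c, s) \<in> index S" for c s
    using card_mono[OF fin rep_sub[OF idxD(1)[OF that]]] by simp
  then have "x \<ominus>\<^bsub>?V\<^esub> assemble M S y = \<zero>\<^bsub>?V\<^esub>"
    using z x pc[OF y] by (intro rs_zero_imp_zero[OF S]) auto
  then have "assemble M S y = x" using x pc[OF y] V.M.r_neg1 V.M.minus_equality
    by (metis V.M.add.inv_solve_right' V.M.l_zero V.M.zero_closed a_minus_def)
  then show ?thesis using y by blast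
qed

end

end

section \<open>The equivalence\<close>

text \<open>Pointwise inverses suffice: composing the naturality square of \<open>\<eta>\<close>
  with them on both sides gives their own naturality.\<close>

lemma iso_functor_cat:
  assumes D: "category D" and F: "is_functor C D F" and K: "is_functor C D K"
    and \<eta>: "\<eta> \<in> nat_trans C D F K" and iso: "\<And>a. a \<in> Ob C \<Longrightarrow> iso_mor D (fobj F a) (fobj K a) (\<eta> a)"
  shows "iso_mor (functor_cat C D) F K \<eta>"
proof -
  interpret D: category D by fact
  note FD = is_functorD[OF F] and KD = is_functorD[OF K] and eD = nat_transD[OF \<eta>]
  have "\<forall>a. \<exists>g. a \<in> Ob C \<longrightarrow> g \<in> Mor D (fobj K a) (fobj F a) \<and>
      Cmp D (fobj F a) (fobj K a) (fobj F a) g (\<eta> a) = Idn D (fobj F a) \<and> Cmp D (fobj K a) (fobj F a) (fobj K a) (\<eta> a) g = Idn D (fobj K a)"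
    using iso unfolding iso_mor_def by blast
  then obtain \<theta> where \<theta>: "\<And>a. a \<in> Ob C \<Longrightarrow> \<theta> a \<in> Mor D (fobj K a) (fobj F a)"
    "\<And>a. a \<in> Ob C \<Longrightarrow> Cmp D (fobj F a) (fobj K a) (fobj F a) (\<theta> a) (\<eta> a) = Idn D (fobj F a)"
    "\<And>a. a \<in> Ob C \<Longrightarrow> Cmp D (fobj K a) (fobj F a) (fobj K a) (\<eta> a) (\<theta> a) = Idn D (fobj K a)"
    by metis
  have nat: "Cmp D (fobj K a) (fobj K b) (fobj F b) (\<theta> b) (fmor K a b f) = Cmp D (fobj K a) (fobj F a) (fobj F b) (fmor F a b f) (\<theta> a)"
    if o: "a \<in> Ob C" "b \<in> Ob C" "f \<in> Mor C a b" for a b f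
  proof -
    let ?Fa = "fobj F a" and ?Fb = "fobj F b" and ?Ka = "fobj K a" and ?Kb = "fobj K b"
    let ?Ff = "fmor F a b f" and ?Kf = "fmor K a b f"
    note m = FD(1)[OF o(1)] FD(1)[OF o(2)] KD(1)[OF o(1)] KD(1)[OF o(2)] FD(2)[OF o] KD(2)[OF o] \<theta>(1)[OF o(1)] \<theta>(1)[OF o(2)] eD(1)[OF o(1)] eD(1)[OF o(2)]
    have "Cmp D ?Ka ?Kb ?Fb (\<theta> b) ?Kf = Cmp D ?Ka ?Kb ?Fb (\<theta> b) (Cmp D ?Ka ?Ka ?Kb ?Kf (Cmp D ?Ka ?Fa ?Ka (\<eta> a) (\<theta> a)))"
      using m \<theta>(3)[OF o(1)] by (simp add: D.idn_right)
    also have "Cmp D ?Ka ?Ka ?Kb ?Kf (Cmp D ?Ka ?Fa ?Ka (\<eta> a) (\<theta> a)) = Cmp D ?Ka ?Fa ?Kb (Cmp D ?Fa ?Ka ?Kb ?Kf (\<eta> a)) (\<theta> a)"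
      using m by (intro D.cmp_assoc[symmetric]) auto
    also have "Cmp D ?Fa ?Ka ?Kb ?Kf (\<eta> a) = Cmp D ?Fa ?Fb ?Kb (\<eta> b) ?Ff" using eD(2)[OF o] by simp
    also have "Cmp D ?Ka ?Kb ?Fb (\<theta> b) (Cmp D ?Ka ?Fa ?Kb (Cmp D ?Fa ?Fb ?Kb (\<eta> b) ?Ff) (\<theta> a)) =
      Cmp D ?Ka ?Fa ?Fb (Cmp D ?Fa ?Kb ?Fb (\<theta> b) (Cmp D ?Fa ?Fb ?Kb (\<eta> b) ?Ff)) (\<theta> a)"
      using m by (intro D.cmp_assoc[symmetric]) (auto intro: D.cmp_mor[of ?Fa ?Fb])
    also have "Cmp D ?Fa ?Kb ?Fb (\<theta> b) (Cmp D ?Fa ?Fb ?Kb (\<eta> b) ?Ff) = Cmp D ?Fa ?Fb ?Fb (Cmp D ?Fb ?Kb ?Fb (\<theta> b) (\<eta> b)) ?Ff"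
      using m by (intro D.cmp_assoc[symmetric]) auto
    also have "\<dots> = ?Ff" using m \<theta>(2)[OF o(2)] by (simp add: D.idn_left)
    finally show ?thesis .
  qed
  have "(\<lambda>a\<in>Ob C. \<theta> a) \<in> nat_trans C D K F" using nat \<theta>(1) by (auto simp: nat_trans_def)
  then show ?thesis
    using \<eta> \<theta>(2,3) unfolding iso_mor_def
    by (auto simp: functor_cat_def intro!: bexI[of _ "\<lambda>a\<in>Ob C. \<theta> a"] restrict_ext)
qed

lemma iso_prod_cat:
  assumes "\<And>i. i \<in> I \<Longrightarrow> iso_mor (C i) (a i) (b i) (f i)"
  shows "iso_mor (prod_cat I C) a b (\<lambda>i\<in>I. f i)"
proof -
  have "\<forall>i. \<exists>g. i \<in> I \<longrightarrow> g \<in> Mor (C i) (b i) (a i) \<and> Cmp (C i) (a i) (b i) (a i) g (f i) = Idn (C i) (a i) \<and>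
      Cmp (C i) (b i) (a i) (b i) (f i) g = Idn (C i) (b i)"
    using assms unfolding iso_mor_def by blast
  then obtain g where "\<And>i. i \<in> I \<Longrightarrow> g i \<in> Mor (C i) (b i) (a i) \<and> Cmp (C i) (a i) (b i) (a i) (g i) (f i) = Idn (C i) (a i) \<and>
      Cmp (C i) (b i) (a i) (b i) (f i) (g i) = Idn (C i) (b i)" by metis
  then show ?thesis
    using assms unfolding iso_mor_def
    by (auto simp: prod_cat_def intro!: bexI[of _ "\<lambda>i\<in>I. g i"] restrict_ext)
qed

context disk
begin

section \<open>The two categories and maps of Mackey functors\<close>

abbreviation mackeys :: "(('a, 's, 'v) mackey_functor, ('a, 's, 'v) mackey_map) cat" where
  "mackeys \<equiv> mackey_cat G TS"

lemma mack_simps: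
  "Mor mackeys M M' = nat_trans lindner vect_cat M M'"
  "Cmp mackeys M M' M'' \<theta> \<eta> = (\<lambda>S\<in>Ob lindner. compose (carrier (fobj M S)) (\<theta> S) (\<eta> S))"
  "Idn mackeys M = (\<lambda>S\<in>Ob lindner. \<lambda>x\<in>carrier (fobj M S). x)"
  by (simp_all add: mackey_cat_def full_subcat_def functor_cat_def)

lemma PC_simps:
  "Mor coeffs X Y = (\<Pi>\<^sub>E c\<in>SubO_classes. nat_trans (osrc c) vect_cat (X c) (Y c))"
  "Cmp coeffs X Y Z \<theta> \<eta> = (\<lambda>c\<in>SubO_classes. \<lambda>a\<in>Ob (osrc c). compose (carrier (fobj (X c) a)) (\<theta> c a) (\<eta> c a))"
  "Idn coeffs X = (\<lambda>c\<in>SubO_classes. \<lambda>a\<in>Ob (osrc c). \<lambda>x\<in>carrier (fobj (X c) a). x)"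
  by (simp_all add: prod_cat_def coeff_cat_eq functor_cat_def)

lemma category_mack: "category mackeys"
  unfolding mackey_cat_def by (rule category_full_subcat[OF category_functor_cat[OF category_vect_cat]])

lemma category_PC: "category coeffs"
  by (rule category_prod_cat) (simp add: coeff_cat_eq category_functor_cat[OF category_vect_cat])

context
  fixes M M' :: "('a, 's, 'v) mackey_functor"
  assumes M: "is_mackey M" and M': "is_mackey M'"
begin

context
  fixes \<eta>
  assumes \<eta>: "\<eta> \<in> nat_trans lindner vect_cat M M'"
begin

lemma nat_lin: "finite_gset G S \<Longrightarrow> lin (fobj M S) (fobj M' S) (\<eta> S)"
  using nat_transD(1)[OF \<eta>, of S] by (simp add: vect_mor_iff)

lemma nat_mact:
  assumes S: "finite_gset G S" and T: "finite_gset G T" and w: "w \<in> spans G TS S T" and x: "x \<in> carrier (fobj M S)"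
  shows "\<eta> T (span_map M S T w x) = span_map M' S T w (\<eta> S x)"
proof -
  have "Cmp vect_cat (fobj M S) (fobj M T) (fobj M' T) (\<eta> T) (fmor M S T (cls S T w))
     = Cmp vect_cat (fobj M S) (fobj M' S) (fobj M' T) (fmor M' S T (cls S T w)) (\<eta> S)"
    by (rule nat_transD(2)[OF \<eta>]) (use S T cls_mor[OF w] in auto)
  from fun_cong[OF this, of x] show ?thesis using x by (simp add: compose_eq span_map_def)
qed

lemma nat_rsm:
  assumes "subgroup K G" "subgroup K' G" "p \<in> pts (orb K')" "K \<subseteq> stab (orb K') p" "x \<in> carrier (fobj M (orb K'))"
  shows "\<eta> (orb K) (restr_orb M K K' p x) = restr_orb M' K K' p (\<eta> (orb K') x)"
  by (rule nat_mact[OF orb_gset[OF assms(2)] orb_gset[OF assms(1)]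
    rsp_spans[OF orb_gset[OF assms(1)] pm_hom[OF assms(1) orb_gset[OF assms(2)] assms(3,4)]] assms(5)])

lemma nat_phi:
  assumes K: "subgroup K G" and x: "x \<in> phi M K"
  shows "\<eta> (orb K) x \<in> phi M' K"
  unfolding phi_def mem_Collect_eq
proof (intro conjI ballI impI)
  show "\<eta> (orb K) x \<in> carrier (fobj M' (orb K))" using nat_lin[OF orb_gset[OF K]] phi_carrier[OF x] by blast
  fix A assume A: "A \<in> SubO" "\<not> K \<subseteq> A"
  note J = SO_inter[OF K A(1)]
  have "restr_orb M' (K \<inter> A) K (base_pt K) (\<eta> (orb K) x) = \<eta> (orb (K \<inter> A)) (restr_orb M (K \<inter> A) K (base_pt K) x)"
    by (rule nat_rsm[OF J K bpt_mem[OF K] _ phi_carrier[OF x], symmetric]) (simp add: bpt_stab[OF K])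
  also have "restr_orb M (K \<inter> A) K (base_pt K) x = \<zero>\<^bsub>fobj M (orb (K \<inter> A))\<^esub>" using x A by (simp add: phi_def)
  also have "\<eta> (orb (K \<inter> A)) \<zero>\<^bsub>fobj M (orb (K \<inter> A))\<^esub> = \<zero>\<^bsub>fobj M' (orb (K \<inter> A))\<^esub>"
    by (rule lin_zero[OF orb_mod[OF M J] orb_mod[OF M' J] nat_lin[OF orb_gset[OF J]]])
  finally show "restr_orb M' (K \<inter> A) K (base_pt K) (\<eta> (orb K) x) = \<zero>\<^bsub>fobj M' (orb (K \<inter> A))\<^esub>" .
qed

text \<open>The components at orbits determine \<open>\<eta>\<close> on all assembled elements;
  together with surjectivity of \<open>assemble\<close> this gives faithfulness.\<close>

lemma nat_psi:
  assumes S: "finite_gset G S" and x: "x \<in> family (coeff_of M) S"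
  shows "\<eta> S (assemble M S x) = assemble M' S (\<lambda>(c, s)\<in>index S. \<eta> (orb (cut_stab c S s)) (x (c, s)))"
proof -
  interpret V: rat_module "fobj M S" by (rule mk_mod[OF M S])
  interpret V': rat_module "fobj M' S" by (rule mk_mod[OF M' S])
  note l = nat_lin[OF S]
  have "\<eta> S (assemble M S x) = finsum (fobj M' S) (\<lambda>p. \<eta> S (case p of (c, s) \<Rightarrow> of_nat (card (cut_stab c S s)) \<odot>\<^bsub>fobj M S\<^esub>
     orbit_map M (cut_stab c S s) (orb (cut_stab c S s)) S (base_pt (cut_stab c S s)) s (x (c, s)))) (index S)"
    unfolding assemble_def by (rule lin_finsum[OF V.rat_module_axioms V'.rat_module_axioms l]) (use psi_term[OF M S x] in auto)
  also have "\<dots> = assemble M' S (\<lambda>(c, s)\<in>index S. \<eta> (orb (cut_stab c S s)) (x (c, s)))"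
    unfolding assemble_def
  proof (rule V'.M.finsum_cong'[OF refl])
    let ?x' = "\<lambda>(c, s)\<in>index S. \<eta> (orb (cut_stab c S s)) (x (c, s))"
    have t: "\<eta> S (of_nat (card (cut_stab c S s)) \<odot>\<^bsub>fobj M S\<^esub> orbit_map M (cut_stab c S s) (orb (cut_stab c S s)) S (base_pt (cut_stab c S s)) s (x (c, s)))
      = of_nat (card (cut_stab c S s)) \<odot>\<^bsub>fobj M' S\<^esub> orbit_map M' (cut_stab c S s) (orb (cut_stab c S s)) S (base_pt (cut_stab c S s)) s (?x' (c, s))"
      "orbit_map M' (cut_stab c S s) (orb (cut_stab c S s)) S (base_pt (cut_stab c S s)) s (?x' (c, s)) \<in> carrier (fobj M' S)"
      if s: "(c, s) \<in> index S" for c s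
    proof -
      note i = idxD[OF s] and Ks = vs_subgroup[OF idxD(3)[OF s]]
      have xc: "x (c, s) \<in> carrier (fobj M (orb (cut_stab c S s)))" by (rule phi_carrier[OF PF_fam[OF M x s]])
      have "\<eta> S (orbit_map M (cut_stab c S s) (orb (cut_stab c S s)) S (base_pt (cut_stab c S s)) s (x (c, s))) = orbit_map M' (cut_stab c S s) (orb (cut_stab c S s)) S (base_pt (cut_stab c S s)) s (\<eta> (orb (cut_stab c S s)) (x (c, s)))"
        unfolding orbit_map_def
        by (rule nat_mact[OF orb_gset[OF Ks] S osp_spans[OF orb_gset[OF Ks] bpt_mem[OF Ks] _ S i(2) ks_O[OF S i(2,1)]] xc])
          (simp add: bpt_stab[OF Ks])
      then show "\<eta> S (of_nat (card (cut_stab c S s)) \<odot>\<^bsub>fobj M S\<^esub> orbit_map M (cut_stab c S s) (orb (cut_stab c S s)) S (base_pt (cut_stab c S s)) s (x (c, s)))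
      = of_nat (card (cut_stab c S s)) \<odot>\<^bsub>fobj M' S\<^esub> orbit_map M' (cut_stab c S s) (orb (cut_stab c S s)) S (base_pt (cut_stab c S s)) s (?x' (c, s))"
        using l psi_term[OF M S x s] s by simp
      show "orbit_map M' (cut_stab c S s) (orb (cut_stab c S s)) S (base_pt (cut_stab c S s)) s (?x' (c, s)) \<in> carrier (fobj M' S)"
        using ks_ot[OF M' S s] nat_lin[OF orb_gset[OF Ks]] xc s by simp
    qed
    show "(\<lambda>(c, s). of_nat (card (cut_stab c S s)) \<odot>\<^bsub>fobj M' S\<^esub> orbit_map M' (cut_stab c S s) (orb (cut_stab c S s)) S (base_pt (cut_stab c S s)) s (?x' (c, s))) \<in> index S \<rightarrow> carrier (fobj M' S)"
    proof (rule funcsetI)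
      fix p assume "p \<in> index S"
      then obtain c s where "p = (c, s)" "(c, s) \<in> index S" by (cases p) auto
      then show "(case p of (c, s) \<Rightarrow> of_nat (card (cut_stab c S s)) \<odot>\<^bsub>fobj M' S\<^esub> orbit_map M' (cut_stab c S s) (orb (cut_stab c S s)) S (base_pt (cut_stab c S s)) s (?x' (c, s))) \<in> carrier (fobj M' S)"
        using t(2) by (simp only: prod.case V'.smult_closed')
    qed
    fix p assume "p \<in> index S"
    then obtain c s where "p = (c, s)" "(c, s) \<in> index S" by (cases p) auto
    then show "\<eta> S (case p of (c, s) \<Rightarrow> of_nat (card (cut_stab c S s)) \<odot>\<^bsub>fobj M S\<^esub> orbit_map M (cut_stab c S s) (orb (cut_stab c S s)) S (base_pt (cut_stab c S s)) s (x (c, s)))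
      = (case p of (c, s) \<Rightarrow> of_nat (card (cut_stab c S s)) \<odot>\<^bsub>fobj M' S\<^esub> orbit_map M' (cut_stab c S s) (orb (cut_stab c S s)) S (base_pt (cut_stab c S s)) s (?x' (c, s)))"
      using t(1) by (simp only: prod.case)
  qed
  finally show ?thesis .
qed

end

lemma psi_inj_on:
  assumes S: "finite_gset G S" shows "inj_on (assemble M S) (family (coeff_of M) S)"
proof (rule inj_onI)
  note X = PF_Ob[OF M]
  interpret W: rat_module "family_mod (coeff_of M) S" by (rule fmod_mod[OF X S])
  interpret V: rat_module "fobj M S" by (rule mk_mod[OF M S])
  note pl = psi_lin[OF M S] and cf = fmod_simps(1)[OF X, of S]
  fix x y assume x: "x \<in> family (coeff_of M) S" and y: "y \<in> family (coeff_of M) S" and e: "assemble M S x = assemble M S y"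
  let ?d = "x \<oplus>\<^bsub>family_mod (coeff_of M) S\<^esub> ((-1) \<odot>\<^bsub>family_mod (coeff_of M) S\<^esub> y)"
  have y1: "(-1) \<odot>\<^bsub>family_mod (coeff_of M) S\<^esub> y \<in> family (coeff_of M) S" unfolding cf[symmetric] by (rule W.smult_closed') (simp only: cf y)
  have d: "?d \<in> family (coeff_of M) S" unfolding cf[symmetric] by (rule W.M.a_closed; simp only: cf x y1)
  have "assemble M S ?d = assemble M S x \<oplus>\<^bsub>fobj M S\<^esub> ((-1) \<odot>\<^bsub>fobj M S\<^esub> assemble M S y)"
    using pl x y y1 unfolding cf by metis
  also have "\<dots> = \<zero>\<^bsub>fobj M S\<^esub>" unfolding e using psi_closed[OF M S y] by (simp add: V.neg_one V.M.r_neg)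
  finally have z: "assemble M S ?d = \<zero>\<^bsub>fobj M S\<^esub>" .
  show "x = y"
  proof (rule extensionalityI[OF famD(3)[OF X x] famD(3)[OF X y]])
    fix p assume "p \<in> index S"
    then obtain c s where p: "p = (c, s)" "(c, s) \<in> index S" by (cases p) auto
    interpret P: rat_module "fobj M (orb (cut_stab c S s))" by (rule orb_mod[OF M vs_subgroup[OF idxD(3)[OF p(2)]]])
    have xy: "x (c, s) \<in> carrier (fobj M (orb (cut_stab c S s)))" "y (c, s) \<in> carrier (fobj M (orb (cut_stab c S s)))"
      using phi_carrier[OF PF_fam[OF M x p(2)]] phi_carrier[OF PF_fam[OF M y p(2)]] .
    have "?d (c, s) = \<zero>\<^bsub>fobj M (orb (cut_stab c S s))\<^esub>" by (rule psi_inj[OF M S d z p(2)])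
    then have "x (c, s) \<oplus>\<^bsub>fobj M (orb (cut_stab c S s))\<^esub> ((-1) \<odot>\<^bsub>fobj M (orb (cut_stab c S s))\<^esub> y (c, s)) = \<zero>\<^bsub>fobj M (orb (cut_stab c S s))\<^esub>"
      using p(2) by (simp add: fmod_simps[OF X] xo_PF[OF M idxD(1,3)[OF p(2)]])
    then show "x p = y p" unfolding p(1) using xy P.M.minus_equality[of "x (c, s)" "\<ominus>\<^bsub>fobj M (orb (cut_stab c S s))\<^esub> y (c, s)"]
      by (simp add: P.neg_one)
  qed
qed

end

section \<open>Morphisms of coefficient systems acting on families\<close>

definition map_family :: "('a set set \<Rightarrow> ('a, 'v) coeff_map) \<Rightarrow> ('a, 't) gset \<Rightarrow> ('a set set \<times> 't \<Rightarrow> 'v) \<Rightarrow> 'a set set \<times> 't \<Rightarrow> 'v" where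
  "map_family \<epsilon> S x = (\<lambda>(c, s)\<in>index S. \<epsilon> c (ncoset c (cut_stab c S s)) (x (c, s)))"

context
  fixes X Y :: "'a set set \<Rightarrow> ('a, 'v) coeff_system" and \<epsilon>
  assumes X: "X \<in> Ob coeffs" and Y: "Y \<in> Ob coeffs" and \<epsilon>: "\<epsilon> \<in> Mor coeffs X Y"
begin

lemma eps_nat: "c \<in> SubO_classes \<Longrightarrow> \<epsilon> c \<in> nat_trans (osrc c) vect_cat (X c) (Y c)"
  using \<epsilon> unfolding PC_simps by blast

lemma eps_lin: "c \<in> SubO_classes \<Longrightarrow> hull_rep c K \<Longrightarrow> lin (coeff_mod X c K) (coeff_mod Y c K) (\<epsilon> c (ncoset c K))"
proof -
  assume c: "c \<in> SubO_classes" and K: "hull_rep c K"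
  have "ncoset c K \<in> Ob (osrc c)" using osrc_Ob[OF c] K by auto
  from nat_transD(1)[OF eps_nat[OF c] this] show ?thesis by (simp add: vect_mor_iff coeff_mod_def)
qed

lemma eps_idx: "(c, s) \<in> index S \<Longrightarrow> lin (coeff_mod X c (cut_stab c S s)) (coeff_mod Y c (cut_stab c S s)) (\<epsilon> c (ncoset c (cut_stab c S s)))"
  by (rule eps_lin) (rule idxD, assumption)+

lemma eps_xm:
  assumes c: "c \<in> SubO_classes" and K: "hull_rep c K" "hull_rep c K'" and a: "a \<in> norm_rep c" "K \<subseteq> conjg a K'" and x: "x \<in> carrier (coeff_mod X c K')"
  shows "\<epsilon> c (ncoset c K) (coeff_res X c K K' a x) = coeff_res Y c K K' a (\<epsilon> c (ncoset c K') x)"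
proof -
  have o: "ncoset c K \<in> Ob (osrc c)" "ncoset c K' \<in> Ob (osrc c)" using osrc_Ob[OF c] K by auto
  have "nmap c K K' a \<in> Mor (osrc c) (ncoset c K') (ncoset c K)" using nmap_hom(1)[OF c K a] by (simp add: osrc_simps[OF c])
  from fun_cong[OF nat_transD(2)[OF eps_nat[OF c] o(2,1) this], of x] show ?thesis
    using x by (simp add: compose_eq coeff_res_def coeff_mod_def)
qed

lemma epsfam_fam:
  assumes S: "finite_gset G S" and x: "x \<in> family X S" shows "map_family \<epsilon> S x \<in> family Y S"
proof (rule famI[OF Y])
  show "map_family \<epsilon> S x \<in> extensional (index S)" by (simp add: map_family_def)
  fix c s assume s: "(c, s) \<in> index S"
  show "map_family \<epsilon> S x (c, s) \<in> carrier (coeff_mod Y c (cut_stab c S s))"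
    using eps_lin[OF idxD(1,3)[OF s]] famD(1)[OF X x s] s by (simp add: map_family_def)
  fix a assume a: "a \<in> norm_rep c"
  show "map_family \<epsilon> S x (c, act S a s) = coeff_res Y c (cut_stab c S (act S a s)) (cut_stab c S s) a (map_family \<epsilon> S x (c, s))"
    using eps_xm[OF idxD(1)[OF s] idxD(3)[OF idx_act[OF S s a]] idxD(3)[OF s] a _ famD(1)[OF X x s]]
      ks_act[OF S idxD(2,1)[OF s] a] famD(2)[OF X x s a] s idx_act[OF S s a] by (simp add: map_family_def)
qed

lemma epsfam_lin:
  assumes S: "finite_gset G S" shows "lin (family_mod X S) (family_mod Y S) (map_family \<epsilon> S)"
proof (intro conjI ballI allI)
  fix x assume x: "x \<in> carrier (family_mod X S)"
  then have xf: "x \<in> family X S" by (simp add: fmod_simps[OF X])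
  show "map_family \<epsilon> S x \<in> carrier (family_mod Y S)" using epsfam_fam[OF S xf] by (simp add: fmod_simps[OF Y])
  show "map_family \<epsilon> S (r \<odot>\<^bsub>family_mod X S\<^esub> x) = r \<odot>\<^bsub>family_mod Y S\<^esub> map_family \<epsilon> S x" for r
  proof -
    have "\<epsilon> c (ncoset c (cut_stab c S s)) (r \<odot>\<^bsub>coeff_mod X c (cut_stab c S s)\<^esub> x (c, s)) = r \<odot>\<^bsub>coeff_mod Y c (cut_stab c S s)\<^esub> \<epsilon> c (ncoset c (cut_stab c S s)) (x (c, s))"
      if s: "(c, s) \<in> index S" for c s using eps_idx[OF s] famD(1)[OF X xf s] by blast
    then show ?thesis by (intro extensionalityI[of _ "index S"]) (auto simp: map_family_def fmod_simps[OF X] fmod_simps[OF Y])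
  qed
  fix y assume y: "y \<in> carrier (family_mod X S)"
  then have yf: "y \<in> family X S" by (simp add: fmod_simps[OF X])
  show "map_family \<epsilon> S (x \<oplus>\<^bsub>family_mod X S\<^esub> y) = map_family \<epsilon> S x \<oplus>\<^bsub>family_mod Y S\<^esub> map_family \<epsilon> S y"
  proof -
    have "\<epsilon> c (ncoset c (cut_stab c S s)) (x (c, s) \<oplus>\<^bsub>coeff_mod X c (cut_stab c S s)\<^esub> y (c, s)) = \<epsilon> c (ncoset c (cut_stab c S s)) (x (c, s)) \<oplus>\<^bsub>coeff_mod Y c (cut_stab c S s)\<^esub> \<epsilon> c (ncoset c (cut_stab c S s)) (y (c, s))"
      if s: "(c, s) \<in> index S" for c s using eps_idx[OF s] famD(1)[OF X xf s] famD(1)[OF X yf s] by blast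
    then show ?thesis by (intro extensionalityI[of _ "index S"]) (auto simp: map_family_def fmod_simps[OF X] fmod_simps[OF Y])
  qed
qed

lemma epsfam_wact:
  assumes S: "finite_gset G S" and T: "finite_gset G T" and w: "w \<in> spans G TS S T" and x: "x \<in> family X S"
  shows "map_family \<epsilon> T (span_act X S T w x) = span_act Y S T w (map_family \<epsilon> S x)"
proof (rule extensionalityI[of _ "index T"])
  fix p assume "p \<in> index T"
  then obtain c t where p: "p = (c, t)" "(c, t) \<in> index T" by (cases p) auto
  note i = idxD[OF p(2)]
  interpret V: rat_module "coeff_mod X c (cut_stab c T t)" by (rule xo_idx[OF X p(2)])
  interpret W: rat_module "coeff_mod Y c (cut_stab c T t)" by (rule xo_idx[OF Y p(2)])
  note tX = wact_term[OF X S w p(2) _ x] and tY = wact_term[OF Y S w p(2) _ epsfam_fam[OF S x]]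
  have "map_family \<epsilon> T (span_act X S T w x) (c, t) = finsum (coeff_mod Y c (cut_stab c T t))
     (\<lambda>u. \<epsilon> c (ncoset c (cut_stab c T t)) (coeff_res X c (cut_stab c T t) (cut_stab c S (lleg w u)) \<one> (x (c, lleg w u)))) (fixed_fibre c w T t)"
    using p(2) lin_finsum[OF V.rat_module_axioms W.rat_module_axioms eps_lin[OF i(1,3)] tX]
    by (simp add: map_family_def wact_apply[OF X])
  also have "\<dots> = span_act Y S T w (map_family \<epsilon> S x) (c, t)"
    unfolding wact_apply[OF Y p(2)]
  proof (rule W.M.finsum_cong'[OF refl])
    fix u assume u: "u \<in> fixed_fibre c w T t"
    note D = wset_D[OF S w p(2) u]
    have "cut_stab c T t \<subseteq> conjg \<one> (cut_stab c S (lleg w u))" using D(5) cj_one[OF subgroup_carrier[OF vs_subgroup[OF idxD(3)[OF D(4)]]]] by simp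
    then show "\<epsilon> c (ncoset c (cut_stab c T t)) (coeff_res X c (cut_stab c T t) (cut_stab c S (lleg w u)) \<one> (x (c, lleg w u))) =
      coeff_res Y c (cut_stab c T t) (cut_stab c S (lleg w u)) \<one> (map_family \<epsilon> S x (c, lleg w u))"
      using eps_xm[OF i(1,3) idxD(3)[OF D(4)] nz_one[OF i(1)] _ famD(1)[OF X x D(4)]] D(4) by (simp add: map_family_def)
  qed (use tY in auto)
  finally show "map_family \<epsilon> T (span_act X S T w x) p = span_act Y S T w (map_family \<epsilon> S x) p" by (simp add: p)
qed (simp_all add: map_family_def span_act_def[OF Y])

end

section \<open>The comparison functor and its full faithfulness\<close>

definition Phi :: "(('a, 's, 'v) mackey_functor, ('a, 's, 'v) mackey_map, 'a set set \<Rightarrow> ('a, 'v) coeff_system,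
    'a set set \<Rightarrow> ('a, 'v) coeff_map) cfunctor" where
  "Phi = \<lparr>fobj = (\<lambda>M\<in>Ob mackeys. coeff_of M), fmor = (\<lambda>M\<in>Ob mackeys. \<lambda>M'\<in>Ob mackeys. \<lambda>\<eta>\<in>Mor mackeys M M'.
     \<lambda>c\<in>SubO_classes. \<lambda>Z\<in>Ob (osrc c). \<lambda>x\<in>phi M (base_subgroup Z). \<eta> (orb (base_subgroup Z)) x)\<rparr>"

lemma fobj_PF: "c \<in> SubO_classes \<Longrightarrow> hull_rep c K \<Longrightarrow> fobj (coeff_of M c) (ncoset c K) = phimod M K"
  using osrc_Ob[of c] by (auto simp: coeff_of_def coeff_at_def sb_co)

lemma Phi_mor:
  assumes M: "is_mackey M" and M': "is_mackey M'" and \<eta>: "\<eta> \<in> Mor mackeys M M'"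
  shows "(\<lambda>c\<in>SubO_classes. \<lambda>Z\<in>Ob (osrc c). \<lambda>x\<in>phi M (base_subgroup Z). \<eta> (orb (base_subgroup Z)) x) \<in> Mor coeffs (coeff_of M) (coeff_of M')"
  unfolding PC_simps
proof (rule restrict_PiE_iff[THEN iffD2], rule ballI)
  note n = \<eta>[unfolded mack_simps]
  fix c assume c: "c \<in> SubO_classes"
  let ?e = "\<lambda>Z\<in>Ob (osrc c). \<lambda>x\<in>phi M (base_subgroup Z). \<eta> (orb (base_subgroup Z)) x"
  have e: "?e (ncoset c K) = (\<lambda>x\<in>phi M K. \<eta> (orb K) x)" if "hull_rep c K" for K
    using osrc_Ob[OF c] that by (auto simp: sb_co[OF c])
  have em: "?e (ncoset c K) \<in> Mor vect_cat (phimod M K) (phimod M' K)" if K: "hull_rep c K" for K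
  proof -
    note Ks = vs_subgroup[OF K]
    have "lin (phimod M K) (phimod M' K) (\<eta> (orb K))"
      using nat_phi[OF M M' n Ks] nat_lin[OF M M' n orb_gset[OF Ks]] by (simp add: phi_def[of M])
    then have "lin (phimod M K) (phimod M' K) (\<lambda>x\<in>phi M K. \<eta> (orb K) x)"
      by (rule lin_cong[OF phi_mod[OF M Ks], rotated]) simp
    then show ?thesis unfolding e[OF K] vect_mor_iff by simp
  qed
  show "?e \<in> nat_trans (osrc c) vect_cat (coeff_of M c) (coeff_of M' c)"
    unfolding nat_trans_def mem_Collect_eq
  proof (intro conjI ballI)
    show "?e \<in> (\<Pi>\<^sub>E a\<in>Ob (osrc c). Mor vect_cat (fobj (coeff_of M c) a) (fobj (coeff_of M' c) a))"
    proof (rule PiE_I)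
      fix Z assume "Z \<in> Ob (osrc c)"
      then obtain K where K: "Z = ncoset c K" "hull_rep c K" using osrc_Ob[OF c] by blast
      show "?e Z \<in> Mor vect_cat (fobj (coeff_of M c) Z) (fobj (coeff_of M' c) Z)"
        unfolding K(1) fobj_PF[OF c K(2)] by (rule em[OF K(2)])
    qed simp
    fix Z' Z \<phi> assume o: "Z' \<in> Ob (osrc c)" "Z \<in> Ob (osrc c)" "\<phi> \<in> Mor (osrc c) Z' Z"
    obtain K K' where K: "Z = ncoset c K" "hull_rep c K" "Z' = ncoset c K'" "hull_rep c K'" using o osrc_Ob[OF c] by blast
    obtain a where a: "a \<in> norm_rep c" "K \<subseteq> conjg a K'" "\<phi> = nmap c K K' a"
      using hom_nmap[OF c K(2,4)] o(3) K by (auto simp: osrc_simps[OF c])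
    note s = vs_subgroup[OF K(2)] vs_subgroup[OF K(4)] and p = orb_nz_stab[OF c K(4) a(1)]
    show "Cmp vect_cat (fobj (coeff_of M c) Z') (fobj (coeff_of M c) Z) (fobj (coeff_of M' c) Z) (?e Z) (fmor (coeff_of M c) Z' Z \<phi>) =
        Cmp vect_cat (fobj (coeff_of M c) Z') (fobj (coeff_of M' c) Z') (fobj (coeff_of M' c) Z) (fmor (coeff_of M' c) Z' Z \<phi>) (?e Z')"
    proof (rule extensionalityI[of _ "phi M K'"])
      fix x assume x: "x \<in> phi M K'"
      have r: "restr_orb M K K' (act (orb K') a (base_pt K')) x \<in> phi M K" using phi_res[OF M s p(1) _ x] p(2) a(2) by simp
      have ex: "\<eta> (orb K') x \<in> phi M' K'" by (rule nat_phi[OF M M' n s(2) x])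
      have P: "coeff_of M c = coeff_at M c" "coeff_of M' c = coeff_at M' c" using c by (simp_all add: coeff_of_def)
      show "Cmp vect_cat (fobj (coeff_of M c) Z') (fobj (coeff_of M c) Z) (fobj (coeff_of M' c) Z) (?e Z) (fmor (coeff_of M c) Z' Z \<phi>) x =
        Cmp vect_cat (fobj (coeff_of M c) Z') (fobj (coeff_of M' c) Z') (fobj (coeff_of M' c) Z) (fmor (coeff_of M' c) Z' Z \<phi>) (?e Z') x"
        unfolding K(1,3) e[OF K(2)] e[OF K(4)] fobj_PF[OF c K(4)] fobj_PF[OF c K(2)] a(3) P
        using x r ex pfun_mor[OF c K(2,4) a(1,2) x] pfun_mor[OF c K(2,4) a(1,2) ex]
          nat_rsm[OF M M' n s p(1) _ phi_carrier[OF x]] p(2) a(2) fobj_PF[OF c K(4), of M, unfolded P]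
          by (simp add: compose_eq)
    qed (simp_all add: K fobj_PF[OF c] compose_def)
  qed
qed

lemma Phi_apply:
  assumes "is_mackey M" "is_mackey M'" "\<eta> \<in> Mor mackeys M M'" "c \<in> SubO_classes" "hull_rep c K" "x \<in> phi M K"
  shows "fmor Phi M M' \<eta> c (ncoset c K) x = \<eta> (orb K) x"
  using assms osrc_Ob[OF assms(4)] by (auto simp: Phi_def sb_co)

lemma Phi_functor: "is_functor mackeys coeffs Phi"
  unfolding Phi_def
proof (rule is_functor_restrictI)
  fix M :: "('a, 's, 'v) mackey_functor" assume M: "is_mackey M"
  show "coeff_of M \<in> Ob coeffs" by (rule PF_Ob[OF M])
  show "Idn mackeys M \<in> Mor mackeys M M" by (rule category.idn_mor[OF category_mack M])
  show "(\<lambda>c\<in>SubO_classes. \<lambda>Z\<in>Ob (osrc c). \<lambda>x\<in>phi M (base_subgroup Z). Idn mackeys M (orb (base_subgroup Z)) x) = Idn coeffs (coeff_of M)"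
    unfolding PC_simps
  proof (intro restrict_ext)
    fix c Z assume c: "c \<in> SubO_classes" and "Z \<in> Ob (osrc c)"
    then obtain K where K: "Z = ncoset c K" "hull_rep c K" using osrc_Ob[OF c] by blast
    show "(\<lambda>x\<in>phi M (base_subgroup Z). Idn mackeys M (orb (base_subgroup Z)) x) = (\<lambda>x\<in>carrier (fobj (coeff_of M c) Z). x)"
      unfolding K(1) sb_co[OF c K(2)] fobj_PF[OF c K(2)]
      by (auto simp: mack_simps orb_gset[OF vs_subgroup[OF K(2)]] phi_carrier intro!: restrict_ext)
  qed
next
  fix M M' :: "('a, 's, 'v) mackey_functor" and \<eta> assume "is_mackey M" "is_mackey M'" "\<eta> \<in> Mor mackeys M M'"
  then show "(\<lambda>c\<in>SubO_classes. \<lambda>Z\<in>Ob (osrc c). \<lambda>x\<in>phi M (base_subgroup Z). \<eta> (orb (base_subgroup Z)) x) \<in> Mor coeffs (coeff_of M) (coeff_of M')" by (rule Phi_mor)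
next
  fix M M' M'' :: "('a, 's, 'v) mackey_functor" and \<eta> \<theta> assume M: "is_mackey M" "is_mackey M'" "is_mackey M''" and n: "\<eta> \<in> Mor mackeys M M'" "\<theta> \<in> Mor mackeys M' M''"
  show "Cmp mackeys M M' M'' \<theta> \<eta> \<in> Mor mackeys M M''" by (rule category.cmp_mor[OF category_mack M n])
  show "(\<lambda>c\<in>SubO_classes. \<lambda>Z\<in>Ob (osrc c). \<lambda>x\<in>phi M (base_subgroup Z). Cmp mackeys M M' M'' \<theta> \<eta> (orb (base_subgroup Z)) x) =
    Cmp coeffs (coeff_of M) (coeff_of M') (coeff_of M'') (\<lambda>c\<in>SubO_classes. \<lambda>Z\<in>Ob (osrc c). \<lambda>x\<in>phi M' (base_subgroup Z). \<theta> (orb (base_subgroup Z)) x)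
      (\<lambda>c\<in>SubO_classes. \<lambda>Z\<in>Ob (osrc c). \<lambda>x\<in>phi M (base_subgroup Z). \<eta> (orb (base_subgroup Z)) x)"
    unfolding PC_simps
  proof (intro restrict_ext)
    fix c Z assume c: "c \<in> SubO_classes" and Z: "Z \<in> Ob (osrc c)"
    then obtain K where K: "Z = ncoset c K" "hull_rep c K" using osrc_Ob[OF c] by blast
    note Ks = vs_subgroup[OF K(2)]
    show "(\<lambda>x\<in>phi M (base_subgroup Z). Cmp mackeys M M' M'' \<theta> \<eta> (orb (base_subgroup Z)) x) = compose (carrier (fobj (coeff_of M c) Z))
       ((\<lambda>c\<in>SubO_classes. \<lambda>Z\<in>Ob (osrc c). \<lambda>x\<in>phi M' (base_subgroup Z). \<theta> (orb (base_subgroup Z)) x) c Z) ((\<lambda>c\<in>SubO_classes. \<lambda>Z\<in>Ob (osrc c). \<lambda>x\<in>phi M (base_subgroup Z). \<eta> (orb (base_subgroup Z)) x) c Z)"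
      using c Z nat_phi[OF M(1,2) n(1)[unfolded mack_simps] Ks]
      by (auto simp: K sb_co[OF c] fobj_PF[OF c] mack_simps(2) orb_gset[OF Ks] phi_carrier compose_def intro!: restrict_ext)
  qed
qed

text \<open>Every element of \<open>M(S)\<close> is assembled from elements of subspaces
  \<open>phi M K\<close>, on which two maps with the same image agree.\<close>

lemma Phi_faithful:
  assumes M: "is_mackey M" and M': "is_mackey M'"
  shows "inj_on (fmor Phi M M') (Mor mackeys M M')"
proof (rule inj_onI)
  fix \<eta> \<theta> assume n: "\<eta> \<in> Mor mackeys M M'" "\<theta> \<in> Mor mackeys M M'" and e: "fmor Phi M M' \<eta> = fmor Phi M M' \<theta>"
  note n' = n[unfolded mack_simps]
  have eq: "\<eta> (orb K) x = \<theta> (orb K) x" if "c \<in> SubO_classes" "hull_rep c K" "x \<in> phi M K" for c K x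
    using Phi_apply[OF M M' n(1) that] Phi_apply[OF M M' n(2) that] e by simp
  show "\<eta> = \<theta>"
  proof (rule extensionalityI[OF nat_transD(3)[OF n'(1)] nat_transD(3)[OF n'(2)]])
    fix S assume "S \<in> Ob lindner"
    then have S: "finite_gset G S" by simp
    show "\<eta> S = \<theta> S"
    proof (rule extensionalityI[of _ "carrier (fobj M S)"])
      show "\<eta> S \<in> extensional (carrier (fobj M S))" "\<theta> S \<in> extensional (carrier (fobj M S))"
        using nat_transD(1)[OF n'(1), of S] nat_transD(1)[OF n'(2), of S] S by (simp_all add: vect_mor_iff)
      fix v assume "v \<in> carrier (fobj M S)"
      then obtain x where x: "x \<in> family (coeff_of M) S" "assemble M S x = v" using psi_surj[OF M S] by blast
      have "(\<lambda>(c, s)\<in>index S. \<eta> (orb (cut_stab c S s)) (x (c, s))) = (\<lambda>(c, s)\<in>index S. \<theta> (orb (cut_stab c S s)) (x (c, s)))"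
        by (rule restrict_ext) (use eq[OF idxD(1,3) PF_fam[OF M x(1)]] in auto)
      then show "\<eta> S v = \<theta> S v"
        using nat_psi[OF M M' n'(1) S x(1)] nat_psi[OF M M' n'(2) S x(1)] x(2) by simp
    qed
  qed
qed

text \<open>\<open>assemble\<close> identifies \<open>M(S)\<close> and \<open>M'(S)\<close> with
  spaces of families, so \<open>\<epsilon>\<close> induces maps \<open>\<theta> S\<close>, natural
  because \<open>assemble\<close> and \<open>map_family\<close> are compatible with spans. That
  \<open>\<theta>\<close> restricts to \<open>\<epsilon>\<close> on \<open>phi M K\<close> is tested
  on \<open>top_fam\<close>, which represents a nonzero multiple of the given element.\<close>

lemma Phi_full:
  assumes M: "is_mackey M" and M': "is_mackey M'" and \<epsilon>: "\<epsilon> \<in> Mor coeffs (coeff_of M) (coeff_of M')"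
  shows "\<exists>\<theta>\<in>Mor mackeys M M'. fmor Phi M M' \<theta> = \<epsilon>"
proof -
  note X = PF_Ob[OF M] and Y = PF_Ob[OF M']
  define \<theta> where "\<theta> = (\<lambda>S\<in>Ob lindner. \<lambda>v\<in>carrier (fobj M S). assemble M' S (map_family \<epsilon> S (inv_into (family (coeff_of M) S) (assemble M S) v)))"
  have \<theta>: "\<theta> S (assemble M S x) = assemble M' S (map_family \<epsilon> S x)" if S: "finite_gset G S" and x: "x \<in> family (coeff_of M) S" for S x
    using S inv_into_f_f[OF psi_inj_on[OF M M' S] x] psi_closed[OF M S x] by (simp add: \<theta>_def)
  have surj: "\<exists>x\<in>family (coeff_of M) S. v = assemble M S x" if "finite_gset G S" "v \<in> carrier (fobj M S)" for S v
    using psi_surj[OF M that] by blast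
  have tl: "lin (fobj M S) (fobj M' S) (\<theta> S)" if S: "finite_gset G S" for S
  proof (intro conjI ballI allI)
    interpret W: rat_module "family_mod (coeff_of M) S" by (rule fmod_mod[OF X S])
    note pl = psi_lin[OF M S] and l2 = lin_comp[OF epsfam_lin[OF X Y \<epsilon> S] psi_lin[OF M' S]] and cf = fmod_simps(1)[OF X, of S]
    fix u assume "u \<in> carrier (fobj M S)"
    then obtain x where x: "x \<in> carrier (family_mod (coeff_of M) S)" "u = assemble M S x" using surj[OF S] unfolding cf by blast
    have tx: "\<theta> S (assemble M S z) = assemble M' S (map_family \<epsilon> S z)" if "z \<in> carrier (family_mod (coeff_of M) S)" for z using \<theta>[OF S] that unfolding cf by blast
    show "\<theta> S u \<in> carrier (fobj M' S)" unfolding x(2) tx[OF x(1)] using l2 x(1) by blast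
    show "\<theta> S (r \<odot>\<^bsub>fobj M S\<^esub> u) = r \<odot>\<^bsub>fobj M' S\<^esub> \<theta> S u" for r
    proof -
      have "r \<odot>\<^bsub>fobj M S\<^esub> u = assemble M S (r \<odot>\<^bsub>family_mod (coeff_of M) S\<^esub> x)" using pl x by metis
      then show ?thesis unfolding x(2) tx[OF x(1)] using tx[OF W.smult_closed'[OF x(1), of r]] l2 x(1) by metis
    qed
    fix v assume "v \<in> carrier (fobj M S)"
    then obtain y where y: "y \<in> carrier (family_mod (coeff_of M) S)" "v = assemble M S y" using surj[OF S] unfolding cf by blast
    have "u \<oplus>\<^bsub>fobj M S\<^esub> v = assemble M S (x \<oplus>\<^bsub>family_mod (coeff_of M) S\<^esub> y)" using pl x y by metis
    then show "\<theta> S (u \<oplus>\<^bsub>fobj M S\<^esub> v) = \<theta> S u \<oplus>\<^bsub>fobj M' S\<^esub> \<theta> S v"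
      unfolding x(2) y(2) tx[OF x(1)] tx[OF y(1)] using tx[OF W.M.a_closed[OF x(1) y(1)]] l2 x(1) y(1) by metis
  qed
  have tm: "\<theta> S \<in> Mor vect_cat (fobj M S) (fobj M' S)" if S: "finite_gset G S" for S
    unfolding vect_mor_iff using tl[OF S] S by (simp add: \<theta>_def)
  have tmact: "\<theta> T (span_map M S T w v) = span_map M' S T w (\<theta> S v)"
    if S: "finite_gset G S" and T: "finite_gset G T" and w: "w \<in> spans G TS S T" and v: "v \<in> carrier (fobj M S)"
    for S T v and w :: "('a, 's, 's) gspan"
  proof -
    obtain x where x: "x \<in> family (coeff_of M) S" "v = assemble M S x" using surj[OF S v] by blast
    show ?thesis
      unfolding x(2) psi_natural[OF M S T w x(1), symmetric] \<theta>[OF T wact_fam[OF X S T w x(1)]] \<theta>[OF S x(1)]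
        epsfam_wact[OF X Y \<epsilon> S T w x(1)] by (rule psi_natural[OF M' S T w epsfam_fam[OF X Y \<epsilon> S x(1)]])
  qed
  have tn: "\<theta> \<in> Mor mackeys M M'"
    unfolding mack_simps nat_trans_def mem_Collect_eq
  proof (intro conjI ballI)
    show "\<theta> \<in> (\<Pi>\<^sub>E a\<in>Ob lindner. Mor vect_cat (fobj M a) (fobj M' a))"
      unfolding PiE_iff using tm by (simp add: \<theta>_def)
    fix S T \<alpha> assume o: "S \<in> Ob lindner" "T \<in> Ob lindner" "\<alpha> \<in> Mor lindner S T"
    then have S: "finite_gset G S" and T: "finite_gset G T" by simp_all
    obtain w :: "('a, 's, 's) gspan" where w: "w \<in> spans G TS S T" "\<alpha> = cls S T w" using mor_cls[OF o(3)] by blast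
    show "Cmp vect_cat (fobj M S) (fobj M T) (fobj M' T) (\<theta> T) (fmor M S T \<alpha>) = Cmp vect_cat (fobj M S) (fobj M' S) (fobj M' T) (fmor M' S T \<alpha>) (\<theta> S)"
      unfolding w(2) span_map_def[symmetric] using tmact[OF S T w(1)] by (auto simp: compose_def intro!: restrict_ext)
  qed
  moreover have "fmor Phi M M' \<theta> = \<epsilon>"
  proof (rule extensionalityI[of _ SubO_classes])
    show "fmor Phi M M' \<theta> \<in> extensional SubO_classes" using M M' tn by (simp add: Phi_def)
    show "\<epsilon> \<in> extensional SubO_classes" using \<epsilon> unfolding PC_simps PiE_iff by simp
    fix c assume c: "c \<in> SubO_classes"
    note en = eps_nat[OF X Y \<epsilon> c]
    show "fmor Phi M M' \<theta> c = \<epsilon> c"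
    proof (rule extensionalityI[OF _ nat_transD(3)[OF en]])
      show "fmor Phi M M' \<theta> c \<in> extensional (Ob (osrc c))" using M M' tn c by (simp add: Phi_def)
      fix Z assume Z: "Z \<in> Ob (osrc c)"
      then obtain K where K: "Z = ncoset c K" "hull_rep c K" using osrc_Ob[OF c] by blast
      note Ks = vs_subgroup[OF K(2)]
      note OK = orb_gset[OF Ks]
      interpret V': rat_module "fobj M' (orb K)" by (rule orb_mod[OF M' Ks])
      have el: "lin (phimod M K) (phimod M' K) (\<epsilon> c (ncoset c K))" using eps_lin[OF X Y \<epsilon> c K(2)] xo_PF[OF M c K(2)] xo_PF[OF M' c K(2)] by simp
      show "fmor Phi M M' \<theta> c Z = \<epsilon> c Z"
      proof (rule extensionalityI[of _ "phi M K"])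
        show "fmor Phi M M' \<theta> c Z \<in> extensional (phi M K)" using M M' tn c Z K sb_co[OF c K(2)] by (simp add: Phi_def)
        show "\<epsilon> c Z \<in> extensional (phi M K)" using nat_transD(1)[OF en Z] by (simp add: vect_mor_iff K fobj_PF[OF c K(2)])
        fix x assume x: "x \<in> phi M K"
        have ex: "\<epsilon> c (ncoset c K) x \<in> phi M' K" using el x by simp
        note t = top_fam[OF M c K(2) x] and t' = top_fam[OF M' c K(2) ex]
        \<comment> \<open>The family generated by \<open>x\<close> is carried to the one generated
          by the image of \<open>x\<close>, because \<open>\<epsilon>\<close> commutes with
          restriction.\<close>
        have "map_family \<epsilon> (orb K) (top_fam M c K x) = top_fam M' c K (\<epsilon> c (ncoset c K) x)"
        proof (rule extensionalityI[of _ "index (orb K)"])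
          fix p assume "p \<in> index (orb K)"
          then obtain d u where p: "p = (d, u)" "(d, u) \<in> index (orb K)" by (cases p) auto
          note i = idxD[OF p(2)]
          show "map_family \<epsilon> (orb K) (top_fam M c K x) p = top_fam M' c K (\<epsilon> c (ncoset c K) x) p"
          proof (cases "d = c")
            case False
            have "lin (phimod M (cut_stab d (orb K) u)) (phimod M' (cut_stab d (orb K) u)) (\<epsilon> d (ncoset d (cut_stab d (orb K) u)))"
              using eps_lin[OF X Y \<epsilon> i(1,3)] xo_PF[OF M i(1,3)] xo_PF[OF M' i(1,3)] by simp
            from lin_zero[OF phi_mod[OF M vs_subgroup[OF i(3)]] phi_mod[OF M' vs_subgroup[OF i(3)]] this] False
            show ?thesis using p(2) by (simp add: p(1) map_family_def top_fam_def[OF M] top_fam_def[OF M'])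
          next
            case True
            obtain a where a: "a \<in> norm_rep c" "u = act (orb K) a (base_pt K)" using idx_orb(3)[OF c K(2) p(2) True] by blast
            note k = idx_orb_nz(2)[OF c K(2) a(1), folded a(2)]
            have s: "cut_stab c (orb K) u \<subseteq> conjg a K" "hull_rep c (cut_stab c (orb K) u)" using k i(3) True by auto
            have "\<epsilon> c (ncoset c (cut_stab c (orb K) u)) (coeff_res (coeff_of M) c (cut_stab c (orb K) u) K a x) = coeff_res (coeff_of M') c (cut_stab c (orb K) u) K a (\<epsilon> c (ncoset c K) x)"
              by (rule eps_xm[OF X Y \<epsilon> c s(2) K(2) a(1) s(1)]) (simp add: xo_PF[OF M c K(2)] x)
            then show ?thesis
              using p(2) True xm_PF[OF M c s(2) K(2) a(1) s(1) x] xm_PF[OF M' c s(2) K(2) a(1) s(1) ex]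
              by (simp add: p(1) map_family_def top_fam_def[OF M] top_fam_def[OF M'] a(2)[symmetric])
          qed
        qed (simp_all add: map_family_def top_fam_def[OF M'])
        then have "of_nat (card (norm_rep c)) \<odot>\<^bsub>fobj M' (orb K)\<^esub> \<theta> (orb K) x = of_nat (card (norm_rep c)) \<odot>\<^bsub>fobj M' (orb K)\<^esub> \<epsilon> c (ncoset c K) x"
          using \<theta>[OF OK t(1)] t(2) t'(2) tl[OF OK] phi_carrier[OF x] by metis
        then have "\<theta> (orb K) x = \<epsilon> c (ncoset c K) x"
          by (rule V'.smult_cancel[rotated 3]) (use nz_card_pos[OF M c] tl[OF OK] phi_carrier[OF x] phi_carrier[OF ex] in auto)
        then show "fmor Phi M M' \<theta> c Z x = \<epsilon> c Z x" using Phi_apply[OF M M' tn c K(2) x] K(1) by simp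
      qed
    qed
  qed
  ultimately show ?thesis by blast
qed

section \<open>Essential surjectivity\<close>

context
  fixes X :: "'a set set \<Rightarrow> ('a, 'v) coeff_system"
  assumes X: "X \<in> Ob coeffs"
begin

lemma mact_mx:
  assumes "finite_gset G S" "finite_gset G T" "w \<in> spans G TS S T" "x \<in> family X S"
  shows "span_map (mackey_of X) S T w (family_embed X S x) = family_embed X T (span_act X S T w x)"
  unfolding span_map_def by (rule mx_mor[OF X assms])

text \<open>The right leg is the identity, so the fibre over \<open>t\<close> is \<open>t\<close>
  alone and the sum has a single term.\<close>

lemma wact_res:
  assumes S: "finite_gset G S" and Y: "finite_gset G Y" and f: "f \<in> gset_hom G Y S" and x: "x \<in> family X S" and t: "(c, t) \<in> index Y"
  shows "span_act X S Y (restr_span Y f) x (c, t) = coeff_res X c (cut_stab c Y t) (cut_stab c S (f t)) \<one> (x (c, f t))"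
proof -
  note i = idxD[OF t]
  interpret V: rat_module "coeff_mod X c (cut_stab c Y t)" by (rule xo_idx[OF X t])
  have w: "fixed_fibre c (restr_span Y f) Y t = {t}" using i by (auto simp: fixed_fibre_def restr_span_def)
  then have "coeff_res X c (cut_stab c Y t) (cut_stab c S (f t)) \<one> (x (c, f t)) \<in> carrier (coeff_mod X c (cut_stab c Y t))"
    using wact_term[OF X S rsp_spans[OF Y f] t _ x, of t] by (simp add: restr_span_def)
  then show ?thesis unfolding wact_apply[OF X t] w by (simp add: restr_span_def V.M.finsum_insert)
qed

context
  fixes c K
  assumes c: "c \<in> SubO_classes" and K: "hull_rep c K"
begin

lemma bpt_idx: "(c, base_pt K) \<in> index (orb K)" "cut_stab c (orb K) (base_pt K) = K"
proof -
  note Ks = vs_subgroup[OF K]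
  show k: "cut_stab c (orb K) (base_pt K) = K" using bpt_stab[OF Ks] vs_sub[OF K] by (auto simp: cut_stab_def)
  show "(c, base_pt K) \<in> index (orb K)" using c K bpt_mem[OF Ks] k by (simp add: index_def)
qed

lemma fam_orb_act:
  assumes x: "x \<in> family X (orb K)" and a: "a \<in> norm_rep c"
  shows "x (c, act (orb K) a (base_pt K)) = coeff_res X c (conjg a K) K a (x (c, base_pt K))"
  using famD(2)[OF X x bpt_idx(1) a] bpt_idx(2) idx_orb_nz(2)[OF c K a] by simp

text \<open>An entry at a class \<open>d\<close> other than \<open>c\<close> survives restriction to
  \<open>K \<inter> A\<close> for a suitable \<open>A\<close> not containing \<open>K\<close>, so it
  must vanish for an element of \<open>phi\<close>. Conversely, class \<open>c\<close> does not
  occur on \<open>G/(K \<inter> A)\<close>, so a family supported on \<open>c\<close> restricts to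
  zero there.\<close>

lemma phi_mx:
  assumes x: "x \<in> family X (orb K)"
  shows "family_embed X (orb K) x \<in> phi (mackey_of X) K \<longleftrightarrow> (\<forall>d u. (d, u) \<in> index (orb K) \<longrightarrow> d \<noteq> c \<longrightarrow> x (d, u) = \<zero>\<^bsub>coeff_mod X d (cut_stab d (orb K) u)\<^esub>)"
proof -
  note Ks = vs_subgroup[OF K]
  note OK = orb_gset[OF Ks] and Kc = subgroup_carrier[OF Ks]
  have zero: "family_embed X S y = \<zero>\<^bsub>fobj (mackey_of X) S\<^esub> \<longleftrightarrow> (\<forall>d u. (d, u) \<in> index S \<longrightarrow> y (d, u) = \<zero>\<^bsub>coeff_mod X d (cut_stab d S u)\<^esub>)"
    if S: "finite_gset G S" and y: "y \<in> family X S" for S y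
  proof -
    interpret W: rat_module "family_mod X S" by (rule fmod_mod[OF X S])
    have 0: "\<zero>\<^bsub>family_mod X S\<^esub> \<in> family X S" using W.M.zero_closed unfolding fmod_simps(1)[OF X] .
    have "family_embed X S \<zero>\<^bsub>family_mod X S\<^esub> = \<zero>\<^bsub>fobj (mackey_of X) S\<^esub>"
      by (rule lin_zero[OF W.rat_module_axioms io_facts(1,2)[OF X S]])
    then have "family_embed X S y = \<zero>\<^bsub>fobj (mackey_of X) S\<^esub> \<longleftrightarrow> y = \<zero>\<^bsub>family_mod X S\<^esub>"
      using inj_on_eq_iff[OF io_inj[OF X S] y 0] by simp
    also have "\<dots> \<longleftrightarrow> (\<forall>d u. (d, u) \<in> index S \<longrightarrow> y (d, u) = \<zero>\<^bsub>coeff_mod X d (cut_stab d S u)\<^esub>)"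
      using famD(3)[OF X y] unfolding fmod_simps[OF X] by (auto simp: extensional_def fun_eq_iff)
    finally show ?thesis .
  qed
  have J: "subgroup (K \<inter> A) G" "pt_map (K \<inter> A) (orb K) (base_pt K) \<in> gset_hom G (orb (K \<inter> A)) (orb K)" if "A \<in> SubO" for A
    using SO_inter[OF Ks that] pm_hom[OF SO_inter[OF Ks that] OK bpt_mem[OF Ks]] bpt_stab[OF Ks] by auto
  have r: "restr_orb (mackey_of X) (K \<inter> A) K (base_pt K) (family_embed X (orb K) x) = \<zero>\<^bsub>fobj (mackey_of X) (orb (K \<inter> A))\<^esub> \<longleftrightarrow>
    (\<forall>d q. (d, q) \<in> index (orb (K \<inter> A)) \<longrightarrow> coeff_res X d (cut_stab d (orb (K \<inter> A)) q) (cut_stab d (orb K) (pt_map (K \<inter> A) (orb K) (base_pt K) q)) \<one>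
        (x (d, pt_map (K \<inter> A) (orb K) (base_pt K) q)) = \<zero>\<^bsub>coeff_mod X d (cut_stab d (orb (K \<inter> A)) q)\<^esub>)" if A: "A \<in> SubO" for A
  proof -
    note s = rsp_spans[OF orb_gset[OF J(1)[OF A]] J(2)[OF A]]
    show ?thesis
      unfolding mact_mx[OF OK orb_gset[OF J(1)[OF A]] s x] zero[OF orb_gset[OF J(1)[OF A]] wact_fam[OF X OK orb_gset[OF J(1)[OF A]] s x]]
      using wact_res[OF OK orb_gset[OF J(1)[OF A]] J(2)[OF A] x] by simp
  qed
  show ?thesis
  proof
    assume "family_embed X (orb K) x \<in> phi (mackey_of X) K"
    then have p: "restr_orb (mackey_of X) (K \<inter> A) K (base_pt K) (family_embed X (orb K) x) = \<zero>\<^bsub>fobj (mackey_of X) (orb (K \<inter> A))\<^esub>" if "A \<in> SubO" "\<not> K \<subseteq> A" for A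
      using that by (simp add: phi_def)
    show "\<forall>d u. (d, u) \<in> index (orb K) \<longrightarrow> d \<noteq> c \<longrightarrow> x (d, u) = \<zero>\<^bsub>coeff_mod X d (cut_stab d (orb K) u)\<^esub>"
    proof (intro allI impI)
      fix d u assume u: "(d, u) \<in> index (orb K)" and ne: "d \<noteq> c"
      note i = idxD[OF u]
      obtain g where g: "g \<in> carrier G" "u = act (orb K) g (base_pt K)" "stab (orb K) u = conjg g K" using orb_stab[OF Ks i(2)] by blast
      have gi: "inv g \<in> carrier G" using g(1) by simp
      \<comment> \<open>\<open>A\<close> is \<open>rep d\<close> moved to the base point, so that
        passing from \<open>K\<close> to \<open>K \<inter> A\<close> leaves the subgroup cut out at
        \<open>u\<close> unchanged.\<close>
      define A where "A = conjg (inv g) (rep d)"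
      have A: "A \<in> SubO" unfolding A_def by (rule SO_cj[OF rep_SO[OF i(1)] gi])
      \<comment> \<open>Orders decide: a class other than \<open>c\<close> that occurs on
        \<open>G/K\<close> has a representative of strictly smaller order, too small to contain a
        conjugate of \<open>rep c\<close>.\<close>
      have nA: "\<not> K \<subseteq> A"
      proof
        assume "K \<subseteq> A"
        then have "rep c \<subseteq> A" using hull_least[OF Kc A] vs_hO[OF K] by simp
        then have "card (rep c) \<le> card (rep d)"
          using card_mono[OF finite_subset[OF SO_sub[OF A] fin]] cj_card[OF rep_sub[OF i(1)] gi] by (simp add: A_def)
        then show False using idx_orb(1,2)[OF c K u] ne by fastforce
      qed
      note JA = J[OF A]
      let ?J = "K \<inter> A"
      let ?q = "act (orb ?J) g (base_pt ?J)"
      have q: "?q \<in> pts (orb ?J)" by (rule act_closed[OF orb_gset[OF JA(1)] g(1) bpt_mem[OF JA(1)]])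
      have base_subgroup: "?J \<subseteq> stab (orb K) (base_pt K)" using bpt_stab[OF Ks] by simp
      have pq: "pt_map ?J (orb K) (base_pt K) ?q = u" unfolding g(2) by (rule pm_act[OF JA(1) OK bpt_mem[OF Ks] base_subgroup g(1)])
      have "stab (orb ?J) ?q = conjg g ?J"
        using stab_act[OF orb_gset[OF JA(1)] g(1) bpt_mem[OF JA(1)]] bpt_stab[OF JA(1)] by simp
      also have "\<dots> = conjg g K \<inter> rep d" using cj_Int[OF Kc SO_sub[OF A] g(1)] cj_inv(2)[OF rep_sub[OF i(1)] g(1)] by (simp add: A_def)
      finally have k: "cut_stab d (orb ?J) ?q = cut_stab d (orb K) u" using g(3) by (auto simp: cut_stab_def)
      have dq: "(d, ?q) \<in> index (orb ?J)" using i q k by (simp add: index_def)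
      have "coeff_res X d (cut_stab d (orb ?J) ?q) (cut_stab d (orb K) (pt_map ?J (orb K) (base_pt K) ?q)) \<one> (x (d, pt_map ?J (orb K) (base_pt K) ?q)) = \<zero>\<^bsub>coeff_mod X d (cut_stab d (orb ?J) ?q)\<^esub>"
        using p[OF A nA] r[OF A] dq by blast
      moreover have "\<one> \<in> cut_stab d (orb K) u" by (rule subgroup.one_closed[OF vs_subgroup[OF i(3)]])
      ultimately show "x (d, u) = \<zero>\<^bsub>coeff_mod X d (cut_stab d (orb K) u)\<^esub>"
        using xm_id[OF X i(1,3) _ famD(1)[OF X x u]] unfolding pq k by simp
    qed
  next
    assume z: "\<forall>d u. (d, u) \<in> index (orb K) \<longrightarrow> d \<noteq> c \<longrightarrow> x (d, u) = \<zero>\<^bsub>coeff_mod X d (cut_stab d (orb K) u)\<^esub>"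
    show "family_embed X (orb K) x \<in> phi (mackey_of X) K"
      unfolding phi_def mem_Collect_eq
    proof (intro conjI ballI impI)
      show "family_embed X (orb K) x \<in> carrier (fobj (mackey_of X) (orb K))" using io_facts(4)[OF X OK] x by simp
      fix A assume A: "A \<in> SubO" "\<not> K \<subseteq> A"
      note JA = J[OF A(1)]
      let ?J = "K \<inter> A"
      show "restr_orb (mackey_of X) ?J K (base_pt K) (family_embed X (orb K) x) = \<zero>\<^bsub>fobj (mackey_of X) (orb ?J)\<^esub>"
        unfolding r[OF A(1)]
      proof (intro allI impI)
        fix d q assume q: "(d, q) \<in> index (orb ?J)"
        note i = idxD[OF q]
        have pq: "(d, pt_map ?J (orb K) (base_pt K) q) \<in> index (orb K)" by (rule idx_hom[OF orb_gset[OF JA(1)] OK JA(2) q])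
        \<comment> \<open>If class \<open>c\<close> occurred on \<open>G/(K \<inter> A)\<close>, the
          hull of \<open>K \<inter> A\<close> would be all of \<open>rep c\<close>, and
          \<open>A\<close> would contain \<open>K\<close>.\<close>
        have "d \<noteq> c"
        proof
          assume dc: "d = c"
          obtain g where g: "g \<in> carrier G" "stab (orb ?J) q = conjg g ?J" using orb_stab[OF JA(1) i(2)] by blast
          note Jc = subgroup_carrier[OF JA(1)]
          have "rep c \<subseteq> hullO (conjg g ?J)"
            using hull_mono[OF ks_sub[of c "orb ?J" q], OF stab_carrier[OF orb_gset[OF JA(1)]]] vs_hO[OF i(3)] g(2) dc by simp
          then have "rep c \<subseteq> conjg g (hullO ?J)" using hull_cj[OF Jc g(1)] by simp
          then have le: "card (rep c) \<le> card (hullO ?J)"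
            using card_mono[OF finite_subset[OF cj_carrier[OF hull_carrier[OF Jc] g(1)] fin]] cj_card[OF hull_carrier[OF Jc] g(1)] by metis
          have "hullO ?J \<subseteq> rep c" using hull_mono[OF _ Kc, of ?J] vs_hO[OF K] by simp
          then have "hullO ?J = rep c" using le card_seteq[OF finite_subset[OF rep_sub[OF c] fin]] by blast
          moreover have "hullO ?J \<subseteq> A" by (rule hull_least[OF Jc A(1)]) simp
          ultimately show False using A(2) vs_sub[OF K] by blast
        qed
        then have "x (d, pt_map ?J (orb K) (base_pt K) q) = \<zero>\<^bsub>coeff_mod X d (cut_stab d (orb K) (pt_map ?J (orb K) (base_pt K) q))\<^esub>" using z pq by blast
        moreover have "cut_stab d (orb ?J) q \<subseteq> cut_stab d (orb K) (pt_map ?J (orb K) (base_pt K) q)"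
          by (rule ks_hom[OF orb_gset[OF JA(1)] JA(2) i(2)])
        then have "lin (coeff_mod X d (cut_stab d (orb K) (pt_map ?J (orb K) (base_pt K) q))) (coeff_mod X d (cut_stab d (orb ?J) q)) (coeff_res X d (cut_stab d (orb ?J) q) (cut_stab d (orb K) (pt_map ?J (orb K) (base_pt K) q)) \<one>)"
          by (intro xm_lin[OF X i(1,3) idxD(3)[OF pq] nz_one[OF i(1)]]) (simp add: cj_one[OF subgroup_carrier[OF vs_subgroup[OF idxD(3)[OF pq]]]])
        ultimately show "coeff_res X d (cut_stab d (orb ?J) q) (cut_stab d (orb K) (pt_map ?J (orb K) (base_pt K) q)) \<one> (x (d, pt_map ?J (orb K) (base_pt K) q)) = \<zero>\<^bsub>coeff_mod X d (cut_stab d (orb ?J) q)\<^esub>"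
          using lin_zero[OF xo_idx[OF X pq] xo_idx[OF X q]] by simp
      qed
    qed
  qed
qed

text \<open>By \<open>phi_mx\<close> an element of \<open>phi\<close> is supported on class
  \<open>c\<close>, where equivariance determines it from its entry at the base point.\<close>

definition eval_top :: "'v \<Rightarrow> 'v" where
  "eval_top = (\<lambda>v\<in>phi (mackey_of X) K. inv_into (family X (orb K)) (family_embed X (orb K)) v (c, base_pt K))"

lemma ev_io: "x \<in> family X (orb K) \<Longrightarrow> family_embed X (orb K) x \<in> phi (mackey_of X) K \<Longrightarrow> eval_top (family_embed X (orb K) x) = x (c, base_pt K)"
  by (simp add: eval_top_def inv_into_f_f[OF io_inj[OF X orb_gset[OF vs_subgroup[OF K]]]])

lemma phi_mx_ex:
  assumes "v \<in> phi (mackey_of X) K" obtains x where "x \<in> family X (orb K)" "v = family_embed X (orb K) x"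
  using phi_carrier[OF assms] io_facts(4)[OF X orb_gset[OF vs_subgroup[OF K]]] by blast

lemma ev_mor: "eval_top \<in> Mor vect_cat (phimod (mackey_of X) K) (coeff_mod X c K)"
  unfolding vect_mor_iff
proof (rule conjI)
  note OK = orb_gset[OF vs_subgroup[OF K]]
  show "eval_top \<in> extensional (carrier (phimod (mackey_of X) K))" by (simp add: eval_top_def)
  let ?j = "inv_into (family X (orb K)) (family_embed X (orb K))"
  have j: "?j v \<in> family X (orb K)" if "v \<in> phi (mackey_of X) K" for v
    using phi_carrier[OF that] io_facts(4)[OF X OK] by (simp add: inv_into_into)
  have p: "lin (family_mod X (orb K)) (coeff_mod X c K) (\<lambda>x. x (c, base_pt K))"
    using famD(1)[OF X _ bpt_idx(1)] bpt_idx by (simp add: fmod_simps[OF X])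
  have l: "lin (phimod (mackey_of X) K) (family_mod X (orb K)) ?j"
    using io_facts(3)[OF X OK] phi_carrier[of _ "mackey_of X" K] by simp
  have "lin (phimod (mackey_of X) K) (coeff_mod X c K) (\<lambda>v. ?j v (c, base_pt K))" by (rule lin_comp[OF l p])
  then show "lin (phimod (mackey_of X) K) (coeff_mod X c K) eval_top"
    by (rule lin_cong[OF phi_mod[OF mx_mackey[OF X] vs_subgroup[OF K]], rotated]) (simp add: eval_top_def)
qed

text \<open>The points of class \<open>c\<close> are the translates of the base point by the
  normalizer. Equivariance therefore expresses a family in \<open>phi\<close> through its entry at
  the base point, and the same formula extends any prescribed entry to a family.\<close>

lemma ev_bij: "bij_betw eval_top (phi (mackey_of X) K) (carrier (coeff_mod X c K))"
proof (rule bij_betw_imageI)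
  note Ks = vs_subgroup[OF K]
  note OK = orb_gset[OF Ks]
  show "inj_on eval_top (phi (mackey_of X) K)"
  proof (rule inj_onI)
    fix v w assume v: "v \<in> phi (mackey_of X) K" and w: "w \<in> phi (mackey_of X) K" and e: "eval_top v = eval_top w"
    obtain x where x: "x \<in> family X (orb K)" "v = family_embed X (orb K) x" using phi_mx_ex[OF v] .
    obtain y where y: "y \<in> family X (orb K)" "w = family_embed X (orb K) y" using phi_mx_ex[OF w] .
    have e': "x (c, base_pt K) = y (c, base_pt K)" using e ev_io[OF x(1)] ev_io[OF y(1)] v w x(2) y(2) by simp
    have "x = y"
    proof (rule extensionalityI[OF famD(3)[OF X x(1)] famD(3)[OF X y(1)]])
      fix p assume "p \<in> index (orb K)"
      then obtain d u where p: "p = (d, u)" "(d, u) \<in> index (orb K)" by (cases p) auto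
      show "x p = y p"
      proof (cases "d = c")
        case True
        obtain a where a: "a \<in> norm_rep c" "u = act (orb K) a (base_pt K)" using idx_orb(3)[OF c K p(2) True] by blast
        show ?thesis using fam_orb_act[OF x(1) a(1)] fam_orb_act[OF y(1) a(1)] e' by (simp add: p(1) True a(2))
      next
        case False
        then show ?thesis using phi_mx[OF x(1)] phi_mx[OF y(1)] v w x(2) y(2) p by simp
      qed
    qed
    then show "v = w" using x y by simp
  qed
  show "eval_top ` phi (mackey_of X) K = carrier (coeff_mod X c K)"
  proof
    show "eval_top ` phi (mackey_of X) K \<subseteq> carrier (coeff_mod X c K)" using ev_mor unfolding vect_mor_iff by auto
    show "carrier (coeff_mod X c K) \<subseteq> eval_top ` phi (mackey_of X) K"
    proof
      fix v assume v: "v \<in> carrier (coeff_mod X c K)"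
      define f where "f a = coeff_res X c (conjg a K) K a v" for a
      define sa where "sa u = (SOME a. a \<in> norm_rep c \<and> u = act (orb K) a (base_pt K))" for u
      define x where "x = (\<lambda>(d, u)\<in>index (orb K). if d = c then f (sa u) else \<zero>\<^bsub>coeff_mod X d (cut_stab d (orb K) u)\<^esub>)"
      \<comment> \<open>Two elements with the same translate differ by an element of
        \<open>K\<close>, which acts as the identity on the value of \<open>X\<close> at
        \<open>K\<close>.\<close>
      have fa: "f (sa u) = f a" if a: "a \<in> norm_rep c" "u = act (orb K) a (base_pt K)" for a u
      proof -
        have "sa u \<in> norm_rep c \<and> u = act (orb K) (sa u) (base_pt K)" unfolding sa_def by (rule someI[of _ a]) (use a in simp)
        then have b: "sa u \<in> norm_rep c" "act (orb K) (sa u) (base_pt K) = act (orb K) a (base_pt K)" using a(2) by auto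
        let ?k = "inv a \<otimes> sa u"
        have k: "?k \<in> K" using act_eq_iff[OF OK nz_cl[OF c b(1)] nz_cl[OF c a(1)] bpt_mem[OF Ks]] b(2) bpt_stab[OF Ks] by simp
        have kn: "?k \<in> norm_rep c" by (rule nz_mult[OF c nz_inv[OF c a(1)] b(1)])
        have ak: "a \<otimes> ?k = sa u" using nz_cl[OF c a(1)] nz_cl[OF c b(1)] by (simp add: m_assoc[symmetric])
        have kK: "conjg ?k K = K" by (rule cj_self[OF Ks k])
        have ca: "conjg (sa u) K = conjg a K"
          using cj_cj[OF subgroup_carrier[OF Ks] nz_cl[OF c a(1)] nz_cl[OF c kn]] kK ak by simp
        have "coeff_res X c (conjg a K) K a (coeff_res X c K K ?k v) = coeff_res X c (conjg a K) K (a \<otimes> ?k) v"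
          by (rule xm_comp[OF X c vs_cj[OF c a(1) K] K K a(1) _ kn _ v]) (simp_all add: kK)
        then show ?thesis unfolding f_def ca ak using xm_id[OF X c K k v] by simp
      qed
      have f_mem: "f a \<in> carrier (coeff_mod X c (conjg a K))" if "a \<in> norm_rep c" for a
        using xm_lin[OF X c vs_cj[OF c that K] K that subset_refl] v by (simp add: f_def)
      have xf: "x \<in> family X (orb K)"
      proof (rule famI[OF X])
        show "x \<in> extensional (index (orb K))" by (simp add: x_def)
        fix d u assume u: "(d, u) \<in> index (orb K)"
        note i = idxD[OF u]
        show "x (d, u) \<in> carrier (coeff_mod X d (cut_stab d (orb K) u))"
        proof (cases "d = c")
          case True
          obtain a where a: "a \<in> norm_rep c" "u = act (orb K) a (base_pt K)" using idx_orb(3)[OF c K u True] by blast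
          show ?thesis using u True fa[OF a] f_mem[OF a(1)] idx_orb_nz(2)[OF c K a(1)] a(2) by (simp add: x_def)
        next
          case False then show ?thesis using u rat_module.add_facts(1)[OF xo_idx[OF X u]] by (simp add: x_def)
        qed
        fix b assume b: "b \<in> norm_rep d"
        note bu = idx_act[OF OK u b]
        show "x (d, act (orb K) b u) = coeff_res X d (cut_stab d (orb K) (act (orb K) b u)) (cut_stab d (orb K) u) b (x (d, u))"
        proof (cases "d = c")
          case True
          obtain a where a: "a \<in> norm_rep c" "u = act (orb K) a (base_pt K)" using idx_orb(3)[OF c K u True] by blast
          have b': "b \<in> norm_rep c" using b True by simp
          note ba = nz_mult[OF c b' a(1)] and acl = nz_cl[OF c a(1)] and bcl = nz_cl[OF c b']
          have bu': "act (orb K) b u = act (orb K) (b \<otimes> a) (base_pt K)" unfolding a(2) by (rule act_mult[OF OK bcl acl bpt_mem[OF Ks], symmetric])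
          have k: "cut_stab c (orb K) u = conjg a K" "cut_stab c (orb K) (act (orb K) b u) = conjg (b \<otimes> a) K"
            using idx_orb_nz(2)[OF c K a(1)] idx_orb_nz(2)[OF c K ba] a(2) bu' by simp_all
          have cc: "conjg (b \<otimes> a) K = conjg b (conjg a K)" using cj_cj[OF subgroup_carrier[OF Ks] bcl acl] by simp
          have "coeff_res X c (conjg (b \<otimes> a) K) (conjg a K) b (coeff_res X c (conjg a K) K a v) = coeff_res X c (conjg (b \<otimes> a) K) K (b \<otimes> a) v"
            by (rule xm_comp[OF X c vs_cj[OF c ba K] vs_cj[OF c a(1) K] K b' _ a(1) subset_refl v]) (simp add: cc)
          then show ?thesis using u bu fa[OF a] fa[OF ba bu'] True k by (simp add: x_def f_def)
        next
          case False
          have "lin (coeff_mod X d (cut_stab d (orb K) u)) (coeff_mod X d (cut_stab d (orb K) (act (orb K) b u))) (coeff_res X d (cut_stab d (orb K) (act (orb K) b u)) (cut_stab d (orb K) u) b)"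
            by (rule xm_idx[OF X OK u b])
          from lin_zero[OF xo_idx[OF X u] xo_idx[OF X bu] this] show ?thesis using u bu False by (simp add: x_def)
        qed
      qed
      have p: "family_embed X (orb K) x \<in> phi (mackey_of X) K" using phi_mx[OF xf] by (simp add: x_def)
      have one: "base_pt K = act (orb K) \<one> (base_pt K)" using act_one[OF OK bpt_mem[OF Ks]] by simp
      have "eval_top (family_embed X (orb K) x) = f \<one>"
        unfolding ev_io[OF xf p] using bpt_idx(1) fa[OF nz_one[OF c] one] by (simp add: x_def)
      also have "\<dots> = v" unfolding f_def cj_one[OF subgroup_carrier[OF Ks]] by (rule xm_id[OF X c K subgroup.one_closed[OF Ks] v])
      finally show "v \<in> eval_top ` phi (mackey_of X) K" using p by force
    qed
  qed
qed

end

text \<open>The restricted family has as its entry at the base point the restriction of the entry at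
  the \<open>a\<close>-translate, and equivariance expresses the latter through the entry at the
  base point of \<open>orb K'\<close>.\<close>

lemma ev_natural:
  assumes c: "c \<in> SubO_classes" and K: "hull_rep c K" "hull_rep c K'" and a: "a \<in> norm_rep c" "K \<subseteq> conjg a K'" and v: "v \<in> phi (mackey_of X) K'"
  shows "eval_top c K (restr_orb (mackey_of X) K K' (act (orb K') a (base_pt K')) v) = coeff_res X c K K' a (eval_top c K' v)"
proof -
  note s = vs_subgroup[OF K(1)] vs_subgroup[OF K(2)] and p = orb_nz_stab[OF c K(2) a(1)]
  note O = orb_gset[OF s(1)] and O' = orb_gset[OF s(2)]
  have st: "K \<subseteq> stab (orb K') (act (orb K') a (base_pt K'))" using p(2) a(2) by simp
  note h = pm_hom[OF s(1) O' p(1) st]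
  obtain x where x: "x \<in> family X (orb K')" "v = family_embed X (orb K') x" using phi_mx_ex[OF c K(2) v] .
  let ?y = "span_act X (orb K') (orb K) (restr_span (orb K) (pt_map K (orb K') (act (orb K') a (base_pt K')))) x"
  have y: "?y \<in> family X (orb K)" by (rule wact_fam[OF X O' O rsp_spans[OF O h] x(1)])
  have e: "restr_orb (mackey_of X) K K' (act (orb K') a (base_pt K')) v = family_embed X (orb K) ?y"
    unfolding x(2) by (rule mact_mx[OF O' O rsp_spans[OF O h] x(1)])
  have "family_embed X (orb K) ?y \<in> phi (mackey_of X) K" unfolding e[symmetric] by (rule phi_res[OF mx_mackey[OF X] s p(1) st v])
  then have "eval_top c K (restr_orb (mackey_of X) K K' (act (orb K') a (base_pt K')) v) = ?y (c, base_pt K)"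
    unfolding e by (rule ev_io[OF c K(1) y])
  also have "\<dots> = coeff_res X c K (conjg a K') \<one> (coeff_res X c (conjg a K') K' a (x (c, base_pt K')))"
    using wact_res[OF O' O h x(1) bpt_idx(1)[OF c K(1)]] bpt_idx(2)[OF c K(1)] pm_bpt[OF s(1) O' p(1) st]
      idx_orb_nz(2)[OF c K(2) a(1)] fam_orb_act[OF c K(2) x(1) a(1)] by simp
  also have "\<dots> = coeff_res X c K K' (\<one> \<otimes> a) (x (c, base_pt K'))"
    by (rule xm_comp[OF X c K(1) vs_cj[OF c a(1) K(2)] K(2) nz_one[OF c] _ a(1) subset_refl])
      (use a(2) cj_one[OF subgroup_carrier[OF vs_subgroup[OF vs_cj[OF c a(1) K(2)]]]] famD(1)[OF X x(1) bpt_idx(1)[OF c K(2)]] bpt_idx(2)[OF c K(2)] in simp_all)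
  also have "\<dots> = coeff_res X c K K' a (eval_top c K' v)"
    using ev_io[OF c K(2) x(1)] v x(2) nz_cl[OF c a(1)] by simp
  finally show ?thesis .
qed

lemma Phi_mx_iso: "\<exists>f. iso_mor coeffs (coeff_of (mackey_of X)) X f"
proof -
  note M = mx_mackey[OF X]
  let ?e = "\<lambda>c. \<lambda>Z\<in>Ob (osrc c). eval_top c (base_subgroup Z)"
  have "iso_mor (coeff_cat G TS (rep c)) (coeff_of (mackey_of X) c) (X c) (?e c)" if c: "c \<in> SubO_classes" for c
    unfolding coeff_cat_eq
  proof (rule iso_functor_cat[OF category_vect_cat])
    show F: "is_functor (osrc c) vect_cat (coeff_of (mackey_of X) c)" by (rule X_functor[OF PF_Ob[OF M] c])
    show "is_functor (osrc c) vect_cat (X c)" by (rule X_functor[OF X c])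
    have e: "?e c (ncoset c K) = eval_top c K" if "hull_rep c K" for K using that osrc_Ob[OF c] by (auto simp: sb_co[OF c])
    note fP = fobj_PF[OF c, of _ "mackey_of X"]
    show "iso_mor vect_cat (fobj (coeff_of (mackey_of X) c) Z) (fobj (X c) Z) (?e c Z)" if "Z \<in> Ob (osrc c)" for Z
    proof -
      obtain K where K: "Z = ncoset c K" "hull_rep c K" using \<open>Z \<in> Ob (osrc c)\<close> osrc_Ob[OF c] by blast
      have "iso_mor vect_cat (phimod (mackey_of X) K) (coeff_mod X c K) (eval_top c K)"
        by (rule vect_isoI[OF phi_mod[OF M vs_subgroup[OF K(2)]] xo_mod[OF X c K(2)] ev_mor[OF c K(2)]]) (simp add: ev_bij[OF c K(2)])
      then show ?thesis unfolding K(1) e[OF K(2)] fP[OF K(2)] coeff_mod_def .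
    qed
    show "?e c \<in> nat_trans (osrc c) vect_cat (coeff_of (mackey_of X) c) (X c)"
      unfolding nat_trans_def mem_Collect_eq
    proof (intro conjI ballI)
      show "?e c \<in> (\<Pi>\<^sub>E a\<in>Ob (osrc c). Mor vect_cat (fobj (coeff_of (mackey_of X) c) a) (fobj (X c) a))"
      proof (rule PiE_I)
        fix Z assume "Z \<in> Ob (osrc c)"
        then obtain K where K: "Z = ncoset c K" "hull_rep c K" using osrc_Ob[OF c] by blast
        show "?e c Z \<in> Mor vect_cat (fobj (coeff_of (mackey_of X) c) Z) (fobj (X c) Z)"
          unfolding K(1) e[OF K(2)] fP[OF K(2)] using ev_mor[OF c K(2)] by (simp add: coeff_mod_def)
      qed simp
      fix Z' Z \<phi> assume o: "Z' \<in> Ob (osrc c)" "Z \<in> Ob (osrc c)" "\<phi> \<in> Mor (osrc c) Z' Z"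
      obtain K K' where K: "Z = ncoset c K" "hull_rep c K" "Z' = ncoset c K'" "hull_rep c K'" using o osrc_Ob[OF c] by blast
      obtain a where a: "a \<in> norm_rep c" "K \<subseteq> conjg a K'" "\<phi> = nmap c K K' a"
        using hom_nmap[OF c K(2,4)] o(3) K by (auto simp: osrc_simps[OF c])
      have P: "coeff_of (mackey_of X) c = coeff_at (mackey_of X) c" using c by (simp add: coeff_of_def)
      show "Cmp vect_cat (fobj (coeff_of (mackey_of X) c) Z') (fobj (coeff_of (mackey_of X) c) Z) (fobj (X c) Z) (?e c Z) (fmor (coeff_of (mackey_of X) c) Z' Z \<phi>) =
        Cmp vect_cat (fobj (coeff_of (mackey_of X) c) Z') (fobj (X c) Z') (fobj (X c) Z) (fmor (X c) Z' Z \<phi>) (?e c Z')"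
      proof (rule extensionalityI[of _ "phi (mackey_of X) K'"])
        fix v assume v: "v \<in> phi (mackey_of X) K'"
        show "Cmp vect_cat (fobj (coeff_of (mackey_of X) c) Z') (fobj (coeff_of (mackey_of X) c) Z) (fobj (X c) Z) (?e c Z) (fmor (coeff_of (mackey_of X) c) Z' Z \<phi>) v =
        Cmp vect_cat (fobj (coeff_of (mackey_of X) c) Z') (fobj (X c) Z') (fobj (X c) Z) (fmor (X c) Z' Z \<phi>) (?e c Z') v"
          unfolding K(1,3) e[OF K(2)] e[OF K(4)] fP[OF K(4)] fP[OF K(2)] a(3) vect_cat_simps
          using v ev_natural[OF c K(2,4) a(1,2) v] pfun_mor[OF c K(2,4) a(1,2) v] by (simp add: compose_eq P coeff_res_def)
      qed (simp_all add: K fP compose_def)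
    qed
  qed
  then have "iso_mor coeffs (coeff_of (mackey_of X)) X (\<lambda>c\<in>SubO_classes. ?e c)" by (rule iso_prod_cat)
  then show ?thesis by blast
qed

end

lemma mackey_equivalence: "equivalent_categories (mackeys :: (('a, 's, 'v) mackey_functor, ('a, 's, 'v) mackey_map) cat)
    (coeffs :: ('a set set \<Rightarrow> ('a, 'v) coeff_system, 'a set set \<Rightarrow> ('a, 'v) coeff_map) cat)"
proof (rule equivalent_categoriesI[OF category_mack category_PC Phi_functor])
  fix M M' :: "('a, 's, 'v) mackey_functor" assume M: "is_mackey M" "is_mackey M'"
  have o: "fobj Phi M = coeff_of M" "fobj Phi M' = coeff_of M'" using M by (simp_all add: Phi_def)
  have "fmor Phi M M' ` Mor mackeys M M' = Mor coeffs (coeff_of M) (coeff_of M')"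
  proof
    show "fmor Phi M M' ` Mor mackeys M M' \<subseteq> Mor coeffs (coeff_of M) (coeff_of M')"
      using is_functorD(2)[OF Phi_functor M] o by auto
    show "Mor coeffs (coeff_of M) (coeff_of M') \<subseteq> fmor Phi M M' ` Mor mackeys M M'" using Phi_full[OF M] by blast
  qed
  then show "bij_betw (fmor Phi M M') (Mor mackeys M M') (Mor coeffs (fobj Phi M) (fobj Phi M'))"
    using Phi_faithful[OF M] o by (simp add: bij_betw_def)
next
  fix X :: "'a set set \<Rightarrow> ('a, 'v) coeff_system" assume X: "X \<in> Ob coeffs"
  have "fobj Phi (mackey_of X) = coeff_of (mackey_of X)" using mx_mackey[OF X] by (simp add: Phi_def)
  then show "\<exists>M\<in>Ob (mackeys :: (('a, 's, 'v) mackey_functor, ('a, 's, 'v) mackey_map) cat). \<exists>f. iso_mor coeffs (fobj Phi M) X f"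
    using Phi_mx_iso[OF X] mx_mackey[OF X] by metis
qed

end

theorem theorem4:
  fixes G :: "('g, 'a) monoid_scheme"
    and \<O> :: "('g set \<times> 'g set) set"
    and rep :: "'g set set \<Rightarrow> 'g set"
  assumes "group G" and "finite (carrier G)"
    and "disk_like G \<O>"
    and "infinite (UNIV :: 's set)"
    and "\<And>c. c \<in> Sub_O_classes G \<O> \<Longrightarrow> rep c \<in> c"
  shows "equivalent_categories
    (mackey_cat G \<O> :: (('g, 's, 'v) mackey_functor, ('g, 's, 'v) mackey_map) cat)
    (prod_cat (Sub_O_classes G \<O>)
      (\<lambda>c. coeff_cat G \<O> (rep c) :: (('g, 'v) coeff_system, ('g, 'v) coeff_map) cat))"
proof -
  \<comment> \<open>An infinite type contains a copy of the natural numbers, which is the form in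
    which the locale records infinity.\<close>
  obtain emb :: "nat \<Rightarrow> 's" where "inj emb"
    using infinite_countable_subset[OF assms(4)] by blast
  then interpret disk G \<O> rep emb
    using assms by (intro disk.intro disk_axioms.intro)
  show ?thesis by (rule mackey_equivalence)
qed

end
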